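(* Let $m \geq 1$, $n \geq 1$, and $N_t \in \mathbb{Z}$ be integers, and suppose $g_0,g_1:[0,\infty)\to\mathbb{R}$ ($m+2$ and $m+1$ times weakly differentiable, respectively) satisfy $$\begin{cases} (1+t)^n(g_0(t) - 2\pi N_t) \in L^1([0,\infty)),\\ (1+t)^n\partial^i g_0(t) \in L^1([0,\infty)), \quad i = 1, \dots, m+2,\\ (1+t)^n\partial^i g_1(t) \in L^1([0,\infty)), \quad i = 0,1, \dots, m+1. \end{cases}$$ Then the spectral functions $A(k)$ and $B(k)$ have the following properties: (a) $A(k)$ and $B(k)$ are continuous for $k \in \bar{D}_+$ and analytic for $k \in D_+$. (b) For $j = 1, \dots, n$, the derivatives $A^{(j)}(k)$ and $B^{(j)}(k)$ are well-defined and continuous on $\bar{D}_+ \setminus \{0\}$. (c) There exist complex constants $\{A_i, B_i, \hat{A}_i, \hat{B}_i\}_{i=1}^m$ such that the following expansions hold uniformly for each $j = 0, 1, \dots, n$: $$\begin{pmatrix} B^{(j)}(k) \\ A^{(j)}(k) \end{pmatrix} = \begin{pmatrix} \frac{d^j}{dk^j}\big(\frac{B_1}{k} + \cdots + \frac{B_m}{k^m}\big)\\ \frac{d^j}{dk^j}\big(1 + \frac{A_1}{k} + \cdots + \frac{A_m}{k^m}\big) \end{pmatrix} + O\bigg(\frac{1}{k^{m+1}}\bigg),\qquad k \to \infty, \ k \in \bar{D}_+,$$ and $$\begin{pmatrix} B^{(j)}(k) \\ A^{(j)}(k) \end{pmatrix} = \mathcal{G}_0(0) \begin{pmatrix} \frac{d^j}{dk^j}\big(\hat{B}_1k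 + \cdots + \hat{B}_mk^m\big) \\ \frac{d^j}{dk^j}\big(1 + \hat{A}_1k + \cdots + \hat{A}_mk^m\big) \end{pmatrix} + O\big(k^{m+1-2j}\big),\qquad k \to 0, \ k \in \bar{D}_+.$$ (d) $A(k) = \overline{A(-\bar{k})}$ and $B(k) = \overline{B(-\bar{k})}$ for $k \in \bar{D}_+$. (e) $A(k)\overline{A(\bar k)}+B(k)\overline{B(\bar k)}= 1$ for $k \in \mathbb{R} \cup \{|k| = 1\}$.
   Context: Pauli matrices: $\sigma_1=\begin{pmatrix}0&1\\1&0\end{pmatrix}$, $\sigma_2=\begin{pmatrix}0&-i\\i&0\end{pmatrix}$, $\sigma_3=\begin{pmatrix}1&0\\0&-1\end{pmatrix}$; $e^{\alpha\hat\sigma_3}A=e^{\alpha\sigma_3}Ae^{-\alpha\sigma_3}$ for a $2\times2$ matrix $A$. $D_1=\{\operatorname{Im}k>0,|k|>1\}$, $D_2=\{\operatorname{Im}k>0,|k|<1\}$, $D_3=\{\operatorname{Im}k<0,|k|<1\}$, $D_4=\{\operatorname{Im}k<0,|k|>1\}$, $D_+=D_1\cup D_3$, $D_-=D_2\cup D_4$; bars denote closures in $\mathbb{C}$. $\theta_2=\theta_2(k)=\frac14(k+\frac1k)$ and $$\mathsf{V}(t,k)=-\frac{i(g_1+g_{0t})}{4}\sigma_2-\frac{i\sin g_0}{4k}\sigma_1-\frac{i(\cos g_0-1)}{4k}\sigma_3.$$ $T(t,k)$ is the unique $2\times2$-matrix valued solution of the Volterra equation $$T(t,k)=I+\int_\infty^te^{i\theta_2(t'-t)\hat\sigma_3}(\mathsf{V}T)(t',k)dt',\qquad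 t\ge0,$$ read columnwise: the first column is defined for $k\in\bar D_-\setminus\{0\}$ and the second for $k\in\bar D_+\setminus\{0\}$. It has the symmetry $T(t,k)=\sigma_2\overline{T(t,\bar k)}\sigma_2$. The spectral functions $A,B$ are defined by $$T(0,k)=\begin{pmatrix}\overline{A(\bar k)}&B(k)\\-\overline{B(\bar k)}&A(k)\end{pmatrix},$$ i.e. $(B(k),A(k))^T$ is the second column of $T(0,k)$, $k\in\bar D_+\setminus\{0\}$; values at $k=0$ are understood as limits (continuous extension). $$\mathcal{G}_0(t)=(-1)^{N_t}\begin{pmatrix}\cos\frac{g_0(t)}2&-\sin\frac{g_0(t)}2\\ \sin\frac{g_0(t)}2&\cos\frac{g_0(t)}2\end{pmatrix}.$$ *)

theory Defs
  imports "HOL-Analysis.Analysis" "HOL-Library.Landau_Symbols"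
begin

section \<open>Weak derivatives on the half-line\<close>

definition test_function :: "(real \<Rightarrow> real) \<Rightarrow> bool" where
  "test_function \<phi> \<longleftrightarrow>
     (\<forall>j x. (deriv ^^ j) \<phi> field_differentiable at x) \<and>
     (\<exists>a b. 0 < a \<and> (\<forall>x. x \<notin> {a..b} \<longrightarrow> \<phi> x = 0))"

definition locally_integrable :: "(real \<Rightarrow> real) \<Rightarrow> bool" where
  "locally_integrable f \<longleftrightarrow> (\<forall>a b. 0 < a \<longrightarrow> f absolutely_integrable_on {a..b})"

definition has_weak_deriv :: "nat \<Rightarrow> (real \<Rightarrow> real) \<Rightarrow> (real \<Rightarrow> real) \<Rightarrow> bool" where
  "has_weak_deriv i g h \<longleftrightarrow> locally_integrable g \<and> locally_integrable h \<and>
     (\<forall>\<phi>. test_function \<phi> \<longrightarrow>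
        integral {0<..} (\<lambda>t. g t * (deriv ^^ i) \<phi> t) =
        (- 1) ^ i * integral {0<..} (\<lambda>t. h t * \<phi> t))"

definition weakly_differentiable :: "nat \<Rightarrow> (real \<Rightarrow> real) \<Rightarrow> bool" where
  "weakly_differentiable r g \<longleftrightarrow> (\<forall>i\<in>{1..r}. \<exists>h. has_weak_deriv i g h)"

text \<open>
  A weak derivative is determined only up to a null set. The function below picks one
  representative; it is used only under integrals over \<open>t\<close>, where the choice is immaterial.
\<close>

definition weak_deriv :: "nat \<Rightarrow> (real \<Rightarrow> real) \<Rightarrow> real \<Rightarrow> real" where
  "weak_deriv i g = (if i = 0 then g else (SOME h. has_weak_deriv i g h))"

section \<open>The Volterra equation\<close>

definition sigma1 :: "complex^2^2" where
  "sigma1 = vector [vector [0, 1], vector [1, 0]]"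

definition sigma2 :: "complex^2^2" where
  "sigma2 = vector [vector [0, - \<i>], vector [\<i>, 0]]"

definition sigma3 :: "complex^2^2" where
  "sigma3 = vector [vector [1, 0], vector [0, - 1]]"

text \<open>The matrix exponential of \<open>\<alpha> \<sigma>\<^sub>3\<close>, which is diagonal.\<close>

definition exp_sigma3 :: "complex \<Rightarrow> complex^2^2" where
  "exp_sigma3 \<alpha> = vector [vector [exp \<alpha>, 0], vector [0, exp (- \<alpha>)]]"

definition exp_sigma3_hat :: "complex \<Rightarrow> complex^2^2 \<Rightarrow> complex^2^2" where
  "exp_sigma3_hat \<alpha> M = exp_sigma3 \<alpha> ** M ** exp_sigma3 (- \<alpha>)"

definition theta2 :: "complex \<Rightarrow> complex" where
  "theta2 k = (k + 1 / k) / 4"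

text \<open>Here \<open>mat c ** M\<close> is the product of the scalar \<open>c\<close> with the matrix \<open>M\<close>.\<close>

definition V_mat :: "(real \<Rightarrow> real) \<Rightarrow> (real \<Rightarrow> real) \<Rightarrow> real \<Rightarrow> complex \<Rightarrow> complex^2^2" where
  "V_mat g0 g1 t k =
     - (mat (\<i> * of_real (g1 t + weak_deriv 1 g0 t) / 4) ** sigma2)
     - mat (\<i> * of_real (sin (g0 t)) / (4 * k)) ** sigma1
     - mat (\<i> * of_real (cos (g0 t) - 1) / (4 * k)) ** sigma3"

text \<open>
  The \<open>j\<close>-th column of the Volterra equation
  \<open>T(t) = I + \<integral>\<^sub>\<infinity>\<^sup>t e\<^bsup>i \<theta>\<^sub>2 (s - t) \<sigma>\<^sub>3\<^esup> V T e\<^bsup>- i \<theta>\<^sub>2 (s - t) \<sigma>\<^sub>3\<^esup> ds\<close> on \<open>[0, \<infinity>)\<close>, the integral being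
  absolutely convergent. It involves only the \<open>j\<close>-th column of \<open>T\<close>.
\<close>

definition volterra_column ::
  "(real \<Rightarrow> real) \<Rightarrow> (real \<Rightarrow> real) \<Rightarrow> complex \<Rightarrow> 2 \<Rightarrow> (real \<Rightarrow> complex^2^2) \<Rightarrow> bool" where
  "volterra_column g0 g1 k j T \<longleftrightarrow>
     (\<forall>t\<ge>0.
        (\<lambda>s. column j (exp_sigma3_hat (\<i> * theta2 k * of_real (s - t)) (V_mat g0 g1 s k ** T s)))
          absolutely_integrable_on {t..} \<and>
        column j (T t) = column j (mat 1) -
          integral {t..}
            (\<lambda>s. column j (exp_sigma3_hat (\<i> * theta2 k * of_real (s - t)) (V_mat g0 g1 s k ** T s))))"

text \<open>
  The matrix \<open>T(t,k)\<close>, read columnwise. The second column is meaningful for nonzero \<open>k\<close> in the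
  closure of \<open>D\<^sub>+\<close>, the first one for nonzero \<open>k\<close> in the closure of \<open>D\<^sub>-\<close>.
\<close>

definition T_mat :: "(real \<Rightarrow> real) \<Rightarrow> (real \<Rightarrow> real) \<Rightarrow> real \<Rightarrow> complex \<Rightarrow> complex^2^2" where
  "T_mat g0 g1 t k =
     (\<chi> i j. (THE v. \<exists>T. volterra_column g0 g1 k j T \<and> v = column j (T t)) $ i)"

section \<open>The spectral functions\<close>

definition D1 :: "complex set" where
  "D1 = {k. Im k > 0 \<and> cmod k > 1}"

definition D3 :: "complex set" where
  "D3 = {k. Im k < 0 \<and> cmod k < 1}"

definition D_plus :: "complex set" where
  "D_plus = D1 \<union> D3"

text \<open>The values at \<open>k = 0\<close> are limits from within the closure of \<open>D\<^sub>+\<close>.\<close>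

definition spectral_A :: "(real \<Rightarrow> real) \<Rightarrow> (real \<Rightarrow> real) \<Rightarrow> complex \<Rightarrow> complex" where
  "spectral_A g0 g1 k =
     (if k = 0 then Lim (at 0 within closure D_plus) (\<lambda>z. T_mat g0 g1 0 z $ 2 $ 2)
      else T_mat g0 g1 0 k $ 2 $ 2)"

definition spectral_B :: "(real \<Rightarrow> real) \<Rightarrow> (real \<Rightarrow> real) \<Rightarrow> complex \<Rightarrow> complex" where
  "spectral_B g0 g1 k =
     (if k = 0 then Lim (at 0 within closure D_plus) (\<lambda>z. T_mat g0 g1 0 z $ 1 $ 2)
      else T_mat g0 g1 0 k $ 1 $ 2)"

definition G0_mat :: "(real \<Rightarrow> real) \<Rightarrow> int \<Rightarrow> real \<Rightarrow> complex^2^2" where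
  "G0_mat g0 N t = mat ((- 1) powi N) **
     vector [vector [of_real (cos (g0 t / 2)), - of_real (sin (g0 t / 2))],
             vector [of_real (sin (g0 t / 2)), of_real (cos (g0 t / 2))]]"

section \<open>Complex derivatives relative to a set\<close>

text \<open>
  The functions \<open>A\<close> and \<open>B\<close> live on the closure of \<open>D\<^sub>+\<close>; at its boundary points derivatives are
  limits of difference quotients within that set. At interior points of \<open>S\<close> the following
  is the ordinary complex derivative.
\<close>

definition deriv_within :: "complex set \<Rightarrow> (complex \<Rightarrow> complex) \<Rightarrow> complex \<Rightarrow> complex" where
  "deriv_within S f z = (THE d. (f has_field_derivative d) (at z within S))"

definition higher_deriv_within ::
  "complex set \<Rightarrow> nat \<Rightarrow> (complex \<Rightarrow> complex) \<Rightarrow> complex \<Rightarrow> complex" where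
  "higher_deriv_within S j f = (deriv_within S ^^ j) f"

definition n_times_differentiable_within ::
  "complex set \<Rightarrow> nat \<Rightarrow> (complex \<Rightarrow> complex) \<Rightarrow> bool" where
  "n_times_differentiable_within S n f \<longleftrightarrow>
     (\<forall>j<n. \<forall>z\<in>S. \<exists>d. (higher_deriv_within S j f has_field_derivative d) (at z within S))"

end

theory Submission
  imports Defs "HOL-Complex_Analysis.Complex_Analysis" "HOL-Computational_Algebra.Polynomial"
begin

text \<open>
  The second column \<open>(x, y)\<close> of \<open>T(t, k)\<close> solves
  \<open>x' = - 2 i \<theta>\<^sub>2 x - u y / 4 - i (c x + s y) / (4 k)\<close>, \<open>y' = u x / 4 - i (s x - c y) / (4 k)\<close> with \<open>x \<rightarrow> 0\<close>, \<open>y \<rightarrow> 1\<close> at infinity,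
  where \<open>u = g\<^sub>1 + g\<^sub>0'\<close>, \<open>s = sin g\<^sub>0\<close>, \<open>c = cos g\<^sub>0 - 1\<close>, and \<open>(B, A) = (x, y)(0)\<close>. The
  exponential in the corresponding Volterra equation is bounded exactly when \<open>Im \<theta>\<^sub>2 \<ge> 0\<close>, that is, for
  nonzero \<open>k\<close> in the closure of \<open>D\<^sub>+\<close>.

  For \<open>|k| > 1/2\<close> the Volterra equation is a fixed point problem \<open>z = h + K(k) z\<close> in a space of
  pairs of bounded continuous functions. In a norm weighted by the tails of \<open>|u| + |s| + |c|\<close> the operator
  \<open>K(k)\<close> is a contraction, uniformly in \<open>k\<close>. Each derivative in \<open>k\<close> puts one factor \<open>s - t\<close> under the
  integral, and the weights \<open>(1 + t)\<^sup>n\<close> pay for \<open>n\<close> of them. A resolvent argument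
  (\<open>derivs_bounded_resolvent\<close>) then gives: if the inhomogeneity \<open>h\<close> has \<open>n\<close> derivatives of size \<open>w(k)\<close>,
  so has the solution.

  For the expansion at infinity, formal solutions \<open>\<Sum> b\<^sub>i(t) k\<^sup>-\<^sup>i\<close>, \<open>\<Sum> a\<^sub>i(t) k\<^sup>-\<^sup>i\<close> are computed
  recursively: \<open>b\<^sub>i\<^sub>+\<^sub>1\<close> is algebraic in \<open>b\<^sub>i'\<close> and earlier terms, and \<open>a\<^sub>i\<close> is a tail integral. Truncated at order
  \<open>m\<close>, the series solve the system up to \<open>O(k\<^sup>-\<^sup>m\<^sup>-\<^sup>1)\<close>, so the difference from the true
  solution solves the Volterra equation with an inhomogeneity of that size, together with its \<open>n\<close> derivatives;
  the resolvent argument applies (\<open>lax_expansion_at_infinity\<close>). Since the error has \<open>n\<close> derivatives up to the boundary, this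
  also gives the regularity of \<open>A\<close> and \<open>B\<close> for \<open>|k| > 1/2\<close>.

  The point \<open>k = 0\<close> is reduced to infinity by a gauge transformation: rotating the column by the angle
  \<open>g\<^sub>0 / 2\<close> (with the sign \<open>(-1)\<^sup>N\<close> that makes the rotation tend to the identity) maps a solution for the
  boundary values \<open>- g\<^sub>0, g\<^sub>1\<close> at \<open>1 / k\<close> to a solution for \<open>g\<^sub>0, g\<^sub>1\<close> at \<open>k\<close> (\<open>gauge_lax_solution\<close>). This
  also solves the equation for small \<open>k\<close>. The factor \<open>G\<^sub>0(0)\<close> of the expansion at zero is this rotation
  at \<open>t = 0\<close>, and the error \<open>k\<^sup>m\<^sup>+\<^sup>1\<^sup>-\<^sup>2\<^sup>j\<close> appears because differentiating a function of \<open>1 / k\<close> costs \<open>k\<^sup>-\<^sup>2\<close>.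

  The symmetry under \<open>k \<mapsto> - cnj k\<close> is uniqueness for the conjugated system, and the determinant
  identity is the constancy of a Wronskian. Two preliminary steps connect this with the
  definitions: weak derivatives have absolutely continuous representatives (\<open>sobolev_representative\<close>), and
  the Volterra equation without any growth condition has only the bounded solution
  (\<open>volterra_lax_solution\<close>, \<open>lax_solution_unique\<close>).
\<close>

section \<open>Complex derivatives of Banach space valued functions\<close>

text \<open>
  Holomorphic dependence on \<open>k\<close> is needed for elements of spaces of bounded continuous functions, hence for
  complex Banach spaces. They are obtained from real ones by adding a compatible complex scalar multiplication.
\<close>

class complex_banach = banach +
  fixes scaleC :: "complex \<Rightarrow> 'a \<Rightarrow> 'a"  (infixr \<open>*\<^sub>c\<close> 75)
  assumes scaleC_add_right: "c *\<^sub>c (x + y) = c *\<^sub>c x + c *\<^sub>c y"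
    and scaleC_add_left: "(b + c) *\<^sub>c x = b *\<^sub>c x + c *\<^sub>c x"
    and scaleC_scaleC: "b *\<^sub>c c *\<^sub>c x = (b * c) *\<^sub>c x"
    and scaleC_of_real: "complex_of_real r *\<^sub>c x = r *\<^sub>R x"
    and norm_scaleC: "norm (c *\<^sub>c x) = cmod c * norm x"

lemma bounded_bilinear_scaleC: "bounded_bilinear (scaleC :: complex \<Rightarrow> 'a \<Rightarrow> 'a::complex_banach)"
proof
  show "(a + a') *\<^sub>c (b::'a) = a *\<^sub>c b + a' *\<^sub>c b" for a a' b by (rule scaleC_add_left)
  show "a *\<^sub>c (b + b') = a *\<^sub>c b + a *\<^sub>c (b'::'a)" for a b b' by (rule scaleC_add_right)
  show "(r *\<^sub>R a) *\<^sub>c b = r *\<^sub>R (a *\<^sub>c (b::'a))" for r a b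
    by (simp add: scaleR_conv_of_real flip: scaleC_scaleC scaleC_of_real)
  show "a *\<^sub>c (r *\<^sub>R b) = r *\<^sub>R (a *\<^sub>c (b::'a))" for r a b
    by (simp add: scaleC_scaleC mult.commute flip: scaleC_of_real)
  show "\<exists>K. \<forall>a b. norm (a *\<^sub>c (b::'a)) \<le> norm a * norm b * K"
    by (rule exI[of _ 1]) (simp add: norm_scaleC)
qed

lemmas scaleC_diff_right = bounded_bilinear.diff_right[OF bounded_bilinear_scaleC]
  and scaleC_diff_left = bounded_bilinear.diff_left[OF bounded_bilinear_scaleC]
  and scaleC_zero_right = bounded_bilinear.zero_right[OF bounded_bilinear_scaleC]
  and tendsto_scaleC = bounded_bilinear.tendsto[OF bounded_bilinear_scaleC]
  and continuous_on_scaleC = bounded_bilinear.continuous_on[OF bounded_bilinear_scaleC]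

instantiation complex :: complex_banach
begin
definition scaleC_complex :: "complex \<Rightarrow> complex \<Rightarrow> complex" where
  [simp]: "scaleC_complex c x = c * x"
instance
  by standard (simp_all add: algebra_simps norm_mult scaleR_conv_of_real)
end

instantiation prod :: (complex_banach, complex_banach) complex_banach
begin
definition scaleC_prod :: "complex \<Rightarrow> 'a \<times> 'b \<Rightarrow> 'a \<times> 'b" where
  [simp]: "scaleC_prod c x = (c *\<^sub>c fst x, c *\<^sub>c snd x)"
instance
proof
  fix c :: complex and x :: "'a \<times> 'b"
  have "norm (c *\<^sub>c x) = sqrt ((cmod c)\<^sup>2 * ((norm (fst x))\<^sup>2 + (norm (snd x))\<^sup>2))"
    by (simp add: norm_prod_def norm_scaleC power_mult_distrib algebra_simps)
  then show "norm (c *\<^sub>c x) = cmod c * norm x"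
    by (simp add: norm_prod_def real_sqrt_mult)
qed (auto simp: scaleC_add_right scaleC_add_left scaleC_scaleC scaleC_of_real scaleR_prod_def)
end

instantiation bcontfun :: (metric_space, complex_banach) complex_banach
begin
definition scaleC_bcontfun :: "complex \<Rightarrow> ('a \<Rightarrow>\<^sub>C 'b) \<Rightarrow> 'a \<Rightarrow>\<^sub>C 'b" where
  "scaleC_bcontfun c f = Bcontfun (\<lambda>x. c *\<^sub>c apply_bcontfun f x)"

lemma apply_scaleC_bcontfun [simp]:
  "apply_bcontfun (c *\<^sub>c f) = (\<lambda>x. c *\<^sub>c apply_bcontfun (f :: 'a \<Rightarrow>\<^sub>C 'b) x)"
proof -
  have "norm (c *\<^sub>c apply_bcontfun f x) \<le> cmod c * norm f" for x
    by (simp add: norm_scaleC mult_left_mono norm_bounded)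
  then have "(\<lambda>x. c *\<^sub>c apply_bcontfun f x) \<in> bcontfun"
    by (intro bcontfun_normI continuous_on_scaleC) auto
  then show ?thesis by (simp add: scaleC_bcontfun_def Bcontfun_inverse)
qed

instance
proof
  fix c b :: complex and x y :: "'a \<Rightarrow>\<^sub>C 'b" and r :: real
  show "c *\<^sub>c (x + y) = c *\<^sub>c x + c *\<^sub>c y"
    by (rule bcontfun_eqI) (simp add: scaleC_add_right plus_bcontfun.rep_eq)
  show "(b + c) *\<^sub>c x = b *\<^sub>c x + c *\<^sub>c x"
    by (rule bcontfun_eqI) (simp add: scaleC_add_left plus_bcontfun.rep_eq)
  show sS: "b *\<^sub>c c *\<^sub>c x = (b * c) *\<^sub>c x" for b c and x :: "'a \<Rightarrow>\<^sub>C 'b"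
    by (rule bcontfun_eqI) (simp add: scaleC_scaleC)
  show sr: "complex_of_real r *\<^sub>c x = r *\<^sub>R x" for r and x :: "'a \<Rightarrow>\<^sub>C 'b"
    by (rule bcontfun_eqI) (simp add: scaleC_of_real scaleR_bcontfun.rep_eq)
  have le: "norm (c *\<^sub>c x) \<le> cmod c * norm x" for c and x :: "'a \<Rightarrow>\<^sub>C 'b"
    by (rule norm_bound) (simp add: norm_scaleC mult_left_mono norm_bounded)
  show "norm (c *\<^sub>c x) = cmod c * norm x"
  proof (cases "c = 0")
    case True
    then show ?thesis using le[of c x] by simp
  next
    case False
    have "norm x = norm (inverse c *\<^sub>c c *\<^sub>c x)" using sS[of "inverse c" c] sr[of 1 x] False by simp
    also have "\<dots> \<le> inverse (cmod c) * norm (c *\<^sub>c x)" using le[of "inverse c" "c *\<^sub>c x"]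
      by (simp add: norm_inverse)
    finally have "cmod c * norm x \<le> norm (c *\<^sub>c x)" using False by (simp add: field_simps)
    then show ?thesis using le[of c x] by linarith
  qed
qed
end

text \<open>
  The derivative is a limit within \<open>P\<close>, because solutions are differentiated up to the boundary of
  \<open>D\<^sub>+\<close>, where no complex neighbourhood is available.
\<close>

definition has_cderiv :: "(complex \<Rightarrow> 'a::complex_banach) \<Rightarrow> 'a \<Rightarrow> complex \<Rightarrow> complex set \<Rightarrow> bool" where
  "has_cderiv f d k P \<longleftrightarrow> ((\<lambda>z. inverse (z - k) *\<^sub>c (f z - f k)) \<longlongrightarrow> d) (at k within P)"

lemma has_cderiv_complex: "has_cderiv f d k P \<longleftrightarrow> (f has_field_derivative d) (at k within P)"
  unfolding has_cderiv_def has_field_derivative_iff by (simp add: field_simps)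

lemma has_cderiv_add: "has_cderiv f d k P \<Longrightarrow> has_cderiv g e k P \<Longrightarrow> has_cderiv (\<lambda>z. f z + g z) (d + e) k P"
  unfolding has_cderiv_def
  by (drule (1) tendsto_add) (simp only: scaleC_add_right[symmetric] add_diff_add)

lemma has_cderiv_scaleC:
  assumes c: "has_cderiv c c' k P" and f: "has_cderiv f f' k P" and cont: "continuous (at k within P) f"
  shows "has_cderiv (\<lambda>z. c z *\<^sub>c f z) (c' *\<^sub>c f k + c k *\<^sub>c f') k P"
proof -
  have "((\<lambda>z. (inverse (z - k) * (c z - c k)) *\<^sub>c f z + c k *\<^sub>c (inverse (z - k) *\<^sub>c (f z - f k)))
      \<longlongrightarrow> c' *\<^sub>c f k + c k *\<^sub>c f') (at k within P)"
    using assms unfolding has_cderiv_def continuous_within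
    by (intro tendsto_add tendsto_scaleC tendsto_const) auto
  then show ?thesis unfolding has_cderiv_def
    by (simp add: algebra_simps scaleC_diff_right scaleC_diff_left scaleC_add_right scaleC_scaleC)
qed

text \<open>
  \<open>derivs_bounded P r w f\<close>: on \<open>P\<close> the function \<open>f\<close> has \<open>r\<close> successive continuous complex derivatives, the
  \<open>j\<close>-th being \<open>O(w j)\<close>. The derivatives are existentially quantified one at a time, so that no choice of a
  derivative operator on a set with boundary is involved.
\<close>

primrec derivs_bounded :: "complex set \<Rightarrow> nat \<Rightarrow> (nat \<Rightarrow> complex \<Rightarrow> real) \<Rightarrow> (complex \<Rightarrow> 'a::complex_banach) \<Rightarrow> bool" where
  "derivs_bounded P 0 w f \<longleftrightarrow> continuous_on P f \<and> (\<exists>C. \<forall>k\<in>P. norm (f k) \<le> C * w 0 k)"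
| "derivs_bounded P (Suc r) w f \<longleftrightarrow> (continuous_on P f \<and> (\<exists>C. \<forall>k\<in>P. norm (f k) \<le> C * w 0 k)) \<and>
     (\<exists>f'. (\<forall>k\<in>P. has_cderiv f (f' k) k P) \<and> derivs_bounded P r (\<lambda>j. w (Suc j)) f')"

lemma derivs_bounded_continuous: "derivs_bounded P r w f \<Longrightarrow> continuous_on P f"
  by (cases r) auto

lemma derivs_bounded_bound: "derivs_bounded P r w f \<Longrightarrow> \<exists>C. \<forall>k\<in>P. norm (f k) \<le> C * w 0 k"
  by (cases r) auto

lemma derivs_bounded_pred: "derivs_bounded P (Suc r) w f \<Longrightarrow> derivs_bounded P r w f"
proof (induction r arbitrary: f w)
  case 0
  then show ?case by simp
next
  case (Suc r)
  then obtain f' where "\<forall>k\<in>P. has_cderiv f (f' k) k P" "derivs_bounded P (Suc r) (\<lambda>j. w (Suc j)) f'"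
    using derivs_bounded.simps(2)[of P "Suc r" w f] by blast
  with Suc.IH[of "\<lambda>j. w (Suc j)" f'] derivs_bounded.simps(2)[of P "Suc r" w f] Suc.prems
  show ?case unfolding derivs_bounded.simps(2)[of P r w f] by blast
qed

lemma derivs_bounded_le: "derivs_bounded P r w f \<Longrightarrow> q \<le> r \<Longrightarrow> derivs_bounded P q w f"
proof (induction r)
  case (Suc r)
  then show ?case using derivs_bounded_pred[of P r w f] by (cases "q = Suc r") auto
qed simp

lemma derivs_bounded_SucI:
  assumes "derivs_bounded P 0 w f" "\<And>k. k \<in> P \<Longrightarrow> has_cderiv f (f' k) k P" "derivs_bounded P r (\<lambda>j. w (Suc j)) f'"
  shows "derivs_bounded P (Suc r) w f"
  unfolding derivs_bounded.simps(2) using assms(1)[unfolded derivs_bounded.simps(1)] assms(2,3)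
  by - (rule conjI, assumption, rule exI[of _ f'], rule conjI, rule ballI)

lemma derivs_bounded_SucE:
  assumes "derivs_bounded P (Suc r) w f"
  obtains f' where "\<And>k. k \<in> P \<Longrightarrow> has_cderiv f (f' k) k P" "derivs_bounded P r (\<lambda>j. w (Suc j)) f'"
proof -
  obtain f' where "\<forall>k\<in>P. has_cderiv f (f' k) k P" "derivs_bounded P r (\<lambda>j. w (Suc j)) f'"
    using assms unfolding derivs_bounded.simps(2) by (elim conjE exE)
  then show ?thesis by (intro that[of f']) simp_all
qed

lemma derivs_bounded_add:
  "derivs_bounded P r w f \<Longrightarrow> derivs_bounded P r w g \<Longrightarrow> derivs_bounded P r w (\<lambda>k. f k + g k)"
proof (induction r arbitrary: f g w)
  case 0
  then obtain C D where C: "\<forall>k\<in>P. norm (f k) \<le> C * w 0 k" and D: "\<forall>k\<in>P. norm (g k) \<le> D * w 0 k"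
    by auto
  have "norm (f k + g k) \<le> (C + D) * w 0 k" if "k \<in> P" for k
    using C D that norm_triangle_ineq[of "f k" "g k"] by (fastforce simp: algebra_simps)
  with 0 show ?case by (auto intro!: continuous_intros)
next
  case (Suc r)
  obtain f' where f': "\<And>k. k \<in> P \<Longrightarrow> has_cderiv f (f' k) k P" "derivs_bounded P r (\<lambda>j. w (Suc j)) f'"
    by (rule derivs_bounded_SucE[OF Suc.prems(1)]) blast
  obtain g' where g': "\<And>k. k \<in> P \<Longrightarrow> has_cderiv g (g' k) k P" "derivs_bounded P r (\<lambda>j. w (Suc j)) g'"
    by (rule derivs_bounded_SucE[OF Suc.prems(2)]) blast
  have "derivs_bounded P 0 w (\<lambda>k. f k + g k)"
    using Suc.IH[OF derivs_bounded_pred derivs_bounded_pred, OF Suc.prems] by (rule derivs_bounded_le) simp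
  then show ?case
    by (rule derivs_bounded_SucI[where f' = "\<lambda>k. f' k + g' k"]) (auto intro: has_cderiv_add f' g' Suc.IH)
qed

lemma derivs_bounded_scaleC:
  assumes "derivs_bounded P r (\<lambda>_. v) c" "derivs_bounded P r (\<lambda>_. w) f"
  shows "derivs_bounded P r (\<lambda>_ k. v k * w k) (\<lambda>k. c k *\<^sub>c f k)"
  using assms
proof (induction r arbitrary: c f)
  case 0
  then obtain C D where C: "\<forall>k\<in>P. norm (c k) \<le> C * v k" and D: "\<forall>k\<in>P. norm (f k) \<le> D * w k"
    by auto
  have "norm (c k *\<^sub>c f k) \<le> C * D * (v k * w k)" if "k \<in> P" for k
  proof -
    have "cmod (c k) * norm (f k) \<le> (C * v k) * (D * w k)"
      using C D that by (intro mult_mono) (auto intro: order_trans[OF norm_ge_zero])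
    then show ?thesis by (simp add: norm_scaleC algebra_simps)
  qed
  with 0 show ?case by (auto intro!: continuous_on_scaleC)
next
  case (Suc r)
  obtain f' where f': "\<And>k. k \<in> P \<Longrightarrow> has_cderiv f (f' k) k P" "derivs_bounded P r (\<lambda>j. w) f'"
    by (rule derivs_bounded_SucE[OF Suc.prems(2)]) blast
  obtain c' where c': "\<And>k. k \<in> P \<Longrightarrow> has_cderiv c (c' k) k P" "derivs_bounded P r (\<lambda>j. v) c'"
    by (rule derivs_bounded_SucE[OF Suc.prems(1)]) blast
  note down = Suc.prems[THEN derivs_bounded_pred]
  have "derivs_bounded P 0 (\<lambda>_ k. v k * w k) (\<lambda>k. c k *\<^sub>c f k)"
    using Suc.IH[OF down] by (rule derivs_bounded_le) simp
  then show ?case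
  proof (rule derivs_bounded_SucI[where f' = "\<lambda>k. c' k *\<^sub>c f k + c k *\<^sub>c f' k"])
    show "has_cderiv (\<lambda>k. c k *\<^sub>c f k) (c' k *\<^sub>c f k + c k *\<^sub>c f' k) k P" if "k \<in> P" for k
      using that derivs_bounded_continuous[OF Suc.prems(2)]
      by (intro has_cderiv_scaleC c' f') (auto simp: continuous_on_eq_continuous_within)
    show "derivs_bounded P r (\<lambda>j k. v k * w k) (\<lambda>k. c' k *\<^sub>c f k + c k *\<^sub>c f' k)"
      by (intro derivs_bounded_add Suc.IH c' f' down)
  qed
qed

lemma derivs_bounded_weight_mono:
  assumes "derivs_bounded P r w f" "\<And>j k. j \<le> r \<Longrightarrow> k \<in> P \<Longrightarrow> 0 \<le> w j k \<and> w j k \<le> C * w' j k"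
  shows "derivs_bounded P r w' f"
  using assms
proof (induction r arbitrary: f w w')
  case 0
  then obtain D where D: "\<forall>k\<in>P. norm (f k) \<le> D * w 0 k" by auto
  have "norm (f k) \<le> \<bar>D\<bar> * C * w' 0 k" if "k \<in> P" for k
  proof -
    have "norm (f k) \<le> \<bar>D\<bar> * w 0 k"
      using D 0(2)[of 0 k] that by (smt (verit) mult_right_mono le_numeral_extra(3))
    also have "\<dots> \<le> \<bar>D\<bar> * (C * w' 0 k)" using 0(2)[of 0 k] that by (intro mult_left_mono) auto
    finally show ?thesis by simp
  qed
  with 0 show ?case by auto
next
  case (Suc r)
  obtain f' where f': "\<And>k. k \<in> P \<Longrightarrow> has_cderiv f (f' k) k P" "derivs_bounded P r (\<lambda>j. w (Suc j)) f'"
    by (rule derivs_bounded_SucE[OF Suc.prems(1)]) blast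
  show ?case
  proof (rule derivs_bounded_SucI)
    show "derivs_bounded P 0 w' f"
      by (rule derivs_bounded_le[OF Suc.IH[OF derivs_bounded_pred[OF Suc.prems(1)]]]) (use Suc.prems(2) in auto)
    show "has_cderiv f (f' k) k P" if "k \<in> P" for k using f' that by auto
    show "derivs_bounded P r (\<lambda>j. w' (Suc j)) f'" by (rule Suc.IH[OF f'(2)]) (use Suc.prems(2) in auto)
  qed
qed

lemma derivs_bounded_const: "derivs_bounded P r (\<lambda>_ _. 1) (\<lambda>_. x)"
proof (induction r arbitrary: x)
  case (Suc r)
  show ?case
    by (rule derivs_bounded_SucI[where f' = "\<lambda>_. 0"])
      (auto simp: has_cderiv_def scaleC_zero_right Suc intro: exI[of _ "norm x"])
qed (auto intro: exI[of _ "norm x"])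

section \<open>Operator families and their resolvents\<close>

definition linear_family :: "complex set \<Rightarrow> (complex \<Rightarrow> 'a::complex_banach \<Rightarrow> 'b::complex_banach) \<Rightarrow> bool" where
  "linear_family P K \<longleftrightarrow> (\<forall>k\<in>P. \<forall>x y. K k (x + y) = K k x + K k y) \<and>
     (\<forall>k\<in>P. \<forall>c x. K k (c *\<^sub>c x) = c *\<^sub>c K k x) \<and>
     (\<exists>C. \<forall>k\<in>P. \<forall>x. norm (K k x) \<le> C * norm x) \<and> (\<forall>x. continuous_on P (\<lambda>k. K k x))"

text \<open>
  Differentiability in the strong sense, for each vector separately: this is what product rules applied to
  \<open>K k (f k)\<close> require, given the uniform bound in \<open>linear_family\<close>.
\<close>

primrec op_smooth :: "complex set \<Rightarrow> nat \<Rightarrow> (complex \<Rightarrow> 'a::complex_banach \<Rightarrow> 'b::complex_banach) \<Rightarrow> bool" where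
  "op_smooth P 0 K \<longleftrightarrow> linear_family P K"
| "op_smooth P (Suc r) K \<longleftrightarrow> linear_family P K \<and>
     (\<exists>K'. (\<forall>x. \<forall>k\<in>P. has_cderiv (\<lambda>k. K k x) (K' k x) k P) \<and> op_smooth P r K')"

lemma op_smooth_0: "op_smooth P r K \<Longrightarrow> op_smooth P 0 K"
  by (cases r) auto

lemma op_smooth_pred: "op_smooth P (Suc r) K \<Longrightarrow> op_smooth P r K"
proof (induction r arbitrary: K)
  case 0
  then show ?case by simp
next
  case (Suc r)
  then obtain K' where "\<forall>x. \<forall>k\<in>P. has_cderiv (\<lambda>k. K k x) (K' k x) k P" "op_smooth P (Suc r) K'"
    using op_smooth.simps(2)[of P "Suc r" K] by blast
  with Suc.IH[of K'] op_smooth.simps(2)[of P "Suc r" K] Suc.prems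
  show ?case unfolding op_smooth.simps(2)[of P r K] by blast
qed

lemma op_smooth_SucI:
  assumes "op_smooth P 0 K" "\<And>x k. k \<in> P \<Longrightarrow> has_cderiv (\<lambda>k. K k x) (K' k x) k P" "op_smooth P r K'"
  shows "op_smooth P (Suc r) K"
  unfolding op_smooth.simps(2) using assms(1)[unfolded op_smooth.simps(1)] assms(2,3)
  by - (rule conjI, assumption, rule exI[of _ K'], rule conjI, rule allI, rule ballI)

lemma op_smooth_SucE:
  assumes "op_smooth P (Suc r) K"
  obtains K' where "\<And>x k. k \<in> P \<Longrightarrow> has_cderiv (\<lambda>k. K k x) (K' k x) k P" "op_smooth P r K'"
proof -
  obtain K' where "\<forall>x. \<forall>k\<in>P. has_cderiv (\<lambda>k. K k x) (K' k x) k P" "op_smooth P r K'"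
    using assms unfolding op_smooth.simps(2) by (elim conjE exE)
  then show ?thesis by (intro that[of K']) simp_all
qed

lemma op_smooth_diff: "op_smooth P 0 K \<Longrightarrow> k \<in> P \<Longrightarrow> K k (x - y) = K k x - K k y"
proof -
  assume K: "op_smooth P 0 K" and k: "k \<in> P"
  have "K k (x - y + y) = K k (x - y) + K k y" using K k by (metis op_smooth.simps(1) linear_family_def)
  then show ?thesis by (simp add: algebra_simps)
qed

lemma op_smooth_tendsto:
  assumes K: "op_smooth P 0 K" and k: "k \<in> P" and f: "(f \<longlongrightarrow> x) (at k within P)"
  shows "((\<lambda>z. K z (f z)) \<longlongrightarrow> K k x) (at k within P)"
proof -
  obtain C where C: "\<forall>k\<in>P. \<forall>x. norm (K k x) \<le> C * norm x" using K by (auto simp: linear_family_def)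
  have "((\<lambda>z. K z (f z - x)) \<longlongrightarrow> 0) (at k within P)"
  proof (rule Lim_null_comparison)
    show "\<forall>\<^sub>F z in at k within P. norm (K z (f z - x)) \<le> C * norm (f z - x)"
      using C by (auto simp: eventually_at_filter)
    show "((\<lambda>z. C * norm (f z - x)) \<longlongrightarrow> 0) (at k within P)"
      using tendsto_mult[OF tendsto_const tendsto_norm[OF LIM_zero[OF f]]] by simp
  qed
  moreover have "((\<lambda>z. K z x) \<longlongrightarrow> K k x) (at k within P)"
    using K k by (auto simp: linear_family_def continuous_on_def)
  ultimately have "((\<lambda>z. K z (f z - x) + K z x) \<longlongrightarrow> 0 + K k x) (at k within P)"
    by (rule tendsto_add)
  then show ?thesis
    by (rule Lim_transform_eventually[THEN tendsto_eq_rhs])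
      (auto simp: eventually_at_filter op_smooth_diff[OF K])
qed

lemma op_smooth_apply_deriv:
  assumes K: "op_smooth P 0 K" "has_cderiv (\<lambda>z. K z (f k)) (K' k (f k)) k P" and k: "k \<in> P"
    and f: "has_cderiv f f' k P"
  shows "has_cderiv (\<lambda>z. K z (f z)) (K' k (f k) + K k f') k P"
proof -
  have "((\<lambda>z. inverse (z - k) *\<^sub>c (K z (f k) - K k (f k)) + K z (inverse (z - k) *\<^sub>c (f z - f k)))
     \<longlongrightarrow> K' k (f k) + K k f') (at k within P)"
    using K(2) f unfolding has_cderiv_def by (intro tendsto_add op_smooth_tendsto[OF K(1) k])
  then show ?thesis unfolding has_cderiv_def
  proof (rule Lim_transform_eventually)
    have "K z (inverse (z - k) *\<^sub>c (f z - f k)) = inverse (z - k) *\<^sub>c (K z (f z) - K z (f k))"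
      if "z \<in> P" for z
      using K(1) that by (simp add: op_smooth_diff[OF K(1)] linear_family_def)
    then show "\<forall>\<^sub>F z in at k within P. inverse (z - k) *\<^sub>c (K z (f k) - K k (f k)) +
          K z (inverse (z - k) *\<^sub>c (f z - f k)) = inverse (z - k) *\<^sub>c (K z (f z) - K k (f k))"
      by (auto simp: eventually_at_filter simp flip: scaleC_add_right)
  qed
qed

lemma op_smooth_apply:
  "op_smooth P r K \<Longrightarrow> derivs_bounded P r (\<lambda>_. w) f \<Longrightarrow> derivs_bounded P r (\<lambda>_. w) (\<lambda>k. K k (f k))"
proof (induction r arbitrary: K f)
  case 0
  obtain C where C: "\<forall>k\<in>P. \<forall>x. norm (K k x) \<le> C * norm x" using 0 by (auto simp: linear_family_def)
  obtain D where D: "\<forall>k\<in>P. norm (f k) \<le> D * w k" using 0 by auto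
  have "norm (K k (f k)) \<le> \<bar>C\<bar> * D * w k" if "k \<in> P" for k
  proof -
    have "norm (K k (f k)) \<le> C * norm (f k)" using C that by auto
    also have "\<dots> \<le> \<bar>C\<bar> * norm (f k)" by (intro mult_right_mono) auto
    also have "\<dots> \<le> \<bar>C\<bar> * (D * w k)" using D that by (intro mult_left_mono) auto
    finally show ?thesis by simp
  qed
  moreover have "continuous_on P (\<lambda>k. K k (f k))"
    unfolding continuous_on_def
  proof
    fix k assume k: "k \<in> P"
    then have "(f \<longlongrightarrow> f k) (at k within P)" using 0(2) by (simp add: continuous_on_def)
    then show "((\<lambda>k. K k (f k)) \<longlongrightarrow> K k (f k)) (at k within P)" by (rule op_smooth_tendsto[OF 0(1) k])
  qed
  ultimately show ?case unfolding derivs_bounded.simps(1) by - (rule conjI, assumption, rule exI[of _ "\<bar>C\<bar> * D"], rule ballI)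
next
  case (Suc r)
  obtain K' where K': "\<And>x k. k \<in> P \<Longrightarrow> has_cderiv (\<lambda>k. K k x) (K' k x) k P" "op_smooth P r K'"
    by (rule op_smooth_SucE[OF Suc.prems(1)]) blast
  obtain f' where f': "\<And>k. k \<in> P \<Longrightarrow> has_cderiv f (f' k) k P" "derivs_bounded P r (\<lambda>_. w) f'"
    by (rule derivs_bounded_SucE[OF Suc.prems(2)]) blast
  note down = op_smooth_pred[OF Suc.prems(1)] derivs_bounded_pred[OF Suc.prems(2)]
  show ?case
  proof (rule derivs_bounded_SucI[where f' = "\<lambda>k. K' k (f k) + K k (f' k)"])
    show "derivs_bounded P 0 (\<lambda>_. w) (\<lambda>k. K k (f k))" using Suc.IH[OF down] by (rule derivs_bounded_le) simp
    show "has_cderiv (\<lambda>k. K k (f k)) (K' k (f k) + K k (f' k)) k P" if "k \<in> P" for k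
      using that by (intro op_smooth_apply_deriv op_smooth_0[OF down(1)] K' f')
    show "derivs_bounded P r (\<lambda>j. w) (\<lambda>k. K' k (f k) + K k (f' k))"
      by (intro derivs_bounded_add Suc.IH K' f' down)
  qed
qed

text \<open>
  Formally \<open>e = (1 - K)\<^sup>-\<^sup>1 h\<close> and \<open>e' = (1 - K)\<^sup>-\<^sup>1 (h' + K' e)\<close>. The candidate \<open>e'\<close> is the solution of the
  second equation; the difference quotient of \<open>e\<close> minus \<open>e'\<close> solves an equation of the same kind with a right-hand
  side tending to zero, hence tends to zero by the uniform bound for \<open>(1 - K)\<^sup>-\<^sup>1\<close>. Since \<open>h' + K' e\<close> has
  one derivative less, induction gives all derivatives with the weight of \<open>h\<close>.
\<close>

lemma derivs_bounded_resolvent: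
  assumes K: "op_smooth P n K"
    and ex: "\<And>k h. k \<in> P \<Longrightarrow> \<exists>x. x = h + K k x"
    and bd: "\<And>k x. k \<in> P \<Longrightarrow> norm x \<le> C * norm (x - K k x)" and "C \<ge> 0"
    and h: "derivs_bounded P n (\<lambda>_. w) h" and e: "\<And>k. k \<in> P \<Longrightarrow> e k = h k + K k (e k)"
  shows "derivs_bounded P n (\<lambda>_. w) e"
proof -
  note K0 = op_smooth_0[OF K]
  have K_lin: "K k (x - y) = K k x - K k y" if "k \<in> P" for k x y by (rule op_smooth_diff[OF K0 that])
  have K_scale: "K k (c *\<^sub>c x) = c *\<^sub>c K k x" if "k \<in> P" for k c x using K0 that by (simp add: linear_family_def)
  have lim0: "(q \<longlongrightarrow> 0) (at k within P)"
    if q: "((\<lambda>z. q z - K z (q z)) \<longlongrightarrow> 0) (at k within P)" and k: "k \<in> P" for q k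
  proof (rule Lim_null_comparison)
    show "\<forall>\<^sub>F z in at k within P. norm (q z) \<le> C * norm (q z - K z (q z))"
      using bd by (auto simp: eventually_at_filter)
    show "((\<lambda>z. C * norm (q z - K z (q z))) \<longlongrightarrow> 0) (at k within P)"
      using tendsto_mult[OF tendsto_const tendsto_norm[OF q]] by simp
  qed
  have base: "derivs_bounded P 0 (\<lambda>_. w) e" if h: "derivs_bounded P 0 (\<lambda>_. w) h" and e: "\<And>k. k \<in> P \<Longrightarrow> e k = h k + K k (e k)"
    for h e
  proof -
    obtain D where D: "\<forall>k\<in>P. norm (h k) \<le> D * w k" using h by auto
    have "norm (e k) \<le> C * D * w k" if "k \<in> P" for k
    proof -
      have "norm (e k) \<le> C * norm (h k)" using bd[OF that, of "e k"] e[OF that]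
        by (metis add_diff_cancel_right')
      also have "\<dots> \<le> C * (D * w k)" using D that \<open>C \<ge> 0\<close> by (intro mult_left_mono) auto
      finally show ?thesis by simp
    qed
    moreover have "(e \<longlongrightarrow> e k) (at k within P)" if k: "k \<in> P" for k
    proof -
      have "((\<lambda>z. e z - e k) \<longlongrightarrow> 0) (at k within P)"
      proof (rule lim0[OF _ k])
        have "((\<lambda>z. (h z - h k) + (K z (e k) - K k (e k))) \<longlongrightarrow> 0 + 0) (at k within P)"
          using h K0 k by (intro tendsto_add LIM_zero) (auto simp: continuous_on_def linear_family_def)
        then have "((\<lambda>z. (h z - h k) + (K z (e k) - K k (e k))) \<longlongrightarrow> 0) (at k within P)" by simp
        then show "((\<lambda>z. e z - e k - K z (e z - e k)) \<longlongrightarrow> 0) (at k within P)"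
        proof (rule Lim_transform_eventually)
          have "(h z - h k) + (K z (e k) - K k (e k)) = e z - e k - K z (e z - e k)" if "z \<in> P" for z
            using e[OF that] e[OF k] K_lin[OF that] by (simp add: algebra_simps)
          then show "\<forall>\<^sub>F z in at k within P. (h z - h k) + (K z (e k) - K k (e k)) = e z - e k - K z (e z - e k)"
            by (auto simp: eventually_at_filter)
        qed
      qed
      then show ?thesis by (rule LIM_zero_cancel)
    qed
    ultimately show ?thesis by (auto simp: continuous_on_def linear_family_def)
  qed
  have "derivs_bounded P r (\<lambda>_. w) e"
    if "r \<le> n" "derivs_bounded P r (\<lambda>_. w) h" "\<And>k. k \<in> P \<Longrightarrow> e k = h k + K k (e k)" for r h e
    using that
  proof (induction r arbitrary: h e)
    case 0
    then show ?case using base by blast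
  next
    case (Suc r)
    have Kr: "op_smooth P (Suc r) K" using K Suc.prems(1)
    proof (induction n)
      case (Suc n)
      then show ?case using op_smooth_pred[of P n K] by (cases "r = n") auto
    qed auto
    have e_r: "derivs_bounded P r (\<lambda>_. w) e"
      by (rule Suc.IH[OF _ derivs_bounded_pred[OF Suc.prems(2)] Suc.prems(3)]) (use Suc.prems in auto)
    obtain h' where h': "\<And>k. k \<in> P \<Longrightarrow> has_cderiv h (h' k) k P" "derivs_bounded P r (\<lambda>_. w) h'"
      by (rule derivs_bounded_SucE[OF Suc.prems(2)]) blast
    obtain K' where K': "\<And>x k. k \<in> P \<Longrightarrow> has_cderiv (\<lambda>k. K k x) (K' k x) k P" "op_smooth P r K'"
      by (rule op_smooth_SucE[OF Kr]) blast
    \<comment> \<open>the inhomogeneity of the equation obtained by formal differentiation\<close>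
    define H where "H k = h' k + K' k (e k)" for k
    have H: "derivs_bounded P r (\<lambda>_. w) H"
      unfolding H_def by (rule derivs_bounded_add[OF h'(2) op_smooth_apply[OF K'(2) e_r]])
    have "\<exists>x. \<forall>k\<in>P. x k = H k + K k (x k)" by (rule bchoice) (use ex in blast)
    then obtain e' where e': "\<And>k. k \<in> P \<Longrightarrow> e' k = H k + K k (e' k)" by blast
    have e'_r: "derivs_bounded P r (\<lambda>_. w) e'"
      by (rule Suc.IH[OF _ H e']) (use Suc.prems in auto)
    show ?case
    proof (rule derivs_bounded_SucI[OF derivs_bounded_le[OF e_r] _ e'_r])
      fix k assume k: "k \<in> P"
      \<comment> \<open>error of the difference quotient; the uniform bound shows that it tends to zero\<close>
      define q where "q z = inverse (z - k) *\<^sub>c (e z - e k) - e' k" for z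
      have "((\<lambda>z. (inverse (z - k) *\<^sub>c (h z - h k) - h' k)
            + (inverse (z - k) *\<^sub>c (K z (e k) - K k (e k)) - K' k (e k))
            + (K z (e' k) - K k (e' k))) \<longlongrightarrow> 0 + 0 + 0) (at k within P)"
        using h'(1)[OF k] K'(1)[OF k] K0 k unfolding has_cderiv_def
        by (intro tendsto_add LIM_zero) (auto simp: continuous_on_def linear_family_def)
      then have "((\<lambda>z. (inverse (z - k) *\<^sub>c (h z - h k) - h' k)
            + (inverse (z - k) *\<^sub>c (K z (e k) - K k (e k)) - K' k (e k))
            + (K z (e' k) - K k (e' k))) \<longlongrightarrow> 0) (at k within P)" by simp
      then have "((\<lambda>z. q z - K z (q z)) \<longlongrightarrow> 0) (at k within P)"
      proof (rule Lim_transform_eventually)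
        have "(inverse (z - k) *\<^sub>c (h z - h k) - h' k)
            + (inverse (z - k) *\<^sub>c (K z (e k) - K k (e k)) - K' k (e k))
            + (K z (e' k) - K k (e' k)) = q z - K z (q z)" if z: "z \<in> P" for z
        proof -
          define c where "c = inverse (z - k)"
          have a: "K z (q z) = c *\<^sub>c (K z (e z) - K z (e k)) - K z (e' k)"
            unfolding q_def c_def[symmetric] by (simp add: K_lin[OF z] K_scale[OF z])
          have b: "K z (e z) = e z - h z" "K k (e k) = e k - h k"
            using Suc.prems(3)[OF z] Suc.prems(3)[OF k] by (auto simp: algebra_simps)
          have d: "K k (e' k) = e' k - h' k - K' k (e k)"
            using e'[OF k] by (simp add: H_def algebra_simps)
          show ?thesis unfolding a b d unfolding q_def c_def[symmetric]
            by (simp add: scaleC_diff_right scaleC_add_right algebra_simps)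
        qed
        then show "\<forall>\<^sub>F z in at k within P. (inverse (z - k) *\<^sub>c (h z - h k) - h' k)
            + (inverse (z - k) *\<^sub>c (K z (e k) - K k (e k)) - K' k (e k))
            + (K z (e' k) - K k (e' k)) = q z - K z (q z)"
          by (auto simp: eventually_at_filter)
      qed
      then have "(q \<longlongrightarrow> 0) (at k within P)" by (rule lim0[OF _ k])
      then show "has_cderiv e (e' k) k P"
        unfolding has_cderiv_def q_def by (rule LIM_zero_cancel)
    qed simp
  qed
  from this[OF order_refl h e] show ?thesis by blast
qed

section \<open>Absolutely continuous functions on the half-line\<close>

text \<open>
  \<open>F\<close> is locally absolutely continuous on \<open>[0, \<infinity>)\<close> with almost everywhere derivative \<open>f\<close>. The integral form
  avoids differentiation theorems, and it is insensitive to changing \<open>f\<close> on null sets.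
\<close>

definition has_ac_deriv :: "(real \<Rightarrow> complex) \<Rightarrow> (real \<Rightarrow> complex) \<Rightarrow> bool" where
  "has_ac_deriv F f \<longleftrightarrow> (\<forall>t\<ge>0. f absolutely_integrable_on {0..t} \<and> integral {0..t} f = F t - F 0)"

lemma has_ac_deriv_integrable: "has_ac_deriv F f \<Longrightarrow> 0 \<le> a \<Longrightarrow> f absolutely_integrable_on {a..b}"
  by (cases "a \<le> b") (auto simp: has_ac_deriv_def intro: absolutely_integrable_on_subinterval[where S="{0..b}"])

lemma has_ac_deriv_integrable_on: "has_ac_deriv F f \<Longrightarrow> 0 \<le> a \<Longrightarrow> f integrable_on {a..b}"
  using has_ac_deriv_integrable set_lebesgue_integral_eq_integral(1) by blast

lemma has_ac_deriv_eq: "has_ac_deriv F f \<Longrightarrow> 0 \<le> t \<Longrightarrow> F t = F 0 + integral {0..t} f"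
  by (simp add: has_ac_deriv_def)

lemma has_ac_deriv_continuous: assumes "has_ac_deriv F f" shows "continuous_on {0..} F"
proof -
  have "continuous (at t within {0..}) F" if "t \<ge> 0" for t
  proof -
    have "continuous_on {0..t+1} (\<lambda>x. F 0 + integral {0..x} f)"
      by (intro continuous_intros indefinite_integral_continuous_1 has_ac_deriv_integrable_on[OF assms]) auto
    then have "continuous_on {0..t+1} F"
      by (rule continuous_on_eq) (rule has_ac_deriv_eq[OF assms, symmetric], simp)
    then have "continuous (at t within {0..t+1}) F" using that by (simp add: continuous_on_eq_continuous_within)
    moreover have "at t within {0..t+1} = at t within {0..}"
      by (rule at_within_nhd[of _ "{..<t+1}"]) auto
    ultimately show ?thesis by (simp add: continuous_within)
  qed
  then show ?thesis by (auto simp: continuous_on_eq_continuous_within)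
qed

lemma has_ac_deriv_const: "has_ac_deriv (\<lambda>_. c) (\<lambda>_. 0)"
  by (simp add: has_ac_deriv_def)

lemma has_ac_deriv_add: assumes "has_ac_deriv F f" "has_ac_deriv G g" shows "has_ac_deriv (\<lambda>t. F t + G t) (\<lambda>t. f t + g t)"
  unfolding has_ac_deriv_def
proof (intro allI impI conjI)
  fix t :: real assume t: "t \<ge> 0"
  show "(\<lambda>t. f t + g t) absolutely_integrable_on {0..t}"
    by (rule set_integral_add; rule has_ac_deriv_integrable[OF _ order_refl]; rule assms)
  show "integral {0..t} (\<lambda>t. f t + g t) = F t + G t - (F 0 + G 0)"
    using has_ac_deriv_eq[OF assms(1) t] has_ac_deriv_eq[OF assms(2) t]
      integral_add[OF has_ac_deriv_integrable_on[OF assms(1) order_refl] has_ac_deriv_integrable_on[OF assms(2) order_refl], of t]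
    by simp
qed

lemma has_ac_deriv_cmult: assumes "has_ac_deriv F f" shows "has_ac_deriv (\<lambda>t. c * F t) (\<lambda>t. c * f t)"
  unfolding has_ac_deriv_def
proof (intro allI impI conjI)
  fix t :: real assume t: "t \<ge> 0"
  show "(\<lambda>t. c * f t) absolutely_integrable_on {0..t}"
    using has_ac_deriv_integrable[OF assms, of 0 t] by (intro set_integrable_mult_right) auto
  show "integral {0..t} (\<lambda>t. c * f t) = c * F t - c * F 0"
    by (subst has_ac_deriv_eq[OF assms t]) (simp add: algebra_simps)
qed

lemma has_ac_deriv_minus: "has_ac_deriv F f \<Longrightarrow> has_ac_deriv (\<lambda>t. - F t) (\<lambda>t. - f t)"
  using has_ac_deriv_cmult[of F f "-1"] by simp

lemma has_ac_deriv_diff: "has_ac_deriv F f \<Longrightarrow> has_ac_deriv G g \<Longrightarrow> has_ac_deriv (\<lambda>t. F t - G t) (\<lambda>t. f t - g t)"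
  using has_ac_deriv_add[of F f "\<lambda>t. - G t" "\<lambda>t. - g t"] has_ac_deriv_minus[of G g] by simp

lemma has_ac_deriv_sum: "(\<And>i. i \<in> I \<Longrightarrow> has_ac_deriv (F i) (f i)) \<Longrightarrow> has_ac_deriv (\<lambda>t. \<Sum>i\<in>I. F i t) (\<lambda>t. \<Sum>i\<in>I. f i t)"
  by (induction I rule: infinite_finite_induct) (auto intro: has_ac_deriv_add has_ac_deriv_const)

lemma has_ac_deriv_cong:
  assumes "has_ac_deriv F f" "\<And>t. t \<ge> 0 \<Longrightarrow> F t = G t"
  shows "has_ac_deriv G f"
  unfolding has_ac_deriv_def
proof (intro allI impI)
  fix t :: real assume "t \<ge> 0"
  then show "f absolutely_integrable_on {0..t} \<and> integral {0..t} f = G t - G 0"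
    using assms(1) assms(2)[of 0] assms(2)[of t] unfolding has_ac_deriv_def by simp
qed

lemma has_ac_deriv_spike:
  assumes "has_ac_deriv F f" "negligible N" "\<And>t. t \<ge> 0 \<Longrightarrow> t \<notin> N \<Longrightarrow> f t = g t"
  shows "has_ac_deriv F g"
  unfolding has_ac_deriv_def
proof (intro allI impI conjI)
  fix t :: real assume t: "t \<ge> 0"
  show "g absolutely_integrable_on {0..t}"
    by (rule absolutely_integrable_spike[OF has_ac_deriv_integrable[OF assms(1), of 0] assms(2)])
      (use assms(3) in auto)
  have "integral {0..t} f = integral {0..t} g"
    by (rule integral_spike[OF assms(2)]) (use assms(3) in auto)
  then show "integral {0..t} g = F t - F 0" using has_ac_deriv_eq[OF assms(1) t] by simp
qed

lemma has_ac_deriv_cong_deriv: "has_ac_deriv F f \<Longrightarrow> (\<And>t. t \<ge> 0 \<Longrightarrow> f t = g t) \<Longrightarrow> has_ac_deriv F g"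
  by (rule has_ac_deriv_spike[of F f "{}"]) auto

lemma has_ac_deriv_C1:
  assumes "\<And>t. t \<ge> 0 \<Longrightarrow> (F has_vector_derivative f t) (at t within {0..})" "continuous_on {0..} f"
  shows "has_ac_deriv F f"
  unfolding has_ac_deriv_def
proof (intro allI impI conjI)
  fix t :: real assume t: "t \<ge> 0"
  show "f absolutely_integrable_on {0..t}"
    by (intro absolutely_integrable_continuous_real continuous_on_subset[OF assms(2)]) auto
  have "(f has_integral (F t - F 0)) {0..t}"
    using t by (intro fundamental_theorem_of_calculus)
      (auto intro: has_vector_derivative_within_subset[OF assms(1)])
  then show "integral {0..t} f = F t - F 0" by (simp add: integral_unique)
qed

lemma has_ac_deriv_vector_derivative:
  assumes "has_ac_deriv F f" "continuous_on {0..} f" "t \<ge> 0"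
  shows "(F has_vector_derivative f t) (at t within {0..})"
proof -
  have "((\<lambda>u. F 0 + integral {0..u} f) has_vector_derivative 0 + f t) (at t within {0..t+1})"
    using assms(3) by (intro has_vector_derivative_add has_vector_derivative_const
      integral_has_vector_derivative continuous_on_subset[OF assms(2)]) auto
  then have *: "((\<lambda>u. F 0 + integral {0..u} f) has_vector_derivative f t) (at t within {0..t+1})" by simp
  have "(F has_vector_derivative f t) (at t within {0..t+1})"
  proof (rule has_vector_derivative_transform[OF _ _ *])
    show "t \<in> {0..t+1}" using assms(3) by simp
    show "F x = F 0 + integral {0..x} f" if "x \<in> {0..t+1}" for x
      using that by (intro has_ac_deriv_eq[OF assms(1)]) simp
  qed
  moreover have "at t within {0..t+1} = at t within {0..}"
    by (rule at_within_nhd[of _ "{..<t+1}"]) (use assms(3) in auto)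
  ultimately show ?thesis by (simp add: has_vector_derivative_def)
qed

lemma sigma_finite_lebesgue: "sigma_finite_measure (lebesgue :: real measure)"
proof
  obtain A :: "real set set" where A: "countable A" "A \<subseteq> sets lborel" "\<Union>A = space lborel" "\<forall>a\<in>A. emeasure lborel a \<noteq> \<infinity>"
    using lborel.sigma_finite_countable by blast
  have "A \<subseteq> sets lebesgue" using A(2) by (auto intro: sets_completionI_sets)
  moreover have "\<forall>a\<in>A. emeasure lebesgue a \<noteq> \<infinity>" using A(2,4) by (auto simp: emeasure_completion)
  ultimately show "\<exists>A. countable A \<and> A \<subseteq> sets (lebesgue::real measure) \<and> \<Union> A = space lebesgue \<and> (\<forall>a\<in>A. emeasure lebesgue a \<noteq> \<infinity>)"
    using A by (intro exI[of _ A]) auto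
qed

text \<open>
  Fubini's theorem on the triangle \<open>0 \<le> r \<le> s \<le> t\<close>; it is the source of integration by parts for
  absolutely continuous functions.
\<close>

lemma integral_triangle_swap:
  fixes f g :: "real \<Rightarrow> complex"
  assumes f: "f absolutely_integrable_on {0..t}" and g: "g absolutely_integrable_on {0..t}"
  shows "integral {0..t} (\<lambda>s. f s * integral {0..s} g) = integral {0..t} (\<lambda>r. g r * integral {r..t} f)"
    and "(\<lambda>s. f s * integral {0..s} g) absolutely_integrable_on {0..t}"
proof -
  interpret L: sigma_finite_measure "lebesgue :: real measure" by (rule sigma_finite_lebesgue)
  interpret P: pair_sigma_finite "lebesgue :: real measure" "lebesgue :: real measure" ..
  define F where "F s = indicator {0..t} s *\<^sub>R f s" for s
  define G where "G s = indicator {0..t} s *\<^sub>R g s" for s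
  have F: "integrable lebesgue F" and G: "integrable lebesgue G"
    using f g by (simp_all add: F_def[abs_def] G_def[abs_def] set_integrable_def)
  have [measurable]: "F \<in> borel_measurable lebesgue" "G \<in> borel_measurable lebesgue"
    using F G by auto
  define H where "H s r = F s * (G r * indicator {..s} r)" for s r
  have idm: "(\<lambda>x. x) \<in> measurable (lebesgue :: real measure) borel"
    by (rule measurable_completion) simp
  have m1: "(\<lambda>p. fst p) \<in> measurable (lebesgue \<Otimes>\<^sub>M (lebesgue :: real measure)) (borel :: real measure)"
    using measurable_compose[OF measurable_fst idm, of "lebesgue"] by simp
  have m2: "(\<lambda>p. snd p) \<in> measurable (lebesgue \<Otimes>\<^sub>M (lebesgue :: real measure)) (borel :: real measure)"
    using measurable_compose[OF measurable_snd idm, of "lebesgue"] by simp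
  have pm: "{p \<in> space (lebesgue \<Otimes>\<^sub>M lebesgue). snd p \<le> (fst p :: real)} \<in> sets (lebesgue \<Otimes>\<^sub>M (lebesgue :: real measure))"
    by (rule borel_measurable_le[OF m2 m1])
  have meas: "(\<lambda>p. H (fst p) (snd p)) \<in> borel_measurable (lebesgue \<Otimes>\<^sub>M lebesgue)"
  proof -
    have "(\<lambda>p. H (fst p) (snd p)) =
       (\<lambda>p. F (fst p) * (G (snd p) * indicator {p \<in> space (lebesgue \<Otimes>\<^sub>M lebesgue). snd p \<le> fst p} p))"
      by (auto simp: H_def indicator_def space_pair_measure)
    also have "\<dots> \<in> borel_measurable (lebesgue \<Otimes>\<^sub>M lebesgue)"
      using pm by measurable
    finally show ?thesis .
  qed
  have int: "integrable lebesgue (\<lambda>r. H s r)" for s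
  proof -
    have "integrable lebesgue (\<lambda>r. G r * indicator {..s} r)"
    proof (rule Bochner_Integration.integrable_bound[OF G])
      have "{..s} \<in> sets lebesgue" by (simp add: sets_completionI_sets)
      then show "(\<lambda>r. G r * indicator {..s} r) \<in> borel_measurable lebesgue" by measurable
    qed (auto simp: indicator_def)
    then show ?thesis by (simp add: H_def)
  qed
  have next_b: "norm (integral\<^sup>L lebesgue (\<lambda>r. norm (H s r))) \<le> norm (F s * integral\<^sup>L lebesgue (\<lambda>r. norm (G r)))" for s
  proof -
    have "integral\<^sup>L lebesgue (\<lambda>r. norm (H s r)) \<le> integral\<^sup>L lebesgue (\<lambda>r. norm (F s) * norm (G r))"
    proof (rule integral_mono)
      show "integrable lebesgue (\<lambda>r. norm (H s r))" by (rule integrable_norm[OF int])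
      show "integrable lebesgue (\<lambda>r. norm (F s) * norm (G r))" using G by simp
    qed (auto simp: H_def norm_mult indicator_def)
    also have "\<dots> = norm (F s) * integral\<^sup>L lebesgue (\<lambda>r. norm (G r))" by simp
    finally show ?thesis by (simp add: norm_mult)
  qed
  have "integrable (lebesgue \<Otimes>\<^sub>M lebesgue) (\<lambda>p. H (fst p) (snd p))"
  proof (rule P.Fubini_integrable[OF meas])
    have "integrable lebesgue (\<lambda>s. F s * integral\<^sup>L lebesgue (\<lambda>r. norm (G r)))" using F by simp
    moreover have "(\<lambda>s. \<integral>r. norm (H s r) \<partial>lebesgue) \<in> borel_measurable lebesgue"
      using meas by (intro L.borel_measurable_lebesgue_integral) (auto simp: case_prod_beta)
    ultimately show "integrable lebesgue (\<lambda>x. \<integral>y. norm (H (fst (x,y)) (snd (x,y))) \<partial>lebesgue)"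
      unfolding fst_conv snd_conv by (rule Bochner_Integration.integrable_bound) (rule AE_I2, rule next_b)
    show "AE x in lebesgue. integrable lebesgue (\<lambda>y. H (fst (x,y)) (snd (x,y)))"
      unfolding fst_conv snd_conv by (rule AE_I2) (rule int)
  qed
  then have HI: "integrable (lebesgue \<Otimes>\<^sub>M lebesgue) (case_prod H)" by (simp add: case_prod_beta')
  have inner1: "(\<integral>r. H s r \<partial>lebesgue) = indicator {0..t} s *\<^sub>R (f s * integral {0..s} g)" for s
  proof (cases "s \<in> {0..t}")
    case True
    have "(\<integral>r. H s r \<partial>lebesgue) = F s * (\<integral>r. G r * indicator {..s} r \<partial>lebesgue)" by (simp add: H_def)
    also have "(\<integral>r. G r * indicator {..s} r \<partial>lebesgue) = (LINT r:{0..s}|lebesgue. g r)"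
      unfolding set_lebesgue_integral_def using True
      by (intro Bochner_Integration.integral_cong) (auto simp: G_def indicator_def)
    also have "\<dots> = integral {0..s} g"
      using True by (intro set_lebesgue_integral_eq_integral(2) absolutely_integrable_on_subinterval[OF g]) auto
    finally show ?thesis using True by (simp add: F_def)
  qed (simp add: H_def F_def)
  have inner2: "(\<integral>s. H s r \<partial>lebesgue) = indicator {0..t} r *\<^sub>R (g r * integral {r..t} f)" for r
  proof (cases "r \<in> {0..t}")
    case True
    have "(\<integral>s. H s r \<partial>lebesgue) = (\<integral>s. G r * (F s * indicator {r..} s) \<partial>lebesgue)"
      by (intro Bochner_Integration.integral_cong) (auto simp: H_def indicator_def)
    also have "\<dots> = G r * (\<integral>s. F s * indicator {r..} s \<partial>lebesgue)" by simp
    also have "(\<integral>s. F s * indicator {r..} s \<partial>lebesgue) = (LINT s:{r..t}|lebesgue. f s)"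
      unfolding set_lebesgue_integral_def using True
      by (intro Bochner_Integration.integral_cong) (auto simp: F_def indicator_def)
    also have "\<dots> = integral {r..t} f"
      using True by (intro set_lebesgue_integral_eq_integral(2) absolutely_integrable_on_subinterval[OF f]) auto
    finally show ?thesis using True by (simp add: G_def)
  qed (simp add: H_def G_def)
  show *: "(\<lambda>s. f s * integral {0..s} g) absolutely_integrable_on {0..t}"
    unfolding set_integrable_def using P.integrable_fst[OF HI] by (simp add: inner1)
  have **: "(\<lambda>r. g r * integral {r..t} f) absolutely_integrable_on {0..t}"
    unfolding set_integrable_def using P.integrable_snd[OF HI] by (simp add: inner2)
  have "(LINT s:{0..t}|lebesgue. f s * integral {0..s} g) = (LINT r:{0..t}|lebesgue. g r * integral {r..t} f)"
    unfolding set_lebesgue_integral_def using P.Fubini_integral[OF HI] by (simp add: inner1 inner2)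
  then show "integral {0..t} (\<lambda>s. f s * integral {0..s} g) = integral {0..t} (\<lambda>r. g r * integral {r..t} f)"
    using set_lebesgue_integral_eq_integral(2)[OF *] set_lebesgue_integral_eq_integral(2)[OF **] by simp
qed

text \<open>
  With \<open>F\<close> and \<open>G\<close> written as integrals of \<open>f\<close> and \<open>g\<close>, the product rule amounts to splitting the square
  \<open>[0, t]\<^sup>2\<close> into two triangles.
\<close>

lemma has_ac_deriv_mult:
  assumes F: "has_ac_deriv F f" and G: "has_ac_deriv G g"
  shows "has_ac_deriv (\<lambda>t. F t * G t) (\<lambda>t. f t * G t + F t * g t)"
  unfolding has_ac_deriv_def
proof (intro allI impI)
  fix t :: real assume t: "t \<ge> 0"
  let ?F = "\<lambda>t. integral {0..t} f" and ?G = "\<lambda>t. integral {0..t} g"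
  note af = has_ac_deriv_integrable[OF F order_refl, of t] and ag = has_ac_deriv_integrable[OF G order_refl, of t]
  have i1: "(\<lambda>s. f s * ?G s) absolutely_integrable_on {0..t}" by (rule integral_triangle_swap[OF af ag])
  have i2: "(\<lambda>s. g s * ?F s) absolutely_integrable_on {0..t}" by (rule integral_triangle_swap[OF ag af])
  note I = i1[THEN set_lebesgue_integral_eq_integral(1)] i2[THEN set_lebesgue_integral_eq_integral(1)]
    af[THEN set_lebesgue_integral_eq_integral(1)] ag[THEN set_lebesgue_integral_eq_integral(1)]
  have "integral {0..t} (\<lambda>s. f s * ?G s) = integral {0..t} (\<lambda>r. g r * integral {r..t} f)"
    by (rule integral_triangle_swap[OF af ag])
  also have "\<dots> = integral {0..t} (\<lambda>r. ?F t * g r - g r * ?F r)"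
  proof (rule integral_cong)
    fix r assume r: "r \<in> {0..t}"
    have "?F r + integral {r..t} f = ?F t"
      using r I(3) by (intro Henstock_Kurzweil_Integration.integral_combine) auto
    then show "g r * integral {r..t} f = ?F t * g r - g r * ?F r"
      by (simp add: algebra_simps flip: distrib_left)
  qed
  also have "\<dots> = ?F t * ?G t - integral {0..t} (\<lambda>r. g r * ?F r)"
    using I by (subst integral_diff) (auto intro!: integrable_on_mult_right)
  finally have key: "integral {0..t} (\<lambda>s. f s * ?G s) + integral {0..t} (\<lambda>r. g r * ?F r) = ?F t * ?G t"
    by simp
  let ?d = "\<lambda>s. f s * ?G s + g s * ?F s + (G 0 * f s + F 0 * g s)"
  have d: "f s * G s + F s * g s = ?d s" if "s \<in> {0..t}" for s
    using that by (subst has_ac_deriv_eq[OF F, of s], simp, subst has_ac_deriv_eq[OF G, of s], simp) (simp add: algebra_simps)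
  have ad: "?d absolutely_integrable_on {0..t}"
    using i1 i2 af ag by (intro set_integral_add set_integrable_mult_right)
  show "(\<lambda>t. f t * G t + F t * g t) absolutely_integrable_on {0..t} \<and>
      integral {0..t} (\<lambda>t. f t * G t + F t * g t) = F t * G t - F 0 * G 0"
  proof
    show "(\<lambda>t. f t * G t + F t * g t) absolutely_integrable_on {0..t}"
      by (rule absolutely_integrable_spike[OF ad, of "{}"]) (use d in auto)
    have "integral {0..t} (\<lambda>t. f t * G t + F t * g t) = integral {0..t} ?d"
      by (rule integral_cong) (use d in auto)
    also have "\<dots> = ?F t * ?G t + (G 0 * ?F t + F 0 * ?G t)"
      using I by (simp add: integral_add integrable_add integrable_on_mult_right key flip: key)
    finally show "integral {0..t} (\<lambda>t. f t * G t + F t * g t) = F t * G t - F 0 * G 0"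
      by (subst has_ac_deriv_eq[OF F t], subst has_ac_deriv_eq[OF G t]) (simp add: algebra_simps)
  qed
qed

section \<open>Integrability on the half-line and weighted Sobolev classes\<close>

abbreviation L1 :: "(real \<Rightarrow> 'a::euclidean_space) \<Rightarrow> bool" where
  "L1 f \<equiv> f absolutely_integrable_on {0..}"

lemma L1_subset: "L1 f \<Longrightarrow> S \<in> sets lebesgue \<Longrightarrow> S \<subseteq> {0..} \<Longrightarrow> f absolutely_integrable_on S"
  by (rule set_integrable_subset)

lemma L1_tail: "L1 f \<Longrightarrow> 0 \<le> t \<Longrightarrow> f absolutely_integrable_on {t..}"
  by (rule L1_subset) auto

lemma L1_Icc: "L1 f \<Longrightarrow> 0 \<le> a \<Longrightarrow> f absolutely_integrable_on {a..b}"
  by (rule L1_subset) auto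

lemma L1_measurable: "L1 f \<Longrightarrow> f \<in> borel_measurable (lebesgue_on {0..})"
  by (rule absolutely_integrable_measurable[THEN iffD1, THEN conjunct1]) auto

lemma abs_int_dominated:
  fixes f :: "real \<Rightarrow> 'a::euclidean_space" and g :: "real \<Rightarrow> 'b::euclidean_space"
  assumes "f \<in> borel_measurable (lebesgue_on S)" "S \<in> sets lebesgue" "g absolutely_integrable_on S"
    "\<And>t. t \<in> S \<Longrightarrow> norm (f t) \<le> norm (g t)"
  shows "f absolutely_integrable_on S"
proof (rule measurable_bounded_by_integrable_imp_absolutely_integrable[OF assms(1,2) _ assms(4)])
  show "(\<lambda>t. norm (g t)) integrable_on S"
    using absolutely_integrable_norm[OF assms(3)] by (simp add: o_def set_lebesgue_integral_eq_integral(1))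
qed

lemma L1_dominated:
  fixes f :: "real \<Rightarrow> 'a::euclidean_space" and g :: "real \<Rightarrow> 'b::euclidean_space"
  assumes "f \<in> borel_measurable (lebesgue_on {0..})" "L1 g" "\<And>t. t \<ge> 0 \<Longrightarrow> norm (f t) \<le> norm (g t)"
  shows "L1 f"
proof (rule abs_int_dominated[OF assms(1) _ assms(2)])
  fix t :: real assume "t \<in> {0..}"
  then show "norm (f t) \<le> norm (g t)" using assms(3)[of t] by simp
qed simp

lemma continuous_measurable: "continuous_on {0..} (f :: real \<Rightarrow> 'a::euclidean_space) \<Longrightarrow> f \<in> borel_measurable (lebesgue_on {0..})"
  by (rule continuous_imp_measurable_on_sets_lebesgue) auto

lemma L1_mult:
  fixes f a :: "real \<Rightarrow> complex"
  assumes "L1 f" "continuous_on {0..} a" "\<And>t. t \<ge> 0 \<Longrightarrow> norm (a t) \<le> C"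
  shows "L1 (\<lambda>t. a t * f t)"
proof (rule L1_dominated)
  show "(\<lambda>t. a t * f t) \<in> borel_measurable (lebesgue_on {0..})"
    using assms by (intro borel_measurable_times L1_measurable continuous_measurable)
  show "L1 (\<lambda>t. complex_of_real C * f t)" using assms(1) by simp
  show "norm (a t * f t) \<le> norm (complex_of_real C * f t)" if "t \<ge> 0" for t
    using assms(3)[OF that] by (auto simp: norm_mult intro!: mult_right_mono)
qed

lemma integral_tail_split:
  assumes "L1 f" "0 \<le> a" "a \<le> t"
  shows "integral {a..} f = integral {a..t} f + integral {t..} f"
proof -
  have "{a..} = {a..t} \<union> {t..}" "{a..t} \<inter> {t..} = {t}" using assms by auto
  then show ?thesis
    using assms by (subst \<open>{a..} = _\<close>, intro integral_Un set_lebesgue_integral_eq_integral(1) L1_subset[OF assms(1)]) auto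
qed

lemma tail_tendsto_0:
  assumes "L1 f" shows "((\<lambda>t. integral {t..} f) \<longlongrightarrow> 0) at_top"
proof -
  have "((\<lambda>t. set_lebesgue_integral lebesgue {0..t} f) \<longlongrightarrow> set_lebesgue_integral lebesgue {0..} f) at_top"
    by (rule tendsto_set_lebesgue_integral_at_top) (use assms in auto)
  then have "((\<lambda>t. integral {0..} f - set_lebesgue_integral lebesgue {0..t} f) \<longlongrightarrow> integral {0..} f - integral {0..} f) at_top"
    by (intro tendsto_intros) (simp add: set_lebesgue_integral_eq_integral(2)[OF assms])
  then have "((\<lambda>t. integral {0..} f - set_lebesgue_integral lebesgue {0..t} f) \<longlongrightarrow> 0) at_top" by simp
  then show ?thesis
  proof (rule Lim_transform_eventually)
    show "\<forall>\<^sub>F t in at_top. integral {0..} f - set_lebesgue_integral lebesgue {0..t} f = integral {t..} f"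
      using eventually_ge_at_top[of 0]
    proof eventually_elim
      case (elim t)
      then show ?case using integral_tail_split[OF assms order_refl elim] L1_Icc[OF assms, of 0 t]
        by (simp add: set_lebesgue_integral_eq_integral(2))
    qed
  qed
qed

lemma has_ac_deriv_tail:
  assumes "L1 f" shows "has_ac_deriv (\<lambda>t. integral {t..} f) (\<lambda>t. - f t)"
  unfolding has_ac_deriv_def
proof (intro allI impI conjI)
  fix t :: real assume t: "t \<ge> 0"
  show "(\<lambda>t. - f t) absolutely_integrable_on {0..t}"
    using set_integrable_mult_right[of "-1" lebesgue "{0..t}" f] L1_Icc[OF assms, of 0 t] by simp
  show "integral {0..t} (\<lambda>t. - f t) = integral {t..} f - integral {0..} f"
    using integral_tail_split[OF assms order_refl t] by simp
qed

lemma has_ac_deriv_limit_eq: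
  assumes "has_ac_deriv F f" "L1 f" "(F \<longlongrightarrow> L) at_top" "t \<ge> 0"
  shows "F t = L - integral {t..} f"
proof -
  have "has_ac_deriv (\<lambda>t. F t + integral {t..} f) (\<lambda>t. f t + - f t)"
    by (intro has_ac_deriv_add assms has_ac_deriv_tail)
  then have 0: "has_ac_deriv (\<lambda>t. F t + integral {t..} f) (\<lambda>t. 0)" by simp
  have c: "F t + integral {t..} f = F 0 + integral {0..} f" if "t \<ge> 0" for t
    using has_ac_deriv_eq[OF 0 that] by simp
  have "((\<lambda>t. F t + integral {t..} f) \<longlongrightarrow> L + 0) at_top"
    by (intro tendsto_add assms tail_tendsto_0)
  moreover have "((\<lambda>t. F t + integral {t..} f) \<longlongrightarrow> F 0 + integral {0..} f) at_top"
  proof (rule Lim_transform_eventually[OF tendsto_const])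
    show "\<forall>\<^sub>F t in at_top. F 0 + integral {0..} f = F t + integral {t..} f"
      using eventually_ge_at_top[of 0] by eventually_elim (rule c[symmetric])
  qed
  ultimately have "L + 0 = F 0 + integral {0..} f" by (rule tendsto_unique[OF trivial_limit_at_top_linorder])
  then show ?thesis using c[OF assms(4)] by (simp add: eq_diff_eq)
qed

lemma norm_tail_le:
  assumes "L1 (f :: real \<Rightarrow> complex)" "0 \<le> t"
  shows "norm (integral {t..} f) \<le> integral {0..} (\<lambda>s. norm (f s))"
proof -
  have n: "L1 (\<lambda>s. norm (f s))" by (rule absolutely_integrable_norm[OF assms(1), unfolded o_def])
  have "norm (integral {t..} f) \<le> integral {t..} (\<lambda>s. norm (f s))"
    by (intro integral_norm_bound_integral set_lebesgue_integral_eq_integral(1) L1_tail[OF n] L1_tail[OF assms(1)] assms(2)) auto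
  also have "\<dots> \<le> integral {0..} (\<lambda>s. norm (f s))"
    using assms by (intro integral_subset_le set_lebesgue_integral_eq_integral(1) L1_tail[OF n]) auto
  finally show ?thesis .
qed

lemma has_ac_deriv_bounded:
  assumes "has_ac_deriv F f" "L1 f"
  shows "\<exists>C. \<forall>t\<ge>0. norm (F t) \<le> C"
proof -
  have n: "L1 (\<lambda>s. norm (f s))" by (rule absolutely_integrable_norm[OF assms(2), unfolded o_def])
  have "norm (F t) \<le> norm (F 0) + integral {0..} (\<lambda>s. norm (f s))" if "t \<ge> 0" for t
  proof -
    have "norm (integral {0..t} f) \<le> integral {0..t} (\<lambda>s. norm (f s))"
      by (intro integral_norm_bound_integral set_lebesgue_integral_eq_integral(1) L1_Icc n L1_Icc[OF assms(2)]) auto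
    also have "\<dots> \<le> integral {0..} (\<lambda>s. norm (f s))"
      by (intro integral_subset_le set_lebesgue_integral_eq_integral(1) L1_Icc n) auto
    finally show ?thesis using has_ac_deriv_eq[OF assms(1) that] norm_triangle_ineq[of "F 0" "integral {0..t} f"] by simp
  qed
  then show ?thesis by blast
qed

text \<open>
  An integrable derivative forces a limit, and an integrable function can only have the limit zero.
\<close>

lemma has_ac_deriv_tendsto_0:
  assumes F: "has_ac_deriv F f" and f: "L1 f" and ansatz_x: "L1 F"
  shows "(F \<longlongrightarrow> 0) at_top"
proof -
  define L where "L = F 0 + integral {0..} f"
  have Feq: "F t = L - integral {t..} f" if "t \<ge> 0" for t
    using has_ac_deriv_eq[OF F that] integral_tail_split[OF f order_refl that] by (simp add: L_def)
  have FL: "(F \<longlongrightarrow> L) at_top"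
  proof (rule Lim_transform_eventually)
    show "((\<lambda>t. L - integral {t..} f) \<longlongrightarrow> L) at_top"
      using tendsto_diff[OF tendsto_const tail_tendsto_0[OF f]] by simp
    show "\<forall>\<^sub>F t in at_top. L - integral {t..} f = F t"
      using eventually_ge_at_top[of 0] by eventually_elim (simp add: Feq)
  qed
  have "L = 0"
  proof (rule ccontr)
    assume "L \<noteq> 0"
    then have "\<forall>\<^sub>F t in at_top. dist (F t) L < norm L / 2" using FL by (intro tendstoD) auto
    then obtain T where T: "\<And>t. t \<ge> T \<Longrightarrow> dist (F t) L < norm L / 2"
      by (auto simp: eventually_at_top_linorder)
    define a where "a = max T 0"
    have big: "norm (F t) \<ge> norm L / 2" if "t \<ge> a" for t
      using T[of t] that norm_triangle_ineq2[of L "F t"] by (auto simp: a_def dist_norm norm_minus_commute)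
    have n: "L1 (\<lambda>s. norm (F s))" by (rule absolutely_integrable_norm[OF ansatz_x, unfolded o_def])
    define M where "M = integral {0..} (\<lambda>s. norm (F s))"
    have "x * (norm L / 2) \<le> M" if "x \<ge> 0" for x
    proof -
      have "integral {a..a+x} (\<lambda>s. norm L / 2) \<le> integral {a..a+x} (\<lambda>s. norm (F s))"
      proof (rule integral_le)
        show "(\<lambda>s. norm L / 2) integrable_on {a..a+x}" by (rule integrable_const_ivl)
        show "(\<lambda>s. norm (F s)) integrable_on {a..a+x}"
          by (rule set_lebesgue_integral_eq_integral(1)[OF L1_Icc[OF n]]) (simp add: a_def)
      qed (use big in auto)
      also have "\<dots> \<le> M" unfolding M_def
        by (intro integral_subset_le set_lebesgue_integral_eq_integral(1) L1_Icc n) (auto simp: a_def)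
      finally show ?thesis using that by simp
    qed
    from this[of "(\<bar>M\<bar> + 1) / (norm L / 2)"] have "\<bar>M\<bar> + 1 \<le> M"
      using \<open>L \<noteq> 0\<close> by simp
    then show False by simp
  qed
  then show ?thesis using FL by simp
qed

definition weighted_L1 :: "nat \<Rightarrow> (real \<Rightarrow> complex) \<Rightarrow> bool" where
  "weighted_L1 n f \<longleftrightarrow> L1 (\<lambda>t. (1 + t) ^ n *\<^sub>R f t)"

lemma weighted_L1_measurable: assumes "weighted_L1 n f" shows "f \<in> borel_measurable (lebesgue_on {0..})"
proof -
  have "(\<lambda>t. inverse ((1 + t) ^ n) *\<^sub>R ((1 + t) ^ n *\<^sub>R f t)) \<in> borel_measurable (lebesgue_on {0..})"
    using assms unfolding weighted_L1_def
    by (intro borel_measurable_scaleR L1_measurable continuous_measurable continuous_intros) auto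
  then show ?thesis
    by (subst measurable_cong[where g = "\<lambda>t. inverse ((1 + t) ^ n) *\<^sub>R ((1 + t) ^ n *\<^sub>R f t)"])
      (auto simp: add_eq_0_iff)
qed

lemma weighted_L1_dominated:
  assumes "weighted_L1 n g" "f \<in> borel_measurable (lebesgue_on {0..})" "\<And>t. t \<ge> 0 \<Longrightarrow> norm (f t) \<le> C * norm (g t)"
  shows "weighted_L1 n f"
  unfolding weighted_L1_def
proof (rule L1_dominated)
  show "(\<lambda>t. (1 + t) ^ n *\<^sub>R f t) \<in> borel_measurable (lebesgue_on {0..})"
    by (rule borel_measurable_scaleR[OF continuous_measurable assms(2)]) (intro continuous_intros)
  show "L1 (\<lambda>t. \<bar>C\<bar> *\<^sub>R ((1 + t) ^ n *\<^sub>R g t))" using assms(1) unfolding weighted_L1_def by (rule set_integrable_scaleR_right)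
  show "norm ((1 + t) ^ n *\<^sub>R f t) \<le> norm (\<bar>C\<bar> *\<^sub>R ((1 + t) ^ n *\<^sub>R g t))" if "t \<ge> 0" for t
  proof -
    have "norm (f t) \<le> \<bar>C\<bar> * norm (g t)"
      using assms(3)[OF that] by (smt (verit) mult_right_mono norm_ge_zero)
    then have "(1 + t) ^ n * norm (f t) \<le> (1 + t) ^ n * (\<bar>C\<bar> * norm (g t))"
      using that by (intro mult_left_mono) auto
    then show ?thesis using that by (simp add: algebra_simps)
  qed
qed

lemma weighted_L1_power:
  assumes "weighted_L1 n f" "p \<le> n"
  shows "L1 (\<lambda>t. t ^ p *\<^sub>R f t)"
proof (rule L1_dominated)
  show "(\<lambda>t. t ^ p *\<^sub>R f t) \<in> borel_measurable (lebesgue_on {0..})"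
    by (intro borel_measurable_scaleR weighted_L1_measurable[OF assms(1)] continuous_measurable continuous_intros)
  show "L1 (\<lambda>t. (1 + t) ^ n *\<^sub>R f t)" using assms(1) by (simp add: weighted_L1_def)
  show "norm (t ^ p *\<^sub>R f t) \<le> norm ((1 + t) ^ n *\<^sub>R f t)" if "t \<ge> 0" for t
  proof -
    have "t ^ p \<le> (1 + t) ^ p" using that by (intro power_mono) auto
    also have "\<dots> \<le> (1 + t) ^ n" using that assms(2) by (intro power_increasing) auto
    finally show ?thesis using that by (simp add: mult_right_mono)
  qed
qed

lemma weighted_L1_L1: "weighted_L1 n f \<Longrightarrow> L1 f"
  using weighted_L1_power[of n f 0] by simp

lemma weighted_L1_mult:
  assumes "weighted_L1 n f" "continuous_on {0..} a" "\<And>t. t \<ge> 0 \<Longrightarrow> norm (a t) \<le> C"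
  shows "weighted_L1 n (\<lambda>t. a t * f t)"
proof (rule weighted_L1_dominated[OF assms(1)])
  show "(\<lambda>t. a t * f t) \<in> borel_measurable (lebesgue_on {0..})"
    using assms by (intro borel_measurable_times weighted_L1_measurable continuous_measurable)
  show "norm (a t * f t) \<le> C * norm (f t)" if "t \<ge> 0" for t
    using assms(3)[OF that] by (auto simp: norm_mult intro!: mult_right_mono)
qed

lemma weighted_L1_add: "weighted_L1 n f \<Longrightarrow> weighted_L1 n g \<Longrightarrow> weighted_L1 n (\<lambda>t. f t + g t)"
  unfolding weighted_L1_def scaleR_add_right by (rule set_integral_add)

lemma weighted_L1_cmult: "weighted_L1 n f \<Longrightarrow> weighted_L1 n (\<lambda>t. c * f t)"
  by (rule weighted_L1_mult[where C = "norm c"]) auto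

text \<open>
  The weighted Sobolev space \<open>W\<^sup>r\<^sup>,\<^sup>1\<close>, with weight \<open>(1 + t)\<^sup>n\<close> on the function and its \<open>r\<close> derivatives.
\<close>

primrec weighted_sobolev :: "nat \<Rightarrow> nat \<Rightarrow> (real \<Rightarrow> complex) \<Rightarrow> bool" where
  "weighted_sobolev n 0 f \<longleftrightarrow> weighted_L1 n f"
| "weighted_sobolev n (Suc r) f \<longleftrightarrow> weighted_L1 n f \<and> (\<exists>f'. has_ac_deriv f f' \<and> weighted_sobolev n r f')"

text \<open>
  Multipliers for \<open>weighted_sobolev n r\<close>: only the function itself is merely bounded, its derivatives are
  weighted integrable. The coefficients \<open>a\<^sub>i\<close> of the expansion are of this kind (\<open>a\<^sub>0 = 1\<close>).
\<close>

primrec bounded_sobolev :: "nat \<Rightarrow> nat \<Rightarrow> (real \<Rightarrow> complex) \<Rightarrow> bool" where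
  "bounded_sobolev n 0 a \<longleftrightarrow> continuous_on {0..} a \<and> (\<exists>C. \<forall>t\<ge>0. norm (a t) \<le> C)"
| "bounded_sobolev n (Suc r) a \<longleftrightarrow> (\<exists>C. \<forall>t\<ge>0. norm (a t) \<le> C) \<and> (\<exists>a'. has_ac_deriv a a' \<and> weighted_sobolev n r a')"

lemma weighted_sobolev_weighted_L1: "weighted_sobolev n r f \<Longrightarrow> weighted_L1 n f"
  by (cases r) auto

lemma weighted_sobolev_pred: "weighted_sobolev n (Suc r) f \<Longrightarrow> weighted_sobolev n r f"
proof (induction r arbitrary: f)
  case (Suc r)
  then obtain f' where "weighted_L1 n f" "has_ac_deriv f f'" "weighted_sobolev n (Suc r) f'" by auto
  then show ?case using Suc.IH[of f'] by auto
qed simp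

lemma weighted_sobolev_le: "weighted_sobolev n r f \<Longrightarrow> q \<le> r \<Longrightarrow> weighted_sobolev n q f"
proof (induction r)
  case (Suc r)
  then show ?case using weighted_sobolev_pred[of n r f] by (cases "q = Suc r") auto
qed simp

lemma bounded_sobolev_bounded: "bounded_sobolev n r a \<Longrightarrow> \<exists>C. \<forall>t\<ge>0. norm (a t) \<le> C"
  by (cases r) auto

lemma bounded_sobolev_continuous: "bounded_sobolev n r a \<Longrightarrow> continuous_on {0..} a"
  by (cases r) (auto intro: has_ac_deriv_continuous)

lemma bounded_sobolev_pred: "bounded_sobolev n (Suc r) a \<Longrightarrow> bounded_sobolev n r a"
proof (cases r)
  case 0
  then show "bounded_sobolev n (Suc r) a \<Longrightarrow> bounded_sobolev n r a" by (auto intro: has_ac_deriv_continuous)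
next
  case (Suc q)
  assume "bounded_sobolev n (Suc r) a"
  then obtain a' where "\<exists>C. \<forall>t\<ge>0. norm (a t) \<le> C" "has_ac_deriv a a'" "weighted_sobolev n (Suc q) a'" using Suc by auto
  then show "bounded_sobolev n r a" using weighted_sobolev_pred[of n q a'] Suc by auto
qed

lemma bounded_sobolev_le: "bounded_sobolev n r f \<Longrightarrow> q \<le> r \<Longrightarrow> bounded_sobolev n q f"
proof (induction r)
  case (Suc r)
  then show ?case using bounded_sobolev_pred[of n r f] by (cases "q = Suc r") auto
qed simp

lemma weighted_sobolev_add: "weighted_sobolev n r f \<Longrightarrow> weighted_sobolev n r g \<Longrightarrow> weighted_sobolev n r (\<lambda>t. f t + g t)"
proof (induction r arbitrary: f g)
  case (Suc r)
  then obtain f' g' where "has_ac_deriv f f'" "weighted_sobolev n r f'" "has_ac_deriv g g'" "weighted_sobolev n r g'" by auto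
  then show ?case using Suc.IH[of f' g'] has_ac_deriv_add[of f f' g g'] weighted_L1_add[of n f g] Suc.prems by auto
qed (simp add: weighted_L1_add)

lemma weighted_sobolev_cmult: "weighted_sobolev n r f \<Longrightarrow> weighted_sobolev n r (\<lambda>t. c * f t)"
proof (induction r arbitrary: f)
  case (Suc r)
  then obtain f' where "has_ac_deriv f f'" "weighted_sobolev n r f'" by auto
  then show ?case using Suc.IH[of f'] has_ac_deriv_cmult[of f f' c] weighted_L1_cmult[of n f c] Suc.prems by auto
qed (simp add: weighted_L1_cmult)

lemma weighted_sobolev_minus: "weighted_sobolev n r f \<Longrightarrow> weighted_sobolev n r (\<lambda>t. - f t)"
  using weighted_sobolev_cmult[of n r f "-1"] by simp

lemma weighted_sobolev_diff: "weighted_sobolev n r f \<Longrightarrow> weighted_sobolev n r g \<Longrightarrow> weighted_sobolev n r (\<lambda>t. f t - g t)"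
  using weighted_sobolev_add[of n r f "\<lambda>t. - g t"] weighted_sobolev_minus[of n r g] by simp

lemma weighted_sobolev_zero: "weighted_sobolev n r (\<lambda>_. 0)"
  by (induction r) (auto simp: weighted_L1_def intro: has_ac_deriv_const)

lemma weighted_sobolev_Suc_bounded_sobolev: assumes "weighted_sobolev n (Suc r) f" shows "bounded_sobolev n (Suc r) f"
proof -
  obtain f' where f': "has_ac_deriv f f'" "weighted_sobolev n r f'" using assms by auto
  then show ?thesis using has_ac_deriv_bounded[OF f'(1) weighted_L1_L1[OF weighted_sobolev_weighted_L1[OF f'(2)]]] by auto
qed

lemma weighted_sobolev_mult: "weighted_sobolev n r f \<Longrightarrow> bounded_sobolev n r a \<Longrightarrow> weighted_sobolev n r (\<lambda>t. a t * f t)"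
proof (induction r arbitrary: f a)
  case 0
  then obtain C where "\<forall>t\<ge>0. norm (a t) \<le> C" by auto
  then show ?case using 0 by (auto intro: weighted_L1_mult)
next
  case (Suc r)
  obtain f' where f': "has_ac_deriv f f'" "weighted_sobolev n r f'" using Suc.prems by auto
  obtain a' C where a': "has_ac_deriv a a'" "weighted_sobolev n r a'" "\<forall>t\<ge>0. norm (a t) \<le> C" using Suc.prems by auto
  have fb: "bounded_sobolev n r f" using Suc.prems(1) weighted_sobolev_Suc_bounded_sobolev bounded_sobolev_pred by blast
  have "weighted_sobolev n r (\<lambda>t. f t * a' t + a t * f' t)"
    by (intro weighted_sobolev_add Suc.IH a' f' fb bounded_sobolev_pred[OF Suc.prems(2)])
  moreover have "has_ac_deriv (\<lambda>t. a t * f t) (\<lambda>t. f t * a' t + a t * f' t)"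
    using has_ac_deriv_mult[OF a'(1) f'(1)] by (simp add: algebra_simps)
  moreover have "weighted_L1 n (\<lambda>t. a t * f t)"
    using a' Suc.prems(1) bounded_sobolev_continuous[OF Suc.prems(2)] by (intro weighted_L1_mult[where C=C]) auto
  ultimately show ?case by auto
qed

lemma bounded_sobolev_const: "bounded_sobolev n r (\<lambda>_. c)"
  by (cases r) (auto intro: has_ac_deriv_const weighted_sobolev_zero)

lemma bounded_sobolev_tail: assumes "weighted_sobolev n r f" shows "bounded_sobolev n (Suc r) (\<lambda>t. integral {t..} f)"
proof -
  note f = weighted_L1_L1[OF weighted_sobolev_weighted_L1[OF assms]]
  have "\<forall>t\<ge>0. norm (integral {t..} f) \<le> integral {0..} (\<lambda>s. norm (f s))" using norm_tail_le[OF f] by auto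
  then show ?thesis using has_ac_deriv_tail[OF f] weighted_sobolev_minus[OF assms] by auto
qed

lemma weighted_sobolev_continuous: "weighted_sobolev n (Suc r) f \<Longrightarrow> continuous_on {0..} f"
  by (auto intro: has_ac_deriv_continuous)

lemma weighted_sobolev_tendsto_0: assumes "weighted_sobolev n (Suc r) f" shows "(f \<longlongrightarrow> 0) at_top"
proof -
  obtain f' where f': "has_ac_deriv f f'" "weighted_sobolev n r f'" using assms by auto
  then show ?thesis using has_ac_deriv_tendsto_0[OF f'(1)] weighted_L1_L1 weighted_sobolev_weighted_L1 assms by blast
qed

section \<open>Exponential integral operators depending on a parameter\<close>

lemma exp_diff_le:
  fixes a b :: complex
  assumes "Re a \<le> 0" "Re b \<le> 0"
  shows "norm (exp a - exp b) \<le> norm (a - b)"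
proof -
  have "norm (exp a - exp b) \<le> 1 * norm (a - b)"
  proof (rule field_differentiable_bound[where S = "{z. Re z \<le> 0}"])
    show "convex {z. Re z \<le> 0}" by (rule convex_halfspace_Re_le)
    show "(exp has_field_derivative exp z) (at z within {z. Re z \<le> 0})" for z :: complex
      by (rule DERIV_subset[OF DERIV_exp]) simp
  qed (use assms in auto)
  then show ?thesis by simp
qed

lemma exp_diff_le_2:
  fixes a b :: complex
  assumes "Re a \<le> 0" "Re b \<le> 0"
  shows "norm (exp a - exp b) \<le> 2"
proof -
  have "norm (exp a - exp b) \<le> exp (Re a) + exp (Re b)" using norm_triangle_ineq4[of "exp a" "exp b"] by simp
  also have "\<dots> \<le> 1 + 1" using assms by (intro add_mono) auto
  finally show ?thesis by simp
qed

lemma exp_taylor1_le: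
  fixes a b :: complex
  assumes "Re a \<le> 0" "Re b \<le> 0"
  shows "norm (exp a - exp b - (a - b) * exp b) \<le> norm (a - b) * norm (a - b)"
proof -
  have seg: "Re z \<le> 0" if "z \<in> closed_segment b a" for z
    using that closed_segment_subset[of b "{z. Re z \<le> 0}" a] assms convex_halfspace_Re_le[of 0] by auto
  have "norm ((\<lambda>z. exp z - z * exp b) a - (\<lambda>z. exp z - z * exp b) b) \<le> norm (a - b) * norm (a - b)"
  proof (rule field_differentiable_bound[where S = "closed_segment b a"])
    fix z assume z: "z \<in> closed_segment b a"
    show "((\<lambda>z. exp z - z * exp b) has_field_derivative exp z - exp b) (at z within closed_segment b a)"
      by (auto intro!: derivative_eq_intros)
    have "norm (exp z - exp b) \<le> norm (z - b)" by (rule exp_diff_le) (use seg z assms in auto)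
    also have "\<dots> \<le> norm (a - b)" using segment_bound1[of z b a] z by (simp add: norm_minus_commute)
    finally show "norm (exp z - exp b) \<le> norm (a - b)" .
  qed auto
  then show ?thesis by (simp add: algebra_simps)
qed

text \<open>
  Increments and first order Taylor remainders of \<open>\<zeta> \<mapsto> exp (\<zeta> \<tau>)\<close> on the left half plane. The factor
  \<open>min 2 (|a - b| \<tau>)\<close> tends to zero with \<open>a - b\<close> and is bounded in \<open>\<tau>\<close>, so that it does not use up a
  power of the weight.
\<close>

lemma exp_scaled_diff_le:
  fixes a b :: complex
  assumes "Re a \<le> 0" "Re b \<le> 0" "0 \<le> \<tau>"
  shows "norm (exp (a * of_real \<tau>) - exp (b * of_real \<tau>)) \<le> min 2 (norm (a - b) * \<tau>)"
    and "norm (exp (a * of_real \<tau>) - exp (b * of_real \<tau>) - (a - b) * of_real \<tau> * exp (b * of_real \<tau>))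
       \<le> norm (a - b) * (\<tau> * min 2 (norm (a - b) * \<tau>))"
proof -
  have re: "Re (a * of_real \<tau>) \<le> 0" "Re (b * of_real \<tau>) \<le> 0"
    using assms by (auto simp: mult_nonpos_nonneg)
  have d: "a * of_real \<tau> - b * of_real \<tau> = (a - b) * of_real \<tau>" by (simp add: algebra_simps)
  have n: "norm ((a - b) * of_real \<tau>) = norm (a - b) * \<tau>" using assms by (simp add: norm_mult)
  have 1: "norm (exp (a * of_real \<tau>) - exp (b * of_real \<tau>)) \<le> norm (a - b) * \<tau>"
    using exp_diff_le[OF re] by (simp add: d n)
  show "norm (exp (a * of_real \<tau>) - exp (b * of_real \<tau>)) \<le> min 2 (norm (a - b) * \<tau>)"
    using 1 exp_diff_le_2[OF re] by simp
  let ?q = "exp (a * of_real \<tau>) - exp (b * of_real \<tau>) - (a - b) * of_real \<tau> * exp (b * of_real \<tau>)"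
  have 2: "norm ?q \<le> norm (a - b) * \<tau> * (norm (a - b) * \<tau>)"
    using exp_taylor1_le[OF re] by (simp add: d n)
  have "norm ?q \<le> norm (exp (a * of_real \<tau>) - exp (b * of_real \<tau>)) + norm ((a - b) * of_real \<tau> * exp (b * of_real \<tau>))"
    by (rule norm_triangle_ineq4)
  also have "\<dots> \<le> norm (a - b) * \<tau> + norm (a - b) * \<tau> * 1"
  proof (rule add_mono[OF 1])
    have "norm (exp (b * of_real \<tau>)) \<le> 1" using re(2) by simp
    then show "norm ((a - b) * of_real \<tau> * exp (b * of_real \<tau>)) \<le> norm (a - b) * \<tau> * 1"
      unfolding norm_mult[of "(a - b) * of_real \<tau>"] n using assms(3) by (intro mult_left_mono) auto
  qed
  finally have 3: "norm ?q \<le> norm (a - b) * \<tau> * 2" by (simp only: mult_1_right mult_2_right)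
  have "norm ?q \<le> norm (a - b) * \<tau> * min 2 (norm (a - b) * \<tau>)"
    using 2 3 by (simp add: min_def)
  then show "norm ?q \<le> norm (a - b) * (\<tau> * min 2 (norm (a - b) * \<tau>))" by (simp add: mult.assoc)
qed

text \<open>
  Dominated convergence; there is no rate, since \<open>s h(s)\<close> need not be integrable.
\<close>

lemma small_kernel_tendsto:
  fixes h :: "real \<Rightarrow> real"
  assumes h: "L1 h"
  shows "isCont (\<lambda>d. integral {0..} (\<lambda>s. \<bar>h s\<bar> * min 2 (\<bar>d\<bar> * s))) 0"
    and "L1 (\<lambda>s. \<bar>h s\<bar> * min 2 (\<bar>d\<bar> * s))"
proof -
  have ah: "L1 (\<lambda>s. \<bar>h s\<bar>)" using absolutely_integrable_norm[OF h] by (simp add: o_def)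
  have h2: "L1 (\<lambda>s. 2 * \<bar>h s\<bar>)" using ah by simp
  have le: "norm (\<bar>h s\<bar> * min 2 (\<bar>d\<bar> * s)) \<le> 2 * \<bar>h s\<bar>" if "s \<ge> 0" for s d :: real
    using that mult_left_mono[of "min 2 (\<bar>d\<bar> * s)" 2 "\<bar>h s\<bar>"] by (simp add: abs_mult mult.commute)
  show int: "L1 (\<lambda>s. \<bar>h s\<bar> * min 2 (\<bar>d\<bar> * s))" for d
  proof (rule L1_dominated[OF _ h2])
    show "(\<lambda>s. \<bar>h s\<bar> * min 2 (\<bar>d\<bar> * s)) \<in> borel_measurable (lebesgue_on {0..})"
      by (intro borel_measurable_times L1_measurable ah continuous_measurable continuous_intros)
  qed (use le in auto)
  show "isCont (\<lambda>d. integral {0..} (\<lambda>s. \<bar>h s\<bar> * min 2 (\<bar>d\<bar> * s))) 0"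
    unfolding isCont_def
  proof (subst tendsto_at_iff_sequentially, intro allI impI, unfold o_def)
    fix X :: "nat \<Rightarrow> real" assume X: "\<forall>i. X i \<in> UNIV - {0}" "X \<longlonglongrightarrow> 0"
    show "(\<lambda>i. integral {0..} (\<lambda>s. \<bar>h s\<bar> * min 2 (\<bar>X i\<bar> * s)))
      \<longlonglongrightarrow> integral {0..} (\<lambda>s. \<bar>h s\<bar> * min 2 (\<bar>0\<bar> * s))"
    proof (rule dominated_convergence)
      show "(\<lambda>s. \<bar>h s\<bar> * min 2 (\<bar>X i\<bar> * s)) integrable_on {0..}" for i
        by (rule set_lebesgue_integral_eq_integral(1)[OF int])
      show "(\<lambda>s. 2 * \<bar>h s\<bar>) integrable_on {0..}"
        by (rule set_lebesgue_integral_eq_integral(1)[OF h2])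
      show "norm (\<bar>h s\<bar> * min 2 (\<bar>X i\<bar> * s)) \<le> 2 * \<bar>h s\<bar>" if "s \<in> {0..}" for i s
        using le that by auto
      show "(\<lambda>i. \<bar>h s\<bar> * min 2 (\<bar>X i\<bar> * s)) \<longlonglongrightarrow> \<bar>h s\<bar> * min 2 (\<bar>0\<bar> * s)" for s
        by (intro tendsto_intros X)
    qed
  qed
qed

lemma tail_kernel_bound:
  fixes f \<rho> :: "real \<Rightarrow> complex" and h :: "real \<Rightarrow> real"
  assumes "f absolutely_integrable_on {t..}" "L1 h" "0 \<le> t" "\<And>s. s \<ge> t \<Longrightarrow> norm (f s) \<le> h s"
    "\<And>s. s \<ge> 0 \<Longrightarrow> 0 \<le> h s"
  shows "norm (integral {t..} f) \<le> integral {0..} h"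
proof -
  have "norm (integral {t..} f) \<le> integral {t..} h"
    using assms(4) by (intro integral_norm_bound_integral set_lebesgue_integral_eq_integral(1)[OF assms(1)]
      set_lebesgue_integral_eq_integral(1)[OF L1_tail[OF assms(2,3)]]) auto
  also have "\<dots> \<le> integral {0..} h"
    using assms(3,5) by (intro integral_subset_le set_lebesgue_integral_eq_integral(1)[OF assms(2)]
      set_lebesgue_integral_eq_integral(1)[OF L1_tail[OF assms(2,3)]]) auto
  finally show ?thesis .
qed

definition poly_exp :: "complex \<Rightarrow> nat \<Rightarrow> real \<Rightarrow> complex" where
  "poly_exp \<zeta> i \<tau> = of_real (\<tau> ^ i) * exp (\<zeta> * of_real \<tau>)"

text \<open>
  The \<open>i\<close>-th derivative in \<open>\<zeta>\<close> of \<open>\<integral>\<^sub>t\<^sup>\<infinity> exp (\<zeta> (s - t)) \<rho>(s) g(s) ds\<close>.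
\<close>

definition tail_transform :: "complex \<Rightarrow> nat \<Rightarrow> (real \<Rightarrow> complex) \<Rightarrow> (real \<Rightarrow> complex) \<Rightarrow> real \<Rightarrow> complex" where
  "tail_transform \<zeta> i \<rho> g t = integral {t..} (\<lambda>s. poly_exp \<zeta> i (s - t) * (\<rho> s * g s))"

lemma norm_poly_exp_le: "Re \<zeta> \<le> 0 \<Longrightarrow> 0 \<le> \<tau> \<Longrightarrow> norm (poly_exp \<zeta> i \<tau>) \<le> \<tau> ^ i"
  by (simp add: poly_exp_def norm_mult norm_power mult_left_le mult_nonpos_nonneg)

text \<open>
  Separates \<open>s\<close> from \<open>t\<close> in the kernel, which turns \<open>tail_transform\<close> into a finite combination of tails of fixed
  integrable functions; continuity in \<open>t\<close> and integrability follow from this.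
\<close>

lemma poly_exp_binomial:
  "poly_exp \<zeta> i (s - t) = (\<Sum>j\<le>i. (of_nat (i choose j) * (of_real (- t)) ^ (i - j) * exp (- \<zeta> * of_real t)) * poly_exp \<zeta> j s)"
proof -
  have "poly_exp \<zeta> i (s - t) = (of_real s + of_real (- t)) ^ i * (exp (- \<zeta> * of_real t) * exp (\<zeta> * of_real s))"
    by (simp add: poly_exp_def ring_distribs flip: exp_add)
  also have "\<dots> = (\<Sum>j\<le>i. (of_nat (i choose j) * (of_real (- t)) ^ (i - j) * exp (- \<zeta> * of_real t)) * poly_exp \<zeta> j s)"
    unfolding binomial_ring sum_distrib_right poly_exp_def by (intro sum.cong) (simp_all add: algebra_simps)
  finally show ?thesis .
qed

locale tail_data =
  fixes n i :: nat and \<rho> g :: "real \<Rightarrow> complex" and C :: real and \<zeta> :: complex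
  assumes rho: "weighted_L1 n \<rho>" and i_le: "i \<le> n" and g_cont: "continuous_on {0..} g" and g_bd: "\<And>s. s \<ge> 0 \<Longrightarrow> norm (g s) \<le> C"
    and Re_le: "Re \<zeta> \<le> 0"
begin

lemma L1_poly_exp: "j \<le> i \<Longrightarrow> L1 (\<lambda>s. poly_exp \<zeta> j s * (\<rho> s * g s))"
proof -
  assume j: "j \<le> i"
  have "weighted_L1 n (\<lambda>s. g s * \<rho> s)" by (rule weighted_L1_mult[OF rho g_cont g_bd])
  then have "L1 (\<lambda>s. s ^ j *\<^sub>R (g s * \<rho> s))" by (rule weighted_L1_power) (use j i_le in auto)
  then have "L1 (\<lambda>s. exp (\<zeta> * of_real s) * s ^ j *\<^sub>R (g s * \<rho> s))"
    by (rule L1_mult[where C = 1]) (use Re_le in \<open>auto intro!: continuous_intros mult_nonpos_nonneg\<close>)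
  then show ?thesis by (simp add: poly_exp_def scaleR_conv_of_real algebra_simps)
qed

lemma tail_transform_binomial:
  assumes "0 \<le> t"
  shows "tail_transform \<zeta> i \<rho> g t = (\<Sum>j\<le>i. (of_nat (i choose j) * (of_real (- t)) ^ (i - j) * exp (- \<zeta> * of_real t)) *
      integral {t..} (\<lambda>s. poly_exp \<zeta> j s * (\<rho> s * g s)))"
    and tail_transform_integrable: "(\<lambda>s. poly_exp \<zeta> i (s - t) * (\<rho> s * g s)) absolutely_integrable_on {t..}"
proof -
  let ?c = "\<lambda>j. of_nat (i choose j) * (of_real (- t)) ^ (i - j) * exp (- \<zeta> * of_real t)"
  have eq: "(\<lambda>s. poly_exp \<zeta> i (s - t) * (\<rho> s * g s)) = (\<lambda>s. \<Sum>j\<le>i. ?c j * (poly_exp \<zeta> j s * (\<rho> s * g s)))"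
    unfolding poly_exp_binomial sum_distrib_right by (simp add: mult.assoc)
  have a: "(\<lambda>s. ?c j * (poly_exp \<zeta> j s * (\<rho> s * g s))) absolutely_integrable_on {t..}" if "j \<le> i" for j
    using L1_tail[OF L1_poly_exp[OF that] assms] by (intro set_integrable_mult_right) auto
  show "(\<lambda>s. poly_exp \<zeta> i (s - t) * (\<rho> s * g s)) absolutely_integrable_on {t..}"
    unfolding eq by (rule absolutely_integrable_sum) (use a in auto)
  show "tail_transform \<zeta> i \<rho> g t = (\<Sum>j\<le>i. ?c j * integral {t..} (\<lambda>s. poly_exp \<zeta> j s * (\<rho> s * g s)))"
    unfolding tail_transform_def eq
    by (subst integral_sum) (use a set_lebesgue_integral_eq_integral(1) in auto)
qed

lemma tail_transform_continuous: "continuous_on {0..} (tail_transform \<zeta> i \<rho> g)"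
proof -
  have "continuous_on {0..} (\<lambda>t. \<Sum>j\<le>i. (of_nat (i choose j) * (of_real (- t)) ^ (i - j) * exp (- \<zeta> * of_real t)) *
      integral {t..} (\<lambda>s. poly_exp \<zeta> j s * (\<rho> s * g s)))"
    by (intro continuous_on_sum continuous_on_mult has_ac_deriv_continuous[OF has_ac_deriv_tail] L1_poly_exp continuous_intros) auto
  then show ?thesis by (rule continuous_on_eq) (simp add: tail_transform_binomial)
qed

lemma rho_power: "L1 (\<lambda>s. s ^ i *\<^sub>R norm (\<rho> s))"
proof -
  have "L1 (\<lambda>s. s ^ i *\<^sub>R \<rho> s)" by (rule weighted_L1_power[OF rho i_le])
  from absolutely_integrable_norm[OF this] have "L1 (\<lambda>s. \<bar>s ^ i\<bar> * norm (\<rho> s))" by (simp add: o_def)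
  then show ?thesis by (rule absolutely_integrable_spike[OF _ negligible_empty]) simp
qed

lemma C_nonneg: "0 \<le> C"
  using g_bd[of 0] norm_ge_zero[of "g 0"] by linarith

lemma tail_transform_bound:
  assumes "0 \<le> t"
  shows "norm (tail_transform \<zeta> i \<rho> g t) \<le> integral {0..} (\<lambda>s. s ^ i * norm (\<rho> s)) * C"
proof -
  have "norm (tail_transform \<zeta> i \<rho> g t) \<le> integral {0..} (\<lambda>s. s ^ i *\<^sub>R norm (\<rho> s) * C)"
    unfolding tail_transform_def
  proof (rule tail_kernel_bound[OF tail_transform_integrable[OF assms] _ assms])
    show "L1 (\<lambda>s. s ^ i *\<^sub>R norm (\<rho> s) * C)" using rho_power by (rule set_integrable_mult_left)
    fix s assume s: "s \<ge> t"
    have "norm (poly_exp \<zeta> i (s - t)) \<le> s ^ i"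
      using norm_poly_exp_le[OF Re_le, of "s - t" i] s assms power_mono[of "s - t" s i] by linarith
    then have "norm (poly_exp \<zeta> i (s - t)) * (norm (\<rho> s) * norm (g s)) \<le> s ^ i * (norm (\<rho> s) * C)"
      using g_bd[of s] s assms by (intro mult_mono) auto
    then show "norm (poly_exp \<zeta> i (s - t) * (\<rho> s * g s)) \<le> s ^ i *\<^sub>R norm (\<rho> s) * C"
      by (simp add: norm_mult algebra_simps)
  qed (simp add: C_nonneg)
  then show ?thesis by simp
qed

end

text \<open>
  Bounded continuous functions are taken on all of \<open>\<real>\<close>, extended constantly to negative times by \<open>max t 0\<close>.
\<close>

definition tail_op :: "complex \<Rightarrow> nat \<Rightarrow> (real \<Rightarrow> complex) \<Rightarrow> (real \<Rightarrow>\<^sub>C complex) \<Rightarrow> real \<Rightarrow>\<^sub>C complex" where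
  "tail_op \<zeta> i \<rho> x = Bcontfun (\<lambda>t. tail_transform \<zeta> i \<rho> (apply_bcontfun x) (max t 0))"

lemma tail_data_bcontfun: "weighted_L1 n \<rho> \<Longrightarrow> i \<le> n \<Longrightarrow> Re \<zeta> \<le> 0 \<Longrightarrow> tail_data n i \<rho> (apply_bcontfun x) (norm x) \<zeta>"
  by unfold_locales (auto simp: norm_bounded)

lemma apply_tail_op:
  assumes "weighted_L1 n \<rho>" "i \<le> n" "Re \<zeta> \<le> 0"
  shows "apply_bcontfun (tail_op \<zeta> i \<rho> x) t = tail_transform \<zeta> i \<rho> (apply_bcontfun x) (max t 0)"
proof -
  interpret tail_data n i \<rho> "apply_bcontfun x" "norm x" \<zeta> by (rule tail_data_bcontfun[OF assms])
  have "continuous_on UNIV (\<lambda>t. tail_transform \<zeta> i \<rho> (apply_bcontfun x) (max t 0))"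
    by (rule continuous_on_compose2[OF tail_transform_continuous]) (auto intro!: continuous_intros)
  then have "(\<lambda>t. tail_transform \<zeta> i \<rho> (apply_bcontfun x) (max t 0)) \<in> bcontfun"
    by (rule bcontfun_normI) (rule tail_transform_bound, simp)
  then show ?thesis by (simp add: tail_op_def Bcontfun_inverse)
qed

lemma norm_tail_op_le:
  assumes "weighted_L1 n \<rho>" "i \<le> n" "Re \<zeta> \<le> 0"
  shows "norm (tail_op \<zeta> i \<rho> x) \<le> integral {0..} (\<lambda>s. s ^ i * norm (\<rho> s)) * norm x"
proof -
  interpret tail_data n i \<rho> "apply_bcontfun x" "norm x" \<zeta> by (rule tail_data_bcontfun[OF assms])
  show ?thesis by (rule norm_bound) (simp add: apply_tail_op[OF assms] tail_transform_bound)
qed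

lemma tail_op_add:
  assumes "weighted_L1 n \<rho>" "i \<le> n" "Re \<zeta> \<le> 0"
  shows "tail_op \<zeta> i \<rho> (x + y) = tail_op \<zeta> i \<rho> x + tail_op \<zeta> i \<rho> y"
proof (rule bcontfun_eqI)
  fix t :: real
  define t' where "t' = max t 0"
  have "0 \<le> t'" by (simp add: t'_def)
  then have int: "(\<lambda>s. poly_exp \<zeta> i (s - t') * (\<rho> s * apply_bcontfun z s)) integrable_on {t'..}" for z
    by (rule set_lebesgue_integral_eq_integral(1)[OF tail_data.tail_transform_integrable[OF tail_data_bcontfun[OF assms]]])
  show "apply_bcontfun (tail_op \<zeta> i \<rho> (x + y)) t = apply_bcontfun (tail_op \<zeta> i \<rho> x + tail_op \<zeta> i \<rho> y) t"
    unfolding plus_bcontfun.rep_eq apply_tail_op[OF assms] tail_transform_def t'_def[symmetric]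
    by (simp add: distrib_left Henstock_Kurzweil_Integration.integral_add[OF int int])
qed

lemma tail_op_scaleC:
  assumes "weighted_L1 n \<rho>" "i \<le> n" "Re \<zeta> \<le> 0"
  shows "tail_op \<zeta> i \<rho> (c *\<^sub>c x) = c *\<^sub>c tail_op \<zeta> i \<rho> x"
proof (rule bcontfun_eqI)
  fix t
  have "(\<lambda>s. poly_exp \<zeta> i (s - max t 0) * (\<rho> s * (c * apply_bcontfun x s)))
    = (\<lambda>s. c * (poly_exp \<zeta> i (s - max t 0) * (\<rho> s * apply_bcontfun x s)))"
    by (auto simp: algebra_simps)
  then show "apply_bcontfun (tail_op \<zeta> i \<rho> (c *\<^sub>c x)) t = apply_bcontfun (c *\<^sub>c tail_op \<zeta> i \<rho> x) t"
    unfolding apply_scaleC_bcontfun apply_tail_op[OF assms] tail_transform_def scaleC_complex_def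
    by (simp only: integral_mult_right)
qed

lemma tail_op_lipschitz:
  assumes "weighted_L1 n \<rho>" "i \<le> n" "Re \<zeta> \<le> 0" "Re \<xi> \<le> 0"
  shows "norm (tail_op \<zeta> i \<rho> x - tail_op \<xi> i \<rho> x)
    \<le> integral {0..} (\<lambda>s. \<bar>s ^ i * norm (\<rho> s)\<bar> * min 2 (\<bar>norm (\<zeta> - \<xi>)\<bar> * s)) * norm x"
proof (rule norm_bound)
  fix t :: real
  define t' where "t' = max t 0"
  have t': "0 \<le> t'" by (simp add: t'_def)
  interpret Z: tail_data n i \<rho> "apply_bcontfun x" "norm x" \<zeta> by (rule tail_data_bcontfun[OF assms(1-3)])
  interpret X: tail_data n i \<rho> "apply_bcontfun x" "norm x" \<xi> by (rule tail_data_bcontfun[OF assms(1,2,4)])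
  let ?f = "\<lambda>s. poly_exp \<zeta> i (s - t') * (\<rho> s * apply_bcontfun x s) - poly_exp \<xi> i (s - t') * (\<rho> s * apply_bcontfun x s)"
  have rp: "L1 (\<lambda>s. s ^ i * norm (\<rho> s))" using Z.rho_power by simp
  have "apply_bcontfun (tail_op \<zeta> i \<rho> x - tail_op \<xi> i \<rho> x) t = integral {t'..} ?f"
    unfolding minus_bcontfun.rep_eq apply_tail_op[OF assms(1-3)] apply_tail_op[OF assms(1,2,4)] tail_transform_def t'_def[symmetric]
    by (intro Henstock_Kurzweil_Integration.integral_diff[symmetric] set_lebesgue_integral_eq_integral(1)
        Z.tail_transform_integrable X.tail_transform_integrable t')
  moreover have "norm (integral {t'..} ?f) \<le> integral {0..} (\<lambda>s. \<bar>s ^ i * norm (\<rho> s)\<bar> * min 2 (\<bar>norm (\<zeta> - \<xi>)\<bar> * s) * norm x)"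
  proof (rule tail_kernel_bound[OF _ _ t'])
    show "?f absolutely_integrable_on {t'..}"
      by (intro set_integral_diff(1) Z.tail_transform_integrable X.tail_transform_integrable t')
    show "L1 (\<lambda>s. \<bar>s ^ i * norm (\<rho> s)\<bar> * min 2 (\<bar>norm (\<zeta> - \<xi>)\<bar> * s) * norm x)"
      by (rule set_integrable_mult_left) (rule small_kernel_tendsto(2)[OF rp])
    fix s assume s: "s \<ge> t'"
    let ?d = "exp (\<zeta> * of_real (s - t')) - exp (\<xi> * of_real (s - t'))"
    have "norm ?d \<le> min 2 (norm (\<zeta> - \<xi>) * (s - t'))"
      using s by (intro exp_scaled_diff_le assms) auto
    also have "\<dots> \<le> min 2 (norm (\<zeta> - \<xi>) * s)"
      using t' by (intro min.mono mult_left_mono) auto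
    finally have d: "norm ?d \<le> min 2 (norm (\<zeta> - \<xi>) * s)" .
    have "?f s = of_real ((s - t') ^ i) * ?d * (\<rho> s * apply_bcontfun x s)"
      unfolding poly_exp_def by (simp only: left_diff_distrib right_diff_distrib)
    then have "norm (?f s) = (s - t') ^ i * norm ?d * (norm (\<rho> s) * norm (apply_bcontfun x s))"
      using s by (simp add: norm_mult norm_power del: of_real_diff)
    also have "\<dots> \<le> s ^ i * min 2 (norm (\<zeta> - \<xi>) * s) * (norm (\<rho> s) * norm x)"
    proof (rule mult_mono)
      show "(s - t') ^ i * norm ?d \<le> s ^ i * min 2 (norm (\<zeta> - \<xi>) * s)"
        by (rule mult_mono[OF power_mono d]) (use s t' in simp_all)
      show "norm (\<rho> s) * norm (apply_bcontfun x s) \<le> norm (\<rho> s) * norm x"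
        by (intro mult_left_mono norm_bounded) simp
    qed (use s t' in simp_all)
    finally show "norm (?f s) \<le> \<bar>s ^ i * norm (\<rho> s)\<bar> * min 2 (\<bar>norm (\<zeta> - \<xi>)\<bar> * s) * norm x"
      using s t' by (simp add: abs_mult algebra_simps)
  qed auto
  ultimately show "norm (apply_bcontfun (tail_op \<zeta> i \<rho> x - tail_op \<xi> i \<rho> x) t)
    \<le> integral {0..} (\<lambda>s. \<bar>s ^ i * norm (\<rho> s)\<bar> * min 2 (\<bar>norm (\<zeta> - \<xi>)\<bar> * s)) * norm x"
    by simp
qed

text \<open>
  Passing from index \<open>i\<close> to \<open>Suc i\<close> is differentiation in the exponent, with a remainder of smaller order.
\<close>

lemma tail_op_taylor:
  assumes "weighted_L1 n \<rho>" "Suc i \<le> n" "Re \<zeta> \<le> 0" "Re \<xi> \<le> 0"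
  shows "norm (tail_op \<zeta> i \<rho> x - tail_op \<xi> i \<rho> x - (\<zeta> - \<xi>) *\<^sub>c tail_op \<xi> (Suc i) \<rho> x)
    \<le> norm (\<zeta> - \<xi>) * integral {0..} (\<lambda>s. \<bar>s ^ Suc i * norm (\<rho> s)\<bar> * min 2 (\<bar>norm (\<zeta> - \<xi>)\<bar> * s)) * norm x"
proof (rule norm_bound)
  fix t :: real
  define t' where "t' = max t 0"
  have t': "0 \<le> t'" by (simp add: t'_def)
  have i: "i \<le> n" using assms(2) by simp
  interpret Z: tail_data n i \<rho> "apply_bcontfun x" "norm x" \<zeta> by (rule tail_data_bcontfun[OF assms(1) i assms(3)])
  interpret X: tail_data n i \<rho> "apply_bcontfun x" "norm x" \<xi> by (rule tail_data_bcontfun[OF assms(1) i assms(4)])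
  interpret Y: tail_data n "Suc i" \<rho> "apply_bcontfun x" "norm x" \<xi> by (rule tail_data_bcontfun[OF assms(1,2,4)])
  let ?g = "\<lambda>s. \<rho> s * apply_bcontfun x s"
  let ?f = "\<lambda>s. poly_exp \<zeta> i (s - t') * ?g s - poly_exp \<xi> i (s - t') * ?g s - (\<zeta> - \<xi>) * (poly_exp \<xi> (Suc i) (s - t') * ?g s)"
  have rp: "L1 (\<lambda>s. s ^ Suc i * norm (\<rho> s))" using Y.rho_power by simp
  note I = Z.tail_transform_integrable[OF t'] X.tail_transform_integrable[OF t'] Y.tail_transform_integrable[OF t']
  have af: "?f absolutely_integrable_on {t'..}"
    by (intro set_integral_diff(1) set_integrable_mult_right I)
  note I' = I[THEN set_lebesgue_integral_eq_integral(1)]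
  have "apply_bcontfun (tail_op \<zeta> i \<rho> x - tail_op \<xi> i \<rho> x - (\<zeta> - \<xi>) *\<^sub>c tail_op \<xi> (Suc i) \<rho> x) t = integral {t'..} ?f"
    unfolding minus_bcontfun.rep_eq apply_scaleC_bcontfun apply_tail_op[OF assms(1) i assms(3)]
      apply_tail_op[OF assms(1) i assms(4)] apply_tail_op[OF assms(1,2,4)] tail_transform_def t'_def[symmetric] scaleC_complex_def
    using I' by (simp add: Henstock_Kurzweil_Integration.integral_diff integrable_diff integrable_on_mult_right)
  moreover have "norm (integral {t'..} ?f)
    \<le> integral {0..} (\<lambda>s. norm (\<zeta> - \<xi>) * (\<bar>s ^ Suc i * norm (\<rho> s)\<bar> * min 2 (\<bar>norm (\<zeta> - \<xi>)\<bar> * s)) * norm x)"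
  proof (rule tail_kernel_bound[OF af _ t'])
    show "L1 (\<lambda>s. norm (\<zeta> - \<xi>) * (\<bar>s ^ Suc i * norm (\<rho> s)\<bar> * min 2 (\<bar>norm (\<zeta> - \<xi>)\<bar> * s)) * norm x)"
      by (intro set_integrable_mult_left set_integrable_mult_right) (rule small_kernel_tendsto(2)[OF rp])
    fix s assume s: "s \<ge> t'"
    define \<tau> where "\<tau> = s - t'"
    have \<tau>: "0 \<le> \<tau>" "\<tau> \<le> s" using s t' by (auto simp: \<tau>_def)
    let ?d = "exp (\<zeta> * of_real \<tau>) - exp (\<xi> * of_real \<tau>) - (\<zeta> - \<xi>) * of_real \<tau> * exp (\<xi> * of_real \<tau>)"
    have "norm ?d \<le> norm (\<zeta> - \<xi>) * (\<tau> * min 2 (norm (\<zeta> - \<xi>) * \<tau>))"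
      using \<tau> by (intro exp_scaled_diff_le assms) auto
    also have "\<dots> \<le> norm (\<zeta> - \<xi>) * (s * min 2 (norm (\<zeta> - \<xi>) * s))"
      using \<tau> by (intro mult_left_mono mult_mono min.mono) auto
    finally have d: "norm ?d \<le> norm (\<zeta> - \<xi>) * (s * min 2 (norm (\<zeta> - \<xi>) * s))" .
    have "?f s = of_real (\<tau> ^ i) * ?d * ?g s"
      unfolding poly_exp_def \<tau>_def[symmetric] by (simp add: algebra_simps)
    then have "norm (?f s) = \<tau> ^ i * norm ?d * (norm (\<rho> s) * norm (apply_bcontfun x s))"
      using \<tau> by (simp add: norm_mult norm_power)
    also have "\<dots> \<le> s ^ i * (norm (\<zeta> - \<xi>) * (s * min 2 (norm (\<zeta> - \<xi>) * s))) * (norm (\<rho> s) * norm x)"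
    proof (rule mult_mono)
      show "\<tau> ^ i * norm ?d \<le> s ^ i * (norm (\<zeta> - \<xi>) * (s * min 2 (norm (\<zeta> - \<xi>) * s)))"
        by (rule mult_mono[OF power_mono d]) (use \<tau> in simp_all)
      show "norm (\<rho> s) * norm (apply_bcontfun x s) \<le> norm (\<rho> s) * norm x"
        by (intro mult_left_mono norm_bounded) simp
    qed (use \<tau> in simp_all)
    finally show "norm (?f s) \<le> norm (\<zeta> - \<xi>) * (\<bar>s ^ Suc i * norm (\<rho> s)\<bar> * min 2 (\<bar>norm (\<zeta> - \<xi>)\<bar> * s)) * norm x"
      using \<tau> by (simp add: abs_mult algebra_simps)
  qed auto
  ultimately show "norm (apply_bcontfun (tail_op \<zeta> i \<rho> x - tail_op \<xi> i \<rho> x - (\<zeta> - \<xi>) *\<^sub>c tail_op \<xi> (Suc i) \<rho> x) t)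
    \<le> norm (\<zeta> - \<xi>) * integral {0..} (\<lambda>s. \<bar>s ^ Suc i * norm (\<rho> s)\<bar> * min 2 (\<bar>norm (\<zeta> - \<xi>)\<bar> * s)) * norm x"
    by simp
qed

lemma op_smooth_add: "op_smooth P r K \<Longrightarrow> op_smooth P r L \<Longrightarrow> op_smooth P r (\<lambda>k x. K k x + L k x)"
proof (induction r arbitrary: K L)
  case 0
  obtain C D where C: "\<forall>k\<in>P. \<forall>x. norm (K k x) \<le> C * norm x" and D: "\<forall>k\<in>P. \<forall>x. norm (L k x) \<le> D * norm x"
    using 0 unfolding op_smooth.simps linear_family_def by blast
  have "norm (K k x + L k x) \<le> (C + D) * norm x" if "k \<in> P" for k x
    using C D that norm_triangle_mono[of "K k x" "C * norm x" "L k x" "D * norm x"] by (simp add: distrib_right)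
  then have "\<exists>C. \<forall>k\<in>P. \<forall>x. norm (K k x + L k x) \<le> C * norm x" by blast
  with 0 show ?case
    unfolding op_smooth.simps linear_family_def by (auto simp: scaleC_add_right intro!: continuous_on_add)
next
  case (Suc r)
  obtain K' where K': "\<And>x k. k \<in> P \<Longrightarrow> has_cderiv (\<lambda>k. K k x) (K' k x) k P" "op_smooth P r K'"
    using op_smooth_SucE[OF Suc.prems(1)] by blast
  obtain L' where L': "\<And>x k. k \<in> P \<Longrightarrow> has_cderiv (\<lambda>k. L k x) (L' k x) k P" "op_smooth P r L'"
    using op_smooth_SucE[OF Suc.prems(2)] by blast
  show ?case
    by (rule op_smooth_SucI[where K' = "\<lambda>k x. K' k x + L' k x"], rule op_smooth_0[OF Suc.IH[OF op_smooth_pred op_smooth_pred, OF Suc.prems]],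
        rule has_cderiv_add[OF K'(1) L'(1)], assumption+, rule Suc.IH[OF K'(2) L'(2)])
qed

lemma op_smooth_scaleC:
  "derivs_bounded P r (\<lambda>_ _. 1) c \<Longrightarrow> op_smooth P r K \<Longrightarrow> op_smooth P r (\<lambda>k x. c k *\<^sub>c K k x)"
proof (induction r arbitrary: c K)
  case 0
  obtain C D where C: "\<forall>k\<in>P. \<forall>x. norm (K k x) \<le> C * norm x" and D: "\<forall>k\<in>P. norm (c k) \<le> D * 1"
    using 0 unfolding op_smooth.simps derivs_bounded.simps linear_family_def by blast
  have "norm (c k *\<^sub>c K k x) \<le> (D * C) * norm x" if "k \<in> P" for k x
  proof -
    have "norm (c k) * norm (K k x) \<le> D * (C * norm x)"
      using C D that by (intro mult_mono) (auto intro: order_trans[OF norm_ge_zero])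
    then show ?thesis by (simp add: norm_scaleC)
  qed
  then have "\<exists>C. \<forall>k\<in>P. \<forall>x. norm (c k *\<^sub>c K k x) \<le> C * norm x" by blast
  with 0 show ?case
    unfolding op_smooth.simps derivs_bounded.simps linear_family_def
    by (auto simp: scaleC_add_right scaleC_scaleC mult.commute intro!: continuous_on_scaleC)
next
  case (Suc r)
  obtain K' where K': "\<And>x k. k \<in> P \<Longrightarrow> has_cderiv (\<lambda>k. K k x) (K' k x) k P" "op_smooth P r K'"
    using op_smooth_SucE[OF Suc.prems(2)] by blast
  obtain c' where c': "\<And>k. k \<in> P \<Longrightarrow> has_cderiv c (c' k) k P" "derivs_bounded P r (\<lambda>_ _. 1) c'"
    using derivs_bounded_SucE[OF Suc.prems(1)] by blast
  note down = derivs_bounded_pred[OF Suc.prems(1)] op_smooth_pred[OF Suc.prems(2)]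
  show ?case
  proof (rule op_smooth_SucI[where K' = "\<lambda>k x. c' k *\<^sub>c K k x + c k *\<^sub>c K' k x"])
    show "op_smooth P 0 (\<lambda>k x. c k *\<^sub>c K k x)" by (rule op_smooth_0[OF Suc.IH[OF down]])
    show "op_smooth P r (\<lambda>k x. c' k *\<^sub>c K k x + c k *\<^sub>c K' k x)"
      by (rule op_smooth_add[OF Suc.IH[OF c'(2) down(2)] Suc.IH[OF down(1) K'(2)]])
    fix k x assume k: "k \<in> P"
    have "continuous (at k within P) (\<lambda>k. K k x)"
      using op_smooth_0[OF down(2)] k by (auto simp: linear_family_def continuous_on_eq_continuous_within)
    then show "has_cderiv (\<lambda>k. c k *\<^sub>c K k x) (c' k *\<^sub>c K k x + c k *\<^sub>c K' k x) k P"
      by (rule has_cderiv_scaleC[OF c'(1)[OF k] K'(1)[OF k]])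
  qed
qed

text \<open>
  The chain rule for the exponent \<open>\<phi>(k)\<close>: a derivative multiplies by \<open>\<phi>'\<close> and raises the index \<open>i\<close> by one, so that \<open>r\<close>
  derivatives starting from index \<open>i\<close> require \<open>i + r \<le> n\<close>. The exponent itself may be unbounded
  (weight \<open>w\<close>); its derivatives are bounded.
\<close>

lemma op_smooth_tail_op:
  assumes rho: "weighted_L1 n \<rho>" and \<phi>: "derivs_bounded P r (case_nat w (\<lambda>_ _. 1)) \<phi>" and Re: "\<And>k. k \<in> P \<Longrightarrow> Re (\<phi> k) \<le> 0"
  shows "i + r \<le> n \<Longrightarrow> op_smooth P r (\<lambda>k. tail_op (\<phi> k) i \<rho>)"
  using \<phi>
proof (induction r arbitrary: i)
  case 0
  have i: "i \<le> n" using 0 by simp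
  define M where "M d = integral {0..} (\<lambda>s. \<bar>s ^ i * norm (\<rho> s)\<bar> * min 2 (\<bar>d\<bar> * s))" for d
  have "L1 (\<lambda>s. s ^ i * norm (\<rho> s))"
    using tail_data.rho_power[OF tail_data_bcontfun[OF rho i, of 0 0]] by simp
  then have M: "isCont M 0" unfolding M_def by (rule small_kernel_tendsto)
  have M0: "M 0 = 0" by (simp add: M_def)
  have "((\<lambda>z. tail_op (\<phi> z) i \<rho> x) \<longlongrightarrow> tail_op (\<phi> k) i \<rho> x) (at k within P)" if k: "k \<in> P" for k x
  proof -
    have "((\<lambda>z. M (norm (\<phi> z - \<phi> k))) \<longlongrightarrow> M 0) (at k within P)"
      using 0(2) k by (intro isCont_tendsto_compose[OF M] tendsto_norm_zero LIM_zero) (auto simp: continuous_on_def)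
    then have lim: "((\<lambda>z. M (norm (\<phi> z - \<phi> k)) * norm x) \<longlongrightarrow> 0) (at k within P)"
      using tendsto_mult[OF _ tendsto_const, of _ "M 0"] by (simp add: M0)
    have "((\<lambda>z. tail_op (\<phi> z) i \<rho> x - tail_op (\<phi> k) i \<rho> x) \<longlongrightarrow> 0) (at k within P)"
    proof (rule Lim_null_comparison[OF _ lim])
      show "\<forall>\<^sub>F z in at k within P. norm (tail_op (\<phi> z) i \<rho> x - tail_op (\<phi> k) i \<rho> x) \<le> M (norm (\<phi> z - \<phi> k)) * norm x"
        using tail_op_lipschitz[OF rho i Re Re[OF k]] by (auto simp: eventually_at_filter M_def)
    qed
    then show ?thesis by (rule LIM_zero_cancel)
  qed
  then show ?case
    unfolding op_smooth.simps linear_family_def continuous_on_def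
    using tail_op_add[OF rho i Re] tail_op_scaleC[OF rho i Re] norm_tail_op_le[OF rho i Re] by blast
next
  case (Suc r)
  have i: "i \<le> n" "Suc i \<le> n" using Suc by auto
  obtain \<phi>' where \<phi>': "\<And>k. k \<in> P \<Longrightarrow> has_cderiv \<phi> (\<phi>' k) k P" "derivs_bounded P r (\<lambda>_ _. 1) \<phi>'"
    using derivs_bounded_SucE[OF Suc.prems(2)] by auto
  note \<phi>r = derivs_bounded_pred[OF Suc.prems(2)]
  define M where "M d = integral {0..} (\<lambda>s. \<bar>s ^ Suc i * norm (\<rho> s)\<bar> * min 2 (\<bar>d\<bar> * s))" for d
  have "L1 (\<lambda>s. s ^ Suc i * norm (\<rho> s))"
    using tail_data.rho_power[OF tail_data_bcontfun[OF rho i(2), of 0 0]] by simp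
  then have M: "isCont M 0" unfolding M_def by (rule small_kernel_tendsto)
  have M0: "M 0 = 0" by (simp add: M_def)
  show ?case
  proof (rule op_smooth_SucI[where K' = "\<lambda>k x. \<phi>' k *\<^sub>c tail_op (\<phi> k) (Suc i) \<rho> x"])
    have "op_smooth P r (\<lambda>k. tail_op (\<phi> k) i \<rho>)" by (rule Suc.IH[OF _ \<phi>r]) (use Suc.prems in auto)
    then show "op_smooth P 0 (\<lambda>k. tail_op (\<phi> k) i \<rho>)" by (rule op_smooth_0)
    show "op_smooth P r (\<lambda>k x. \<phi>' k *\<^sub>c tail_op (\<phi> k) (Suc i) \<rho> x)"
      by (rule op_smooth_scaleC[OF \<phi>'(2)], rule Suc.IH[OF _ \<phi>r]) (use Suc.prems in auto)
    fix k x assume k: "k \<in> P"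
    have c\<phi>: "((\<lambda>z. \<phi> z - \<phi> k) \<longlongrightarrow> 0) (at k within P)"
      using derivs_bounded_continuous[OF Suc.prems(2)] k by (intro LIM_zero) (auto simp: continuous_on_def)
    have q\<phi>: "((\<lambda>z. inverse (z - k) * (\<phi> z - \<phi> k)) \<longlongrightarrow> \<phi>' k) (at k within P)"
      using \<phi>'(1)[OF k] by (simp add: has_cderiv_def)
    have "((\<lambda>z. norm (inverse (z - k) * (\<phi> z - \<phi> k)) * M (norm (\<phi> z - \<phi> k)) * norm x
        + norm (inverse (z - k) * (\<phi> z - \<phi> k) - \<phi>' k) * norm (tail_op (\<phi> k) (Suc i) \<rho> x))
        \<longlongrightarrow> norm (\<phi>' k) * M 0 * norm x + 0 * norm (tail_op (\<phi> k) (Suc i) \<rho> x)) (at k within P)"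
      by (intro tendsto_add tendsto_mult tendsto_const tendsto_norm q\<phi> isCont_tendsto_compose[OF M]
           tendsto_norm_zero LIM_zero c\<phi>)
    then have lim: "((\<lambda>z. norm (inverse (z - k) * (\<phi> z - \<phi> k)) * M (norm (\<phi> z - \<phi> k)) * norm x
        + norm (inverse (z - k) * (\<phi> z - \<phi> k) - \<phi>' k) * norm (tail_op (\<phi> k) (Suc i) \<rho> x)) \<longlongrightarrow> 0) (at k within P)"
      by (simp add: M0)
    have "((\<lambda>z. inverse (z - k) *\<^sub>c (tail_op (\<phi> z) i \<rho> x - tail_op (\<phi> k) i \<rho> x) - \<phi>' k *\<^sub>c tail_op (\<phi> k) (Suc i) \<rho> x) \<longlongrightarrow> 0) (at k within P)"
    proof (rule Lim_null_comparison[OF _ lim])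
      have "norm (inverse (z - k) *\<^sub>c (tail_op (\<phi> z) i \<rho> x - tail_op (\<phi> k) i \<rho> x) - \<phi>' k *\<^sub>c tail_op (\<phi> k) (Suc i) \<rho> x)
        \<le> norm (inverse (z - k) * (\<phi> z - \<phi> k)) * M (norm (\<phi> z - \<phi> k)) * norm x
        + norm (inverse (z - k) * (\<phi> z - \<phi> k) - \<phi>' k) * norm (tail_op (\<phi> k) (Suc i) \<rho> x)" if z: "z \<in> P" for z
      proof -
        define c where "c = inverse (z - k)"
        define D where "D = tail_op (\<phi> z) i \<rho> x - tail_op (\<phi> k) i \<rho> x"
        define Y where "Y = tail_op (\<phi> k) (Suc i) \<rho> x"
        have "c *\<^sub>c D - \<phi>' k *\<^sub>c Y = c *\<^sub>c (D - (\<phi> z - \<phi> k) *\<^sub>c Y) + (c * (\<phi> z - \<phi> k) - \<phi>' k) *\<^sub>c Y"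
          by (simp add: scaleC_diff_right scaleC_diff_left scaleC_scaleC right_diff_distrib)
        then have "norm (c *\<^sub>c D - \<phi>' k *\<^sub>c Y)
          \<le> norm c * norm (D - (\<phi> z - \<phi> k) *\<^sub>c Y) + norm (c * (\<phi> z - \<phi> k) - \<phi>' k) * norm Y"
          by (metis norm_triangle_ineq norm_scaleC)
        also have "norm c * norm (D - (\<phi> z - \<phi> k) *\<^sub>c Y) \<le> norm c * (norm (\<phi> z - \<phi> k) * M (norm (\<phi> z - \<phi> k)) * norm x)"
          unfolding D_def Y_def M_def by (intro mult_left_mono tail_op_taylor[OF rho i(2) Re[OF z] Re[OF k]]) auto
        finally show ?thesis unfolding c_def D_def Y_def by (simp only: norm_mult[of "inverse (z - k)"] mult.assoc)
      qed
      then show "\<forall>\<^sub>F z in at k within P. norm (inverse (z - k) *\<^sub>c (tail_op (\<phi> z) i \<rho> x - tail_op (\<phi> k) i \<rho> x) - \<phi>' k *\<^sub>c tail_op (\<phi> k) (Suc i) \<rho> x)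
        \<le> norm (inverse (z - k) * (\<phi> z - \<phi> k)) * M (norm (\<phi> z - \<phi> k)) * norm x
        + norm (inverse (z - k) * (\<phi> z - \<phi> k) - \<phi>' k) * norm (tail_op (\<phi> k) (Suc i) \<rho> x)"
        by (auto simp: eventually_at_filter)
    qed
    then show "has_cderiv (\<lambda>k. tail_op (\<phi> k) i \<rho> x) (\<phi>' k *\<^sub>c tail_op (\<phi> k) (Suc i) \<rho> x) k P"
      unfolding has_cderiv_def by (rule LIM_zero_cancel)
  qed
qed

section \<open>Exponential tail integrals and a backward Gronwall inequality\<close>

lemma bounded_linear_complex_of_real: "bounded_linear complex_of_real"
  by (rule bounded_linear_of_real)

lemma has_ac_deriv_exp: "has_ac_deriv (\<lambda>t. exp (\<zeta> * of_real t)) (\<lambda>t. \<zeta> * exp (\<zeta> * of_real t))"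
proof (rule has_ac_deriv_C1)
  show "((\<lambda>t. exp (\<zeta> * of_real t)) has_vector_derivative \<zeta> * exp (\<zeta> * of_real t)) (at t within {0..})" for t
    by (rule has_vector_derivative_at_within)
      (auto intro!: derivative_eq_intros has_vector_derivative_real_field simp: mult.commute)
qed (intro continuous_intros)

text \<open>
  The decaying solution operator: \<open>F' = - \<zeta> F - f\<close> is solved by \<open>F = exp_transform \<zeta> f\<close>.
\<close>

definition exp_transform :: "complex \<Rightarrow> (real \<Rightarrow> complex) \<Rightarrow> real \<Rightarrow> complex" where
  "exp_transform \<zeta> f t = integral {t..} (\<lambda>s. exp (\<zeta> * of_real (s - t)) * f s)"

lemma L1_exp_mult: "L1 f \<Longrightarrow> Re \<zeta> \<le> 0 \<Longrightarrow> L1 (\<lambda>s. exp (\<zeta> * of_real s) * f s)"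
  by (rule L1_mult[where C=1]) (auto intro!: continuous_intros mult_nonpos_nonneg)

lemma exp_transform_eq: "exp_transform \<zeta> f t = exp (- \<zeta> * of_real t) * integral {t..} (\<lambda>s. exp (\<zeta> * of_real s) * f s)"
proof -
  have "(\<lambda>s. exp (\<zeta> * of_real (s - t)) * f s) = (\<lambda>s. exp (- \<zeta> * of_real t) * (exp (\<zeta> * of_real s) * f s))"
    by (auto simp: algebra_simps simp flip: exp_add)
  then show ?thesis unfolding exp_transform_def by (simp only: integral_mult_right)
qed

lemma exp_transform_integrable:
  assumes "L1 f" "Re \<zeta> \<le> 0" "0 \<le> t"
  shows "(\<lambda>s. exp (\<zeta> * of_real (s - t)) * f s) absolutely_integrable_on {t..}"
proof -
  have eq: "(\<lambda>s. exp (\<zeta> * of_real (s - t)) * f s) = (\<lambda>s. exp (- \<zeta> * of_real t) * (exp (\<zeta> * of_real s) * f s))"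
    by (auto simp: algebra_simps simp flip: exp_add)
  show ?thesis unfolding eq
    by (rule set_integrable_mult_right) (rule L1_tail[OF L1_exp_mult[OF assms(1,2)] assms(3)])
qed

lemma has_ac_deriv_exp_transform:
  assumes "L1 f" "Re \<zeta> \<le> 0"
  shows "has_ac_deriv (exp_transform \<zeta> f) (\<lambda>t. - \<zeta> * exp_transform \<zeta> f t - f t)"
proof -
  have "has_ac_deriv (\<lambda>t. exp (- \<zeta> * of_real t) * integral {t..} (\<lambda>s. exp (\<zeta> * of_real s) * f s))
     (\<lambda>t. (- \<zeta> * exp (- \<zeta> * of_real t)) * integral {t..} (\<lambda>s. exp (\<zeta> * of_real s) * f s)
        + exp (- \<zeta> * of_real t) * - (exp (\<zeta> * of_real t) * f t))"
    by (rule has_ac_deriv_mult[OF has_ac_deriv_exp has_ac_deriv_tail[OF L1_exp_mult[OF assms]]])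
  then have "has_ac_deriv (exp_transform \<zeta> f) (\<lambda>t. (- \<zeta> * exp (- \<zeta> * of_real t)) * integral {t..} (\<lambda>s. exp (\<zeta> * of_real s) * f s)
        + exp (- \<zeta> * of_real t) * - (exp (\<zeta> * of_real t) * f t))"
    by (rule has_ac_deriv_cong) (simp only: exp_transform_eq)
  then show ?thesis
  proof (rule has_ac_deriv_cong_deriv)
    fix t :: real
    have "exp (- \<zeta> * of_real t) * (exp (\<zeta> * of_real t) * f t) = f t"
      by (simp add: mult.assoc[symmetric] flip: exp_add)
    then show "(- \<zeta> * exp (- \<zeta> * of_real t)) * integral {t..} (\<lambda>s. exp (\<zeta> * of_real s) * f s)
        + exp (- \<zeta> * of_real t) * - (exp (\<zeta> * of_real t) * f t) = - \<zeta> * exp_transform \<zeta> f t - f t"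
      unfolding exp_transform_eq by simp
  qed
qed

lemma norm_exp_transform_le:
  assumes "L1 f" "Re \<zeta> \<le> 0" "0 \<le> t"
  shows "norm (exp_transform \<zeta> f t) \<le> integral {t..} (\<lambda>s. norm (f s))"
  unfolding exp_transform_def
proof (rule integral_norm_bound_integral)
  show "(\<lambda>s. exp (\<zeta> * of_real (s - t)) * f s) integrable_on {t..}"
    by (rule set_lebesgue_integral_eq_integral(1)[OF exp_transform_integrable[OF assms]])
  show "(\<lambda>s. norm (f s)) integrable_on {t..}"
    by (rule set_lebesgue_integral_eq_integral(1)[OF absolutely_integrable_norm[OF L1_tail[OF assms(1,3)], unfolded o_def]])
  fix s assume "s \<in> {t..}"
  then have "Re (\<zeta> * of_real (s - t)) \<le> 0" using assms(2) by (auto simp: mult_nonpos_nonneg)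
  then have "norm (exp (\<zeta> * of_real (s - t))) \<le> 1" by simp
  then show "norm (exp (\<zeta> * of_real (s - t)) * f s) \<le> norm (f s)"
    by (simp only: norm_mult mult_left_le_one_le norm_ge_zero)
qed

lemma exp_transform_tendsto_0:
  assumes "L1 f" "Re \<zeta> \<le> 0"
  shows "(exp_transform \<zeta> f \<longlongrightarrow> 0) at_top"
proof (rule Lim_null_comparison)
  have "L1 (\<lambda>s. norm (f s))" by (rule absolutely_integrable_norm[OF assms(1), unfolded o_def])
  then have L: "L1 (\<lambda>s. complex_of_real (norm (f s)))"
    using absolutely_integrable_linear[OF _ bounded_linear_of_real] by (fastforce simp: o_def)
  have i: "(\<lambda>s. norm (f s)) integrable_on {t..}" if "t \<ge> 0" for t
    by (rule set_lebesgue_integral_eq_integral(1)[OF absolutely_integrable_norm[OF L1_tail[OF assms(1) that], unfolded o_def]])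
  have eq: "integral {t..} (\<lambda>s. complex_of_real (norm (f s))) = of_real (integral {t..} (\<lambda>s. norm (f s)))" if "t \<ge> 0" for t
    using integral_linear[OF i[OF that] bounded_linear_complex_of_real] by (simp add: o_def)
  show "((\<lambda>t. norm (integral {t..} (\<lambda>s. complex_of_real (norm (f s))))) \<longlongrightarrow> 0) at_top"
    by (rule tendsto_norm_zero[OF tail_tendsto_0[OF L]])
  show "\<forall>\<^sub>F t in at_top. norm (exp_transform \<zeta> f t) \<le> norm (integral {t..} (\<lambda>s. complex_of_real (norm (f s))))"
    using eventually_ge_at_top[of 0]
  proof eventually_elim
    case (elim t)
    then show ?case using norm_exp_transform_le[OF assms elim] eq[OF elim] by simp
  qed
qed

text \<open>
  The difference of the two sides solves \<open>G' = - \<zeta> G\<close>, so it is a multiple of \<open>exp (- \<zeta> t)\<close>. For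
  \<open>Re \<zeta> \<le> 0\<close> this function does not decay, and the limit zero leaves only \<open>G = 0\<close>.
\<close>

lemma has_ac_deriv_eq_exp_transform:
  assumes F: "has_ac_deriv F f" and L: "L1 \<rho>" and lim: "(F \<longlongrightarrow> 0) at_top" and Re: "Re \<zeta> \<le> 0"
    and f: "\<And>t. t \<ge> 0 \<Longrightarrow> f t = - \<zeta> * F t + \<rho> t" and t: "t \<ge> 0"
  shows "F t = - exp_transform \<zeta> \<rho> t"
proof -
  define G where "G t = F t + exp_transform \<zeta> \<rho> t" for t
  have "has_ac_deriv G (\<lambda>t. f t + (- \<zeta> * exp_transform \<zeta> \<rho> t - \<rho> t))"
    unfolding G_def by (rule has_ac_deriv_add[OF F has_ac_deriv_exp_transform[OF L Re]])
  then have G: "has_ac_deriv G (\<lambda>t. - \<zeta> * G t)"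
    by (rule has_ac_deriv_cong_deriv) (simp add: f G_def algebra_simps)
  have "has_ac_deriv (\<lambda>t. exp (\<zeta> * of_real t) * G t) (\<lambda>t. (\<zeta> * exp (\<zeta> * of_real t)) * G t + exp (\<zeta> * of_real t) * (- \<zeta> * G t))"
    by (rule has_ac_deriv_mult[OF has_ac_deriv_exp G])
  then have "has_ac_deriv (\<lambda>t. exp (\<zeta> * of_real t) * G t) (\<lambda>t. 0)"
    by (rule has_ac_deriv_cong_deriv) simp
  then have c: "exp (\<zeta> * of_real t) * G t = G 0" if "t \<ge> 0" for t
    using has_ac_deriv_eq[of _ "\<lambda>t. 0" t] that by fastforce
  have "(G \<longlongrightarrow> 0 + 0) at_top" unfolding G_def by (intro tendsto_add lim exp_transform_tendsto_0 L Re)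
  then have Gl: "((\<lambda>t. norm (G t)) \<longlongrightarrow> 0) at_top" using tendsto_norm_zero by fastforce
  have "norm (G 0) \<le> 0"
  proof (rule tendsto_lowerbound[OF Gl _ trivial_limit_at_top_linorder])
    show "\<forall>\<^sub>F t in at_top. norm (G 0) \<le> norm (G t)"
      using eventually_ge_at_top[of 0]
    proof eventually_elim
      case (elim t)
      have "norm (exp (\<zeta> * of_real t)) \<le> 1" using Re elim by (simp add: mult_nonpos_nonneg)
      then have "norm (exp (\<zeta> * of_real t) * G t) \<le> norm (G t)"
        by (simp only: norm_mult mult_left_le_one_le norm_ge_zero)
      then show ?case by (simp only: c[OF elim])
    qed
  qed
  then have "G t = 0" using c[OF t] by simp
  then show ?thesis by (simp add: G_def eq_neg_iff_add_eq_0)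
qed

text \<open>
  \<open>v\<close> dominates the coefficients of a linear system. The tail mass \<open>\<tau>\<close> measures how much of it is still to
  come when integrating from infinity, and exponentials in \<open>\<tau>\<close> are the natural weights for Volterra operators.
\<close>

locale majorant =
  fixes v :: "real \<Rightarrow> real"
  assumes v_cont: "continuous_on {0..} v" and v_L1: "L1 v" and v_nonneg: "\<And>t. 0 \<le> t \<Longrightarrow> 0 \<le> v t"
begin

definition tau :: "real \<Rightarrow> real" where "tau t = integral {t..} v"

lemma tau_nonneg: "0 \<le> t \<Longrightarrow> 0 \<le> tau t"
  unfolding tau_def using v_nonneg by (intro integral_nonneg set_lebesgue_integral_eq_integral(1)[OF L1_tail[OF v_L1]]) auto

lemma tau_antimono: "0 \<le> a \<Longrightarrow> a \<le> b \<Longrightarrow> tau b \<le> tau a"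
  unfolding tau_def using v_nonneg
  by (intro integral_subset_le set_lebesgue_integral_eq_integral(1)[OF L1_tail[OF v_L1]]) auto

lemma L1_of_real: "L1 (\<lambda>t. complex_of_real (v t))"
  using absolutely_integrable_linear[OF v_L1 bounded_linear_of_real] by (simp add: o_def)

lemma tail_of_real:
  assumes "0 \<le> t" "L1 w"
  shows "integral {t..} (\<lambda>s. complex_of_real (w s)) = of_real (integral {t..} w)"
  using integral_linear[OF set_lebesgue_integral_eq_integral(1)[OF L1_tail[OF assms(2,1)]] bounded_linear_complex_of_real]
  by (simp add: o_def)

lemma has_ac_deriv_tau: "has_ac_deriv (\<lambda>t. complex_of_real (tau t)) (\<lambda>t. - complex_of_real (v t))"
  by (rule has_ac_deriv_cong[OF has_ac_deriv_tail[OF L1_of_real]]) (simp add: tail_of_real v_L1 tau_def)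

lemma continuous_tau: "continuous_on {0..} tau"
proof -
  have "continuous_on {0..} (\<lambda>t. Re (complex_of_real (tau t)))"
    by (rule continuous_on_Re[OF has_ac_deriv_continuous[OF has_ac_deriv_tau]])
  then show ?thesis by simp
qed

lemma exp_tau_le: "0 \<le> t \<Longrightarrow> 0 \<le> L \<Longrightarrow> exp (L * tau t) \<le> exp (L * tau 0)"
  using tau_antimono[of 0 t] by (simp add: mult_left_mono)

lemma exp_tail_L1:
  assumes "0 \<le> L"
  shows "L1 (\<lambda>s. v s * exp (L * tau s))"
proof (rule L1_dominated)
  show "(\<lambda>s. v s * exp (L * tau s)) \<in> borel_measurable (lebesgue_on {0..})"
    by (intro continuous_measurable continuous_intros v_cont continuous_tau)
  show "L1 (\<lambda>s. v s * exp (L * tau 0))" using v_L1 by (rule set_integrable_mult_left)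
  show "norm (v t * exp (L * tau t)) \<le> norm (v t * exp (L * tau 0))" if "0 \<le> t" for t
    using exp_tau_le[OF that assms] v_nonneg[OF that] by (simp add: abs_mult mult_left_mono)
qed

text \<open>
  The integrand is \<open>- 1 / L\<close> times the derivative of \<open>exp (L \<tau>)\<close>.
\<close>

lemma exp_tail_le:
  assumes L: "0 < L" and t: "0 \<le> t"
  shows "integral {t..} (\<lambda>s. v s * exp (L * tau s)) \<le> exp (L * tau t) / L"
proof -
  define F where "F t = exp (complex_of_real L * complex_of_real (tau t))" for t
  have Fr: "F t = complex_of_real (exp (L * tau t))" for t by (simp add: F_def flip: exp_of_real)
  have L0: "0 \<le> L" using L by simp
  have F: "has_ac_deriv F (\<lambda>t. of_real L * - of_real (v t) * F t)"
  proof (rule has_ac_deriv_C1)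
    fix t :: real assume "0 \<le> t"
    then have "((\<lambda>t. complex_of_real (tau t)) has_vector_derivative - complex_of_real (v t)) (at t within {0..})"
      by (intro has_ac_deriv_vector_derivative[OF has_ac_deriv_tau] continuous_intros v_cont)
    then have "((\<lambda>t. complex_of_real L * complex_of_real (tau t)) has_vector_derivative complex_of_real L * - complex_of_real (v t)) (at t within {0..})"
      by (rule has_vector_derivative_mult_right)
    from field_vector_diff_chain_within[OF this DERIV_subset[OF DERIV_exp]]
    show "(F has_vector_derivative of_real L * - of_real (v t) * F t) (at t within {0..})"
      by (simp add: F_def[abs_def] o_def)
  next
    show "continuous_on {0..} (\<lambda>t. of_real L * - of_real (v t) * F t)"
      unfolding F_def by (intro continuous_intros v_cont continuous_tau)
  qed
  have LL: "L1 (\<lambda>s. complex_of_real (- L * (v s * exp (L * tau s))))"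
    using absolutely_integrable_linear[OF set_integrable_mult_right[OF exp_tail_L1[OF L0]] bounded_linear_of_real, of "- L"] by (simp add: o_def)
  have F': "has_ac_deriv F (\<lambda>s. complex_of_real (- L * (v s * exp (L * tau s))))"
    by (rule has_ac_deriv_cong_deriv[OF F]) (simp add: Fr)
  have "(F \<longlongrightarrow> exp (of_real L * 0)) at_top"
    unfolding F_def
  proof (intro tendsto_exp tendsto_mult tendsto_const)
    show "((\<lambda>t. complex_of_real (tau t)) \<longlongrightarrow> 0) at_top"
    proof (rule Lim_transform_eventually[OF tail_tendsto_0[OF L1_of_real]])
      show "\<forall>\<^sub>F t in at_top. integral {t..} (\<lambda>t. complex_of_real (v t)) = complex_of_real (tau t)"
        using eventually_ge_at_top[of 0] by eventually_elim (simp add: tail_of_real v_L1 tau_def)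
    qed
  qed
  then have "F t = 1 - integral {t..} (\<lambda>s. complex_of_real (- L * (v s * exp (L * tau s))))"
    by (intro has_ac_deriv_limit_eq[OF F' LL _ t]) simp
  also have "\<dots> = of_real (1 + L * integral {t..} (\<lambda>s. v s * exp (L * tau s)))"
    by (subst tail_of_real[OF t]) (use set_integrable_mult_right[OF exp_tail_L1[OF L0], of "- L"] in simp_all)
  finally have "exp (L * tau t) = 1 + L * integral {t..} (\<lambda>s. v s * exp (L * tau s))"
    unfolding Fr of_real_eq_iff .
  then have "L * integral {t..} (\<lambda>s. v s * exp (L * tau s)) \<le> exp (L * tau t)" by simp
  then show ?thesis using L by (simp add: field_simps)
qed

text \<open>
  The supremum of \<open>f exp (- 2 \<tau>)\<close> is finite because \<open>f\<close> is bounded. By \<open>exp_tail_le\<close> with \<open>L = 2\<close> the integral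
  term contributes at most half of this supremum, which can be absorbed.
\<close>

lemma gronwall:
  fixes f :: "real \<Rightarrow> real"
  assumes a: "0 \<le> a" and f0: "\<And>t. a \<le> t \<Longrightarrow> 0 \<le> f t" and bd: "\<And>t. a \<le> t \<Longrightarrow> f t \<le> B"
    and int: "(\<lambda>s. v s * f s) integrable_on {t. a \<le> t}"
    and H: "0 \<le> H" and le: "\<And>t. a \<le> t \<Longrightarrow> f t \<le> H + integral {t..} (\<lambda>s. v s * f s)"
    and intt: "\<And>t. a \<le> t \<Longrightarrow> (\<lambda>s. v s * f s) integrable_on {t..}"
    and t: "a \<le> t"
  shows "f t \<le> 2 * H * exp (2 * tau a)"
proof -
  define g where "g t = f t * exp (- (2 * tau t))" for t
  define M where "M = (SUP t\<in>{a..}. g t)"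
  have g0: "0 \<le> g t" if "a \<le> t" for t using f0[OF that] by (simp add: g_def)
  have gB: "g t \<le> B" if "a \<le> t" for t
  proof -
    have "f t * exp (- (2 * tau t)) \<le> f t * 1"
      using f0[OF that] tau_nonneg[of t] a that by (intro mult_left_mono) auto
    then show ?thesis using bd[OF that] by (simp add: g_def)
  qed
  then have bdd: "bdd_above (g ` {a..})" by (auto intro!: bdd_aboveI)
  have gM: "g t \<le> M" if "a \<le> t" for t unfolding M_def using that by (intro cSUP_upper bdd) auto
  have M0: "0 \<le> M" using gM[of a] g0[of a] by simp
  have fM: "f t \<le> M * exp (2 * tau t)" if "a \<le> t" for t
    using mult_right_mono[OF gM[OF that], of "exp (2 * tau t)"] by (simp add: g_def mult.assoc flip: exp_add)
  have "g t \<le> H + M / 2" if t: "a \<le> t" for t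
  proof -
    have t0: "0 \<le> t" using a t by simp
    have "integral {t..} (\<lambda>s. v s * f s) \<le> integral {t..} (\<lambda>s. M * (v s * exp (2 * tau s)))"
    proof (rule integral_le[OF intt[OF t]])
      show "(\<lambda>s. M * (v s * exp (2 * tau s))) integrable_on {t..}"
        by (intro set_lebesgue_integral_eq_integral(1) set_integrable_mult_right L1_tail[OF exp_tail_L1] t0) simp
      fix s assume "s \<in> {t..}"
      then have "v s * f s \<le> v s * (M * exp (2 * tau s))" using t t0 by (intro mult_left_mono fM v_nonneg) auto
      then show "v s * f s \<le> M * (v s * exp (2 * tau s))" by (simp add: mult.left_commute)
    qed
    also have "\<dots> = M * integral {t..} (\<lambda>s. v s * exp (2 * tau s))" by simp
    also have "\<dots> \<le> M * (exp (2 * tau t) / 2)" by (intro mult_left_mono exp_tail_le t0 M0) simp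
    finally have f: "f t \<le> H + M * (exp (2 * tau t) / 2)" using le[OF t] by linarith
    have "g t \<le> (H + M * (exp (2 * tau t) / 2)) * exp (- (2 * tau t))"
      unfolding g_def by (rule mult_right_mono[OF f]) simp
    also have "\<dots> = H * exp (- (2 * tau t)) + M / 2" by (simp add: distrib_right flip: exp_add)
    also have "\<dots> \<le> H * 1 + M / 2" using H tau_nonneg[OF t0] by (intro add_mono mult_left_mono) auto
    finally show ?thesis by simp
  qed
  then have "M \<le> H + M / 2" unfolding M_def by (intro cSUP_least) auto
  then have M2: "M \<le> 2 * H" by simp
  have "f t \<le> M * exp (2 * tau t)" by (rule fM[OF t])
  also have "\<dots> \<le> 2 * H * exp (2 * tau a)"
    using M2 M0 H tau_antimono[OF a t] by (intro mult_mono) auto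
  finally show ?thesis .
qed

end

section \<open>The second column of the Lax system\<close>

text \<open>
  The exponent \<open>2 i \<theta>\<^sub>2\<close> with which the off-diagonal entry of the column oscillates.
\<close>

definition phase :: "complex \<Rightarrow> complex" where "phase k = 2 * \<i> * theta2 k"

text \<open>
  The two rows of \<open>V T\<close> applied to the column \<open>(x, y)\<close>.
\<close>

definition rhs_x :: "(real \<Rightarrow> complex) \<Rightarrow> (real \<Rightarrow> complex) \<Rightarrow> (real \<Rightarrow> complex) \<Rightarrow> complex \<Rightarrow>
    (real \<Rightarrow> complex) \<Rightarrow> (real \<Rightarrow> complex) \<Rightarrow> real \<Rightarrow> complex" where
  "rhs_x u s c k x y t = - (u t / 4) * y t - \<i> / (4 * k) * (c t * x t + s t * y t)"

definition rhs_y :: "(real \<Rightarrow> complex) \<Rightarrow> (real \<Rightarrow> complex) \<Rightarrow> (real \<Rightarrow> complex) \<Rightarrow> complex \<Rightarrow>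
    (real \<Rightarrow> complex) \<Rightarrow> (real \<Rightarrow> complex) \<Rightarrow> real \<Rightarrow> complex" where
  "rhs_y u s c k x y t = u t / 4 * x t - \<i> / (4 * k) * (s t * x t - c t * y t)"

text \<open>
  The differential form of the Volterra equation. It is linear, local in \<open>t\<close>, and stable under conjugation and
  rotation of the column, which makes it the convenient form for symmetries.
\<close>

definition lax_solution :: "(real \<Rightarrow> complex) \<Rightarrow> (real \<Rightarrow> complex) \<Rightarrow> (real \<Rightarrow> complex) \<Rightarrow> complex \<Rightarrow>
    (real \<Rightarrow> complex) \<Rightarrow> (real \<Rightarrow> complex) \<Rightarrow> bool" where
  "lax_solution u s c k x y \<longleftrightarrow>
     has_ac_deriv x (\<lambda>t. - phase k * x t + rhs_x u s c k x y t) \<and> has_ac_deriv y (rhs_y u s c k x y) \<and>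
     (\<exists>C. \<forall>t\<ge>0. norm (x t) \<le> C \<and> norm (y t) \<le> C) \<and> (x \<longlongrightarrow> 0) at_top \<and> (y \<longlongrightarrow> 1) at_top"

lemma norm_tail_pointwise_le:
  fixes f :: "real \<Rightarrow> complex" and h :: "real \<Rightarrow> real"
  assumes "L1 f" "L1 h" "0 \<le> t" "\<And>s. s \<ge> t \<Longrightarrow> norm (f s) \<le> h s"
  shows "integral {t..} (\<lambda>s. norm (f s)) \<le> integral {t..} h"
  using assms(4)
  by (intro integral_le set_lebesgue_integral_eq_integral(1)[OF L1_tail[OF assms(2,3)]]
    set_lebesgue_integral_eq_integral(1)[OF absolutely_integrable_norm[OF L1_tail[OF assms(1,3)], unfolded o_def]]) auto

text \<open>
  In the application \<open>u = g\<^sub>1 + g\<^sub>0'\<close>, \<open>s = sin g\<^sub>0\<close> and \<open>c = cos g\<^sub>0 - 1\<close>. One derivative makes the coefficients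
  continuous and bounded.
\<close>

locale lax =
  fixes n :: nat and u s c :: "real \<Rightarrow> complex"
  assumes u: "weighted_sobolev n (Suc 0) u" and s: "weighted_sobolev n (Suc 0) s" and c: "weighted_sobolev n (Suc 0) c"
begin

definition v :: "real \<Rightarrow> real" where "v t = norm (u t) + norm (s t) + norm (c t)"

lemma v_cont: "continuous_on {0..} v"
  unfolding v_def by (intro continuous_intros weighted_sobolev_continuous[OF u] weighted_sobolev_continuous[OF s] weighted_sobolev_continuous[OF c])

lemma v_L1: "L1 v"
  unfolding v_def using u s c weighted_L1_L1 weighted_sobolev_weighted_L1 absolutely_integrable_norm[unfolded o_def]
  by (intro set_integral_add(1)) blast+

lemma v_nonneg: "0 \<le> v t"
  by (simp add: v_def)

lemma majorant_scaled: assumes "0 \<le> \<kappa>" shows "majorant (\<lambda>t. \<kappa> * v t)"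
proof
  show "continuous_on {0..} (\<lambda>t. \<kappa> * v t)" by (intro continuous_intros v_cont)
  show "L1 (\<lambda>t. \<kappa> * v t)" by (rule set_integrable_mult_right[OF v_L1])
  show "0 \<le> \<kappa> * v t" for t using assms v_nonneg by simp
qed

sublocale V: majorant v
  by unfold_locales (rule v_cont v_L1 v_nonneg)+

definition coupling :: "complex \<Rightarrow> real" where "coupling k = 1 / 4 + 1 / (4 * norm k)"

lemma coupling_pos: "0 < coupling k"
  unfolding coupling_def by (simp add: add_pos_nonneg)

lemma norm_rhs_x_le: "norm (rhs_x u s c k x y t) \<le> coupling k * v t * (norm (x t) + norm (y t))"
  and norm_rhs_y_le: "norm (rhs_y u s c k x y t) \<le> coupling k * v t * (norm (x t) + norm (y t))"
proof -
  let ?X = "norm (x t)" and ?Y = "norm (y t)"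
  have i: "norm (\<i> / (4 * k)) = 1 / (4 * norm k)" by (simp add: norm_divide norm_mult)
  have a: "norm (u t) * z \<le> v t * (?X + ?Y)" if "0 \<le> z" "z \<le> ?X + ?Y" for z
    using that by (intro mult_mono) (auto simp: v_def)
  have ee: "norm (c t) * ?X + norm (s t) * ?Y \<le> v t * (?X + ?Y)" "norm (s t) * ?X + norm (c t) * ?Y \<le> v t * (?X + ?Y)"
    by (simp_all add: v_def algebra_simps)
  have "norm (rhs_x u s c k x y t) \<le> norm (u t / 4 * y t) + norm (\<i> / (4 * k) * (c t * x t + s t * y t))"
    unfolding rhs_x_def using norm_triangle_ineq4[of "- (u t / 4) * y t" "\<i> / (4 * k) * (c t * x t + s t * y t)"] by simp
  also have "\<dots> \<le> 1 / 4 * (v t * (?X + ?Y)) + 1 / (4 * norm k) * (v t * (?X + ?Y))"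
  proof (rule add_mono)
    show "norm (u t / 4 * y t) \<le> 1 / 4 * (v t * (?X + ?Y))" using a[of ?Y] by (simp add: norm_mult)
    have "norm (c t * x t + s t * y t) \<le> v t * (?X + ?Y)"
      using norm_triangle_ineq[of "c t * x t" "s t * y t"] ee(1) by (simp add: norm_mult)
    then show "norm (\<i> / (4 * k) * (c t * x t + s t * y t)) \<le> 1 / (4 * norm k) * (v t * (?X + ?Y))"
      unfolding norm_mult[of "\<i> / (4 * k)"] i by (rule mult_left_mono) simp
  qed
  finally show "norm (rhs_x u s c k x y t) \<le> coupling k * v t * (norm (x t) + norm (y t))"
    by (simp add: coupling_def distrib_right mult.assoc)
  have "norm (rhs_y u s c k x y t) \<le> norm (u t / 4 * x t) + norm (\<i> / (4 * k) * (s t * x t - c t * y t))"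
    unfolding rhs_y_def by (rule norm_triangle_ineq4)
  also have "\<dots> \<le> 1 / 4 * (v t * (?X + ?Y)) + 1 / (4 * norm k) * (v t * (?X + ?Y))"
  proof (rule add_mono)
    show "norm (u t / 4 * x t) \<le> 1 / 4 * (v t * (?X + ?Y))" using a[of ?X] by (simp add: norm_mult)
    have "norm (s t * x t - c t * y t) \<le> v t * (?X + ?Y)"
      using norm_triangle_ineq4[of "s t * x t" "c t * y t"] ee(2) by (simp add: norm_mult)
    then show "norm (\<i> / (4 * k) * (s t * x t - c t * y t)) \<le> 1 / (4 * norm k) * (v t * (?X + ?Y))"
      unfolding norm_mult[of "\<i> / (4 * k)"] i by (rule mult_left_mono) simp
  qed
  finally show "norm (rhs_y u s c k x y t) \<le> coupling k * v t * (norm (x t) + norm (y t))"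
    by (simp add: coupling_def distrib_right mult.assoc)
qed

lemma L1_coeff_mult:
  assumes "continuous_on {0..} x" "\<And>t. 0 \<le> t \<Longrightarrow> norm (x t) \<le> C"
  shows "L1 (\<lambda>t. u t * x t)" "L1 (\<lambda>t. s t * x t)" "L1 (\<lambda>t. c t * x t)"
  using L1_mult[OF weighted_L1_L1[OF weighted_sobolev_weighted_L1[OF u]] assms] L1_mult[OF weighted_L1_L1[OF weighted_sobolev_weighted_L1[OF s]] assms]
    L1_mult[OF weighted_L1_L1[OF weighted_sobolev_weighted_L1[OF c]] assms] by (simp_all add: mult.commute)

lemma L1_rhs:
  assumes "continuous_on {0..} x" "\<And>t. 0 \<le> t \<Longrightarrow> norm (x t) \<le> C"
    "continuous_on {0..} y" "\<And>t. 0 \<le> t \<Longrightarrow> norm (y t) \<le> C"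
  shows "L1 (rhs_x u s c k x y)" "L1 (rhs_y u s c k x y)"
proof -
  note X = L1_coeff_mult[OF assms(1,2)] and Y = L1_coeff_mult[OF assms(3,4)]
  have "L1 (\<lambda>t. (- 1 / 4) * (u t * y t) - \<i> / (4 * k) * (c t * x t + s t * y t))"
    by (intro set_integral_diff(1) set_integral_add(1) set_integrable_mult_right X Y)
  moreover have "(\<lambda>t. (- 1 / 4) * (u t * y t) - \<i> / (4 * k) * (c t * x t + s t * y t)) = rhs_x u s c k x y"
    by (auto simp: rhs_x_def)
  ultimately show "L1 (rhs_x u s c k x y)" by simp
  have "L1 (\<lambda>t. (1 / 4) * (u t * x t) - \<i> / (4 * k) * (s t * x t - c t * y t))"
    by (intro set_integral_diff(1) set_integrable_mult_right X Y)
  moreover have "(\<lambda>t. (1 / 4) * (u t * x t) - \<i> / (4 * k) * (s t * x t - c t * y t)) = rhs_y u s c k x y"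
    by (auto simp: rhs_y_def)
  ultimately show "L1 (rhs_y u s c k x y)" by simp
qed

lemma lax_solution_L1:
  assumes "lax_solution u s c k x y"
  shows "L1 (rhs_x u s c k x y)" "L1 (rhs_y u s c k x y)"
proof -
  obtain C where "\<forall>t\<ge>0. norm (x t) \<le> C \<and> norm (y t) \<le> C" using assms unfolding lax_solution_def by blast
  moreover have "continuous_on {0..} x" "continuous_on {0..} y"
    using assms unfolding lax_solution_def by (blast intro: has_ac_deriv_continuous)+
  ultimately show "L1 (rhs_x u s c k x y)" "L1 (rhs_y u s c k x y)" by (auto intro!: L1_rhs)
qed

lemma lax_solution_volterra:
  assumes lax_solution: "lax_solution u s c k x y" and Re: "Re (phase k) \<le> 0" and t: "0 \<le> t"
  shows "x t = - exp_transform (phase k) (rhs_x u s c k x y) t" "y t = 1 - integral {t..} (rhs_y u s c k x y)"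
proof -
  note S = lax_solution[unfolded lax_solution_def]
  show "x t = - exp_transform (phase k) (rhs_x u s c k x y) t"
    by (rule has_ac_deriv_eq_exp_transform[OF _ lax_solution_L1(1)[OF lax_solution] _ Re _ t, where f = "\<lambda>t. - phase k * x t + rhs_x u s c k x y t"])
      (use S in simp_all)
  show "y t = 1 - integral {t..} (rhs_y u s c k x y)"
    using S by (intro has_ac_deriv_limit_eq[OF _ lax_solution_L1(2)[OF lax_solution] _ t]) simp_all
qed

text \<open>
  The difference of two solutions satisfies the homogeneous Volterra inequality, and Gronwall's inequality with \<open>H = 0\<close> makes
  it vanish.
\<close>

lemma lax_solution_unique:
  assumes a: "lax_solution u s c k x y" and b: "lax_solution u s c k x' y'" and Re: "Re (phase k) \<le> 0" and t: "0 \<le> t"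
  shows "x t = x' t \<and> y t = y' t"
proof -
  define D where "D t = norm (x t - x' t) + norm (y t - y' t)" for t
  obtain C C' where C: "\<forall>t\<ge>0. norm (x t) \<le> C \<and> norm (y t) \<le> C" and C': "\<forall>t\<ge>0. norm (x' t) \<le> C' \<and> norm (y' t) \<le> C'"
    using a b unfolding lax_solution_def by blast
  have cont: "continuous_on {0..} x" "continuous_on {0..} y" "continuous_on {0..} x'" "continuous_on {0..} y'"
    using a b unfolding lax_solution_def by (blast intro: has_ac_deriv_continuous)+
  have Db: "D t \<le> 2 * (C + C')" if "0 \<le> t" for t
    using C C' that norm_triangle_ineq4[of "x t" "x' t"] norm_triangle_ineq4[of "y t" "y' t"]
    unfolding D_def by (smt (verit))
  interpret M: majorant "\<lambda>t. (2 * coupling k) * v t" using coupling_pos[of k] by (intro majorant_scaled) simp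
  have DL: "L1 (\<lambda>s. (2 * coupling k) * v s * D s)"
  proof (rule L1_dominated)
    show "(\<lambda>s. (2 * coupling k) * v s * D s) \<in> borel_measurable (lebesgue_on {0..})"
      unfolding D_def by (intro continuous_measurable continuous_intros v_cont cont)
    show "L1 (\<lambda>s. (2 * coupling k * (2 * (C + C'))) * v s)" using v_L1 by (rule set_integrable_mult_right)
    show "norm ((2 * coupling k) * v s * D s) \<le> norm ((2 * coupling k * (2 * (C + C'))) * v s)" if "0 \<le> s" for s
    proof -
      have D0: "0 \<le> D s" by (simp add: D_def)
      have "v s * D s \<le> v s * (2 * (C + C'))" by (rule mult_left_mono[OF Db[OF that]]) (simp add: v_def)
      then have "(2 * coupling k) * (v s * D s) \<le> (2 * coupling k) * (v s * (2 * (C + C')))"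
        by (rule mult_left_mono) (use coupling_pos[of k] in simp)
      moreover have "0 \<le> C + C'" using order_trans[OF D0 Db[OF that]] by simp
      moreover have "norm ((2 * coupling k) * v s * D s) = 2 * coupling k * (v s * D s)"
        using D0 v_nonneg[of s] coupling_pos[of k] by (simp add: abs_mult)
      moreover have "norm ((2 * coupling k * (2 * (C + C'))) * v s) = 2 * coupling k * (v s * (2 * (C + C')))"
        using v_nonneg[of s] coupling_pos[of k] \<open>0 \<le> C + C'\<close> by (simp add: abs_mult)
      ultimately show ?thesis by (simp only:)
    qed
  qed
  have ge: "D t \<le> 0 + integral {t..} (\<lambda>s. (2 * coupling k) * v s * D s)" if t: "0 \<le> t" for t
  proof -
    let ?f = "\<lambda>t. rhs_x u s c k x y t - rhs_x u s c k x' y' t" and ?g = "\<lambda>t. rhs_y u s c k x y t - rhs_y u s c k x' y' t"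
    have fL: "L1 ?f" and gL: "L1 ?g"
      using lax_solution_L1[OF a] lax_solution_L1[OF b] by (auto intro!: set_integral_diff(1))
    have fe: "?f = rhs_x u s c k (\<lambda>t. x t - x' t) (\<lambda>t. y t - y' t)"
      by (rule ext) (simp add: rhs_x_def diff_divide_distrib add_divide_distrib algebra_simps)
    have ge: "?g = rhs_y u s c k (\<lambda>t. x t - x' t) (\<lambda>t. y t - y' t)"
      by (rule ext) (simp add: rhs_y_def diff_divide_distrib add_divide_distrib algebra_simps)
    have bf: "norm (?f r) \<le> coupling k * v r * D r" for r
      using norm_rhs_x_le[of k "\<lambda>t. x t - x' t" "\<lambda>t. y t - y' t" r] fun_cong[OF fe, of r] by (simp only: D_def)
    have bg: "norm (?g r) \<le> coupling k * v r * D r" for r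
      using norm_rhs_y_le[of k "\<lambda>t. x t - x' t" "\<lambda>t. y t - y' t" r] fun_cong[OF ge, of r] by (simp only: D_def)
    have hL: "L1 (\<lambda>s. coupling k * v s * D s)"
      using set_integrable_mult_right[OF DL, of "1/2"] by (simp add: mult.assoc)
    have "x t - x' t = - (exp_transform (phase k) (rhs_x u s c k x y) t - exp_transform (phase k) (rhs_x u s c k x' y') t)"
      using lax_solution_volterra(1)[OF a Re t] lax_solution_volterra(1)[OF b Re t] by simp
    also have "exp_transform (phase k) (rhs_x u s c k x y) t - exp_transform (phase k) (rhs_x u s c k x' y') t = exp_transform (phase k) ?f t"
      unfolding exp_transform_def right_diff_distrib
      by (intro Henstock_Kurzweil_Integration.integral_diff[symmetric] set_lebesgue_integral_eq_integral(1) exp_transform_integrable lax_solution_L1[OF a] lax_solution_L1[OF b] Re t)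
    finally have "norm (x t - x' t) \<le> integral {t..} (\<lambda>s. norm (?f s))"
      using norm_exp_transform_le[OF fL Re t] by simp
    also have "\<dots> \<le> integral {t..} (\<lambda>s. coupling k * v s * D s)"
      by (rule norm_tail_pointwise_le[OF fL hL t bf])
    finally have 1: "norm (x t - x' t) \<le> integral {t..} (\<lambda>s. coupling k * v s * D s)" .
    have "y t - y' t = - (integral {t..} (rhs_y u s c k x y) - integral {t..} (rhs_y u s c k x' y'))"
      using lax_solution_volterra(2)[OF a Re t] lax_solution_volterra(2)[OF b Re t] by simp
    also have "integral {t..} (rhs_y u s c k x y) - integral {t..} (rhs_y u s c k x' y') = exp_transform 0 ?g t"
      unfolding exp_transform_def using Henstock_Kurzweil_Integration.integral_diff[OF
          L1_tail[OF lax_solution_L1(2)[OF a] t, THEN set_lebesgue_integral_eq_integral(1)]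
          L1_tail[OF lax_solution_L1(2)[OF b] t, THEN set_lebesgue_integral_eq_integral(1)]] by simp
    finally have "norm (y t - y' t) \<le> integral {t..} (\<lambda>s. norm (?g s))"
      using norm_exp_transform_le[OF gL _ t, of 0] by simp
    also have "\<dots> \<le> integral {t..} (\<lambda>s. coupling k * v s * D s)"
      by (rule norm_tail_pointwise_le[OF gL hL t bg])
    finally have "D t \<le> 2 * integral {t..} (\<lambda>s. coupling k * v s * D s)" using 1 D_def[of t] by linarith
    also have "2 * integral {t..} (\<lambda>s. coupling k * v s * D s) = integral {t..} (\<lambda>s. (2 * coupling k) * v s * D s)"
      by (simp add: mult.assoc)
    finally show ?thesis by simp
  qed
  have "D t \<le> 2 * 0 * exp (2 * M.tau 0)"
    by (rule M.gronwall[OF order_refl _ Db _ order_refl ge _ t])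
      (use DL L1_tail[OF DL] set_lebesgue_integral_eq_integral(1) in \<open>auto simp: D_def atLeast_def\<close>)
  then have "norm (x t - x' t) = 0" "norm (y t - y' t) = 0"
    unfolding D_def using norm_ge_zero[of "x t - x' t"] norm_ge_zero[of "y t - y' t"] by linarith+
  then show ?thesis by simp
qed

text \<open>
  The equations alone imply boundedness. The component \<open>y\<close> is bounded since its integrand is integrable. For
  \<open>x\<close>, only \<open>z = exp (\<zeta> t) x\<close> is known to be bounded a priori. Gronwall's inequality for \<open>z\<close> on \<open>[a, \<infinity>)\<close>
  has an inhomogeneity of size \<open>exp (a Re \<zeta>)\<close>, and evaluation at \<open>t = a\<close> bounds \<open>x(a)\<close> uniformly in \<open>a\<close>.
\<close>

lemma volterra_lax_solution:
  assumes Re: "Re (phase k) \<le> 0"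
    and Ia: "\<And>t. 0 \<le> t \<Longrightarrow> (\<lambda>r. exp (phase k * of_real (r - t)) * rhs_x u s c k x y r) absolutely_integrable_on {t..}"
    and Ib: "L1 (rhs_y u s c k x y)"
    and x: "\<And>t. 0 \<le> t \<Longrightarrow> x t = - exp_transform (phase k) (rhs_x u s c k x y) t"
    and y: "\<And>t. 0 \<le> t \<Longrightarrow> y t = 1 - integral {t..} (rhs_y u s c k x y)"
  shows "lax_solution u s c k x y"
proof -
  let ?\<zeta> = "phase k" and ?f = "rhs_x u s c k x y" and ?g = "rhs_y u s c k x y"
  have "has_ac_deriv (\<lambda>t. 1 - integral {t..} ?g) (\<lambda>t. 0 - - ?g t)"
    by (rule has_ac_deriv_diff[OF has_ac_deriv_const has_ac_deriv_tail[OF Ib]])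
  then have "has_ac_deriv (\<lambda>t. 1 - integral {t..} ?g) ?g" by simp
  then have ACy: "has_ac_deriv y ?g" by (rule has_ac_deriv_cong) (simp add: y)
  obtain M where M: "\<forall>t\<ge>0. norm (y t) \<le> M" using has_ac_deriv_bounded[OF ACy Ib] by blast
  have M0: "0 \<le> M" using M[rule_format, of 0] norm_ge_zero[of "y 0"] by linarith
  have Lz: "L1 (\<lambda>r. exp (?\<zeta> * of_real r) * ?f r)" using Ia[of 0] by simp
  define z where "z t = exp (?\<zeta> * of_real t) * x t" for t
  have z_eq: "z t = - integral {t..} (\<lambda>r. exp (?\<zeta> * of_real r) * ?f r)" if "0 \<le> t" for t
    unfolding z_def x[OF that] exp_transform_eq by (simp add: mult.assoc[symmetric] flip: exp_add)
  have xz: "x t = exp (- ?\<zeta> * of_real t) * z t" for t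
    unfolding z_def by (simp add: mult.assoc[symmetric] flip: exp_add)
  have "has_ac_deriv (\<lambda>t. - integral {t..} (\<lambda>r. exp (?\<zeta> * of_real r) * ?f r)) (\<lambda>t. - (- (exp (?\<zeta> * of_real t) * ?f t)))"
    by (rule has_ac_deriv_minus[OF has_ac_deriv_tail[OF Lz]])
  then have ACz: "has_ac_deriv z (\<lambda>t. exp (?\<zeta> * of_real t) * ?f t)"
    by (simp, elim has_ac_deriv_cong) (simp add: z_eq)
  have "has_ac_deriv (\<lambda>t. exp (- ?\<zeta> * of_real t) * z t)
     (\<lambda>t. (- ?\<zeta> * exp (- ?\<zeta> * of_real t)) * z t + exp (- ?\<zeta> * of_real t) * (exp (?\<zeta> * of_real t) * ?f t))"
    by (rule has_ac_deriv_mult[OF has_ac_deriv_exp ACz])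
  then have "has_ac_deriv x (\<lambda>t. (- ?\<zeta> * exp (- ?\<zeta> * of_real t)) * z t + exp (- ?\<zeta> * of_real t) * (exp (?\<zeta> * of_real t) * ?f t))"
    by (rule has_ac_deriv_cong) (simp add: xz)
  then have ACx: "has_ac_deriv x (\<lambda>t. - ?\<zeta> * x t + ?f t)"
  proof (rule has_ac_deriv_cong_deriv)
    fix t :: real
    have "exp (- ?\<zeta> * of_real t) * (exp (?\<zeta> * of_real t) * ?f t) = ?f t"
      by (simp add: mult.assoc[symmetric] flip: exp_add)
    then show "(- ?\<zeta> * exp (- ?\<zeta> * of_real t)) * z t + exp (- ?\<zeta> * of_real t) * (exp (?\<zeta> * of_real t) * ?f t) = - ?\<zeta> * x t + ?f t"
      by (simp add: xz mult.assoc)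
  qed
  obtain Bz where Bz: "\<forall>t\<ge>0. norm (z t) \<le> Bz" using has_ac_deriv_bounded[OF ACz Lz] by blast
  have zc: "continuous_on {0..} z" by (rule has_ac_deriv_continuous[OF ACz])
  interpret M: majorant "\<lambda>t. coupling k * v t" using coupling_pos[of k] by (intro majorant_scaled) simp
  have vz: "L1 (\<lambda>r. coupling k * v r * norm (z r))"
  proof (rule L1_dominated)
    show "(\<lambda>r. coupling k * v r * norm (z r)) \<in> borel_measurable (lebesgue_on {0..})"
      by (intro continuous_measurable continuous_intros v_cont zc)
    show "L1 (\<lambda>r. (coupling k * v r) * Bz)" by (rule set_integrable_mult_left[OF M.v_L1])
    show "norm (coupling k * v r * norm (z r)) \<le> norm (coupling k * v r * Bz)" if "0 \<le> r" for r
    proof -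
      have "norm (z r) \<le> \<bar>Bz\<bar>" using Bz that by force
      then show ?thesis by (simp add: abs_mult mult_left_mono)
    qed
  qed
  have xb: "norm (x a) \<le> 2 * (M * M.tau 0) * exp (2 * M.tau 0)" if a: "0 \<le> a" for a
  proof -
    define H where "H = M * exp (Re ?\<zeta> * a) * M.tau 0"
    have H0: "0 \<le> H" unfolding H_def using M0 M.tau_nonneg[of 0] by simp
    have "norm (z a) \<le> 2 * H * exp (2 * M.tau a)"
    proof (rule M.gronwall[OF a, where B = Bz and f = "\<lambda>t. norm (z t)"])
      show "norm (z t) \<le> Bz" if "a \<le> t" for t using Bz that a by simp
      show "(\<lambda>s. coupling k * v s * norm (z s)) integrable_on {t..}" if "a \<le> t" for t
        using that a by (intro set_lebesgue_integral_eq_integral(1) L1_tail[OF vz]) simp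
      from this[of a] show "(\<lambda>s. coupling k * v s * norm (z s)) integrable_on {t. a \<le> t}" by (simp add: atLeast_def)
      fix t assume t: "a \<le> t"
      then have t0: "0 \<le> t" using a by simp
      let ?h = "\<lambda>r. coupling k * v r * norm (z r) + coupling k * v r * (M * exp (Re ?\<zeta> * a))"
      have L2: "L1 (\<lambda>r. coupling k * v r * (M * exp (Re ?\<zeta> * a)))" by (rule set_integrable_mult_left[OF M.v_L1])
      have hL: "L1 ?h" by (rule set_integral_add(1)[OF vz L2])
      have "norm (z t) = norm (exp_transform 0 (\<lambda>r. exp (?\<zeta> * of_real r) * ?f r) t)"
        by (simp add: z_eq[OF t0] exp_transform_def)
      also have "\<dots> \<le> integral {t..} (\<lambda>r. norm (exp (?\<zeta> * of_real r) * ?f r))"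
        by (rule norm_exp_transform_le[OF Lz _ t0]) simp
      also have "\<dots> \<le> integral {t..} ?h"
      proof (rule norm_tail_pointwise_le[OF Lz hL t0])
        fix r assume r: "t \<le> r"
        have e: "norm (exp (?\<zeta> * of_real r)) = exp (Re ?\<zeta> * r)" by simp
        have "norm (exp (?\<zeta> * of_real r) * ?f r) \<le> exp (Re ?\<zeta> * r) * (coupling k * v r * (norm (x r) + norm (y r)))"
          unfolding norm_mult e by (intro mult_left_mono norm_rhs_x_le) simp
        also have "\<dots> = coupling k * v r * (norm (z r) + exp (Re ?\<zeta> * r) * norm (y r))"
          unfolding z_def norm_mult e by (simp add: algebra_simps)
        also have "\<dots> \<le> coupling k * v r * (norm (z r) + exp (Re ?\<zeta> * a) * M)"
        proof (intro mult_left_mono add_left_mono mult_mono)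
          show "exp (Re ?\<zeta> * r) \<le> exp (Re ?\<zeta> * a)" using r t Re by (simp add: mult_left_mono_neg)
          show "norm (y r) \<le> M" using M r t0 by simp
          show "0 \<le> coupling k * v r" using M.v_nonneg[of r] r t0 by simp
        qed auto
        finally show "norm (exp (?\<zeta> * of_real r) * ?f r) \<le> ?h r" by (simp add: algebra_simps)
      qed
      also have "\<dots> = integral {t..} (\<lambda>r. coupling k * v r * norm (z r)) + integral {t..} (\<lambda>r. coupling k * v r * (M * exp (Re ?\<zeta> * a)))"
        by (intro Henstock_Kurzweil_Integration.integral_add set_lebesgue_integral_eq_integral(1) L1_tail[OF vz] L1_tail[OF L2] t0)
      also have "integral {t..} (\<lambda>r. coupling k * v r * (M * exp (Re ?\<zeta> * a))) = M.tau t * (M * exp (Re ?\<zeta> * a))"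
        by (simp only: integral_mult_left M.tau_def)
      also have "\<dots> \<le> M.tau 0 * (M * exp (Re ?\<zeta> * a))"
        using M0 M.tau_antimono[OF order_refl t0] by (intro mult_right_mono) auto
      finally show "norm (z t) \<le> H + integral {t..} (\<lambda>s. coupling k * v s * norm (z s))"
        by (simp add: H_def mult_ac add.commute)
    qed (use H0 in auto)
    then have "exp (- Re ?\<zeta> * a) * norm (z a) \<le> exp (- Re ?\<zeta> * a) * (2 * H * exp (2 * M.tau a))"
      by (intro mult_left_mono) auto
    then have "norm (x a) \<le> exp (- Re ?\<zeta> * a) * (2 * H * exp (2 * M.tau a))"
      using xz[of a] by (simp add: norm_mult)
    also have "\<dots> = 2 * (M * M.tau 0) * exp (2 * M.tau a)"
      by (simp add: H_def exp_minus field_simps)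
    also have "\<dots> \<le> 2 * (M * M.tau 0) * exp (2 * M.tau 0)"
      using M.tau_antimono[OF order_refl a] M0 M.tau_nonneg[of 0] by (intro mult_left_mono) auto
    finally show ?thesis .
  qed
  define C where "C = max M (2 * (M * M.tau 0) * exp (2 * M.tau 0))"
  have C: "norm (x t) \<le> C" "norm (y t) \<le> C" if "0 \<le> t" for t
    using xb[OF that] M that by (auto simp: C_def max_def)
  have fL: "L1 ?f"
    by (rule L1_rhs[OF has_ac_deriv_continuous[OF ACx] C(1) has_ac_deriv_continuous[OF ACy] C(2)])
  have "(x \<longlongrightarrow> 0) at_top"
  proof (rule Lim_transform_eventually)
    show "((\<lambda>t. - exp_transform ?\<zeta> ?f t) \<longlongrightarrow> 0) at_top"
      using tendsto_minus[OF exp_transform_tendsto_0[OF fL Re]] by simp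
    show "\<forall>\<^sub>F t in at_top. - exp_transform ?\<zeta> ?f t = x t"
      using eventually_ge_at_top[of 0] by eventually_elim (rule x[symmetric])
  qed
  moreover have "(y \<longlongrightarrow> 1) at_top"
  proof (rule Lim_transform_eventually)
    show "((\<lambda>t. 1 - integral {t..} ?g) \<longlongrightarrow> 1) at_top"
      using tendsto_diff[OF tendsto_const tail_tendsto_0[OF Ib]] by simp
    show "\<forall>\<^sub>F t in at_top. 1 - integral {t..} ?g = y t"
      using eventually_ge_at_top[of 0] by eventually_elim (rule y[symmetric])
  qed
  ultimately show ?thesis unfolding lax_solution_def using ACx ACy C by blast
qed

end

section \<open>Solving the Volterra equation away from zero\<close>

definition to_bcontfun :: "(real \<Rightarrow> complex) \<Rightarrow> (real \<Rightarrow>\<^sub>C complex)" where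
  "to_bcontfun f = Bcontfun (\<lambda>t. f (max t 0))"

lemma apply_to_bcontfun:
  assumes "continuous_on {0..} f" "\<And>t. 0 \<le> t \<Longrightarrow> norm (f t) \<le> C"
  shows "apply_bcontfun (to_bcontfun f) t = f (max t 0)"
proof -
  have "continuous_on UNIV (\<lambda>t. f (max t 0))"
    by (rule continuous_on_compose2[OF assms(1)]) (auto intro!: continuous_intros)
  then have "(\<lambda>t. f (max t 0)) \<in> bcontfun"
    by (rule bcontfun_normI) (rule assms(2), simp)
  then show ?thesis by (simp add: to_bcontfun_def Bcontfun_inverse)
qed

definition mult_op :: "(real \<Rightarrow> real) \<Rightarrow> (real \<Rightarrow>\<^sub>C complex) \<Rightarrow> (real \<Rightarrow>\<^sub>C complex)" where
  "mult_op a x = Bcontfun (\<lambda>t. of_real (a t) * apply_bcontfun x t)"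

lemma apply_mult_op:
  assumes "continuous_on UNIV a" "\<And>t. norm (a t) \<le> B"
  shows "apply_bcontfun (mult_op a x) t = of_real (a t) * apply_bcontfun x t"
proof -
  have "norm (of_real (a t) * apply_bcontfun x t) \<le> B * norm x" for t
  proof -
    have "norm (a t) * norm (apply_bcontfun x t) \<le> B * norm x"
      by (rule mult_mono[OF assms(2) norm_bounded order_trans[OF norm_ge_zero assms(2)] norm_ge_zero])
    then show ?thesis by (simp add: norm_mult)
  qed
  moreover have "continuous_on UNIV (\<lambda>t. of_real (a t) * apply_bcontfun x t)"
    by (intro continuous_intros assms(1)) auto
  ultimately have "(\<lambda>t. of_real (a t) * apply_bcontfun x t) \<in> bcontfun" by (intro bcontfun_normI)
  then show ?thesis by (simp add: mult_op_def Bcontfun_inverse)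
qed

lemma norm_mult_op_le:
  assumes "continuous_on UNIV a" "\<And>t. norm (a t) \<le> B"
  shows "norm (mult_op a x) \<le> B * norm x"
proof (rule norm_bound)
  fix t
  have "norm (a t) * norm (apply_bcontfun x t) \<le> B * norm x"
    by (rule mult_mono[OF assms(2) norm_bounded order_trans[OF norm_ge_zero assms(2)] norm_ge_zero])
  then show "norm (apply_bcontfun (mult_op a x) t) \<le> B * norm x" by (simp add: apply_mult_op[OF assms] norm_mult)
qed

lemma exp_transform_lin:
  assumes "L1 f" "L1 g" "Re \<zeta> \<le> 0" "0 \<le> t"
  shows "exp_transform \<zeta> (\<lambda>s. a * f s + b * g s) t = a * exp_transform \<zeta> f t + b * exp_transform \<zeta> g t"
proof -
  have eq: "(\<lambda>s. exp (\<zeta> * of_real (s - t)) * (a * f s + b * g s))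
    = (\<lambda>s. a * (exp (\<zeta> * of_real (s - t)) * f s) + b * (exp (\<zeta> * of_real (s - t)) * g s))"
    by (auto simp: algebra_simps)
  note I = exp_transform_integrable[OF assms(1,3,4), THEN set_lebesgue_integral_eq_integral(1)]
    exp_transform_integrable[OF assms(2,3,4), THEN set_lebesgue_integral_eq_integral(1)]
  show ?thesis unfolding exp_transform_def eq
    by (subst Henstock_Kurzweil_Integration.integral_add[OF integrable_on_mult_right[OF I(1)] integrable_on_mult_right[OF I(2)]]) simp
qed

lemma op_smooth_comp:
  fixes L :: "'c::complex_banach \<Rightarrow> 'a::complex_banach" and K :: "complex \<Rightarrow> 'a \<Rightarrow> 'b::complex_banach"
  assumes L: "\<And>x y. L (x + y) = L x + L y" "\<And>a x. L (a *\<^sub>c x) = a *\<^sub>c L x" "\<And>x. norm (L x) \<le> norm x"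
  shows "op_smooth P r K \<Longrightarrow> op_smooth P r (\<lambda>k z. K k (L z))"
proof (induction r arbitrary: K)
  case 0
  obtain C where C: "\<forall>k\<in>P. \<forall>x. norm (K k x) \<le> C * norm x"
    using 0 unfolding op_smooth.simps linear_family_def by blast
  have "norm (K k (L z)) \<le> \<bar>C\<bar> * norm z" if "k \<in> P" for k z
  proof -
    have "norm (K k (L z)) \<le> C * norm (L z)" using C that by blast
    also have "\<dots> \<le> \<bar>C\<bar> * norm (L z)" by (intro mult_right_mono) auto
    also have "\<dots> \<le> \<bar>C\<bar> * norm z" by (intro mult_left_mono L(3)) auto
    finally show ?thesis .
  qed
  then have "\<exists>C. \<forall>k\<in>P. \<forall>z. norm (K k (L z)) \<le> C * norm z" by blast
  with 0 show ?case unfolding op_smooth.simps linear_family_def by (simp add: L(1,2))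
next
  case (Suc r)
  obtain K' where K': "\<And>x k. k \<in> P \<Longrightarrow> has_cderiv (\<lambda>k. K k x) (K' k x) k P" "op_smooth P r K'"
    using op_smooth_SucE[OF Suc.prems] by blast
  show ?case
    by (rule op_smooth_SucI[OF op_smooth_0[OF Suc.IH[OF op_smooth_pred[OF Suc.prems]]] K'(1) Suc.IH[OF K'(2)]])
qed

lemma has_cderiv_Pair:
  "has_cderiv f a k P \<Longrightarrow> has_cderiv g b k P \<Longrightarrow> has_cderiv (\<lambda>z. (f z, g z)) (a, b) k P"
  unfolding has_cderiv_def by (auto intro: tendsto_Pair)

lemma op_smooth_Pair:
  "op_smooth P r K \<Longrightarrow> op_smooth P r L \<Longrightarrow> op_smooth P r (\<lambda>k z. (K k z, L k z))"
proof (induction r arbitrary: K L)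
  case 0
  obtain C D where C: "\<forall>k\<in>P. \<forall>x. norm (K k x) \<le> C * norm x" and D: "\<forall>k\<in>P. \<forall>x. norm (L k x) \<le> D * norm x"
    using 0 unfolding op_smooth.simps linear_family_def by blast
  have "norm (K k x, L k x) \<le> (C + D) * norm x" if "k \<in> P" for k x
  proof -
    have "norm (K k x, L k x) \<le> norm (K k x) + norm (L k x)" by (rule norm_Pair_le)
    also have "\<dots> \<le> C * norm x + D * norm x" using C D that by (intro add_mono) auto
    finally show ?thesis by (simp add: distrib_right)
  qed
  then have "\<exists>C. \<forall>k\<in>P. \<forall>x. norm (K k x, L k x) \<le> C * norm x" by blast
  with 0 show ?case
    unfolding op_smooth.simps linear_family_def by (simp add: continuous_on_Pair)
next
  case (Suc r)
  obtain K' where K': "\<And>x k. k \<in> P \<Longrightarrow> has_cderiv (\<lambda>k. K k x) (K' k x) k P" "op_smooth P r K'"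
    using op_smooth_SucE[OF Suc.prems(1)] by blast
  obtain L' where L': "\<And>x k. k \<in> P \<Longrightarrow> has_cderiv (\<lambda>k. L k x) (L' k x) k P" "op_smooth P r L'"
    using op_smooth_SucE[OF Suc.prems(2)] by blast
  show ?case
    by (rule op_smooth_SucI[OF op_smooth_0[OF Suc.IH[OF op_smooth_pred[OF Suc.prems(1)] op_smooth_pred[OF Suc.prems(2)]]]
        has_cderiv_Pair[OF K'(1) L'(1)] Suc.IH[OF K'(2) L'(2)]])
qed

text \<open>
  The part of the domain on which \<open>1 / k\<close> is bounded. The inversion \<open>k \<mapsto> 1 / k\<close> maps the remaining part into it.
\<close>

definition outer_region :: "complex set" where "outer_region = {k. 0 \<le> Im (theta2 k) \<and> 1 / 2 < norm k}"

lemma outer_region_D: "k \<in> outer_region \<Longrightarrow> k \<noteq> 0 \<and> Re (phase k) \<le> 0 \<and> 1 / norm k \<le> 2"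
proof -
  assume "k \<in> outer_region"
  then have k: "0 \<le> Im (theta2 k)" "1 / 2 < norm k" by (auto simp: outer_region_def)
  then have "1 / norm k \<le> 2" by (simp add: divide_le_eq)
  with k show ?thesis by (auto simp: phase_def)
qed

lemma derivs_bounded_inverse_power: "derivs_bounded outer_region r (\<lambda>_ k. 1 / norm k ^ p) (\<lambda>k. a / k ^ p)"
proof (induction r arbitrary: a p)
  case 0
  show ?case unfolding derivs_bounded.simps
  proof (intro conjI exI ballI)
    show "continuous_on outer_region (\<lambda>k. a / k ^ p)" using outer_region_D by (intro continuous_intros) auto
    show "norm (a / k ^ p) \<le> norm a * (1 / norm k ^ p)" for k by (simp add: norm_divide norm_power)
  qed
next
  case (Suc r)
  show ?case
  proof (rule derivs_bounded_SucI)
    show "derivs_bounded outer_region 0 (\<lambda>_ k. 1 / norm k ^ p) (\<lambda>k. a / k ^ p)" using Suc.IH by (rule derivs_bounded_le) simp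
    show "has_cderiv (\<lambda>k. a / k ^ p) (- (of_nat p * a) / k ^ (p + 1)) k outer_region" if "k \<in> outer_region" for k
    proof -
      have k: "k \<noteq> 0" using outer_region_D[OF that] by simp
      have "((\<lambda>k. a / k ^ p) has_field_derivative (0 * k ^ p - a * (of_nat p * (1 * k ^ (p - Suc 0)))) / (k ^ p * k ^ p)) (at k within outer_region)"
        using k by (intro DERIV_divide DERIV_const DERIV_power DERIV_ident) simp
      moreover have "(0 * k ^ p - a * (of_nat p * (1 * k ^ (p - Suc 0)))) / (k ^ p * k ^ p) = - (of_nat p * a) / k ^ (p + 1)"
        using k by (cases p) (simp_all add: field_simps)
      ultimately show ?thesis unfolding has_cderiv_complex by simp
    qed
    show "derivs_bounded outer_region r (\<lambda>j k. 1 / norm k ^ p) (\<lambda>k. - (of_nat p * a) / k ^ (p + 1))"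
    proof (rule derivs_bounded_weight_mono[OF Suc.IH, where C = 2])
      fix k assume "k \<in> outer_region"
      then have "1 / norm k * (1 / norm k ^ p) \<le> 2 * (1 / norm k ^ p)"
        using outer_region_D by (intro mult_right_mono) auto
      then show "0 \<le> 1 / norm k ^ (p + 1) \<and> 1 / norm k ^ (p + 1) \<le> 2 * (1 / norm k ^ p)" by simp
    qed
  qed
qed

lemma derivs_bounded_outer_region_weight_le:
  assumes "derivs_bounded outer_region r (\<lambda>_ k. 1 / norm k ^ q) f" "p \<le> q"
  shows "derivs_bounded outer_region r (\<lambda>_ k. 1 / norm k ^ p) f"
proof (rule derivs_bounded_weight_mono[OF assms(1), where C = "2 ^ (q - p)"])
  fix k assume "k \<in> outer_region"
  then have k: "k \<noteq> 0" "1 / norm k \<le> 2" using outer_region_D by auto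
  have "(1 / norm k) ^ q = (1 / norm k) ^ (q - p) * (1 / norm k) ^ p" using assms(2) by (simp flip: power_add)
  also have "\<dots> \<le> 2 ^ (q - p) * (1 / norm k) ^ p" using k by (intro mult_right_mono power_mono) auto
  finally show "0 \<le> 1 / norm k ^ q \<and> 1 / norm k ^ q \<le> 2 ^ (q - p) * (1 / norm k ^ p)"
    by (simp add: power_one_over)
qed

text \<open>
  The phase grows like \<open>k\<close>, but its derivatives are bounded on \<open>outer_region\<close>. Therefore differentiation in \<open>k\<close>
  does not spoil decay at infinity.
\<close>

lemma derivs_bounded_phase: "derivs_bounded outer_region r (case_nat (\<lambda>k. norm k) (\<lambda>_ _. 1)) phase"
proof -
  have cont: "continuous_on outer_region phase" unfolding phase_def theta2_def using outer_region_D by (intro continuous_intros) auto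
  have bd: "norm (phase k) \<le> 5 / 2 * norm k" if "k \<in> outer_region" for k
  proof -
    have k: "1 / norm k \<le> 2" "1 / 2 < norm k" using outer_region_D[OF that] that by (auto simp: outer_region_def)
    have "norm (phase k) = norm (k + 1 / k) / 2" by (simp add: phase_def theta2_def norm_mult norm_divide)
    also have "\<dots> \<le> (norm k + 1 / norm k) / 2"
      using norm_triangle_ineq[of k "1 / k"] by (simp add: norm_divide)
    also have "1 / norm k \<le> 4 * norm k" using k by linarith
    finally show ?thesis by simp
  qed
  have base: "derivs_bounded outer_region 0 (case_nat (\<lambda>k. norm k) (\<lambda>_ _. 1)) phase"
    unfolding derivs_bounded.simps
  proof (intro conjI cont exI[of _ "5 / 2"] ballI)
    fix k assume "k \<in> outer_region"
    then show "norm (phase k) \<le> 5 / 2 * (case 0 of 0 \<Rightarrow> norm | Suc x \<Rightarrow> \<lambda>_. 1) k" using bd[of k] by simp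
  qed
  show ?thesis
  proof (cases r)
    case 0
    then show ?thesis using base by simp
  next
    case (Suc q)
    from base show ?thesis unfolding Suc
    proof (rule derivs_bounded_SucI)
      show "has_cderiv phase (\<i> / 2 + (- (\<i> / 2)) / k ^ 2) k outer_region" if "k \<in> outer_region" for k
      proof -
        have k: "k \<noteq> 0" using outer_region_D[OF that] by simp
        have "((\<lambda>k. 2 * \<i> * ((k + 1 / k) / 4)) has_field_derivative 2 * \<i> * ((1 + (0 * k - 1 * 1) / (k * k)) / 4)) (at k within outer_region)"
          using k by (intro DERIV_cmult DERIV_cdivide DERIV_add DERIV_ident DERIV_divide DERIV_const)
        moreover have "2 * \<i> * ((1 + (0 * k - 1 * 1) / (k * k)) / 4) = \<i> / 2 + (- (\<i> / 2)) / k ^ 2"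
          by (simp add: power2_eq_square add_divide_distrib right_diff_distrib diff_divide_distrib)
        ultimately show ?thesis unfolding has_cderiv_complex phase_def[abs_def] theta2_def by (simp only:)
      qed
      have "derivs_bounded outer_region q (\<lambda>_ k. 1 / norm k ^ 0) (\<lambda>k. (- (\<i> / 2)) / k ^ 2)"
        by (rule derivs_bounded_outer_region_weight_le[OF derivs_bounded_inverse_power]) simp
      then have "derivs_bounded outer_region q (\<lambda>_ _. 1) (\<lambda>k. \<i> / 2 + (- (\<i> / 2)) / k ^ 2)"
        by (intro derivs_bounded_add derivs_bounded_const) simp
      then show "derivs_bounded outer_region q (\<lambda>j. case Suc j of 0 \<Rightarrow> norm | Suc x \<Rightarrow> \<lambda>_. 1) (\<lambda>k. \<i> / 2 + (- (\<i> / 2)) / k ^ 2)"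
        by simp
    qed
  qed
qed

lemma derivs_bounded_zero_exponent: "derivs_bounded P r (case_nat (\<lambda>k. 1) (\<lambda>_ _. 1)) (\<lambda>_. 0 :: complex)"
proof -
  have eq: "case_nat (\<lambda>k. 1) (\<lambda>_ _. 1) = (\<lambda>_ _. 1 :: real)" by (rule ext) (simp split: nat.split)
  show ?thesis unfolding eq by (rule derivs_bounded_const)
qed

type_synonym state = "(real \<Rightarrow>\<^sub>C complex) \<times> (real \<Rightarrow>\<^sub>C complex)"

context lax
begin

text \<open>
  The integral operator of the Volterra equation on pairs \<open>(x, y)\<close>, assembled from \<open>tail_op\<close> so that it
  inherits smoothness in \<open>k\<close>.
\<close>

definition volterra_op :: "complex \<Rightarrow> state \<Rightarrow> state" where
  "volterra_op k z =
    ((1 / 4) *\<^sub>c tail_op (phase k) 0 u (snd z) + (\<i> / (4 * k)) *\<^sub>c (tail_op (phase k) 0 c (fst z) + tail_op (phase k) 0 s (snd z)),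
     (- (1 / 4)) *\<^sub>c tail_op 0 0 u (fst z) + (\<i> / (4 * k)) *\<^sub>c (tail_op 0 0 s (fst z) + (- 1) *\<^sub>c tail_op 0 0 c (snd z)))"

lemmas weighted_L1_coeffs = weighted_sobolev_weighted_L1[OF u] weighted_sobolev_weighted_L1[OF s] weighted_sobolev_weighted_L1[OF c]

lemma apply_tail_op_0:
  assumes "weighted_L1 n \<rho>" "Re \<zeta> \<le> 0"
  shows "apply_bcontfun (tail_op \<zeta> 0 \<rho> x) t = exp_transform \<zeta> (\<lambda>s. \<rho> s * apply_bcontfun x s) (max t 0)"
  by (simp add: apply_tail_op[OF assms(1) _ assms(2)] tail_transform_def exp_transform_def poly_exp_def)

lemma volterra_op_apply:
  assumes Re: "Re (phase k) \<le> 0"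
  defines "x z \<equiv> apply_bcontfun (fst z)" and "y z \<equiv> apply_bcontfun (snd z)"
  shows "apply_bcontfun (fst (volterra_op k z)) t = - exp_transform (phase k) (rhs_x u s c k (x z) (y z)) (max t 0)"
    and "apply_bcontfun (snd (volterra_op k z)) t = - exp_transform 0 (rhs_y u s c k (x z) (y z)) (max t 0)"
proof -
  have b: "continuous_on {0..} (x z)" "\<And>t. norm (x z t) \<le> norm (fst z)"
    "continuous_on {0..} (y z)" "\<And>t. norm (y z t) \<le> norm (snd z)"
    by (auto simp: x_def y_def norm_bounded)
  note X = L1_coeff_mult[OF b(1,2)] and Y = L1_coeff_mult[OF b(3,4)]
  have t: "0 \<le> max t 0" by simp
  let ?c = "- (\<i> / (4 * k))"
  have rhs_x: "rhs_x u s c k (x z) (y z) = (\<lambda>t. - (1 / 4) * (u t * y z t) + ?c * (1 * (c t * x z t) + 1 * (s t * y z t)))"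
    by (rule ext) (simp add: rhs_x_def)
  have rhs_y: "rhs_y u s c k (x z) (y z) = (\<lambda>t. (1 / 4) * (u t * x z t) + ?c * (1 * (s t * x z t) + (- 1) * (c t * y z t)))"
    by (rule ext) (simp add: rhs_y_def)
  have L1: "L1 (\<lambda>t. 1 * (c t * x z t) + 1 * (s t * y z t))"
    using set_integral_add(1)[OF X(3) Y(2)] by simp
  have L2: "L1 (\<lambda>t. 1 * (s t * x z t) + (- 1) * (c t * y z t))"
    using set_integral_diff(1)[OF X(2) Y(3)] by simp
  have "exp_transform (phase k) (rhs_x u s c k (x z) (y z)) (max t 0) =
      - (1 / 4) * exp_transform (phase k) (\<lambda>t. u t * y z t) (max t 0)
      + ?c * (1 * exp_transform (phase k) (\<lambda>t. c t * x z t) (max t 0) + 1 * exp_transform (phase k) (\<lambda>t. s t * y z t) (max t 0))"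
    unfolding rhs_x by (subst exp_transform_lin[OF Y(1) L1 Re t], subst exp_transform_lin[OF X(3) Y(2) Re t], rule refl)
  then show "apply_bcontfun (fst (volterra_op k z)) t = - exp_transform (phase k) (rhs_x u s c k (x z) (y z)) (max t 0)"
    by (simp add: volterra_op_def plus_bcontfun.rep_eq apply_tail_op_0[OF weighted_L1_coeffs(1) Re] apply_tail_op_0[OF weighted_L1_coeffs(2) Re]
      apply_tail_op_0[OF weighted_L1_coeffs(3) Re] x_def y_def)
  have R0: "Re (0::complex) \<le> 0" by simp
  have "exp_transform 0 (rhs_y u s c k (x z) (y z)) (max t 0) =
      (1 / 4) * exp_transform 0 (\<lambda>t. u t * x z t) (max t 0)
      + ?c * (1 * exp_transform 0 (\<lambda>t. s t * x z t) (max t 0) + (- 1) * exp_transform 0 (\<lambda>t. c t * y z t) (max t 0))"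
    unfolding rhs_y by (subst exp_transform_lin[OF X(1) L2 R0 t], subst exp_transform_lin[OF X(2) Y(3) R0 t], rule refl)
  then show "apply_bcontfun (snd (volterra_op k z)) t = - exp_transform 0 (rhs_y u s c k (x z) (y z)) (max t 0)"
    by (simp add: volterra_op_def plus_bcontfun.rep_eq apply_tail_op_0[OF weighted_L1_coeffs(1) R0] apply_tail_op_0[OF weighted_L1_coeffs(2) R0]
      apply_tail_op_0[OF weighted_L1_coeffs(3) R0] x_def y_def)
qed

lemma op_smooth_volterra_op: "op_smooth outer_region n volterra_op"
proof -
  have F: "op_smooth P r K \<Longrightarrow> op_smooth P r (\<lambda>k z. K k (fst z))" and S: "op_smooth P r K \<Longrightarrow> op_smooth P r (\<lambda>k z. K k (snd z))"
    for P r and K :: "complex \<Rightarrow> (real \<Rightarrow>\<^sub>C complex) \<Rightarrow> (real \<Rightarrow>\<^sub>C complex)"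
  proof -
    show "op_smooth P r K \<Longrightarrow> op_smooth P r (\<lambda>k z. K k (fst z))"
      by (rule op_smooth_comp) (simp_all, metis norm_fst_le prod.collapse)
    show "op_smooth P r K \<Longrightarrow> op_smooth P r (\<lambda>k z. K k (snd z))"
      by (rule op_smooth_comp) (simp_all, metis norm_snd_le prod.collapse)
  qed
  have J: "op_smooth outer_region n (\<lambda>k. tail_op (phase k) 0 \<rho>)" and J0: "op_smooth outer_region n (\<lambda>k. tail_op 0 0 \<rho>)" if "weighted_L1 n \<rho>" for \<rho>
    using op_smooth_tail_op[OF that derivs_bounded_phase, of 0] op_smooth_tail_op[OF that derivs_bounded_zero_exponent, of _ 0] outer_region_D by auto
  have k: "derivs_bounded outer_region n (\<lambda>_ _. 1) (\<lambda>k. \<i> / (4 * k))"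
    using derivs_bounded_outer_region_weight_le[OF derivs_bounded_inverse_power[of n 1 "\<i> / 4"], of 0] by simp
  note cst = derivs_bounded_const[of outer_region n]
  show ?thesis unfolding volterra_op_def
    by (intro op_smooth_Pair op_smooth_add op_smooth_scaleC[OF cst] op_smooth_scaleC[OF k] F[OF J] S[OF J] F[OF J0] S[OF J0] weighted_L1_coeffs)
qed

lemma volterra_op_diff: "k \<in> outer_region \<Longrightarrow> volterra_op k (z - z') = volterra_op k z - volterra_op k z'"
  by (rule op_smooth_diff[OF op_smooth_0[OF op_smooth_volterra_op]])

text \<open>
  Multiplication by \<open>weight_down\<close> passes to an equivalent norm in which \<open>volterra_op\<close> is a contraction. The
  constant \<open>6\<close> is chosen in \<open>volterra_op_contraction\<close>.
\<close>

definition weight_up :: "real \<Rightarrow> real" where "weight_up t = exp (6 * V.tau (max t 0))"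
definition weight_down :: "real \<Rightarrow> real" where "weight_down t = exp (- (6 * V.tau (max t 0)))"

lemma weight_up_weight_down: "weight_up t * weight_down t = 1"
  by (simp add: weight_up_def weight_down_def flip: exp_add)

lemma weight_continuous: "continuous_on UNIV weight_up" "continuous_on UNIV weight_down"
proof -
  have "continuous_on UNIV (\<lambda>t. V.tau (max t 0))"
    by (rule continuous_on_compose2[OF V.continuous_tau]) (auto intro!: continuous_intros)
  then show "continuous_on UNIV weight_up" "continuous_on UNIV weight_down"
    unfolding weight_up_def weight_down_def by (auto intro!: continuous_intros)
qed

lemma weight_up_bd: "norm (weight_up t) \<le> exp (6 * V.tau 0)"
  using V.tau_antimono[of 0 "max t 0"] by (simp add: weight_up_def)

lemma weight_down_bd: "norm (weight_down t) \<le> 1"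
  using V.tau_nonneg[of "max t 0"] by (simp add: weight_down_def)

definition rescale :: "(real \<Rightarrow> real) \<Rightarrow> state \<Rightarrow> state" where "rescale a z = (mult_op a (fst z), mult_op a (snd z))"

lemma rescale_weight_up_apply: "apply_bcontfun (fst (rescale weight_up z)) t = of_real (weight_up t) * apply_bcontfun (fst z) t"
    "apply_bcontfun (snd (rescale weight_up z)) t = of_real (weight_up t) * apply_bcontfun (snd z) t"
  by (simp_all add: rescale_def apply_mult_op[OF weight_continuous(1) weight_up_bd])

lemma rescale_weight_down_apply: "apply_bcontfun (fst (rescale weight_down z)) t = of_real (weight_down t) * apply_bcontfun (fst z) t"
    "apply_bcontfun (snd (rescale weight_down z)) t = of_real (weight_down t) * apply_bcontfun (snd z) t"
  by (simp_all add: rescale_def apply_mult_op[OF weight_continuous(2) weight_down_bd])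

lemma rescale_inverse: "rescale weight_up (rescale weight_down z) = z" "rescale weight_down (rescale weight_up z) = z"
proof -
  have w: "complex_of_real (weight_up t) * of_real (weight_down t) = 1" for t
    by (metis of_real_1 of_real_mult weight_up_weight_down)
  have 1: "of_real (weight_up t) * (of_real (weight_down t) * a) = a" for t and a :: complex
    by (simp add: mult.assoc[symmetric] w)
  then have 2: "of_real (weight_down t) * (of_real (weight_up t) * a) = a" for t and a :: complex
    by (metis mult.left_commute)
  show "rescale weight_up (rescale weight_down z) = z" "rescale weight_down (rescale weight_up z) = z"
    by (auto intro!: prod_eqI bcontfun_eqI simp: rescale_weight_up_apply rescale_weight_down_apply 1 2)
qed

lemma rescale_weight_up_diff: "rescale weight_up (z - z') = rescale weight_up z - rescale weight_up z'"
  by (auto intro!: prod_eqI bcontfun_eqI simp: rescale_weight_up_apply minus_bcontfun.rep_eq right_diff_distrib)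

lemma rescale_weight_down_diff: "rescale weight_down (z - z') = rescale weight_down z - rescale weight_down z'"
  by (auto intro!: prod_eqI bcontfun_eqI simp: rescale_weight_down_apply minus_bcontfun.rep_eq right_diff_distrib)

lemma rescale_weight_down_add: "rescale weight_down (z + z') = rescale weight_down z + rescale weight_down z'"
  by (auto intro!: prod_eqI bcontfun_eqI simp: rescale_weight_down_apply plus_bcontfun.rep_eq distrib_left)

lemma rescale_weight_down_norm: "norm (rescale weight_down z) \<le> 2 * norm z"
proof -
  have "norm (rescale weight_down z) \<le> norm (mult_op weight_down (fst z)) + norm (mult_op weight_down (snd z))" unfolding rescale_def by (rule norm_Pair_le)
  also have "\<dots> \<le> 1 * norm (fst z) + 1 * norm (snd z)" by (intro add_mono norm_mult_op_le[OF weight_continuous(2) weight_down_bd])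
  also have "\<dots> \<le> 2 * norm z"
    using norm_fst_le[of "fst z" "snd z"] norm_snd_le[of "snd z" "fst z"] by simp
  finally show ?thesis .
qed

lemma rescale_weight_up_norm: "norm (rescale weight_up z) \<le> 2 * exp (6 * V.tau 0) * norm z"
proof -
  have "norm (rescale weight_up z) \<le> norm (mult_op weight_up (fst z)) + norm (mult_op weight_up (snd z))" unfolding rescale_def by (rule norm_Pair_le)
  also have "\<dots> \<le> exp (6 * V.tau 0) * norm (fst z) + exp (6 * V.tau 0) * norm (snd z)"
    by (intro add_mono norm_mult_op_le[OF weight_continuous(1) weight_up_bd])
  also have "\<dots> \<le> exp (6 * V.tau 0) * norm z + exp (6 * V.tau 0) * norm z"
    using norm_fst_le[of "fst z" "snd z"] norm_snd_le[of "snd z" "fst z"] by (intro add_mono mult_left_mono) auto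
  finally show ?thesis by (simp only: mult_2 distrib_right)
qed

text \<open>
  On \<open>outer_region\<close> the coupling is at most \<open>3/4\<close>, and \<open>|x| + |y|\<close> is at most \<open>2 |w| exp (6 \<tau>)\<close>. Integration gains
  the factor \<open>1/6\<close>, so each component is bounded by \<open>3/4 \<cdot> 2 \<cdot> 1/6 = 1/4\<close> times the norm, and the pair by \<open>1/2\<close>.
\<close>

lemma volterra_op_contraction:
  assumes k: "k \<in> outer_region"
  shows "norm (rescale weight_down (volterra_op k (rescale weight_up w))) \<le> 1 / 2 * norm w"
proof -
  define x where "x = apply_bcontfun (fst (rescale weight_up w))"
  define y where "y = apply_bcontfun (snd (rescale weight_up w))"
  define N where "N = norm w"
  have Re: "Re (phase k) \<le> 0" and k2: "coupling k \<le> 3 / 4" using outer_region_D[OF k] by (auto simp: coupling_def)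
  have R0: "Re (0::complex) \<le> 0" by simp
  have N: "norm (fst w) \<le> N" "norm (snd w) \<le> N"
    using norm_fst_le[of "fst w" "snd w"] norm_snd_le[of "snd w" "fst w"] by (auto simp: N_def)
  have xy: "norm (x r) + norm (y r) \<le> 2 * N * exp (6 * V.tau r)" if "0 \<le> r" for r
  proof -
    have "norm (apply_bcontfun (fst w) r) \<le> N" "norm (apply_bcontfun (snd w) r) \<le> N"
      using N norm_bounded order_trans by blast+
    then have "norm (x r) \<le> exp (6 * V.tau r) * N" "norm (y r) \<le> exp (6 * V.tau r) * N"
      using that by (auto simp: x_def y_def rescale_weight_up_apply norm_mult weight_up_def)
    then have "norm (x r) + norm (y r) \<le> exp (6 * V.tau r) * N + exp (6 * V.tau r) * N" by (rule add_mono)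
    also have "\<dots> = 2 * N * exp (6 * V.tau r)" by (simp add: algebra_simps)
    finally show ?thesis .
  qed
  have b: "continuous_on {0..} x" "\<And>t. norm (x t) \<le> norm (rescale weight_up w)"
    "continuous_on {0..} y" "\<And>t. norm (y t) \<le> norm (rescale weight_up w)"
    unfolding x_def y_def
    by (auto intro: order_trans[OF norm_bounded] norm_fst_le[of "fst (rescale weight_up w)" "snd (rescale weight_up w)", simplified]
      norm_snd_le[of "snd (rescale weight_up w)" "fst (rescale weight_up w)", simplified])
  note L = L1_rhs[OF b]
  have hL: "L1 (\<lambda>r. (3 / 2 * N) * (v r * exp (6 * V.tau r)))"
    by (rule set_integrable_mult_right[OF V.exp_tail_L1]) simp
  have est: "coupling k * v r * (norm (x r) + norm (y r)) \<le> (3 / 2 * N) * (v r * exp (6 * V.tau r))" if "0 \<le> r" for r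
  proof -
    have "coupling k * v r * (norm (x r) + norm (y r)) \<le> 3 / 4 * v r * (2 * N * exp (6 * V.tau r))"
      using k2 coupling_pos[of k] v_nonneg[of r] by (intro mult_mono xy that) auto
    then show ?thesis by simp
  qed
  have comp: "norm (of_real (weight_down t) * - exp_transform \<zeta> f (max t 0)) \<le> N / 4"
    if f: "L1 f" "Re \<zeta> \<le> 0" "\<And>r. norm (f r) \<le> coupling k * v r * (norm (x r) + norm (y r))" for t \<zeta> f
  proof -
    define t' where "t' = max t 0"
    have t': "0 \<le> t'" by (simp add: t'_def)
    have "norm (exp_transform \<zeta> f t') \<le> integral {t'..} (\<lambda>r. norm (f r))" by (rule norm_exp_transform_le[OF f(1,2) t'])
    also have "\<dots> \<le> integral {t'..} (\<lambda>r. (3 / 2 * N) * (v r * exp (6 * V.tau r)))"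
      by (rule norm_tail_pointwise_le[OF f(1) hL t']) (use order_trans[OF f(3) est] t' in simp)
    also have "\<dots> = (3 / 2 * N) * integral {t'..} (\<lambda>r. v r * exp (6 * V.tau r))"
      by (rule integral_mult_right)
    also have "\<dots> \<le> (3 / 2 * N) * (exp (6 * V.tau t') / 6)"
      by (rule mult_left_mono[OF V.exp_tail_le[OF _ t']]) (simp_all add: N_def)
    finally have "norm (exp_transform \<zeta> f t') \<le> N / 4 * exp (6 * V.tau t')" by simp
    then have "weight_down t * norm (exp_transform \<zeta> f t') \<le> weight_down t * (N / 4 * exp (6 * V.tau t'))"
      by (intro mult_left_mono) (simp_all add: weight_down_def)
    also have "\<dots> = N / 4 * (weight_up t * weight_down t)" by (simp add: weight_up_def t'_def mult_ac)
    also have "\<dots> = N / 4" by (simp add: weight_up_weight_down)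
    finally show ?thesis by (simp add: norm_mult t'_def weight_down_def)
  qed
  have "norm (fst (rescale weight_down (volterra_op k (rescale weight_up w)))) \<le> N / 4"
    by (rule norm_bound)
      (simp only: rescale_weight_down_apply volterra_op_apply[OF Re], rule comp[OF L(1) Re norm_rhs_x_le, unfolded x_def y_def])
  moreover have "norm (snd (rescale weight_down (volterra_op k (rescale weight_up w)))) \<le> N / 4"
    by (rule norm_bound)
      (simp only: rescale_weight_down_apply volterra_op_apply[OF Re], rule comp[OF L(2) R0 norm_rhs_y_le, unfolded x_def y_def])
  ultimately show ?thesis
    using norm_Pair_le[of "fst (rescale weight_down (volterra_op k (rescale weight_up w)))" "snd (rescale weight_down (volterra_op k (rescale weight_up w)))"] by (simp add: N_def)
qed

lemma volterra_op_bound: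
  assumes k: "k \<in> outer_region"
  shows "norm z \<le> 8 * exp (6 * V.tau 0) * norm (z - volterra_op k z)"
proof -
  have "rescale weight_down z = rescale weight_down (z - volterra_op k z) + rescale weight_down (volterra_op k (rescale weight_up (rescale weight_down z)))"
    by (simp add: rescale_weight_down_diff rescale_inverse)
  then have "norm (rescale weight_down z) \<le> norm (rescale weight_down (z - volterra_op k z)) + norm (rescale weight_down (volterra_op k (rescale weight_up (rescale weight_down z))))"
    by (metis norm_triangle_ineq)
  also have "\<dots> \<le> 2 * norm (z - volterra_op k z) + 1 / 2 * norm (rescale weight_down z)"
    by (intro add_mono rescale_weight_down_norm volterra_op_contraction k)
  finally have a: "norm (rescale weight_down z) \<le> 4 * norm (z - volterra_op k z)" by simp
  have "norm z \<le> 2 * exp (6 * V.tau 0) * norm (rescale weight_down z)" using rescale_weight_up_norm[of "rescale weight_down z"] by (simp add: rescale_inverse)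
  also have "\<dots> \<le> 2 * exp (6 * V.tau 0) * (4 * norm (z - volterra_op k z))" by (intro mult_left_mono a) simp
  finally show ?thesis by simp
qed

lemma volterra_op_exists:
  assumes k: "k \<in> outer_region"
  shows "\<exists>z. z = h + volterra_op k z"
proof -
  define T where "T w = rescale weight_down h + rescale weight_down (volterra_op k (rescale weight_up w))" for w
  have "dist (T w) (T w') \<le> 1 / 2 * dist w w'" for w w'
  proof -
    have "T w - T w' = rescale weight_down (volterra_op k (rescale weight_up (w - w')))"
      by (simp add: T_def rescale_weight_up_diff volterra_op_diff[OF k] rescale_weight_down_diff)
    then show ?thesis unfolding dist_norm by (simp only: volterra_op_contraction[OF k])
  qed
  then have "\<exists>!w. T w = w" by (intro banach_fix_type[where c = "1/2"]) auto
  then obtain w where w: "T w = w" by blast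
  have "rescale weight_up w = rescale weight_up (rescale weight_down (h + volterra_op k (rescale weight_up w)))"
    using w unfolding T_def by (simp add: rescale_weight_down_add)
  then have "rescale weight_up w = h + volterra_op k (rescale weight_up w)" by (simp only: rescale_inverse)
  then show ?thesis by blast
qed

lemma derivs_bounded_solution:
  assumes "derivs_bounded outer_region n (\<lambda>_. w) h" "\<And>k. k \<in> outer_region \<Longrightarrow> e k = h k + volterra_op k (e k)"
  shows "derivs_bounded outer_region n (\<lambda>_. w) e"
  by (rule derivs_bounded_resolvent[OF op_smooth_volterra_op volterra_op_exists volterra_op_bound _ assms]) simp_all

lemma lax_solution_exists:
  assumes k: "k \<in> outer_region"
  shows "\<exists>x y. lax_solution u s c k x y"
proof -
  obtain z where z: "z = (0, const_bcontfun 1) + volterra_op k z" using volterra_op_exists[OF k] by blast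
  have Re: "Re (phase k) \<le> 0" using outer_region_D[OF k] by simp
  let ?x = "apply_bcontfun (fst z)" and ?y = "apply_bcontfun (snd z)"
  have "fst z = fst ((0, const_bcontfun 1) + volterra_op k z)" using z by simp
  then have fz: "fst z = fst (volterra_op k z)" by simp
  have "snd z = snd ((0, const_bcontfun 1) + volterra_op k z)" using z by simp
  then have sz: "snd z = const_bcontfun 1 + snd (volterra_op k z)" by simp
  have b: "continuous_on {0..} ?x" "\<And>t. norm (?x t) \<le> norm z"
    "continuous_on {0..} ?y" "\<And>t. norm (?y t) \<le> norm z"
    by (auto intro: order_trans[OF norm_bounded] norm_fst_le[of "fst z" "snd z", simplified]
      norm_snd_le[of "snd z" "fst z", simplified])
  note L = L1_rhs[OF b]
  have "lax_solution u s c k ?x ?y"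
  proof (rule volterra_lax_solution[OF Re])
    fix t :: real assume t: "0 \<le> t"
    show "(\<lambda>r. exp (phase k * of_real (r - t)) * rhs_x u s c k ?x ?y r) absolutely_integrable_on {t..}"
      by (rule exp_transform_integrable[OF L(1) Re t])
    have "?x t = apply_bcontfun (fst (volterra_op k z)) t" using fz by (rule arg_cong)
    then show "?x t = - exp_transform (phase k) (rhs_x u s c k ?x ?y) t" unfolding volterra_op_apply(1)[OF Re] using t by simp
    have "?y t = apply_bcontfun (const_bcontfun 1 + snd (volterra_op k z)) t" using sz by (rule arg_cong)
    then show "?y t = 1 - integral {t..} (rhs_y u s c k ?x ?y)"
      unfolding plus_bcontfun.rep_eq volterra_op_apply(2)[OF Re] using t by (simp add: exp_transform_def const_bcontfun.rep_eq)
  qed (rule L)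
  then show ?thesis by blast
qed

end

section \<open>The expansion at infinity\<close>

lemma derivs_bounded_Pair:
  "derivs_bounded P r w f \<Longrightarrow> derivs_bounded P r w g \<Longrightarrow> derivs_bounded P r w (\<lambda>k. (f k, g k))"
proof (induction r arbitrary: f g w)
  case 0
  then obtain C D where C: "\<forall>k\<in>P. norm (f k) \<le> C * w 0 k" and D: "\<forall>k\<in>P. norm (g k) \<le> D * w 0 k"
    by auto
  have "norm (f k, g k) \<le> (C + D) * w 0 k" if "k \<in> P" for k
  proof -
    have "norm (f k, g k) \<le> norm (f k) + norm (g k)" by (rule norm_Pair_le)
    also have "\<dots> \<le> C * w 0 k + D * w 0 k" using C D that by (intro add_mono) auto
    finally show ?thesis by (simp only: distrib_right)
  qed
  then have "\<exists>C. \<forall>k\<in>P. norm (f k, g k) \<le> C * w 0 k" by blast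
  with 0 show ?case unfolding derivs_bounded.simps by (auto intro!: continuous_on_Pair)
next
  case (Suc r)
  obtain f' where f': "\<And>k. k \<in> P \<Longrightarrow> has_cderiv f (f' k) k P" "derivs_bounded P r (\<lambda>j. w (Suc j)) f'"
    using derivs_bounded_SucE[OF Suc.prems(1)] by blast
  obtain g' where g': "\<And>k. k \<in> P \<Longrightarrow> has_cderiv g (g' k) k P" "derivs_bounded P r (\<lambda>j. w (Suc j)) g'"
    using derivs_bounded_SucE[OF Suc.prems(2)] by blast
  show ?case
    by (rule derivs_bounded_SucI[OF derivs_bounded_le[OF Suc.IH[OF derivs_bounded_pred[OF Suc.prems(1)] derivs_bounded_pred[OF Suc.prems(2)]]]
        has_cderiv_Pair[OF f'(1) g'(1)] Suc.IH[OF f'(2) g'(2)]]) simp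
qed

lemma derivs_bounded_clinear:
  fixes L :: "'a::complex_banach \<Rightarrow> 'b::complex_banach"
  assumes add: "\<And>x y. L (x + y) = L x + L y" and scale: "\<And>a x. L (a *\<^sub>c x) = a *\<^sub>c L x"
    and norm: "\<And>x. norm (L x) \<le> norm x"
  shows "derivs_bounded P r w f \<Longrightarrow> derivs_bounded P r w (\<lambda>k. L (f k))"
proof -
  have bl: "bounded_linear L"
  proof (rule bounded_linear_intro[where K = 1])
    show "L (r *\<^sub>R x) = r *\<^sub>R L x" for r x using scale[of "of_real r" x] by (simp add: scaleC_of_real)
  qed (use add norm in auto)
  have diff: "L (x - y) = L x - L y" for x y by (rule linear_diff[OF bounded_linear.linear[OF bl]])
  show "derivs_bounded P r w f \<Longrightarrow> derivs_bounded P r w (\<lambda>k. L (f k))"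
  proof (induction r arbitrary: f w)
    case 0
    then obtain C where C: "\<forall>k\<in>P. norm (f k) \<le> C * w 0 k" by auto
    then have "\<forall>k\<in>P. norm (L (f k)) \<le> C * w 0 k" using norm order_trans by blast
    with 0 show ?case unfolding derivs_bounded.simps by (auto intro: bounded_linear.continuous_on[OF bl])
  next
    case (Suc r)
    obtain f' where f': "\<And>k. k \<in> P \<Longrightarrow> has_cderiv f (f' k) k P" "derivs_bounded P r (\<lambda>j. w (Suc j)) f'"
      using derivs_bounded_SucE[OF Suc.prems(1)] by blast
    have d: "has_cderiv (\<lambda>k. L (f k)) (L (f' k)) k P" if "k \<in> P" for k
      using bounded_linear.tendsto[OF bl f'(1)[OF that, unfolded has_cderiv_def]]
      unfolding has_cderiv_def by (simp add: scale diff)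
    show ?case
      by (rule derivs_bounded_SucI[OF derivs_bounded_le[OF Suc.IH[OF derivs_bounded_pred[OF Suc.prems(1)]]] d Suc.IH[OF f'(2)]]) simp_all
  qed
qed

lemma derivs_bounded_cong: "derivs_bounded P r w f \<Longrightarrow> (\<And>k. k \<in> P \<Longrightarrow> f k = g k) \<Longrightarrow> derivs_bounded P r w g"
proof (induction r arbitrary: f g w)
  case 0
  then show ?case by (simp cong: continuous_on_cong)
next
  case (Suc r)
  obtain f' where f': "\<And>k. k \<in> P \<Longrightarrow> has_cderiv f (f' k) k P" "derivs_bounded P r (\<lambda>j. w (Suc j)) f'"
    using derivs_bounded_SucE[OF Suc.prems(1)] by blast
  have d: "has_cderiv g (f' k) k P" if k: "k \<in> P" for k
    using f'(1)[OF k] unfolding has_cderiv_def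
    by (rule Lim_transform_eventually) (use Suc.prems(2) k in \<open>auto simp: eventually_at_filter\<close>)
  show ?case
    by (rule derivs_bounded_SucI[OF derivs_bounded_le[OF Suc.IH[OF derivs_bounded_pred[OF Suc.prems(1)] Suc.prems(2)]] d f'(2)]) simp_all
qed

text \<open>
  The recursion for \<open>b\<^sub>0, \<dots>, b\<^sub>m\<^sub>+\<^sub>1\<close> differentiates \<open>m + 1\<close> times.
\<close>

locale lax_smooth = lax n u s c for n u s c +
  fixes m :: nat
  assumes u_smooth: "weighted_sobolev n (Suc m) u" and s_smooth: "weighted_sobolev n (Suc m) s" and c_smooth: "weighted_sobolev n (Suc m) c"
begin

definition ac_deriv :: "nat \<Rightarrow> (real \<Rightarrow> complex) \<Rightarrow> real \<Rightarrow> complex" where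
  "ac_deriv r f = (SOME f'. has_ac_deriv f f' \<and> weighted_sobolev n r f')"

lemma ac_deriv: "weighted_sobolev n (Suc r) f \<Longrightarrow> has_ac_deriv f (ac_deriv r f) \<and> weighted_sobolev n r (ac_deriv r f)"
proof -
  assume "weighted_sobolev n (Suc r) f"
  then obtain f' where "has_ac_deriv f f' \<and> weighted_sobolev n r f'" by auto
  then show ?thesis unfolding ac_deriv_def by (rule someI[of "\<lambda>f'. has_ac_deriv f f' \<and> weighted_sobolev n r f'"])
qed

text \<open>
  The coefficient of \<open>k\<^sup>-\<^sup>i\<close> in the equation for \<open>x\<close>, solved for \<open>b\<^sub>i\<^sub>+\<^sub>1\<close>, which enters through the product of
  \<open>phase k = i (k + 1 / k) / 2\<close> with the series; \<open>prev_b\<close> and \<open>prev_a\<close> stand for the coefficients of index \<open>i - 1\<close>.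
\<close>

definition next_b :: "(real \<Rightarrow> complex) \<Rightarrow> (real \<Rightarrow> complex) \<Rightarrow> (real \<Rightarrow> complex) \<Rightarrow> (real \<Rightarrow> complex) \<Rightarrow> real \<Rightarrow> complex" where
  "next_b b' prev_b a prev_a t = 2 * \<i> * b' t - prev_b t + \<i> / 2 * (a t * u t) - 1 / 2 * (prev_b t * c t + prev_a t * s t)"

text \<open>
  The coefficient of \<open>k\<^sup>-\<^sup>i\<close> in the equation for \<open>y\<close>: the derivative of \<open>a\<^sub>i\<close>.
\<close>

definition next_a :: "(real \<Rightarrow> complex) \<Rightarrow> (real \<Rightarrow> complex) \<Rightarrow> (real \<Rightarrow> complex) \<Rightarrow> real \<Rightarrow> complex" where
  "next_a b prev_b prev_a t = 1 / 4 * (b t * u t) - \<i> / 4 * (prev_b t * s t - prev_a t * c t)"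

text \<open>
  The recursion has order two, so each step carries the coefficients \<open>(b, a)\<close> of two consecutive indices. The
  starting values are those of index \<open>-1\<close> (zero) and of index \<open>0\<close>. The integration constants in \<open>a\<^sub>i\<close>
  are fixed by \<open>a\<^sub>i \<rightarrow> 0\<close>.
\<close>

primrec coeff_pair :: "nat \<Rightarrow> ((real \<Rightarrow> complex) \<times> (real \<Rightarrow> complex)) \<times> ((real \<Rightarrow> complex) \<times> (real \<Rightarrow> complex))" where
  "coeff_pair 0 = ((\<lambda>_. 0, \<lambda>_. 0), (\<lambda>_. 0, \<lambda>_. 1))"
| "coeff_pair (Suc i) = (let prev_b = fst (fst (coeff_pair i)); prev_a = snd (fst (coeff_pair i)); b = fst (snd (coeff_pair i)); a = snd (snd (coeff_pair i));
      b1 = next_b (ac_deriv (Suc m - i) b) prev_b a prev_a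
    in ((b, a), (b1, \<lambda>t. - integral {t..} (next_a b1 b a))))"

definition prev_b where "prev_b i = fst (fst (coeff_pair i))"
definition prev_a where "prev_a i = snd (fst (coeff_pair i))"
definition coeff_b where "coeff_b i = fst (snd (coeff_pair i))"
definition coeff_a where "coeff_a i = snd (snd (coeff_pair i))"
definition coeff_b_deriv where "coeff_b_deriv i = ac_deriv (Suc m - i) (coeff_b i)"
definition coeff_a_deriv where "coeff_a_deriv i = next_a (coeff_b i) (prev_b i) (prev_a i)"

lemma coeff_pair_simps:
  "prev_b 0 = (\<lambda>_. 0)" "prev_a 0 = (\<lambda>_. 0)" "coeff_b 0 = (\<lambda>_. 0)" "coeff_a 0 = (\<lambda>_. 1)"
  "prev_b (Suc i) = coeff_b i" "prev_a (Suc i) = coeff_a i" "coeff_b (Suc i) = next_b (coeff_b_deriv i) (prev_b i) (coeff_a i) (prev_a i)"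
  "coeff_a (Suc i) = (\<lambda>t. - integral {t..} (coeff_a_deriv (Suc i)))"
  by (simp_all add: prev_b_def prev_a_def coeff_b_def coeff_a_def coeff_b_deriv_def coeff_a_deriv_def Let_def)

lemma bounded_sobolev_minus: "bounded_sobolev n r a \<Longrightarrow> bounded_sobolev n r (\<lambda>t. - a t)"
proof (cases r)
  case 0
  assume "bounded_sobolev n r a"
  then show ?thesis using 0 by (auto intro: continuous_intros)
next
  case (Suc q)
  assume "bounded_sobolev n r a"
  then obtain C a' where "\<forall>t\<ge>0. norm (a t) \<le> C" "has_ac_deriv a a'" "weighted_sobolev n q a'" using Suc by auto
  then show ?thesis using has_ac_deriv_minus[of a a'] weighted_sobolev_minus[of n q a'] Suc by auto
qed

lemma weighted_sobolev_next_b: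
  assumes "weighted_sobolev n r b'" "weighted_sobolev n r p" "bounded_sobolev n r a" "bounded_sobolev n r p'" "r \<le> Suc m"
  shows "weighted_sobolev n r (next_b b' p a p')"
proof -
  note usc = u_smooth[THEN weighted_sobolev_le, OF assms(5)] s_smooth[THEN weighted_sobolev_le, OF assms(5)] c_smooth[THEN weighted_sobolev_le, OF assms(5)]
  have "weighted_sobolev n r (\<lambda>t. c t * p t)"
  proof (cases r)
    case 0
    then show ?thesis using weighted_sobolev_mult[OF assms(2), of c] weighted_sobolev_Suc_bounded_sobolev[OF c] bounded_sobolev_le[of n "Suc 0" c 0] by simp
  next
    case (Suc q)
    then show ?thesis using weighted_sobolev_mult[OF assms(2), of c] weighted_sobolev_Suc_bounded_sobolev[of n q c] usc(3) by simp
  qed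
  then have pc: "weighted_sobolev n r (\<lambda>t. p t * c t)" by (simp add: mult.commute)
  show ?thesis unfolding next_b_def[abs_def]
    by (intro weighted_sobolev_add weighted_sobolev_diff weighted_sobolev_cmult assms(1,2) weighted_sobolev_mult[OF usc(1) assms(3)] weighted_sobolev_mult[OF usc(2) assms(4)] pc)
qed

lemma weighted_sobolev_next_a:
  assumes "weighted_sobolev n r b" "weighted_sobolev n r p" "bounded_sobolev n r p'" "r \<le> Suc m"
  shows "weighted_sobolev n r (next_a b p p')"
proof -
  note usc = u_smooth[THEN weighted_sobolev_le, OF assms(4)] s_smooth[THEN weighted_sobolev_le, OF assms(4)] c_smooth[THEN weighted_sobolev_le, OF assms(4)]
  have bdd: "bounded_sobolev n r u" "bounded_sobolev n r s"
    using weighted_sobolev_Suc_bounded_sobolev[OF u] weighted_sobolev_Suc_bounded_sobolev[OF s] weighted_sobolev_Suc_bounded_sobolev[of n "r - 1" u] weighted_sobolev_Suc_bounded_sobolev[of n "r - 1" s] usc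
      bounded_sobolev_le[of n "Suc 0" u 0] bounded_sobolev_le[of n "Suc 0" s 0] by (cases r; simp)+
  have "weighted_sobolev n r (\<lambda>t. u t * b t)" "weighted_sobolev n r (\<lambda>t. s t * p t)" by (intro weighted_sobolev_mult assms bdd)+
  then have pc: "weighted_sobolev n r (\<lambda>t. b t * u t)" "weighted_sobolev n r (\<lambda>t. p t * s t)" by (simp_all add: mult.commute)
  show ?thesis unfolding next_a_def[abs_def]
    by (intro weighted_sobolev_diff weighted_sobolev_cmult pc weighted_sobolev_mult[OF usc(3) assms(3)])
qed

text \<open>
  Each step costs one derivative, namely that of \<open>b\<^sub>i\<close>; the coefficient \<open>a\<^sub>i\<close>, a tail integral, costs nothing.
\<close>

lemma coeff_pair_regular:
  "i \<le> Suc m \<Longrightarrow> weighted_sobolev n (Suc m - i + 1) (coeff_b i) \<and> bounded_sobolev n (Suc m - i + 1) (coeff_a i) \<and>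
     weighted_sobolev n (Suc m - i + 1) (prev_b i) \<and> bounded_sobolev n (Suc m - i + 1) (prev_a i)"
proof (induction i)
  case 0
  show ?case unfolding coeff_pair_simps by (intro conjI weighted_sobolev_zero bounded_sobolev_const)
next
  case (Suc i)
  define r where "r = Suc m - i"
  have r: "Suc m - Suc i + 1 = r" "r \<le> Suc m" "1 \<le> r" using Suc.prems by (auto simp: r_def)
  have IH: "weighted_sobolev n (Suc r) (coeff_b i)" "bounded_sobolev n (Suc r) (coeff_a i)" "weighted_sobolev n (Suc r) (prev_b i)" "bounded_sobolev n (Suc r) (prev_a i)"
    using Suc by (auto simp: r_def)
  note dn = IH(1)[THEN weighted_sobolev_pred] IH(2)[THEN bounded_sobolev_pred] IH(3)[THEN weighted_sobolev_pred] IH(4)[THEN bounded_sobolev_pred]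
  have coeff_b_deriv: "weighted_sobolev n r (coeff_b_deriv i)" using ac_deriv[OF IH(1)] by (simp add: coeff_b_deriv_def r_def)
  have b: "weighted_sobolev n r (coeff_b (Suc i))" unfolding coeff_pair_simps by (rule weighted_sobolev_next_b[OF coeff_b_deriv dn(3,2,4) r(2)])
  have "weighted_sobolev n r (coeff_a_deriv (Suc i))" unfolding coeff_a_deriv_def coeff_pair_simps(5,6) by (rule weighted_sobolev_next_a[OF b dn(1,2) r(2)])
  then have "bounded_sobolev n r (\<lambda>t. integral {t..} (coeff_a_deriv (Suc i)))" by (rule bounded_sobolev_pred[OF bounded_sobolev_tail])
  then have a: "bounded_sobolev n r (coeff_a (Suc i))" unfolding coeff_pair_simps by (rule bounded_sobolev_minus)
  show ?case unfolding r(1) coeff_pair_simps(5,6) using b a dn by blast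
qed

lemma coeff_b_deriv: "i \<le> Suc m \<Longrightarrow> has_ac_deriv (coeff_b i) (coeff_b_deriv i) \<and> weighted_sobolev n (Suc m - i) (coeff_b_deriv i)"
  unfolding coeff_b_deriv_def by (rule ac_deriv) (use coeff_pair_regular[of i] in simp)

lemma coeff_a_deriv_weighted_sobolev: "i \<le> Suc m \<Longrightarrow> weighted_sobolev n 0 (coeff_a_deriv i)"
proof -
  assume i: "i \<le> Suc m"
  have "weighted_sobolev n 0 (coeff_b i)" "weighted_sobolev n 0 (prev_b i)" "bounded_sobolev n 0 (prev_a i)"
    using coeff_pair_regular[OF i] weighted_sobolev_le[of n _ _ 0] bounded_sobolev_le[of n _ _ 0] by blast+
  then show ?thesis unfolding coeff_a_deriv_def by (intro weighted_sobolev_next_a) auto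
qed

lemma coeff_a_deriv: assumes "i \<le> Suc m" shows "has_ac_deriv (coeff_a i) (coeff_a_deriv i)"
proof (cases i)
  case 0
  have "coeff_a_deriv 0 = (\<lambda>_. 0)" unfolding coeff_a_deriv_def next_a_def[abs_def] coeff_pair_simps by simp
  then show ?thesis unfolding 0 coeff_pair_simps by (simp add: has_ac_deriv_const)
next
  case (Suc j)
  have "L1 (coeff_a_deriv i)" using weighted_L1_L1 coeff_a_deriv_weighted_sobolev[OF assms] by simp
  from has_ac_deriv_minus[OF has_ac_deriv_tail[OF this]] show ?thesis unfolding Suc coeff_pair_simps by simp
qed

lemma coeff_b_tendsto: "i \<le> Suc m \<Longrightarrow> (coeff_b i \<longlongrightarrow> 0) at_top"
  using coeff_pair_regular[of i] weighted_sobolev_tendsto_0[of n "Suc m - i" "coeff_b i"] by simp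

lemma coeff_a_tendsto: assumes "i \<le> Suc m" shows "(coeff_a i \<longlongrightarrow> (if i = 0 then 1 else 0)) at_top"
proof (cases i)
  case 0
  then show ?thesis unfolding 0 coeff_pair_simps by simp
next
  case (Suc j)
  have "L1 (coeff_a_deriv i)" using weighted_L1_L1 coeff_a_deriv_weighted_sobolev[OF assms] by simp
  from tendsto_minus[OF tail_tendsto_0[OF this]] show ?thesis unfolding Suc coeff_pair_simps by simp
qed

lemma coeff_pair_bounded: "i \<le> Suc m \<Longrightarrow> \<exists>C. \<forall>t\<ge>0. norm (coeff_b i t) \<le> C \<and> norm (coeff_a i t) \<le> C"
proof -
  assume i: "i \<le> Suc m"
  obtain C where C: "\<forall>t\<ge>0. norm (coeff_b i t) \<le> C" using coeff_pair_regular[OF i] weighted_sobolev_Suc_bounded_sobolev[of n "Suc m - i" "coeff_b i"] bounded_sobolev_bounded by fastforce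
  obtain D where D: "\<forall>t\<ge>0. norm (coeff_a i t) \<le> D" using coeff_pair_regular[OF i] bounded_sobolev_bounded by fastforce
  have "\<forall>t\<ge>0. norm (coeff_b i t) \<le> max C D \<and> norm (coeff_a i t) \<le> max C D" using C D by (auto simp: le_max_iff_disj)
  then show ?thesis by blast
qed

text \<open>
  The series for \<open>x\<close> is carried one term further than the one for \<open>y\<close>, because the leading term \<open>i k / 2\<close> of the
  phase shifts its coefficients by one order.
\<close>

definition ansatz_x :: "complex \<Rightarrow> real \<Rightarrow> complex" where "ansatz_x k t = (\<Sum>i\<le>Suc m. coeff_b i t * inverse k ^ i)"
definition ansatz_y :: "complex \<Rightarrow> real \<Rightarrow> complex" where "ansatz_y k t = (\<Sum>i\<le>m. coeff_a i t * inverse k ^ i)"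

text \<open>
  The coefficients of \<open>k\<^sup>-\<^sup>m\<^sup>-\<^sup>1\<close> and \<open>k\<^sup>-\<^sup>m\<^sup>-\<^sup>2\<close> that remain when the truncated series are inserted into the two
  equations.
\<close>

definition \<rho>1 where "\<rho>1 t = coeff_b_deriv (Suc m) t + (\<i> / 2 * coeff_b m t + \<i> / 4 * (c t * coeff_b m t)) + \<i> / 4 * (s t * coeff_a m t)"
definition \<rho>2 where "\<rho>2 t = \<i> / 2 * coeff_b (Suc m) t + \<i> / 4 * (c t * coeff_b (Suc m) t)"
definition \<sigma>1 where "\<sigma>1 t = - (u t / 4) * coeff_b (Suc m) t + \<i> / 4 * (s t * coeff_b m t - c t * coeff_a m t)"
definition \<sigma>2 where "\<sigma>2 t = \<i> / 4 * (s t * coeff_b (Suc m) t)"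

lemma ansatz_residual_step_x:
  fixes k \<kappa> h g w :: complex
  assumes "k * \<kappa> = 1" "z = h * (k + \<kappa>)" "h * B + w * A + X = 0"
    and "SD + z * SB + w * SA + g * \<kappa> * (C * SB + S * SA) = X * (\<kappa> * Q) + Y * (\<kappa> * (\<kappa> * Q))"
  shows "(SD + D2 * (\<kappa> * (\<kappa> * Q))) + z * (SB + B * (\<kappa> * (\<kappa> * Q))) + w * (SA + A * (\<kappa> * Q))
      + g * \<kappa> * (C * (SB + B * (\<kappa> * (\<kappa> * Q))) + S * (SA + A * (\<kappa> * Q)))
    = (D2 + Y + g * (S * A)) * (\<kappa> * (\<kappa> * Q)) + (h * B + g * (C * B)) * (\<kappa> * (\<kappa> * (\<kappa> * Q)))"
proof -
  define q where "q = \<kappa> * Q"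
  have "z * (B * (\<kappa> * q)) = h * B * ((k * \<kappa>) * q) + h * B * (\<kappa> * (\<kappa> * q))"
    unfolding assms(2) by (simp add: algebra_simps)
  then have 1: "z * (B * (\<kappa> * q)) = h * B * q + h * B * (\<kappa> * (\<kappa> * q))" unfolding assms(1) by simp
  have "(h * B + w * A + X) * q = 0" unfolding assms(3) by simp
  then have 2: "h * B * q + w * A * q + X * q = 0" by (simp only: distrib_right)
  have "(SD + D2 * (\<kappa> * q)) + z * (SB + B * (\<kappa> * q)) + w * (SA + A * q)
      + g * \<kappa> * (C * (SB + B * (\<kappa> * q)) + S * (SA + A * q))
    = (SD + z * SB + w * SA + g * \<kappa> * (C * SB + S * SA))
      + (D2 * (\<kappa> * q) + z * (B * (\<kappa> * q)) + w * A * q + g * \<kappa> * (C * (B * (\<kappa> * q)) + S * (A * q)))"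
    by (simp add: algebra_simps)
  also have "\<dots> = (X * q + Y * (\<kappa> * q)) + (D2 * (\<kappa> * q) + (h * B * q + h * B * (\<kappa> * (\<kappa> * q))) + w * A * q
      + g * \<kappa> * (C * (B * (\<kappa> * q)) + S * (A * q)))"
    unfolding 1 assms(4)[folded q_def] ..
  also have "\<dots> = (h * B * q + w * A * q + X * q) + ((D2 + Y + g * (S * A)) * (\<kappa> * q) + (h * B + g * (C * B)) * (\<kappa> * (\<kappa> * q)))"
    by (simp add: algebra_simps)
  finally show ?thesis unfolding q_def[symmetric] by (simp only: 2 add_0_left)
qed

lemma ansatz_residual_step_y:
  fixes \<kappa> g w :: complex
  assumes "D + X = 0"
    and "SD - w * SB + g * \<kappa> * (S * SB - C * SA) = X * (\<kappa> * Q) + Y * (\<kappa> * (\<kappa> * Q))"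
    and "Y = g * (S * b)"
  shows "(SD + D * (\<kappa> * Q)) - w * (SB + B * (\<kappa> * (\<kappa> * Q)))
      + g * \<kappa> * (S * (SB + B * (\<kappa> * (\<kappa> * Q))) - C * (SA + A * (\<kappa> * Q)))
    = (- w * B + g * (S * b - C * A)) * (\<kappa> * (\<kappa> * Q)) + g * (S * B) * (\<kappa> * (\<kappa> * (\<kappa> * Q)))"
proof -
  define q where "q = \<kappa> * Q"
  have "(D + X) * q = 0" unfolding assms(1) by simp
  then have 2: "D * q + X * q = 0" by (simp only: distrib_right)
  have "(SD + D * q) - w * (SB + B * (\<kappa> * q)) + g * \<kappa> * (S * (SB + B * (\<kappa> * q)) - C * (SA + A * q))
    = (SD - w * SB + g * \<kappa> * (S * SB - C * SA))
      + (D * q - w * (B * (\<kappa> * q)) + g * \<kappa> * (S * (B * (\<kappa> * q)) - C * (A * q)))"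
    by (simp add: algebra_simps)
  also have "\<dots> = (X * q + Y * (\<kappa> * q)) + (D * q - w * (B * (\<kappa> * q)) + g * \<kappa> * (S * (B * (\<kappa> * q)) - C * (A * q)))"
    unfolding assms(2)[folded q_def] ..
  also have "\<dots> = (D * q + X * q) + ((- w * B + g * (S * b - C * A)) * (\<kappa> * q) + g * (S * B) * (\<kappa> * (\<kappa> * q)))"
    unfolding assms(3) by (simp add: algebra_simps)
  finally show ?thesis unfolding q_def[symmetric] by (simp only: 2 add_0_left)
qed

text \<open>
  All lower orders cancel by the choice of the coefficients. In the induction on the order of truncation, the leading
  part of the previous residual is cancelled by the new coefficient.
\<close>

lemma ansatz_residual_x:
  assumes k: "k \<noteq> 0"
  shows "(\<Sum>i\<le>Suc p. coeff_b_deriv i t * inverse k ^ i) + phase k * (\<Sum>i\<le>Suc p. coeff_b i t * inverse k ^ i)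
      + u t / 4 * (\<Sum>i\<le>p. coeff_a i t * inverse k ^ i)
      + \<i> / 4 * inverse k * (c t * (\<Sum>i\<le>Suc p. coeff_b i t * inverse k ^ i) + s t * (\<Sum>i\<le>p. coeff_a i t * inverse k ^ i))
    = (coeff_b_deriv (Suc p) t + (\<i> / 2 * coeff_b p t + \<i> / 4 * (c t * coeff_b p t)) + \<i> / 4 * (s t * coeff_a p t)) * (inverse k * inverse k ^ p)
      + (\<i> / 2 * coeff_b (Suc p) t + \<i> / 4 * (c t * coeff_b (Suc p) t)) * (inverse k * (inverse k * inverse k ^ p))"
proof (induction p)
  case 0
  have b1: "coeff_b (Suc 0) t = 2 * \<i> * coeff_b_deriv 0 t + \<i> / 2 * u t" unfolding coeff_pair_simps(7) next_b_def by (simp add: coeff_pair_simps(1-4))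
  have r: "\<i> / 2 * coeff_b (Suc 0) t + u t / 4 + coeff_b_deriv 0 t = 0" unfolding b1 by (simp add: algebra_simps)
  have kk: "k * inverse k = 1" using k by simp
  have phase: "phase k = \<i> / 2 * (k + inverse k)" by (simp add: phase_def theta2_def inverse_eq_divide)
  have "coeff_b_deriv 0 t + coeff_b_deriv (Suc 0) t * inverse k + phase k * (coeff_b (Suc 0) t * inverse k) + u t / 4
      + \<i> / 4 * inverse k * (c t * (coeff_b (Suc 0) t * inverse k) + s t)
     = (coeff_b_deriv (Suc 0) t + \<i> / 4 * s t) * inverse k
      + (\<i> / 2 * coeff_b (Suc 0) t + \<i> / 4 * (c t * coeff_b (Suc 0) t)) * (inverse k * inverse k)"
  proof -
    let ?B = "coeff_b (Suc 0) t" and ?\<kappa> = "inverse k"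
    have d0: "coeff_b_deriv 0 t = - (\<i> / 2 * ?B + u t / 4)" using r by (simp only: add_eq_0_iff)
    have "phase k * (?B * ?\<kappa>) = \<i> / 2 * ?B * (k * ?\<kappa>) + \<i> / 2 * ?B * (?\<kappa> * ?\<kappa>)" unfolding phase by (simp add: algebra_simps)
    then have z: "phase k * (?B * ?\<kappa>) = \<i> / 2 * ?B + \<i> / 2 * ?B * (?\<kappa> * ?\<kappa>)" unfolding kk by simp
    show ?thesis unfolding z d0 by (simp add: algebra_simps)
  qed
  then show ?case by (simp add: coeff_pair_simps(1-4))
next
  case (Suc p)
  let ?B = "coeff_b (Suc (Suc p)) t" and ?A = "coeff_a (Suc p) t"
  have B: "?B = 2 * \<i> * coeff_b_deriv (Suc p) t - coeff_b p t + \<i> / 2 * (?A * u t) - 1 / 2 * (coeff_b p t * c t + coeff_a p t * s t)"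
    by (subst coeff_pair_simps(7)) (simp add: next_b_def coeff_pair_simps(5,6))
  have rec: "\<i> / 2 * ?B + u t / 4 * ?A + (coeff_b_deriv (Suc p) t + (\<i> / 2 * coeff_b p t + \<i> / 4 * (c t * coeff_b p t)) + \<i> / 4 * (s t * coeff_a p t)) = 0"
    unfolding B by (simp add: algebra_simps)
  have kk: "k * inverse k = 1" using k by simp
  have phase: "phase k = \<i> / 2 * (k + inverse k)" by (simp add: phase_def theta2_def inverse_eq_divide)
  show ?case
    unfolding sum.atMost_Suc[of _ "Suc p"] sum.atMost_Suc[of "\<lambda>i. coeff_a i t * inverse k ^ i" p] power_Suc
    using ansatz_residual_step_x[OF kk phase rec Suc.IH] by (simp only: power_Suc add.assoc)
qed

lemma ansatz_residual_y:
  shows "(\<Sum>i\<le>p. coeff_a_deriv i t * inverse k ^ i) - u t / 4 * (\<Sum>i\<le>Suc p. coeff_b i t * inverse k ^ i)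
      + \<i> / 4 * inverse k * (s t * (\<Sum>i\<le>Suc p. coeff_b i t * inverse k ^ i) - c t * (\<Sum>i\<le>p. coeff_a i t * inverse k ^ i))
    = (- (u t / 4) * coeff_b (Suc p) t + \<i> / 4 * (s t * coeff_b p t - c t * coeff_a p t)) * (inverse k * inverse k ^ p)
      + (\<i> / 4 * (s t * coeff_b (Suc p) t)) * (inverse k * (inverse k * inverse k ^ p))"
proof (induction p)
  case 0
  have "coeff_a_deriv 0 t = 0" unfolding coeff_a_deriv_def next_a_def coeff_pair_simps by simp
  then show ?case by (simp add: coeff_pair_simps(1-4) algebra_simps)
next
  case (Suc p)
  have rec: "coeff_a_deriv (Suc p) t + (- (u t / 4) * coeff_b (Suc p) t + \<i> / 4 * (s t * coeff_b p t - c t * coeff_a p t)) = 0"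
    unfolding coeff_a_deriv_def next_a_def coeff_pair_simps(5,6) by (simp add: algebra_simps)
  show ?case
    unfolding sum.atMost_Suc[of _ "Suc p"] sum.atMost_Suc[of "\<lambda>i. coeff_a i t * inverse k ^ i" p]
      sum.atMost_Suc[of "\<lambda>i. coeff_a_deriv i t * inverse k ^ i" p] power_Suc
    using ansatz_residual_step_y[OF rec Suc.IH refl] by (simp only: power_Suc)
qed

lemma defect_weighted_L1: "weighted_L1 n \<rho>1" "weighted_L1 n \<rho>2" "weighted_L1 n \<sigma>1" "weighted_L1 n \<sigma>2"
proof -
  have B: "weighted_sobolev n 0 (coeff_b i)" "bounded_sobolev n 0 (coeff_a i)" if "i \<le> Suc m" for i
    using coeff_pair_regular[OF that] weighted_sobolev_le[of n _ _ 0] bounded_sobolev_le[of n _ _ 0] by blast+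
  have bd: "bounded_sobolev n 0 u" "bounded_sobolev n 0 s" "bounded_sobolev n 0 c" using weighted_sobolev_Suc_bounded_sobolev[OF u] weighted_sobolev_Suc_bounded_sobolev[OF s] weighted_sobolev_Suc_bounded_sobolev[OF c] bounded_sobolev_pred by blast+
  have a: "weighted_sobolev n 0 (\<lambda>t. coeff_a m t * c t)" "weighted_sobolev n 0 (\<lambda>t. coeff_a m t * s t)"
    using weighted_sobolev_mult[of n 0 c "coeff_a m"] weighted_sobolev_mult[of n 0 s "coeff_a m"] weighted_L1_coeffs B(2)[of m] by simp_all
  have a': "weighted_sobolev n 0 (\<lambda>t. c t * coeff_a m t)" "weighted_sobolev n 0 (\<lambda>t. s t * coeff_a m t)" using a by (simp_all add: mult.commute)
  have d: "weighted_sobolev n 0 (coeff_b_deriv (Suc m))" using coeff_b_deriv[of "Suc m"] by simp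
  have M: "weighted_sobolev n 0 (\<lambda>t. c t * coeff_b m t)" "weighted_sobolev n 0 (\<lambda>t. c t * coeff_b (Suc m) t)" "weighted_sobolev n 0 (\<lambda>t. s t * coeff_b m t)"
    "weighted_sobolev n 0 (\<lambda>t. s t * coeff_b (Suc m) t)" "weighted_sobolev n 0 (\<lambda>t. u t * coeff_b (Suc m) t)"
    by (intro weighted_sobolev_mult B bd; simp)+
  have "weighted_sobolev n 0 \<rho>1" unfolding \<rho>1_def[abs_def] by (intro weighted_sobolev_add weighted_sobolev_cmult d B M a') simp
  moreover have "weighted_sobolev n 0 \<rho>2" unfolding \<rho>2_def[abs_def] by (intro weighted_sobolev_add weighted_sobolev_cmult B M) simp
  moreover have "weighted_sobolev n 0 (\<lambda>t. - (1 / 4) * (u t * coeff_b (Suc m) t) + \<i> / 4 * (s t * coeff_b m t - c t * coeff_a m t))"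
    by (intro weighted_sobolev_add weighted_sobolev_diff weighted_sobolev_cmult M a')
  then have "weighted_sobolev n 0 \<sigma>1" unfolding \<sigma>1_def[abs_def] by simp
  moreover have "weighted_sobolev n 0 \<sigma>2" unfolding \<sigma>2_def[abs_def] by (intro weighted_sobolev_cmult M)
  ultimately show "weighted_L1 n \<rho>1" "weighted_L1 n \<rho>2" "weighted_L1 n \<sigma>1" "weighted_L1 n \<sigma>2" by simp_all
qed

definition defect_x :: "complex \<Rightarrow> real \<Rightarrow> complex" where
  "defect_x k t = (inverse k * inverse k ^ m) * \<rho>1 t + (inverse k * (inverse k * inverse k ^ m)) * \<rho>2 t"
definition defect_y :: "complex \<Rightarrow> real \<Rightarrow> complex" where
  "defect_y k t = (inverse k * inverse k ^ m) * \<sigma>1 t + (inverse k * (inverse k * inverse k ^ m)) * \<sigma>2 t"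

lemma ansatz_ode:
  assumes k: "k \<noteq> 0"
  shows "has_ac_deriv (ansatz_x k) (\<lambda>t. - phase k * ansatz_x k t + rhs_x u s c k (ansatz_x k) (ansatz_y k) t + defect_x k t)"
    and "has_ac_deriv (ansatz_y k) (\<lambda>t. rhs_y u s c k (ansatz_x k) (ansatz_y k) t + defect_y k t)"
proof -
  have i4: "\<i> / (4 * k) = \<i> / 4 * inverse k" by (simp add: inverse_eq_divide)
  have "has_ac_deriv (\<lambda>t. \<Sum>i\<le>Suc m. inverse k ^ i * coeff_b i t) (\<lambda>t. \<Sum>i\<le>Suc m. inverse k ^ i * coeff_b_deriv i t)"
    by (intro has_ac_deriv_sum has_ac_deriv_cmult) (use coeff_b_deriv in auto)
  then have "has_ac_deriv (ansatz_x k) (\<lambda>t. \<Sum>i\<le>Suc m. inverse k ^ i * coeff_b_deriv i t)"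
    by (rule has_ac_deriv_cong) (simp add: ansatz_x_def mult.commute)
  then show "has_ac_deriv (ansatz_x k) (\<lambda>t. - phase k * ansatz_x k t + rhs_x u s c k (ansatz_x k) (ansatz_y k) t + defect_x k t)"
  proof (rule has_ac_deriv_cong_deriv)
    fix t :: real
    have RA: "defect_x k t = \<rho>1 t * (inverse k * inverse k ^ m) + \<rho>2 t * (inverse k * (inverse k * inverse k ^ m))"
      unfolding defect_x_def by (simp only: mult.commute)
    have sumeq: "(\<Sum>i\<le>Suc m. inverse k ^ i * coeff_b_deriv i t) = (\<Sum>i\<le>Suc m. coeff_b_deriv i t * inverse k ^ i)"
      by (simp only: mult.commute)
    have R: "(\<Sum>i\<le>Suc m. coeff_b_deriv i t * inverse k ^ i) + phase k * ansatz_x k t + u t / 4 * ansatz_y k t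
        + \<i> / 4 * inverse k * (c t * ansatz_x k t + s t * ansatz_y k t) = defect_x k t"
      using ansatz_residual_x[OF k, where p = m and t = t]
      unfolding RA \<rho>1_def \<rho>2_def ansatz_x_def ansatz_y_def .
    show "(\<Sum>i\<le>Suc m. inverse k ^ i * coeff_b_deriv i t) = - phase k * ansatz_x k t + rhs_x u s c k (ansatz_x k) (ansatz_y k) t + defect_x k t"
      unfolding rhs_x_def i4 sumeq R[symmetric] by simp
  qed
  have "has_ac_deriv (\<lambda>t. \<Sum>i\<le>m. inverse k ^ i * coeff_a i t) (\<lambda>t. \<Sum>i\<le>m. inverse k ^ i * coeff_a_deriv i t)"
    by (intro has_ac_deriv_sum has_ac_deriv_cmult) (use coeff_a_deriv in auto)
  then have "has_ac_deriv (ansatz_y k) (\<lambda>t. \<Sum>i\<le>m. inverse k ^ i * coeff_a_deriv i t)"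
    by (rule has_ac_deriv_cong) (simp add: ansatz_y_def mult.commute)
  then show "has_ac_deriv (ansatz_y k) (\<lambda>t. rhs_y u s c k (ansatz_x k) (ansatz_y k) t + defect_y k t)"
  proof (rule has_ac_deriv_cong_deriv)
    fix t :: real
    have RA: "defect_y k t = \<sigma>1 t * (inverse k * inverse k ^ m) + \<sigma>2 t * (inverse k * (inverse k * inverse k ^ m))"
      unfolding defect_y_def by (simp only: mult.commute)
    have sumeq: "(\<Sum>i\<le>m. inverse k ^ i * coeff_a_deriv i t) = (\<Sum>i\<le>m. coeff_a_deriv i t * inverse k ^ i)"
      by (simp only: mult.commute)
    have R: "(\<Sum>i\<le>m. coeff_a_deriv i t * inverse k ^ i) - u t / 4 * ansatz_x k t
        + \<i> / 4 * inverse k * (s t * ansatz_x k t - c t * ansatz_y k t) = defect_y k t"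
      using ansatz_residual_y[where p = m and t = t and k = k]
      unfolding RA \<sigma>1_def \<sigma>2_def ansatz_x_def ansatz_y_def .
    show "(\<Sum>i\<le>m. inverse k ^ i * coeff_a_deriv i t) = rhs_y u s c k (ansatz_x k) (ansatz_y k) t + defect_y k t"
      unfolding rhs_y_def i4 sumeq R[symmetric] by simp
  qed
qed

lemma ansatz_bounded: "\<exists>C. \<forall>t\<ge>0. norm (ansatz_x k t) \<le> C \<and> norm (ansatz_y k t) \<le> C"
proof -
  obtain C where C: "\<And>i t. i \<le> Suc m \<Longrightarrow> 0 \<le> t \<Longrightarrow> norm (coeff_b i t) \<le> C i \<and> norm (coeff_a i t) \<le> C i"
    using coeff_pair_bounded by metis
  have "norm (ansatz_x k t) \<le> (\<Sum>i\<le>Suc m. C i * norm (inverse k ^ i))" if "0 \<le> t" for t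
    unfolding ansatz_x_def by (rule sum_norm_le) (use C that in \<open>auto simp: norm_mult intro!: mult_right_mono\<close>)
  moreover have "norm (ansatz_y k t) \<le> (\<Sum>i\<le>m. C i * norm (inverse k ^ i))" if "0 \<le> t" for t
    unfolding ansatz_y_def by (rule sum_norm_le) (use C that in \<open>auto simp: norm_mult intro!: mult_right_mono\<close>)
  ultimately show ?thesis
    by (intro exI[of _ "max (\<Sum>i\<le>Suc m. C i * norm (inverse k ^ i)) (\<Sum>i\<le>m. C i * norm (inverse k ^ i))"])
      (meson le_max_iff_disj)
qed

lemma ansatz_tendsto: "(ansatz_x k \<longlongrightarrow> 0) at_top" "(ansatz_y k \<longlongrightarrow> 1) at_top"
proof -
  have "((\<lambda>t. \<Sum>i\<le>Suc m. coeff_b i t * inverse k ^ i) \<longlongrightarrow> (\<Sum>i\<le>Suc m. 0 * inverse k ^ i)) at_top"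
    by (intro tendsto_sum tendsto_mult tendsto_const coeff_b_tendsto) simp
  then show "(ansatz_x k \<longlongrightarrow> 0) at_top" unfolding ansatz_x_def[abs_def] by simp
  have "((\<lambda>t. \<Sum>i\<le>m. coeff_a i t * inverse k ^ i) \<longlongrightarrow> (\<Sum>i\<le>m. (if i = 0 then 1 else 0) * inverse k ^ i)) at_top"
    by (intro tendsto_sum tendsto_mult tendsto_const coeff_a_tendsto) simp
  moreover have "(\<Sum>i\<le>m. (if i = 0 then 1 else 0) * inverse k ^ i) = 1"
    using sum.delta[of "{..m}" 0 "\<lambda>i. inverse k ^ i"] by (simp add: if_distrib[of "\<lambda>x. x * _"] cong: if_cong)
  ultimately show "(ansatz_y k \<longlongrightarrow> 1) at_top" unfolding ansatz_y_def[abs_def] by simp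
qed

lemma rhs_diff:
  "rhs_x u s c k x y t - rhs_x u s c k x' y' t = rhs_x u s c k (\<lambda>t. x t - x' t) (\<lambda>t. y t - y' t) t"
  "rhs_y u s c k x y t - rhs_y u s c k x' y' t = rhs_y u s c k (\<lambda>t. x t - x' t) (\<lambda>t. y t - y' t) t"
  by (simp_all add: rhs_x_def rhs_y_def diff_divide_distrib add_divide_distrib algebra_simps)

lemma exp_transform_cong: "(\<And>s. 0 \<le> s \<Longrightarrow> f s = g s) \<Longrightarrow> 0 \<le> t \<Longrightarrow> exp_transform \<zeta> f t = exp_transform \<zeta> g t"
  unfolding exp_transform_def by (rule integral_cong) auto

definition one :: "real \<Rightarrow>\<^sub>C complex" where "one = const_bcontfun 1"

definition forcing :: "complex \<Rightarrow> state" where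
  "forcing k =
    ((1 / k ^ (m + 1)) *\<^sub>c tail_op (phase k) 0 \<rho>1 one + (1 / k ^ (m + 2)) *\<^sub>c tail_op (phase k) 0 \<rho>2 one,
     (1 / k ^ (m + 1)) *\<^sub>c tail_op 0 0 \<sigma>1 one + (1 / k ^ (m + 2)) *\<^sub>c tail_op 0 0 \<sigma>2 one)"

lemma forcing_derivs_bounded: "derivs_bounded outer_region n (\<lambda>_ k. 1 / norm k ^ (m + 1)) forcing"
proof -
  have J: "derivs_bounded outer_region n (\<lambda>_ _. 1) (\<lambda>k. tail_op (phase k) 0 \<rho> one)" and J0: "derivs_bounded outer_region n (\<lambda>_ _. 1) (\<lambda>k. tail_op 0 0 \<rho> one)"
    if "weighted_L1 n \<rho>" for \<rho>
  proof -
    have "op_smooth outer_region n (\<lambda>k. tail_op (phase k) 0 \<rho>)" "op_smooth outer_region n (\<lambda>k. tail_op 0 0 \<rho>)"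
      using op_smooth_tail_op[OF that derivs_bounded_phase, of 0] op_smooth_tail_op[OF that derivs_bounded_zero_exponent, of _ 0] outer_region_D by auto
    then show "derivs_bounded outer_region n (\<lambda>_ _. 1) (\<lambda>k. tail_op (phase k) 0 \<rho> one)" "derivs_bounded outer_region n (\<lambda>_ _. 1) (\<lambda>k. tail_op 0 0 \<rho> one)"
      by (auto intro: op_smooth_apply[OF _ derivs_bounded_const])
  qed
  have p1: "derivs_bounded outer_region n (\<lambda>_ k. 1 / norm k ^ (m + 1)) (\<lambda>k. 1 / k ^ (m + 1) :: complex)" by (rule derivs_bounded_inverse_power)
  have p2: "derivs_bounded outer_region n (\<lambda>_ k. 1 / norm k ^ (m + 1)) (\<lambda>k. 1 / k ^ (m + 2) :: complex)"
    by (rule derivs_bounded_outer_region_weight_le[OF derivs_bounded_inverse_power]) simp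
  have "derivs_bounded outer_region n (\<lambda>_ k. 1 / norm k ^ (m + 1) * 1) forcing"
    unfolding forcing_def[abs_def]
    by (rule derivs_bounded_Pair[OF derivs_bounded_add[OF derivs_bounded_scaleC[OF p1 J] derivs_bounded_scaleC[OF p2 J]] derivs_bounded_add[OF derivs_bounded_scaleC[OF p1 J0] derivs_bounded_scaleC[OF p2 J0]]])
      (rule defect_weighted_L1)+
  then show ?thesis by simp
qed

lemma forcing_apply:
  assumes k: "k \<in> outer_region"
  shows "apply_bcontfun (fst (forcing k)) t = exp_transform (phase k) (defect_x k) (max t 0)"
    "apply_bcontfun (snd (forcing k)) t = exp_transform 0 (defect_y k) (max t 0)"
proof -
  have Re: "Re (phase k) \<le> 0" and R0: "Re (0::complex) \<le> 0" and k0: "k \<noteq> 0" using outer_region_D[OF k] by auto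
  have t: "0 \<le> max t 0" by simp
  have p: "1 / k ^ (m + 1) = inverse k * inverse k ^ m" "1 / k ^ (m + 2) = inverse k * (inverse k * inverse k ^ m)"
    by (simp_all add: inverse_eq_divide power_one_over)
  have J: "apply_bcontfun (tail_op \<zeta> 0 \<rho> one) t = exp_transform \<zeta> \<rho> (max t 0)" if "weighted_L1 n \<rho>" "Re \<zeta> \<le> 0" for \<zeta> \<rho>
    by (simp add: apply_tail_op_0[OF that] one_def const_bcontfun.rep_eq)
  note L = defect_weighted_L1[THEN weighted_L1_L1]
  show "apply_bcontfun (fst (forcing k)) t = exp_transform (phase k) (defect_x k) (max t 0)"
    unfolding defect_x_def[abs_def] exp_transform_lin[OF L(1,2) Re t] forcing_def p fst_conv plus_bcontfun.rep_eq
      apply_scaleC_bcontfun J[OF defect_weighted_L1(1) Re] J[OF defect_weighted_L1(2) Re] by simp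
  show "apply_bcontfun (snd (forcing k)) t = exp_transform 0 (defect_y k) (max t 0)"
    unfolding defect_y_def[abs_def] exp_transform_lin[OF L(3,4) R0 t] forcing_def p snd_conv plus_bcontfun.rep_eq
      apply_scaleC_bcontfun J[OF defect_weighted_L1(3) R0] J[OF defect_weighted_L1(4) R0] by simp
qed

text \<open>
  The difference between the solution and the truncated series satisfies the differential equation with
  the defects as inhomogeneity and has limit zero, so it satisfies the Volterra equation with the forcing
  \<open>O(k\<^sup>-\<^sup>m\<^sup>-\<^sup>1)\<close>.
\<close>

lemma remainder_equation:
  assumes k: "k \<in> outer_region" and lax_solution: "lax_solution u s c k x y"
  defines "e1 \<equiv> \<lambda>t. x t - ansatz_x k t" and "e2 \<equiv> \<lambda>t. y t - ansatz_y k t"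
  shows "(to_bcontfun e1, to_bcontfun e2) = forcing k + volterra_op k (to_bcontfun e1, to_bcontfun e2)"
    and "apply_bcontfun (to_bcontfun e1) 0 = x 0 - ansatz_x k 0" "apply_bcontfun (to_bcontfun e2) 0 = y 0 - ansatz_y k 0"
proof -
  have Re: "Re (phase k) \<le> 0" and R0: "Re (0::complex) \<le> 0" and k0: "k \<noteq> 0" using outer_region_D[OF k] by auto
  note S = lax_solution[unfolded lax_solution_def]
  obtain C where C: "\<forall>t\<ge>0. norm (x t) \<le> C \<and> norm (y t) \<le> C" using S by blast
  obtain D where D: "\<forall>t\<ge>0. norm (ansatz_x k t) \<le> D \<and> norm (ansatz_y k t) \<le> D" using ansatz_bounded by blast
  have b1: "norm (e1 t) \<le> C + D" and b2: "norm (e2 t) \<le> C + D" if "0 \<le> t" for t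
    using C D that norm_triangle_ineq4[of "x t" "ansatz_x k t"] norm_triangle_ineq4[of "y t" "ansatz_y k t"]
    unfolding e1_def e2_def by (meson add_mono order_trans)+
  have a1: "has_ac_deriv e1 (\<lambda>t. - phase k * e1 t + (rhs_x u s c k e1 e2 t - defect_x k t))"
  proof (rule has_ac_deriv_cong_deriv)
    show "has_ac_deriv e1 (\<lambda>t. (- phase k * x t + rhs_x u s c k x y t) - (- phase k * ansatz_x k t + rhs_x u s c k (ansatz_x k) (ansatz_y k) t + defect_x k t))"
      unfolding e1_def using S ansatz_ode[OF k0] by (intro has_ac_deriv_diff) auto
    show "(- phase k * x t + rhs_x u s c k x y t) - (- phase k * ansatz_x k t + rhs_x u s c k (ansatz_x k) (ansatz_y k) t + defect_x k t)
      = - phase k * e1 t + (rhs_x u s c k e1 e2 t - defect_x k t)" for t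
      unfolding e1_def e2_def rhs_diff[symmetric] by (simp add: algebra_simps)
  qed
  have a2: "has_ac_deriv e2 (\<lambda>t. rhs_y u s c k e1 e2 t - defect_y k t)"
  proof (rule has_ac_deriv_cong_deriv)
    show "has_ac_deriv e2 (\<lambda>t. rhs_y u s c k x y t - (rhs_y u s c k (ansatz_x k) (ansatz_y k) t + defect_y k t))"
      unfolding e2_def using S ansatz_ode[OF k0] by (intro has_ac_deriv_diff) auto
    show "rhs_y u s c k x y t - (rhs_y u s c k (ansatz_x k) (ansatz_y k) t + defect_y k t) = rhs_y u s c k e1 e2 t - defect_y k t" for t
      unfolding e1_def e2_def rhs_diff[symmetric] by simp
  qed
  have c1: "continuous_on {0..} e1" and c2: "continuous_on {0..} e2" using a1 a2 has_ac_deriv_continuous by blast+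
  note A1 = apply_to_bcontfun[OF c1 b1] and A2 = apply_to_bcontfun[OF c2 b2]
  show "apply_bcontfun (to_bcontfun e1) 0 = x 0 - ansatz_x k 0" "apply_bcontfun (to_bcontfun e2) 0 = y 0 - ansatz_y k 0"
    by (simp_all add: A1 A2) (simp_all add: e1_def e2_def)
  have Lf: "L1 (rhs_x u s c k e1 e2)" "L1 (rhs_y u s c k e1 e2)"
    using L1_rhs[of e1 "C + D" e2] c1 c2 b1 b2 by blast+
  have LR: "L1 (defect_x k)" "L1 (defect_y k)" unfolding defect_x_def[abs_def] defect_y_def[abs_def]
    by (intro set_integral_add(1) set_integrable_mult_right defect_weighted_L1[THEN weighted_L1_L1])+
  have l1: "(e1 \<longlongrightarrow> 0) at_top" unfolding e1_def using tendsto_diff[OF _ ansatz_tendsto(1)] S by fastforce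
  have l2: "(e2 \<longlongrightarrow> 0) at_top" unfolding e2_def using tendsto_diff[OF _ ansatz_tendsto(2)] S by fastforce
  have E1: "e1 t = - exp_transform (phase k) (rhs_x u s c k e1 e2) t + exp_transform (phase k) (defect_x k) t" if t: "0 \<le> t" for t
  proof -
    have "e1 t = - exp_transform (phase k) (\<lambda>t. 1 * rhs_x u s c k e1 e2 t + (- 1) * defect_x k t) t"
      by (rule has_ac_deriv_eq_exp_transform[OF a1 _ l1 Re _ t]) (use set_integral_diff(1)[OF Lf(1) LR(1)] in auto)
    then show ?thesis unfolding exp_transform_lin[OF Lf(1) LR(1) Re t] by simp
  qed
  have E2: "e2 t = - exp_transform 0 (rhs_y u s c k e1 e2) t + exp_transform 0 (defect_y k) t" if t: "0 \<le> t" for t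
  proof -
    have "e2 t = - exp_transform 0 (\<lambda>t. 1 * rhs_y u s c k e1 e2 t + (- 1) * defect_y k t) t"
      by (rule has_ac_deriv_eq_exp_transform[OF a2 _ l2 R0 _ t]) (use set_integral_diff(1)[OF Lf(2) LR(2)] in auto)
    then show ?thesis unfolding exp_transform_lin[OF Lf(2) LR(2) R0 t] by simp
  qed
  show "(to_bcontfun e1, to_bcontfun e2) = forcing k + volterra_op k (to_bcontfun e1, to_bcontfun e2)"
  proof (intro prod_eqI bcontfun_eqI)
    fix t :: real
    have t: "0 \<le> max t 0" by simp
    have "exp_transform (phase k) (rhs_x u s c k (apply_bcontfun (to_bcontfun e1)) (apply_bcontfun (to_bcontfun e2))) (max t 0)
      = exp_transform (phase k) (rhs_x u s c k e1 e2) (max t 0)"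
      by (rule exp_transform_cong[OF _ t]) (simp add: rhs_x_def A1 A2)
    then show "apply_bcontfun (fst (to_bcontfun e1, to_bcontfun e2)) t = apply_bcontfun (fst (forcing k + volterra_op k (to_bcontfun e1, to_bcontfun e2))) t"
      unfolding fst_add plus_bcontfun.rep_eq volterra_op_apply(1)[OF Re] forcing_apply[OF k] fst_conv snd_conv
      by (simp add: A1 E1)
    have "exp_transform 0 (rhs_y u s c k (apply_bcontfun (to_bcontfun e1)) (apply_bcontfun (to_bcontfun e2))) (max t 0)
      = exp_transform 0 (rhs_y u s c k e1 e2) (max t 0)"
      by (rule exp_transform_cong[OF _ t]) (simp add: rhs_y_def A1 A2)
    then show "apply_bcontfun (snd (to_bcontfun e1, to_bcontfun e2)) t = apply_bcontfun (snd (forcing k + volterra_op k (to_bcontfun e1, to_bcontfun e2))) t"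
      unfolding snd_add plus_bcontfun.rep_eq volterra_op_apply(2)[OF Re] forcing_apply[OF k] fst_conv snd_conv
      by (simp add: A2 E2)
  qed
qed

text \<open>
  The remainder inherits the size of the forcing, derivatives included, and evaluation at \<open>t = 0\<close> is bounded and
  linear. The coefficients are the values \<open>b\<^sub>i(0)\<close> and \<open>a\<^sub>i(0)\<close>.
\<close>

theorem lax_expansion_at_infinity:
  assumes lax_solution: "\<And>k. k \<in> outer_region \<Longrightarrow> lax_solution u s c k (X k) (Y k)"
  shows "\<exists>cA cB. derivs_bounded outer_region n (\<lambda>_ k. 1 / norm k ^ (m + 1)) (\<lambda>k. X k 0 - (\<Sum>i=1..m. cB i / k ^ i)) \<and>
     derivs_bounded outer_region n (\<lambda>_ k. 1 / norm k ^ (m + 1)) (\<lambda>k. Y k 0 - (1 + (\<Sum>i=1..m. cA i / k ^ i)))"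
proof -
  define z where "z k = (to_bcontfun (\<lambda>t. X k t - ansatz_x k t), to_bcontfun (\<lambda>t. Y k t - ansatz_y k t))" for k
  have "derivs_bounded outer_region n (\<lambda>_ k. 1 / norm k ^ (m + 1)) z"
    by (rule derivs_bounded_solution[OF forcing_derivs_bounded]) (unfold z_def, rule remainder_equation(1)[OF _ lax_solution])
  have f: "derivs_bounded outer_region n (\<lambda>_ k. 1 / norm k ^ (m + 1)) (\<lambda>k. apply_bcontfun (fst (z k)) 0)"
    by (rule derivs_bounded_clinear[OF _ _ _ \<open>derivs_bounded outer_region n _ z\<close>, where L = "\<lambda>z. apply_bcontfun (fst z) 0"])
      (auto simp: plus_bcontfun.rep_eq intro: order_trans[OF norm_bounded norm_fst_le])
  have g: "derivs_bounded outer_region n (\<lambda>_ k. 1 / norm k ^ (m + 1)) (\<lambda>k. apply_bcontfun (snd (z k)) 0)"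
    by (rule derivs_bounded_clinear[OF _ _ _ \<open>derivs_bounded outer_region n _ z\<close>, where L = "\<lambda>z. apply_bcontfun (snd z) 0"])
      (auto simp: plus_bcontfun.rep_eq intro: order_trans[OF norm_bounded norm_snd_le])
  \<comment> \<open>the extra term of \<open>ansatz_x\<close> has the size of the error\<close>
  have "derivs_bounded outer_region n (\<lambda>_ k. 1 / norm k ^ (m + 1)) (\<lambda>k. apply_bcontfun (fst (z k)) 0 + coeff_b (Suc m) 0 / k ^ (m + 1))"
    by (rule derivs_bounded_add[OF f derivs_bounded_inverse_power])
  then have 1: "derivs_bounded outer_region n (\<lambda>_ k. 1 / norm k ^ (m + 1)) (\<lambda>k. X k 0 - (\<Sum>i=1..m. coeff_b i 0 / k ^ i))"
  proof (rule derivs_bounded_cong)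
    fix k assume k: "k \<in> outer_region"
    have "ansatz_x k 0 = (\<Sum>i\<le>m. coeff_b i 0 * inverse k ^ i) + coeff_b (Suc m) 0 / k ^ (m + 1)"
      unfolding ansatz_x_def by (simp add: inverse_eq_divide power_one_over)
    also have "(\<Sum>i\<le>m. coeff_b i 0 * inverse k ^ i) = (\<Sum>i=1..m. coeff_b i 0 / k ^ i)"
      by (rule sum.mono_neutral_cong_right) (auto simp: coeff_pair_simps inverse_eq_divide power_one_over Suc_le_eq intro!: Nat.gr0I)
    finally show "apply_bcontfun (fst (z k)) 0 + coeff_b (Suc m) 0 / k ^ (m + 1) = X k 0 - (\<Sum>i=1..m. coeff_b i 0 / k ^ i)"
      unfolding z_def fst_conv remainder_equation(2)[OF k lax_solution[OF k]] by simp
  qed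
  have 2: "derivs_bounded outer_region n (\<lambda>_ k. 1 / norm k ^ (m + 1)) (\<lambda>k. Y k 0 - (1 + (\<Sum>i=1..m. coeff_a i 0 / k ^ i)))"
    using g
  proof (rule derivs_bounded_cong)
    fix k assume k: "k \<in> outer_region"
    have "ansatz_y k 0 = (\<Sum>i\<in>insert 0 {1..m}. coeff_a i 0 * inverse k ^ i)"
      unfolding ansatz_y_def by (rule sum.cong) auto
    also have "\<dots> = 1 + (\<Sum>i=1..m. coeff_a i 0 / k ^ i)"
      by (subst sum.insert) (auto simp: coeff_pair_simps inverse_eq_divide power_one_over)
    finally show "apply_bcontfun (snd (z k)) 0 = Y k 0 - (1 + (\<Sum>i=1..m. coeff_a i 0 / k ^ i))"
      unfolding z_def snd_conv remainder_equation(3)[OF k lax_solution[OF k]] by simp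
  qed
  show ?thesis
    by (rule exI[of _ "\<lambda>i. coeff_a i 0"], rule exI[of _ "\<lambda>i. coeff_b i 0"], rule conjI[OF 1 2])
qed

end

section \<open>Test functions and weak derivatives\<close>

primrec smooth_upto :: "nat \<Rightarrow> (real \<Rightarrow> real) \<Rightarrow> bool" where
  "smooth_upto 0 f \<longleftrightarrow> (\<forall>x. f field_differentiable at x)"
| "smooth_upto (Suc j) f \<longleftrightarrow> (\<forall>x. f field_differentiable at x) \<and> smooth_upto j (deriv f)"

lemma smooth_upto_differentiable: "smooth_upto j f \<Longrightarrow> f field_differentiable at x"
  by (cases j) auto

lemma smooth_upto_DERIV: "smooth_upto j f \<Longrightarrow> (f has_field_derivative deriv f x) (at x)"
  by (rule field_differentiable_derivI) (rule smooth_upto_differentiable)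

lemma smooth_upto_continuous: "smooth_upto j f \<Longrightarrow> continuous_on S f"
  by (rule continuous_at_imp_continuous_on) (use DERIV_isCont[OF smooth_upto_DERIV] in blast)

lemma smooth_upto_funpow: "smooth_upto j f \<Longrightarrow> (deriv ^^ j) f field_differentiable at x"
  by (induction j arbitrary: f) (auto simp: funpow_swap1)

lemma smooth_upto_SucI:
  assumes "\<And>x. (f has_field_derivative f' x) (at x)" "smooth_upto j f'"
  shows "smooth_upto (Suc j) f"
proof -
  have "deriv f = f'" using assms(1) by (intro ext DERIV_imp_deriv)
  then show ?thesis using assms by (auto simp: field_differentiable_def)
qed

lemma smooth_upto_pred: "smooth_upto (Suc j) f \<Longrightarrow> smooth_upto j f"
  by (induction j arbitrary: f) auto

lemma smooth_upto_add: "smooth_upto j f \<Longrightarrow> smooth_upto j g \<Longrightarrow> smooth_upto j (\<lambda>x. f x + g x)"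
proof (induction j arbitrary: f g)
  case (Suc j)
  show ?case
    by (rule smooth_upto_SucI[OF DERIV_add[OF smooth_upto_DERIV[OF Suc.prems(1)] smooth_upto_DERIV[OF Suc.prems(2)]]])
      (use Suc in simp)
qed (auto intro: field_differentiable_add)

lemma smooth_upto_mult: "smooth_upto j f \<Longrightarrow> smooth_upto j g \<Longrightarrow> smooth_upto j (\<lambda>x. f x * g x)"
proof (induction j arbitrary: f g)
  case (Suc j)
  show ?case
    by (rule smooth_upto_SucI[OF DERIV_mult[OF smooth_upto_DERIV[OF Suc.prems(1)] smooth_upto_DERIV[OF Suc.prems(2)]]], rule smooth_upto_add;
        rule Suc.IH) (use Suc.prems smooth_upto_pred in auto)
qed (auto intro: field_differentiable_mult)

lemma smooth_upto_const: "smooth_upto j (\<lambda>_. c)"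
  by (induction j arbitrary: c) (auto simp: field_differentiable_const)

lemma smooth_upto_affine: "smooth_upto j f \<Longrightarrow> smooth_upto j (\<lambda>x. f (a * x + b))"
proof (induction j arbitrary: f)
  case 0
  have "(\<lambda>x. f (a * x + b)) field_differentiable at x" for x
  proof -
    have "((\<lambda>x. f (a * x + b)) has_field_derivative deriv f (a * x + b) * a) (at x)"
      by (rule DERIV_chain2[OF smooth_upto_DERIV[OF 0]]) (auto intro!: derivative_eq_intros)
    then show ?thesis by (auto simp: field_differentiable_def)
  qed
  then show ?case by simp
next
  case (Suc j)
  have "((\<lambda>x. f (a * x + b)) has_field_derivative deriv f (a * x + b) * a) (at x)" for x
    by (rule DERIV_chain2[OF smooth_upto_DERIV[OF Suc.prems]]) (auto intro!: derivative_eq_intros)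
  then show ?case
    by (rule smooth_upto_SucI) (intro smooth_upto_mult smooth_upto_const Suc.IH, use Suc.prems in simp)
qed

text \<open>
  The functions \<open>p(1 / x) exp (- 1 / x)\<close>, extended by zero, are closed under differentiation; this makes
  \<open>exp (- 1 / x)\<close> smooth.
\<close>

definition flat_exp :: "real poly \<Rightarrow> real \<Rightarrow> real" where
  "flat_exp p x = (if 0 < x then poly p (1 / x) * exp (- (1 / x)) else 0)"

definition flat_exp_deriv :: "real poly \<Rightarrow> real poly" where
  "flat_exp_deriv p = [:0, 0, 1:] * (p - pderiv p)"

lemma poly_exp_tendsto_0: "((\<lambda>y::real. poly p y * exp (- y)) \<longlongrightarrow> 0) at_top"
proof -
  have "((\<lambda>y. \<Sum>i\<le>degree p. coeff p i * (y ^ i / exp y)) \<longlongrightarrow> (\<Sum>i\<le>degree p. coeff p i * 0)) at_top"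
    by (intro tendsto_sum tendsto_mult tendsto_const tendsto_power_div_exp_0)
  then show ?thesis by (simp add: poly_altdef sum_distrib_right exp_minus divide_inverse mult.assoc)
qed

lemma flat_exp_DERIV: "(flat_exp p has_field_derivative flat_exp (flat_exp_deriv p) x) (at x)"
proof -
  consider "0 < x" | "x < 0" | "x = 0" by linarith
  then show ?thesis
  proof cases
    case 1
    have "((\<lambda>x. poly p (1 / x) * exp (- (1 / x))) has_field_derivative
       (poly (pderiv p) (1 / x) * (- 1 / (x * x))) * exp (- (1 / x)) + (exp (- (1 / x)) * (- (- 1 / (x * x)))) * poly p (1 / x)) (at x)"
      using 1 by (intro DERIV_mult DERIV_chain2[OF poly_DERIV] DERIV_chain2[OF DERIV_exp] DERIV_minus)
        (auto intro!: derivative_eq_intros)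
    moreover have "(poly (pderiv p) (1 / x) * (- 1 / (x * x))) * exp (- (1 / x)) + (exp (- (1 / x)) * (- (- 1 / (x * x)))) * poly p (1 / x) = flat_exp (flat_exp_deriv p) x"
      using 1 by (simp add: flat_exp_def flat_exp_deriv_def field_simps)
    ultimately have "((\<lambda>x. poly p (1 / x) * exp (- (1 / x))) has_field_derivative flat_exp (flat_exp_deriv p) x) (at x)" by simp
    then show ?thesis
      by (rule has_field_derivative_transform_within_open[where S = "{0<..}"]) (use 1 in \<open>auto simp: flat_exp_def\<close>)
  next
    case 2
    have "((\<lambda>x. 0) has_field_derivative 0) (at x)" by (rule DERIV_const)
    moreover have "flat_exp (flat_exp_deriv p) x = 0" using 2 by (simp add: flat_exp_def)
    ultimately have "((\<lambda>x. 0) has_field_derivative flat_exp (flat_exp_deriv p) x) (at x)" by simp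
    then show ?thesis
      by (rule has_field_derivative_transform_within_open[where S = "{..<0}"]) (use 2 in \<open>auto simp: flat_exp_def\<close>)
  next
    case 3
    have "((\<lambda>h. (flat_exp p (0 + h) - flat_exp p 0) / h) \<longlongrightarrow> 0) (at 0)"
      unfolding filterlim_at_split
    proof
      show "((\<lambda>h. (flat_exp p (0 + h) - flat_exp p 0) / h) \<longlongrightarrow> 0) (at_left 0)"
        by (rule tendsto_eventually) (auto simp: eventually_at_filter flat_exp_def)
      have "((\<lambda>h. poly (pCons 0 p) (inverse h) * exp (- inverse h)) \<longlongrightarrow> 0) (at_right 0)"
        by (rule filterlim_compose[OF poly_exp_tendsto_0 filterlim_inverse_at_top_right])
      then show "((\<lambda>h. (flat_exp p (0 + h) - flat_exp p 0) / h) \<longlongrightarrow> 0) (at_right 0)"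
        by (rule Lim_transform_eventually) (auto simp: eventually_at_filter flat_exp_def divide_inverse)
    qed
    then have "(flat_exp p has_field_derivative 0) (at 0)" unfolding DERIV_def .
    then show ?thesis unfolding 3 by (simp add: flat_exp_def)
  qed
qed

lemma smooth_upto_flat_exp: "smooth_upto j (flat_exp p)"
proof (induction j arbitrary: p)
  case 0
  show ?case using flat_exp_DERIV by (auto simp: field_differentiable_def)
qed (rule smooth_upto_SucI[OF flat_exp_DERIV])

text \<open>
  A smooth function supported in \<open>[a, b]\<close>; as \<open>N\<close> grows it converges pointwise and boundedly to the indicator of
  the open interval.
\<close>

definition bump :: "nat \<Rightarrow> real \<Rightarrow> real \<Rightarrow> real \<Rightarrow> real" where
  "bump N a b x = flat_exp 1 (real (Suc N) * x + (- (real (Suc N) * a))) * flat_exp 1 ((- real (Suc N)) * x + real (Suc N) * b)"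

lemma smooth_upto_bump: "smooth_upto j (bump N a b)"
  unfolding bump_def[abs_def] by (intro smooth_upto_mult smooth_upto_affine smooth_upto_flat_exp)

lemma flat_exp_1: "flat_exp 1 x = (if 0 < x then exp (- (1 / x)) else 0)"
  by (simp add: flat_exp_def)

lemma bump_range: "0 \<le> bump N a b x" "bump N a b x \<le> 1"
  unfolding bump_def flat_exp_1 by (auto intro!: mult_le_one)

lemma bump_outside: "x \<le> a \<or> b \<le> x \<Longrightarrow> bump N a b x = 0"
proof -
  have "0 < real (Suc N) * x + - (real (Suc N) * a) \<longleftrightarrow> 0 < real (Suc N) * (x - a)"
    "0 < (- real (Suc N)) * x + real (Suc N) * b \<longleftrightarrow> 0 < real (Suc N) * (b - x)"
    by (simp_all add: algebra_simps)
  then show "x \<le> a \<or> b \<le> x \<Longrightarrow> bump N a b x = 0"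
    unfolding bump_def flat_exp_1 by (auto simp: zero_less_mult_iff)
qed

lemma bump_tendsto: "(\<lambda>N. bump N a b x) \<longlonglongrightarrow> indicator {a<..<b} x"
proof (cases "a < x \<and> x < b")
  case True
  have "(\<lambda>N. exp (- (inverse (real (Suc N)) * (1 / (x - a)))) * exp (- (inverse (real (Suc N)) * (1 / (b - x))))) \<longlonglongrightarrow> exp (- (0 * (1 / (x - a)))) * exp (- (0 * (1 / (b - x))))"
    by (intro tendsto_mult tendsto_exp tendsto_minus tendsto_const LIMSEQ_inverse_real_of_nat)
  moreover have "bump N a b x = exp (- (inverse (real (Suc N)) * (1 / (x - a)))) * exp (- (inverse (real (Suc N)) * (1 / (b - x))))" for N
  proof -
    have e: "real (Suc N) * x + - (real (Suc N) * a) = real (Suc N) * (x - a)"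
      "(- real (Suc N)) * x + real (Suc N) * b = real (Suc N) * (b - x)" by (simp_all add: algebra_simps)
    have "0 < real (Suc N) * (x - a)" "0 < real (Suc N) * (b - x)" using True by auto
    then show ?thesis unfolding bump_def e flat_exp_1 by (simp add: inverse_eq_divide)
  qed
  ultimately show ?thesis using True by (simp add: indicator_def)
next
  case False
  then have "bump N a b x = 0" for N by (intro bump_outside) auto
  then show ?thesis using False by (auto simp: indicator_def)
qed

lemma bump_continuous: "continuous_on S (bump N a b)"
  by (rule smooth_upto_continuous[OF smooth_upto_bump[of 0]])

lemma abs_int_times_bounded:
  fixes q f :: "real \<Rightarrow> real"
  assumes "q absolutely_integrable_on {a..b}" "continuous_on {a..b} f"
  shows "(\<lambda>x. q x * f x) absolutely_integrable_on {a..b}"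
proof -
  have "(\<lambda>x. f x * q x) absolutely_integrable_on {a..b}"
  proof (rule absolutely_integrable_bounded_measurable_product_real)
    show "f \<in> borel_measurable (lebesgue_on {a..b})"
      by (rule continuous_imp_measurable_on_sets_lebesgue[OF assms(2)]) auto
    show "bounded (f ` {a..b})" using compact_continuous_image[OF assms(2)] compact_imp_bounded by auto
  qed (use assms in auto)
  then show ?thesis by (simp add: mult.commute)
qed

lemma bump_integral_tendsto:
  assumes q: "q absolutely_integrable_on {0..T}" and ab: "0 \<le> a" "b \<le> T"
  shows "(\<lambda>N. integral {0..T} (\<lambda>x. q x * bump N a b x)) \<longlonglongrightarrow> integral {a..b} q"
proof -
  have "(\<lambda>N. integral {0..T} (\<lambda>x. q x * bump N a b x)) \<longlonglongrightarrow> integral {0..T} (\<lambda>x. q x * indicator {a<..<b} x)"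
  proof (rule dominated_convergence)
    show "(\<lambda>x. q x * bump N a b x) integrable_on {0..T}" for N
      by (rule set_lebesgue_integral_eq_integral(1)[OF abs_int_times_bounded[OF q bump_continuous]])
    show "(\<lambda>x. norm (q x)) integrable_on {0..T}"
      using set_lebesgue_integral_eq_integral(1)[OF absolutely_integrable_norm[OF q]] by (simp add: o_def)
    show "norm (q x * bump N a b x) \<le> norm (q x)" for N x
      using bump_range[of N a b x] by (simp add: abs_mult mult_left_le)
    show "(\<lambda>N. q x * bump N a b x) \<longlonglongrightarrow> q x * indicator {a<..<b} x" for x
      by (intro tendsto_mult tendsto_const bump_tendsto)
  qed
  also have "integral {0..T} (\<lambda>x. q x * indicator {a<..<b} x) = integral {0..T} (\<lambda>x. if x \<in> {a..b} then q x else 0)"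
    by (rule integral_spike[of "{a, b}"]) (auto simp: indicator_def)
  also have "\<dots> = integral ({a..b} \<inter> {0..T}) q" by (rule integral_restrict_Int)
  also have "{a..b} \<inter> {0..T} = {a..b}" using ab by auto
  finally show ?thesis .
qed

lemma integral_halfline_eq:
  fixes f :: "real \<Rightarrow> real"
  assumes "0 \<le> T" "\<And>x. x > T \<Longrightarrow> f x = 0"
  shows "integral {0<..} f = integral {0..T} f"
proof -
  have "integral {0<..} f = integral UNIV (\<lambda>x. if x \<in> {0<..} then f x else 0)" by (simp only: integral_restrict_UNIV)
  also have "\<dots> = integral UNIV (\<lambda>x. if x \<in> {0..T} then f x else 0)"
    by (rule integral_spike[of "{0}"]) (use assms in \<open>auto simp: not_le\<close>)
  also have "\<dots> = integral {0..T} f" by (simp only: integral_restrict_UNIV)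
  finally show ?thesis .
qed

text \<open>
  A smooth function of mean zero supported away from \<open>0\<close> is the derivative of a test function.
\<close>

lemma test_primitive:
  assumes psi: "\<And>j. smooth_upto j \<psi>" and supp: "\<And>x. x \<le> a \<or> T \<le> x \<Longrightarrow> \<psi> x = 0" and a: "0 < a" "a \<le> T"
    and mean: "integral {0..T} \<psi> = 0"
  defines "\<phi> \<equiv> \<lambda>x. integral {0..x} \<psi>"
  shows "test_function \<phi>" "\<And>x. (\<phi> has_field_derivative \<psi> x) (at x)" "\<And>x. x \<ge> T \<Longrightarrow> \<phi> x = 0" "\<phi> 0 = 0"
proof -
  have cont: "continuous_on S \<psi>" for S
    by (rule smooth_upto_continuous[OF psi[of 0]])
  have left: "\<phi> x = 0" if "x \<le> a" for x
  proof -
    have "integral {0..x} \<psi> = integral {0..x} (\<lambda>_. 0)" by (rule integral_cong) (use supp that in auto)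
    then show ?thesis by (simp add: \<phi>_def)
  qed
  show right: "\<phi> x = 0" if "x \<ge> T" for x
  proof -
    have "integral {0..T} \<psi> + integral {T..x} \<psi> = integral {0..x} \<psi>"
      using a that by (intro Henstock_Kurzweil_Integration.integral_combine integrable_continuous_real cont) auto
    moreover have "integral {T..x} \<psi> = integral {T..x} (\<lambda>_. 0)" by (rule integral_cong) (use supp in auto)
    ultimately show ?thesis using mean by (simp add: \<phi>_def)
  qed
  show "\<phi> 0 = 0" using left a by simp
  show d: "(\<phi> has_field_derivative \<psi> x) (at x)" for x
  proof (cases "x < a")
    case True
    have "((\<lambda>x. 0) has_field_derivative 0) (at x)" by (rule DERIV_const)
    then have "((\<lambda>x. 0) has_field_derivative \<psi> x) (at x)" using supp[of x] True by simp
    then show ?thesis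
      by (rule has_field_derivative_transform_within_open[where S = "{..<a}"]) (use True left in auto)
  next
    case False
    then have x: "0 < x" using a by simp
    have "(\<phi> has_vector_derivative \<psi> x) (at x within {0..x+1})"
      unfolding \<phi>_def using x by (intro integral_has_vector_derivative cont) auto
    then have "(\<phi> has_field_derivative \<psi> x) (at x within {0..x+1})"
      by (simp add: has_real_derivative_iff_has_vector_derivative)
    moreover have "at x within {0..x+1} = at x" using x by (intro at_within_interior) auto
    ultimately show ?thesis by simp
  qed
  have "smooth_upto j \<phi>" for j using smooth_upto_SucI[OF d psi[of j]] by (rule smooth_upto_pred)
  then have "(deriv ^^ j) \<phi> field_differentiable at x" for j x by (rule smooth_upto_funpow)
  moreover have "\<phi> x = 0" if "x \<notin> {a..T}" for x using that left[of x] right[of x] by force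
  ultimately show "test_function \<phi>" unfolding test_function_def using a by blast
qed

text \<open>
  Integration by parts moves \<open>H\<close> onto its primitive, so \<open>G\<close> minus this primitive has weak derivative zero.
\<close>

lemma weak_deriv_orthogonal:
  assumes wd: "has_weak_deriv 1 G H" and G: "\<And>T. G absolutely_integrable_on {0..T}" and H: "\<And>T. H absolutely_integrable_on {0..T}"
    and psi: "\<And>j. smooth_upto j \<psi>" and supp: "\<And>x. x \<le> a \<or> T \<le> x \<Longrightarrow> \<psi> x = 0" and a: "0 < a" "a \<le> T"
    and mean: "integral {0..T} \<psi> = 0"
  shows "integral {0..T} (\<lambda>x. (G x - integral {0..x} H) * \<psi> x) = 0"
proof -
  define \<phi> where "\<phi> = (\<lambda>x. integral {0..x} \<psi>)"
  have P: "test_function \<phi>" "\<And>x. (\<phi> has_field_derivative \<psi> x) (at x)" "\<And>x. x \<ge> T \<Longrightarrow> \<phi> x = 0" "\<phi> 0 = 0"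
    unfolding \<phi>_def using test_primitive[of \<psi> a T] psi supp a mean by blast+
  have T: "0 \<le> T" using a by simp
  have cpsi: "continuous_on S \<psi>" for S
    by (rule smooth_upto_continuous[OF psi[of 0]])
  have cphi: "continuous_on S \<phi>" for S
    by (rule continuous_at_imp_continuous_on) (use DERIV_isCont[OF P(2)] in blast)
  have dphi: "deriv \<phi> = \<psi>" using P(2) by (intro ext DERIV_imp_deriv)
  have "integral {0<..} (\<lambda>t. G t * \<psi> t) = - integral {0<..} (\<lambda>t. H t * \<phi> t)"
    using wd P(1) unfolding has_weak_deriv_def by (auto simp: dphi)
  moreover have "integral {0<..} (\<lambda>t. G t * \<psi> t) = integral {0..T} (\<lambda>t. G t * \<psi> t)"
    by (rule integral_halfline_eq[OF T]) (simp add: supp)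
  moreover have "integral {0<..} (\<lambda>t. H t * \<phi> t) = integral {0..T} (\<lambda>t. H t * \<phi> t)"
    by (rule integral_halfline_eq[OF T]) (simp add: P(3) less_imp_le)
  ultimately have 1: "integral {0..T} (\<lambda>t. G t * \<psi> t) = - integral {0..T} (\<lambda>t. H t * \<phi> t)" by simp
  have Hc: "(\<lambda>t. complex_of_real (H t)) absolutely_integrable_on {0..t}" for t
    using absolutely_integrable_linear[OF H bounded_linear_complex_of_real] by (simp add: o_def)
  have AP: "has_ac_deriv (\<lambda>t. complex_of_real (integral {0..t} H)) (\<lambda>t. complex_of_real (H t))"
    unfolding has_ac_deriv_def
    using Hc integral_linear[OF set_lebesgue_integral_eq_integral(1)[OF H] bounded_linear_complex_of_real]
    by (simp add: o_def)
  have Ap: "has_ac_deriv (\<lambda>t. complex_of_real (\<phi> t)) (\<lambda>t. complex_of_real (\<psi> t))"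
  proof (rule has_ac_deriv_C1)
    show "((\<lambda>t. complex_of_real (\<phi> t)) has_vector_derivative complex_of_real (\<psi> t)) (at t within {0..})" for t
      by (rule has_vector_derivative_of_real[OF has_field_derivative_at_within[OF P(2)]])
    show "continuous_on {0..} (\<lambda>t. complex_of_real (\<psi> t))" by (intro continuous_intros cpsi)
  qed
  let ?f = "\<lambda>t. complex_of_real (H t) * complex_of_real (\<phi> t) + complex_of_real (integral {0..t} H) * complex_of_real (\<psi> t)"
  note M = has_ac_deriv_mult[OF AP Ap]
  have "integral {0..T} ?f = 0" using has_ac_deriv_eq[OF M T] P(3)[OF order_refl] P(4) by simp
  moreover have "integral {0..T} (\<lambda>t. Re (?f t)) = Re (integral {0..T} ?f)"
    using integral_linear[OF has_ac_deriv_integrable_on[OF M order_refl] bounded_linear_Re] by (simp add: o_def)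
  ultimately have 2: "integral {0..T} (\<lambda>t. H t * \<phi> t + integral {0..t} H * \<psi> t) = 0" by simp
  have cP: "continuous_on {0..T} (\<lambda>t. integral {0..t} H)"
    by (rule indefinite_integral_continuous_1[OF set_lebesgue_integral_eq_integral(1)[OF H]])
  have i1: "(\<lambda>t. G t * \<psi> t) integrable_on {0..T}"
    by (rule set_lebesgue_integral_eq_integral(1)[OF abs_int_times_bounded[OF G cpsi]])
  have i2: "(\<lambda>t. H t * \<phi> t) integrable_on {0..T}"
    by (rule set_lebesgue_integral_eq_integral(1)[OF abs_int_times_bounded[OF H cphi]])
  have i3: "(\<lambda>t. integral {0..t} H * \<psi> t) integrable_on {0..T}"
    by (intro integrable_continuous_real continuous_on_mult cP cpsi)
  have "integral {0..T} (\<lambda>t. integral {0..t} H * \<psi> t) = - integral {0..T} (\<lambda>t. H t * \<phi> t)"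
    using 2 Henstock_Kurzweil_Integration.integral_add[OF i2 i3] by simp
  then show ?thesis
    using 1 Henstock_Kurzweil_Integration.integral_diff[OF i1 i3] by (simp add: left_diff_distrib)
qed

text \<open>
  Testing with the difference of two normalised bumps shows, in the limit, that \<open>G - \<integral> H\<close> has the same average over
  all intervals. By Lebesgue's differentiation theorem it is almost everywhere equal to this average.
\<close>

lemma weak_deriv_primitive:
  assumes wd: "has_weak_deriv 1 G H" and G: "\<And>T. G absolutely_integrable_on {0..T}" and H: "\<And>T. H absolutely_integrable_on {0..T}"
  obtains c N where "negligible N" "\<And>t. 0 < t \<Longrightarrow> t \<notin> N \<Longrightarrow> G t = c + integral {0..t} H"
proof -
  define q where "q x = G x - integral {0..x} H" for x
  have q: "q absolutely_integrable_on {0..T}" for T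
    unfolding q_def using set_lebesgue_integral_eq_integral(1)[OF H]
    by (intro set_integral_diff(1) G absolutely_integrable_continuous_real indefinite_integral_continuous_1)
  \<comment> \<open>the averages of \<open>q\<close> over any two intervals agree\<close>
  have avg: "(d - c) * integral {a..b} q = (b - a) * integral {c..d} q"
    if ab: "0 < a" "a \<le> b" and cd: "0 < c" "c \<le> d" for a b c d
  proof -
    define T where "T = max b d"
    have T: "0 \<le> T" using ab by (simp add: T_def)
    let ?I = "\<lambda>q a b N. integral {0..T} (\<lambda>x. q x * bump N a b x)"
    have one: "(\<lambda>x. 1 :: real) absolutely_integrable_on {0..T}" by (intro absolutely_integrable_continuous_real continuous_intros)
    have key: "?I (\<lambda>_. 1) c d N * ?I q a b N = ?I (\<lambda>_. 1) a b N * ?I q c d N" for N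
    proof -
      define u where "u = ?I (\<lambda>_. 1) c d N"
      define w where "w = ?I (\<lambda>_. 1) a b N"
      let ?psi = "\<lambda>x. u * bump N a b x + (- w) * bump N c d x"
      have ci: "bump N a b integrable_on {0..T}" for a b by (rule integrable_continuous_real[OF bump_continuous])
      have qi: "(\<lambda>x. q x * bump N a b x) integrable_on {0..T}" for a b
        by (rule set_lebesgue_integral_eq_integral(1)[OF abs_int_times_bounded[OF q bump_continuous]])
      have "integral {0..T} (\<lambda>x. (G x - integral {0..x} H) * ?psi x) = 0"
      proof (rule weak_deriv_orthogonal[OF wd G H, where a = "min a c"])
        show "smooth_upto j ?psi" for j by (intro smooth_upto_add smooth_upto_mult smooth_upto_const smooth_upto_bump)
        show "?psi x = 0" if "x \<le> min a c \<or> T \<le> x" for x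
          using that by (auto simp: T_def bump_outside)
        have "integral {0..T} ?psi = u * integral {0..T} (bump N a b) + (- w) * integral {0..T} (bump N c d)"
          by (subst Henstock_Kurzweil_Integration.integral_add[OF integrable_on_mult_right[OF ci] integrable_on_mult_right[OF ci]]) simp
        then show "integral {0..T} ?psi = 0" by (simp add: u_def w_def)
      qed (use ab cd in \<open>auto simp: T_def\<close>)
      then have "integral {0..T} (\<lambda>x. u * (q x * bump N a b x) + (- w) * (q x * bump N c d x)) = 0"
        by (simp add: q_def algebra_simps)
      moreover have "integral {0..T} (\<lambda>x. u * (q x * bump N a b x) + (- w) * (q x * bump N c d x)) = u * ?I q a b N + (- w) * ?I q c d N"
        by (subst Henstock_Kurzweil_Integration.integral_add[OF integrable_on_mult_right[OF qi] integrable_on_mult_right[OF qi]]) simp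
      ultimately show ?thesis unfolding u_def w_def by simp
    qed
    have "(\<lambda>N. ?I (\<lambda>_. 1) c d N * ?I q a b N) \<longlonglongrightarrow> integral {c..d} (\<lambda>_. 1) * integral {a..b} q"
      using ab cd by (intro tendsto_mult bump_integral_tendsto one q) (auto simp: T_def)
    moreover have "(\<lambda>N. ?I (\<lambda>_. 1) a b N * ?I q c d N) \<longlonglongrightarrow> integral {a..b} (\<lambda>_. 1) * integral {c..d} q"
      using ab cd by (intro tendsto_mult bump_integral_tendsto one q) (auto simp: T_def)
    ultimately have "integral {c..d} (\<lambda>_. 1) * integral {a..b} q = integral {a..b} (\<lambda>_. 1) * integral {c..d} q"
      unfolding key by (rule LIMSEQ_unique)
    then show ?thesis using ab cd by simp
  qed
  define C where "C = integral {1..2} q"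
  have qC: "integral {a..b} q = (b - a) * C" if "0 < a" "a \<le> b" for a b
    using avg[of a b 1 2] that by (simp add: C_def)
  define f where "f x = (if x \<in> {0..} then q x - C else 0)" for x
  have fi: "f integrable_on cbox a b" for a b
  proof -
    have "(\<lambda>x. q x - C) integrable_on {0..max b 0}"
      by (intro integrable_diff set_lebesgue_integral_eq_integral(1)[OF q] integrable_const_ivl)
    then have "(\<lambda>x. q x - C) integrable_on {max a 0..b}"
      by (rule integrable_on_subinterval) auto
    moreover have "{max a 0..b} = {0..} \<inter> cbox a b" by auto
    ultimately have "(\<lambda>x. q x - C) integrable_on ({0..} \<inter> cbox a b)" by simp
    then show ?thesis unfolding f_def by (simp only: integrable_restrict_Int)
  qed
  obtain N where N: "negligible N" and lim: "\<And>x e. x \<notin> N \<Longrightarrow> 0 < e \<Longrightarrow>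
      \<exists>d>0. \<forall>h. 0 < h \<and> h < d \<longrightarrow> norm (integral (cbox x (x + h *\<^sub>R One)) f /\<^sub>R h ^ DIM(real) - f x) < e"
    using integrable_ccontinuous_explicit[OF fi] by blast
  have "G t = C + integral {0..t} H" if t: "0 < t" "t \<notin> N" for t
  proof -
    have "norm (f t) < e" if e: "0 < e" for e
    proof -
      obtain d where d: "d > 0" "\<forall>h. 0 < h \<and> h < d \<longrightarrow> norm (integral (cbox t (t + h *\<^sub>R One)) f /\<^sub>R h ^ DIM(real) - f t) < e"
        using lim[OF t(2) e] by blast
      define h where "h = d / 2"
      have h: "0 < h" "h < d" using d by (auto simp: h_def)
      have "integral (cbox t (t + h *\<^sub>R One)) f = integral {t..t+h} (\<lambda>x. q x - C)"
        using t h by (auto simp: f_def intro!: integral_cong)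
      also have "\<dots> = integral {t..t+h} q - integral {t..t+h} (\<lambda>x. C)"
        using t by (intro Henstock_Kurzweil_Integration.integral_diff integrable_const_ivl
          integrable_on_subinterval[OF set_lebesgue_integral_eq_integral(1)[OF q[of "t+h"]]]) auto
      also have "\<dots> = 0" using qC[of t "t+h"] t h by simp
      finally show ?thesis using d(2) h by auto
    qed
    then have "f t = 0" by (metis less_irrefl zero_less_norm_iff)
    then show ?thesis using t by (simp add: f_def q_def)
  qed
  with N show ?thesis by (rule that)
qed

section \<open>Sobolev representatives of the boundary values\<close>

lemma test_function_deriv:
  assumes "test_function \<phi>" shows "test_function (deriv \<phi>)"
proof -
  obtain a b where ab: "0 < a" "\<forall>x. x \<notin> {a..b} \<longrightarrow> \<phi> x = 0" using assms unfolding test_function_def by blast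
  have "(deriv ^^ j) (deriv \<phi>) field_differentiable at x" for j x
    using assms unfolding test_function_def by (metis funpow_Suc_right o_apply)
  moreover have "deriv \<phi> x = 0" if x: "x \<notin> {a..b}" for x
  proof -
    have "((\<lambda>x. 0) has_field_derivative 0) (at x)" by (rule DERIV_const)
    then have "(\<phi> has_field_derivative 0) (at x)"
      by (rule has_field_derivative_transform_within_open[where S = "- {a..b}"]) (use x ab in \<open>auto simp del: not_le\<close>)
    then show ?thesis by (rule DERIV_imp_deriv)
  qed
  ultimately show ?thesis using ab(1) unfolding test_function_def by blast
qed

lemma has_weak_deriv_weak_deriv:
  "weakly_differentiable r g \<Longrightarrow> 1 \<le> i \<Longrightarrow> i \<le> r \<Longrightarrow> has_weak_deriv i g (weak_deriv i g)"
proof -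
  assume "weakly_differentiable r g" and i: "1 \<le> i" "i \<le> r"
  then have "\<exists>h. has_weak_deriv i g h" unfolding weakly_differentiable_def by auto
  from someI_ex[OF this] show ?thesis unfolding weak_deriv_def using i by simp
qed

text \<open>
  The higher weak derivatives are defined by testing against derivatives of \<open>\<phi>\<close>. Since derivatives of test functions
  are test functions, they are iterated first weak derivatives.
\<close>

lemma has_weak_deriv_step:
  assumes wd: "weakly_differentiable r g" and i: "i < r"
  shows "has_weak_deriv 1 (weak_deriv i g) (weak_deriv (Suc i) g)"
proof (cases "i = 0")
  case True
  then show ?thesis using has_weak_deriv_weak_deriv[OF wd, of 1] i by (simp add: weak_deriv_def)
next
  case False
  note a = has_weak_deriv_weak_deriv[OF wd, of i] and b = has_weak_deriv_weak_deriv[OF wd, of "Suc i"]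
  have "integral {0<..} (\<lambda>t. weak_deriv i g t * deriv \<phi> t) = - integral {0<..} (\<lambda>t. weak_deriv (Suc i) g t * \<phi> t)"
    if \<phi>: "test_function \<phi>" for \<phi>
  proof -
    have "integral {0<..} (\<lambda>t. g t * (deriv ^^ Suc i) \<phi> t) = (- 1) ^ Suc i * integral {0<..} (\<lambda>t. weak_deriv (Suc i) g t * \<phi> t)"
      using b i \<phi> unfolding has_weak_deriv_def by auto
    moreover have "integral {0<..} (\<lambda>t. g t * (deriv ^^ i) (deriv \<phi>) t) = (- 1) ^ i * integral {0<..} (\<lambda>t. weak_deriv i g t * deriv \<phi> t)"
      using a False i test_function_deriv[OF \<phi>] unfolding has_weak_deriv_def by auto
    ultimately have "(- 1) ^ i * integral {0<..} (\<lambda>t. weak_deriv i g t * deriv \<phi> t) = (- 1) ^ i * (- integral {0<..} (\<lambda>t. weak_deriv (Suc i) g t * \<phi> t))"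
      by (simp only: funpow_Suc_right o_apply power_Suc)
    from mult_left_cancel[THEN iffD1, OF _ this] show ?thesis by simp
  qed
  then show ?thesis using a b False i unfolding has_weak_deriv_def by auto
qed

abbreviation cplx :: "(real \<Rightarrow> real) \<Rightarrow> real \<Rightarrow> complex" where "cplx f \<equiv> \<lambda>t. complex_of_real (f t)"

lemma weighted_L1_cplx:
  assumes "(\<lambda>t. (1 + t) ^ n * f t) absolutely_integrable_on {0..}"
  shows "weighted_L1 n (cplx f)"
proof -
  have "L1 (\<lambda>t. complex_of_real ((1 + t) ^ n * f t))"
    using absolutely_integrable_linear[OF assms bounded_linear_complex_of_real] by (simp add: o_def)
  then show ?thesis unfolding weighted_L1_def
    by (rule absolutely_integrable_spike[OF _ negligible_empty]) (simp add: scaleR_conv_of_real)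
qed

lemma cplx_integral:
  assumes "f absolutely_integrable_on {a..b}"
  shows "cplx f absolutely_integrable_on {a..b}" "integral {a..b} (cplx f) = of_real (integral {a..b} f)"
  using absolutely_integrable_linear[OF assms bounded_linear_complex_of_real]
    integral_linear[OF set_lebesgue_integral_eq_integral(1)[OF assms] bounded_linear_complex_of_real]
  by (simp_all add: o_def)

lemma weighted_L1_real_Icc:
  assumes "weighted_L1 n (cplx f)" shows "f absolutely_integrable_on {0..T}"
proof -
  have "cplx f absolutely_integrable_on {0..T}" by (rule L1_Icc[OF weighted_L1_L1[OF assms]]) simp
  from absolutely_integrable_linear[OF this bounded_linear_Re] show ?thesis by (simp add: o_def)
qed

lemma weighted_L1_spike:
  assumes "weighted_L1 n f" "negligible N" "\<And>t. 0 < t \<Longrightarrow> t \<notin> N \<Longrightarrow> g t = f t"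
  shows "weighted_L1 n g"
  unfolding weighted_L1_def
proof (rule absolutely_integrable_spike[OF assms(1)[unfolded weighted_L1_def]])
  show "negligible (insert 0 N)" using assms(2) by simp
  show "(1 + t) ^ n *\<^sub>R g t = (1 + t) ^ n *\<^sub>R f t" if "t \<in> {0..} - insert 0 N" for t
    using that assms(3)[of t] by auto
qed

text \<open>
  Each weak derivative below the top order is almost everywhere a primitive of the next one, and this primitive is the
  representative. A single null set serves all orders.
\<close>

lemma sobolev_representative:
  assumes wd: "weakly_differentiable r g" and L: "\<And>i. 1 \<le> i \<Longrightarrow> i \<le> r \<Longrightarrow> weighted_L1 n (cplx (weak_deriv i g))"
    and g: "\<And>T. g absolutely_integrable_on {0..T}"
  obtains D N where "negligible N" "\<And>i t. i \<le> r \<Longrightarrow> 0 < t \<Longrightarrow> t \<notin> N \<Longrightarrow> D i t = weak_deriv i g t"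
    "\<And>i. i < r \<Longrightarrow> has_ac_deriv (cplx (D i)) (cplx (D (Suc i)))"
    "\<And>i. 1 \<le> i \<Longrightarrow> i \<le> r \<Longrightarrow> weighted_sobolev n (r - i) (cplx (D i))"
proof -
  have loc: "weak_deriv i g absolutely_integrable_on {0..T}" if "i \<le> r" for i T
    using g weighted_L1_real_Icc[OF L[of i]] that by (cases "i = 0") (auto simp: weak_deriv_def)
  have "\<exists>c N. negligible N \<and> (\<forall>t>0. t \<notin> N \<longrightarrow> weak_deriv i g t = c + integral {0..t} (weak_deriv (Suc i) g))" if i: "i < r" for i
    using weak_deriv_primitive[OF has_weak_deriv_step[OF wd i] loc loc] i by (metis Suc_leI less_imp_le)
  then obtain c N' where cN: "\<And>i. i < r \<Longrightarrow> negligible (N' i) \<and> (\<forall>t>0. t \<notin> N' i \<longrightarrow> weak_deriv i g t = c i + integral {0..t} (weak_deriv (Suc i) g))"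
    by metis
  define N where "N = (\<Union>i<r. N' i)"
  define D where "D i t = (if i < r then c i + integral {0..t} (weak_deriv (Suc i) g) else weak_deriv i g t)" for i t
  have N: "negligible N" unfolding N_def using cN by (intro negligible_Union) auto
  have D: "D i t = weak_deriv i g t" if "i \<le> r" "0 < t" "t \<notin> N" for i t
    using that cN[of i] unfolding D_def N_def by auto
  have A: "has_ac_deriv (cplx (D i)) (cplx (D (Suc i)))" if i: "i < r" for i
  proof (rule has_ac_deriv_spike)
    show "has_ac_deriv (cplx (D i)) (cplx (weak_deriv (Suc i) g))"
      unfolding has_ac_deriv_def using cplx_integral[OF loc[of "Suc i"]] i by (auto simp: D_def)
    show "negligible (insert 0 N)" using N by simp
    show "cplx (weak_deriv (Suc i) g) t = cplx (D (Suc i)) t" if "0 \<le> t" "t \<notin> insert 0 N" for t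
      using D[of "Suc i" t] that i by auto
  qed
  have wlD: "weighted_L1 n (cplx (D i))" if "1 \<le> i" "i \<le> r" for i
    by (rule weighted_L1_spike[OF L[OF that] N]) (use D that in auto)
  have Wj: "weighted_sobolev n j (cplx (D (r - j)))" if "j < r" for j
    using that
  proof (induction j)
    case 0
    then show ?case using wlD[of r] by simp
  next
    case (Suc j)
    have "Suc (r - Suc j) = r - j" using Suc.prems by simp
    then have "has_ac_deriv (cplx (D (r - Suc j))) (cplx (D (r - j)))" using A[of "r - Suc j"] Suc.prems by simp
    then show ?case using Suc wlD[of "r - Suc j"] by auto
  qed
  have "weighted_sobolev n (r - i) (cplx (D i))" if "1 \<le> i" "i \<le> r" for i
    using Wj[of "r - i"] that by simp
  then show ?thesis using N D A that[of N D] by blast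
qed

lemma continuous_ae_eq:
  fixes f g :: "real \<Rightarrow> real"
  assumes f: "continuous_on {0..} f" and g: "continuous_on {0..} g" and N: "negligible N"
    and eq: "\<And>t. 0 < t \<Longrightarrow> t \<notin> N \<Longrightarrow> f t = g t" and t: "0 \<le> t"
  shows "f t = g t"
proof (rule ccontr)
  assume ne: "f t \<noteq> g t"
  have "continuous_on {0..} (\<lambda>t. f t - g t)" by (intro continuous_intros f g)
  then have "\<exists>d>0. \<forall>x\<in>{0..}. dist x t < d \<longrightarrow> dist (f x - g x) (f t - g t) < \<bar>f t - g t\<bar>"
    unfolding continuous_on_iff using t ne by simp
  then obtain d where d: "d > 0" "\<And>x. 0 \<le> x \<Longrightarrow> dist x t < d \<Longrightarrow> dist (f x - g x) (f t - g t) < \<bar>f t - g t\<bar>"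
    by auto
  have "{t<..<t+d} \<subseteq> N"
  proof
    fix x assume x: "x \<in> {t<..<t+d}"
    then have "dist (f x - g x) (f t - g t) < \<bar>f t - g t\<bar>" using t by (intro d(2)) (auto simp: dist_real_def)
    then have "f x \<noteq> g x" by (auto simp: dist_real_def)
    then show "x \<in> N" using eq[of x] x t by auto
  qed
  then have "negligible {t<..<t+d}" using N negligible_subset by blast
  then show False using d(1) open_not_negligible[of "{t<..<t+d}"] by auto
qed

lemma has_ac_deriv_real_derivative:
  assumes "has_ac_deriv (cplx p) (cplx p')" "continuous_on {0..} p'" "0 \<le> t"
  shows "(p has_real_derivative p' t) (at t within {0..})"
proof -
  have "(cplx p has_vector_derivative cplx p' t) (at t within {0..})"
    by (rule has_ac_deriv_vector_derivative[OF assms(1) _ assms(3)]) (intro continuous_intros assms(2))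
  from bounded_linear.has_vector_derivative[OF bounded_linear_Re this] show ?thesis
    by (simp add: has_real_derivative_iff_has_vector_derivative)
qed

lemma has_ac_deriv_real_C1:
  assumes "\<And>t. 0 \<le> t \<Longrightarrow> (p has_real_derivative p' t) (at t within {0..})" "continuous_on {0..} p'"
  shows "has_ac_deriv (cplx p) (cplx p')"
  by (rule has_ac_deriv_C1) (auto intro!: has_vector_derivative_of_real assms continuous_intros)

lemma trig_has_ac_deriv:
  assumes p: "has_ac_deriv (cplx p) (cplx p')" "continuous_on {0..} p'"
  shows "has_ac_deriv (\<lambda>t. of_real (sin (a * p t))) (\<lambda>t. of_real (a * p' t * cos (a * p t)))"
    and "has_ac_deriv (\<lambda>t. of_real (cos (a * p t))) (\<lambda>t. of_real (- (a * p' t * sin (a * p t))))"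
proof -
  have pc: "continuous_on {0..} p"
    using continuous_on_Re[OF has_ac_deriv_continuous[OF p(1)]] by simp
  have d: "((\<lambda>t. a * p t) has_real_derivative a * p' t) (at t within {0..})" if "0 \<le> t" for t
    by (rule DERIV_cmult[OF has_ac_deriv_real_derivative[OF p that]])
  show "has_ac_deriv (\<lambda>t. of_real (sin (a * p t))) (\<lambda>t. of_real (a * p' t * cos (a * p t)))"
  proof (rule has_ac_deriv_real_C1)
    fix t :: real assume "0 \<le> t"
    from DERIV_chain2[OF DERIV_sin d[OF this]]
    show "((\<lambda>t. sin (a * p t)) has_real_derivative a * p' t * cos (a * p t)) (at t within {0..})"
      by (simp add: mult.commute)
  qed (intro continuous_intros pc p(2))
  show "has_ac_deriv (\<lambda>t. of_real (cos (a * p t))) (\<lambda>t. of_real (- (a * p' t * sin (a * p t))))"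
  proof (rule has_ac_deriv_real_C1)
    fix t :: real assume "0 \<le> t"
    from DERIV_chain2[OF DERIV_cos d[OF this]]
    show "((\<lambda>t. cos (a * p t)) has_real_derivative - (a * p' t * sin (a * p t))) (at t within {0..})"
      by (simp add: mult.commute)
  qed (intro continuous_intros pc p(2))
qed

text \<open>
  The induction runs over \<open>sin p\<close> and \<open>cos p - 1\<close> together: their derivatives
  \<open>p' cos p = p' + p' (cos p - 1)\<close> and \<open>- p' sin p\<close> involve only \<open>p'\<close> and these same functions. Both functions
  are dominated by \<open>|p|\<close>.
\<close>

lemma trig_weighted_sobolev:
  assumes p: "has_ac_deriv (cplx p) (cplx p')" "weighted_sobolev n r (cplx p')" "continuous_on {0..} p'" and weight_up: "weighted_L1 n (cplx p)"
  shows "q \<le> Suc r \<Longrightarrow> weighted_sobolev n q (\<lambda>t. of_real (sin (p t))) \<and> weighted_sobolev n q (\<lambda>t. of_real (cos (p t) - 1))"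
proof (induction q)
  case 0
  have pc: "continuous_on {0..} p"
    using continuous_on_Re[OF has_ac_deriv_continuous[OF p(1)]] by simp
  have sp: "\<bar>sin x\<bar> \<le> \<bar>x\<bar>" for x :: real by (rule abs_sin_x_le_abs_x)
  have cp: "\<bar>cos x - 1\<bar> \<le> 1 * \<bar>x\<bar>" for x :: real
  proof -
    have "\<bar>cos x - 1\<bar> = 2 * (sin (x / 2))\<^sup>2" using cos_double_sin[of "x / 2"] by (simp add: abs_if)
    also have "\<dots> = 2 * (\<bar>sin (x / 2)\<bar> * \<bar>sin (x / 2)\<bar>)" by (simp add: power2_eq_square)
    also have "\<dots> \<le> 2 * (\<bar>x / 2\<bar> * 1)" by (intro mult_left_mono mult_mono sp) auto
    finally show ?thesis by simp
  qed
  have "weighted_L1 n (\<lambda>t. of_real (sin (p t)))"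
  proof (rule weighted_L1_dominated[OF weight_up, where C = 1])
    show "(\<lambda>t. complex_of_real (sin (p t))) \<in> borel_measurable (lebesgue_on {0..})"
      by (intro continuous_measurable continuous_intros pc)
    show "norm (complex_of_real (sin (p t))) \<le> 1 * norm (cplx p t)" for t
      by (simp only: norm_of_real mult_1) (rule sp)
  qed
  moreover have "weighted_L1 n (\<lambda>t. of_real (cos (p t) - 1))"
  proof (rule weighted_L1_dominated[OF weight_up, where C = 1])
    show "(\<lambda>t. complex_of_real (cos (p t) - 1)) \<in> borel_measurable (lebesgue_on {0..})"
      by (intro continuous_measurable continuous_intros pc)
    show "norm (complex_of_real (cos (p t) - 1)) \<le> 1 * norm (cplx p t)" for t
      by (simp only: norm_of_real) (rule cp)
  qed
  ultimately show ?case by simp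
next
  case (Suc q)
  have q: "q \<le> r" using Suc.prems by simp
  have IH: "weighted_sobolev n q (\<lambda>t. of_real (sin (p t)))" "weighted_sobolev n q (\<lambda>t. of_real (cos (p t) - 1))" using Suc by auto
  have pc: "continuous_on {0..} p"
    using continuous_on_Re[OF has_ac_deriv_continuous[OF p(1)]] by simp
  have bounded_sobolev: "bounded_sobolev n q (\<lambda>t. of_real (sin (p t)))" "bounded_sobolev n q (\<lambda>t. of_real (cos (p t) - 1))"
  proof -
    have "norm (complex_of_real (sin x)) \<le> 2" "norm (complex_of_real (cos x - 1)) \<le> 2" for x
      unfolding norm_of_real using abs_sin_le_one[of x] cos_ge_minus_one[of x] cos_le_one[of x] by linarith+
    moreover have "continuous_on {0..} (\<lambda>t. complex_of_real (sin (p t)))" "continuous_on {0..} (\<lambda>t. complex_of_real (cos (p t) - 1))"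
      by (intro continuous_intros pc)+
    ultimately have "bounded_sobolev n 0 (\<lambda>t. of_real (sin (p t)))" "bounded_sobolev n 0 (\<lambda>t. of_real (cos (p t) - 1))"
      unfolding bounded_sobolev.simps by blast+
    then show "bounded_sobolev n q (\<lambda>t. of_real (sin (p t)))" "bounded_sobolev n q (\<lambda>t. of_real (cos (p t) - 1))"
      using IH weighted_sobolev_Suc_bounded_sobolev[of n "q - 1"] by (cases q; simp)+
  qed
  have p'q: "weighted_sobolev n q (cplx p')" by (rule weighted_sobolev_le[OF p(2) q])
  have "has_ac_deriv (\<lambda>t. of_real (sin (p t))) (\<lambda>t. cplx p' t + of_real (cos (p t) - 1) * cplx p' t)"
  proof (rule has_ac_deriv_cong_deriv)
    show "has_ac_deriv (\<lambda>t. of_real (sin (p t))) (\<lambda>t. of_real (p' t * cos (p t)))"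
      using trig_has_ac_deriv(1)[OF p(1,3), of 1] by simp
  qed (simp add: algebra_simps)
  moreover have "weighted_sobolev n q (\<lambda>t. cplx p' t + of_real (cos (p t) - 1) * cplx p' t)"
    by (intro weighted_sobolev_add p'q weighted_sobolev_mult[OF p'q bounded_sobolev(2)])
  ultimately have 1: "weighted_sobolev n (Suc q) (\<lambda>t. of_real (sin (p t)))" using weighted_sobolev_weighted_L1[OF IH(1)] by auto
  have "has_ac_deriv (\<lambda>t. of_real (cos (p t)) - 1) (\<lambda>t. of_real (- (1 * p' t * sin (1 * p t))) - 0)"
    using has_ac_deriv_diff[OF trig_has_ac_deriv(2)[OF p(1,3), of 1] has_ac_deriv_const[of 1]] by simp
  then have "has_ac_deriv (\<lambda>t. of_real (cos (p t) - 1)) (\<lambda>t. - (of_real (sin (p t)) * cplx p' t))"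
    by (simp add: mult.commute)
  moreover have "weighted_sobolev n q (\<lambda>t. - (of_real (sin (p t)) * cplx p' t))"
    by (intro weighted_sobolev_minus weighted_sobolev_mult[OF p'q bounded_sobolev(1)])
  ultimately have "weighted_sobolev n (Suc q) (\<lambda>t. of_real (cos (p t) - 1))" using weighted_sobolev_weighted_L1[OF IH(2)] by auto
  with 1 show ?case by blast
qed

section \<open>Symmetries and the gauge transformation\<close>

lemma phase_inverse: "phase (inverse k) = phase k"
  by (simp add: phase_def theta2_def inverse_eq_divide add.commute)

lemma cnj_phase: "cnj (phase k) = - phase (cnj k)"
  by (simp add: phase_def theta2_def)

lemma cnj_phase_minus: "phase (- cnj k) = cnj (phase k)"
  unfolding cnj_phase by (simp add: phase_def theta2_def algebra_simps minus_divide_right[symmetric] diff_divide_distrib add_divide_distrib)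

lemma has_ac_deriv_cnj: assumes "has_ac_deriv F f" shows "has_ac_deriv (\<lambda>t. cnj (F t)) (\<lambda>t. cnj (f t))"
  unfolding has_ac_deriv_def
proof (intro allI impI conjI)
  fix t :: real assume t: "0 \<le> t"
  note i = has_ac_deriv_integrable[OF assms order_refl, of t]
  show "(\<lambda>t. cnj (f t)) absolutely_integrable_on {0..t}"
    using absolutely_integrable_linear[OF i bounded_linear_cnj] by (simp add: o_def)
  have "integral {0..t} (\<lambda>t. cnj (f t)) = cnj (integral {0..t} f)"
    using integral_linear[OF set_lebesgue_integral_eq_integral(1)[OF i] bounded_linear_cnj] by (simp add: o_def)
  then show "integral {0..t} (\<lambda>t. cnj (f t)) = cnj (F t) - cnj (F 0)" using has_ac_deriv_eq[OF assms t] by simp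
qed

lemma lax_solution_cnj:
  assumes "lax_solution (cplx u) (cplx s) (cplx c) k x y"
  shows "lax_solution (cplx u) (cplx s) (cplx c) (- cnj k) (\<lambda>t. cnj (x t)) (\<lambda>t. cnj (y t))"
proof -
  note S = assms[unfolded lax_solution_def]
  have "has_ac_deriv (\<lambda>t. cnj (x t)) (\<lambda>t. cnj (- phase k * x t + rhs_x (cplx u) (cplx s) (cplx c) k x y t))"
    using S by (intro has_ac_deriv_cnj) blast
  then have "has_ac_deriv (\<lambda>t. cnj (x t)) (\<lambda>t. - phase (- cnj k) * cnj (x t)
      + rhs_x (cplx u) (cplx s) (cplx c) (- cnj k) (\<lambda>t. cnj (x t)) (\<lambda>t. cnj (y t)) t)"
    by (rule has_ac_deriv_cong_deriv) (simp add: rhs_x_def cnj_phase_minus)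
  moreover have "has_ac_deriv (\<lambda>t. cnj (y t)) (\<lambda>t. cnj (rhs_y (cplx u) (cplx s) (cplx c) k x y t))"
    using S by (intro has_ac_deriv_cnj) blast
  then have "has_ac_deriv (\<lambda>t. cnj (y t)) (rhs_y (cplx u) (cplx s) (cplx c) (- cnj k) (\<lambda>t. cnj (x t)) (\<lambda>t. cnj (y t)))"
    by (rule has_ac_deriv_cong_deriv) (simp add: rhs_y_def)
  moreover have "((\<lambda>t. cnj (x t)) \<longlongrightarrow> 0) at_top" "((\<lambda>t. cnj (y t)) \<longlongrightarrow> 1) at_top"
    using S tendsto_cnj[of x 0 at_top] tendsto_cnj[of y 1 at_top] by auto
  ultimately show ?thesis using S unfolding lax_solution_def by simp
qed

lemma wronskian_algebra:
  fixes u s c w x y X Y z :: complex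
  shows "(u / 4 * x - w * (s * x - c * y)) * Y + y * (u / 4 * X + w * (s * X - c * Y))
    + ((- z * x + (- (u / 4) * y - w * (c * x + s * y))) * X + x * (z * X + (- (u / 4) * Y + w * (c * X + s * Y)))) = 0"
  by (simp add: algebra_simps)

text \<open>
  The quantity \<open>y cnj Y + x cnj X\<close>, which is the determinant of the matrix formed from the column and its
  reflection, is constant in \<open>t\<close> and tends to \<open>1\<close>.
\<close>

lemma lax_solution_unitary:
  assumes a: "lax_solution (cplx u) (cplx s) (cplx c) k x y" and b: "lax_solution (cplx u) (cplx s) (cplx c) (cnj k) X Y"
  shows "y 0 * cnj (Y 0) + x 0 * cnj (X 0) = 1"
proof -
  note A = a[unfolded lax_solution_def] and B = b[unfolded lax_solution_def]
  let ?rhs_x = "rhs_x (cplx u) (cplx s) (cplx c)" and ?rhs_y = "rhs_y (cplx u) (cplx s) (cplx c)"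
  have i: "cnj (\<i> / (4 * cnj k)) = - (\<i> / (4 * k))" by simp
  have AX: "has_ac_deriv (\<lambda>t. cnj (X t)) (\<lambda>t. cnj (- phase (cnj k) * X t + ?rhs_x (cnj k) X Y t))"
    using B by (intro has_ac_deriv_cnj) blast
  have AY: "has_ac_deriv (\<lambda>t. cnj (Y t)) (\<lambda>t. cnj (?rhs_y (cnj k) X Y t))" using B by (intro has_ac_deriv_cnj) blast
  have "has_ac_deriv (\<lambda>t. y t * cnj (Y t) + x t * cnj (X t))
     (\<lambda>t. (?rhs_y k x y t * cnj (Y t) + y t * cnj (?rhs_y (cnj k) X Y t))
       + ((- phase k * x t + ?rhs_x k x y t) * cnj (X t) + x t * cnj (- phase (cnj k) * X t + ?rhs_x (cnj k) X Y t)))"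
    using A by (intro has_ac_deriv_add has_ac_deriv_mult AX AY) blast+
  then have "has_ac_deriv (\<lambda>t. y t * cnj (Y t) + x t * cnj (X t)) (\<lambda>t. 0)"
  proof (rule has_ac_deriv_cong_deriv)
    fix t :: real
    have B': "cnj (?rhs_y (cnj k) X Y t) = cplx u t / 4 * cnj (X t) + \<i> / (4 * k) * (cplx s t * cnj (X t) - cplx c t * cnj (Y t))"
      by (simp add: rhs_y_def)
    have A': "cnj (- phase (cnj k) * X t + ?rhs_x (cnj k) X Y t) =
        phase k * cnj (X t) + (- (cplx u t / 4) * cnj (Y t) + \<i> / (4 * k) * (cplx c t * cnj (X t) + cplx s t * cnj (Y t)))"
      by (simp add: rhs_x_def cnj_phase)
    show "(?rhs_y k x y t * cnj (Y t) + y t * cnj (?rhs_y (cnj k) X Y t))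
       + ((- phase k * x t + ?rhs_x k x y t) * cnj (X t) + x t * cnj (- phase (cnj k) * X t + ?rhs_x (cnj k) X Y t)) = 0"
      unfolding A' B' unfolding rhs_x_def rhs_y_def by (rule wronskian_algebra)
  qed
  note Z = this
  have "((\<lambda>t. y t * cnj (Y t) + x t * cnj (X t)) \<longlongrightarrow> 1 * cnj 1 + 0 * cnj 0) at_top"
    using A B by (intro tendsto_intros) auto
  then have lim: "((\<lambda>t. y t * cnj (Y t) + x t * cnj (X t)) \<longlongrightarrow> 1) at_top" by simp
  have L0: "L1 (\<lambda>t. 0 :: complex)" by simp
  from has_ac_deriv_limit_eq[OF Z L0 lim order_refl] show ?thesis by simp
qed

text \<open>
  Here \<open>a\<close> and \<open>b\<close> are the cosine and sine of half the boundary value, with derivatives \<open>- h b / 2\<close> and \<open>h a / 2\<close>;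
  \<open>l\<close> is the inverse of \<open>k\<close>. The half-angle relations \<open>a C + b S = 0\<close> and \<open>a S - b C = 2 b\<close> exchange the
  roles of \<open>k\<close> and \<open>1 / k\<close>: the terms with \<open>k\<close> cancel against the phase, and the phase leaves terms with \<open>1 / k\<close>.
\<close>

lemma gauge_algebra_1:
  fixes a b g h x y k l z S C :: complex
  assumes ab: "a * a + b * b = 1" and S: "S = 2 * a * b" and C: "C = - 2 * b * b" and kl: "z = \<i> / 2 * (k + l)"
  shows "- (h / 2) * b * x + a * (- z * x + (- ((g - h) / 4) * y - \<i> / 4 * k * (C * x - S * y)))
      - (h / 2 * a * y + b * ((g - h) / 4 * x - \<i> / 4 * k * (- S * x - C * y)))
    = - z * (a * x - b * y) + (- ((g + h) / 4) * (b * x + a * y) - \<i> / 4 * l * (C * (a * x - b * y) + S * (b * x + a * y)))"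
proof -
  have 1: "a * C + b * S = 0" unfolding S C by (simp add: algebra_simps)
  have "a * S - b * C = 2 * b * (a * a + b * b)" unfolding S C by (simp add: algebra_simps)
  then have 2: "a * S - b * C = 2 * b" unfolding ab by simp
  have "- (h / 2) * b * x + a * (- z * x + (- ((g - h) / 4) * y - \<i> / 4 * k * (C * x - S * y)))
      - (h / 2 * a * y + b * ((g - h) / 4 * x - \<i> / 4 * k * (- S * x - C * y)))
    = - z * a * x - (g + h) / 4 * (b * x + a * y) - \<i> / 4 * k * ((a * C + b * S) * x - (a * S - b * C) * y)"
    by (simp add: field_simps)
  also have "\<dots> = - z * a * x - (g + h) / 4 * (b * x + a * y) + \<i> / 2 * k * b * y"
    unfolding 1 2 by simp
  also have "\<dots> = - z * (a * x - b * y) - (g + h) / 4 * (b * x + a * y) - \<i> / 4 * l * ((a * C + b * S) * x + (a * S - b * C) * y)"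
    unfolding 1 2 kl by (simp add: field_simps)
  also have "\<dots> = - z * (a * x - b * y) + (- ((g + h) / 4) * (b * x + a * y) - \<i> / 4 * l * (C * (a * x - b * y) + S * (b * x + a * y)))"
    by (simp add: field_simps)
  finally show ?thesis .
qed

lemma gauge_algebra_2:
  fixes a b g h x y k l z S C :: complex
  assumes ab: "a * a + b * b = 1" and S: "S = 2 * a * b" and C: "C = - 2 * b * b" and kl: "z = \<i> / 2 * (k + l)"
  shows "(h / 2 * a * x + b * (- z * x + (- ((g - h) / 4) * y - \<i> / 4 * k * (C * x - S * y))))
      + (- (h / 2) * b * y + a * ((g - h) / 4 * x - \<i> / 4 * k * (- S * x - C * y)))
    = (g + h) / 4 * (a * x - b * y) - \<i> / 4 * l * (S * (a * x - b * y) - C * (b * x + a * y))"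
proof -
  have 1: "a * C + b * S = 0" unfolding S C by (simp add: algebra_simps)
  have "a * S - b * C = 2 * b * (a * a + b * b)" unfolding S C by (simp add: algebra_simps)
  then have 2: "a * S - b * C = 2 * b" unfolding ab by simp
  have "(h / 2 * a * x + b * (- z * x + (- ((g - h) / 4) * y - \<i> / 4 * k * (C * x - S * y))))
      + (- (h / 2) * b * y + a * ((g - h) / 4 * x - \<i> / 4 * k * (- S * x - C * y)))
    = (g + h) / 4 * (a * x - b * y) - z * b * x + \<i> / 4 * k * ((a * S - b * C) * x + (a * C + b * S) * y)"
    by (simp add: field_simps)
  also have "\<dots> = (g + h) / 4 * (a * x - b * y) - \<i> / 4 * l * ((a * S - b * C) * x - (a * C + b * S) * y)"
    unfolding 1 2 kl by (simp add: field_simps)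
  also have "\<dots> = (g + h) / 4 * (a * x - b * y) - \<i> / 4 * l * (S * (a * x - b * y) - C * (b * x + a * y))"
    by (simp add: field_simps)
  finally show ?thesis .
qed

text \<open>
  Boundary values after regularisation: \<open>g\<close> is \<open>g\<^sub>0\<close>, \<open>h\<close> its continuous derivative and \<open>f\<close> the continuous
  representative of \<open>g\<^sub>1\<close>.
\<close>

locale boundary_data =
  fixes n m :: nat and N :: int and g h f :: "real \<Rightarrow> real"
  assumes g: "has_ac_deriv (cplx g) (cplx h)" and h: "weighted_sobolev n (Suc m) (cplx h)" and f: "weighted_sobolev n (Suc m) (cplx f)"
    and gN: "weighted_L1 n (\<lambda>t. of_real (g t - 2 * pi * of_int N))"
begin

lemma h_continuous: "continuous_on {0..} h"
  using continuous_on_Re[OF weighted_sobolev_continuous[OF h]] by simp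

lemma g_shift: "has_ac_deriv (\<lambda>t. of_real (g t - 2 * pi * of_int N)) (cplx h)"
  using has_ac_deriv_diff[OF g has_ac_deriv_const[of "of_real (2 * pi * of_int N)"]] by simp

definition pot_u :: "real \<Rightarrow> complex" where "pot_u = cplx (\<lambda>t. f t + h t)"
definition pot_s :: "real \<Rightarrow> complex" where "pot_s = cplx (\<lambda>t. sin (g t))"
definition pot_c :: "real \<Rightarrow> complex" where "pot_c = cplx (\<lambda>t. cos (g t) - 1)"

lemma trig_shift: "sin (x - 2 * pi * of_int N) = sin x" "cos (x - 2 * pi * of_int N) = cos x"
  by (simp_all add: sin_diff cos_diff sin_int_2pin cos_int_2pin)

lemma lax_smooth_pot: "lax_smooth n pot_u pot_s pot_c m"
proof -
  have "weighted_sobolev n (Suc m) pot_s \<and> weighted_sobolev n (Suc m) pot_c"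
    using trig_weighted_sobolev[OF g_shift h h_continuous gN, of "Suc m"] unfolding trig_shift pot_s_def pot_c_def by simp
  moreover have "weighted_sobolev n (Suc m) pot_u" using weighted_sobolev_add[OF f h] unfolding pot_u_def by simp
  moreover have "weighted_sobolev n (Suc 0) p" if "weighted_sobolev n (Suc m) p" for p
    by (rule weighted_sobolev_le[OF that]) simp
  ultimately show ?thesis by (unfold_locales; blast)
qed

sublocale lax_smooth n pot_u pot_s pot_c m
  by (rule lax_smooth_pot)

text \<open>
  The data to which the gauge transformation leads.
\<close>

lemma boundary_data_reflected: "boundary_data n m (- N) (\<lambda>t. - g t) (\<lambda>t. - h t) f"
proof
  show "has_ac_deriv (\<lambda>t. of_real (- g t)) (\<lambda>t. of_real (- h t))" using has_ac_deriv_minus[OF g] by simp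
  show "weighted_sobolev n (Suc m) (\<lambda>t. of_real (- h t))" using weighted_sobolev_minus[OF h] by simp
  show "weighted_sobolev n (Suc m) (cplx f)" by (rule f)
  have "weighted_sobolev n 0 (\<lambda>t. - of_real (g t - 2 * pi * of_int N))" using gN by (intro weighted_sobolev_minus) simp
  then show "weighted_L1 n (\<lambda>t. of_real (- g t - 2 * pi * of_int (- N)))" by simp
qed

text \<open>
  The entries of the rotation \<open>G\<^sub>0(t)\<close>. The sign makes it tend to the identity, since \<open>g \<rightarrow> 2 \<pi> N\<close>.
\<close>

definition gauge_cos :: "real \<Rightarrow> complex" where "gauge_cos t = (- 1) powi N * of_real (cos (g t / 2))"
definition gauge_sin :: "real \<Rightarrow> complex" where "gauge_sin t = (- 1) powi N * of_real (sin (g t / 2))"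

lemma gauge_has_ac_deriv: "has_ac_deriv gauge_cos (\<lambda>t. - (of_real (h t) / 2) * gauge_sin t)" "has_ac_deriv gauge_sin (\<lambda>t. of_real (h t) / 2 * gauge_cos t)"
proof -
  have "has_ac_deriv gauge_cos (\<lambda>t. (- 1) powi N * of_real (- (1 / 2 * h t * sin (1 / 2 * g t))))"
    unfolding gauge_cos_def using has_ac_deriv_cmult[OF trig_has_ac_deriv(2)[OF g h_continuous, of "1 / 2"]] by simp
  then show "has_ac_deriv gauge_cos (\<lambda>t. - (of_real (h t) / 2) * gauge_sin t)"
    by (rule has_ac_deriv_cong_deriv) (simp add: gauge_sin_def)
  have "has_ac_deriv gauge_sin (\<lambda>t. (- 1) powi N * of_real (1 / 2 * h t * cos (1 / 2 * g t)))"
    unfolding gauge_sin_def using has_ac_deriv_cmult[OF trig_has_ac_deriv(1)[OF g h_continuous, of "1 / 2"]] by simp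
  then show "has_ac_deriv gauge_sin (\<lambda>t. of_real (h t) / 2 * gauge_cos t)"
    by (rule has_ac_deriv_cong_deriv) (simp add: gauge_cos_def)
qed

lemma g_tendsto: "(g \<longlongrightarrow> 2 * pi * of_int N) at_top"
proof -
  have "((\<lambda>t. complex_of_real (g t - 2 * pi * of_int N)) \<longlongrightarrow> 0) at_top"
    by (rule has_ac_deriv_tendsto_0[OF g_shift weighted_L1_L1[OF weighted_sobolev_weighted_L1[OF h]] weighted_L1_L1[OF gN]])
  then have "((\<lambda>t. Re (complex_of_real (g t - 2 * pi * of_int N))) \<longlongrightarrow> Re 0) at_top" by (rule tendsto_Re)
  then have "((\<lambda>t. g t - 2 * pi * of_int N) \<longlongrightarrow> 0) at_top" by simp
  then show ?thesis by (rule LIM_zero_cancel)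
qed

lemma gauge_tendsto: "(gauge_cos \<longlongrightarrow> 1) at_top" "(gauge_sin \<longlongrightarrow> 0) at_top"
proof -
  have half: "2 * pi * of_int N / 2 = pi * of_int N" by simp
  have "(gauge_cos \<longlongrightarrow> (- 1) powi N * of_real (cos (2 * pi * of_int N / 2))) at_top"
    unfolding gauge_cos_def by (intro tendsto_intros g_tendsto) auto
  moreover have "((- 1) powi N :: complex) * of_real (cos (2 * pi * of_int N / 2)) = 1"
    unfolding half cos_npi_int by (cases "even N") (simp_all add: power_int_minus_left)
  ultimately show "(gauge_cos \<longlongrightarrow> 1) at_top" by simp
  have "(gauge_sin \<longlongrightarrow> (- 1) powi N * of_real (sin (2 * pi * of_int N / 2))) at_top"
    unfolding gauge_sin_def by (intro tendsto_intros g_tendsto) auto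
  moreover have "sin (2 * pi * of_int N / 2) = 0" unfolding half sin_npi_int ..
  ultimately show "(gauge_sin \<longlongrightarrow> 0) at_top" by simp
qed

lemma gauge_trig:
  "gauge_cos t * gauge_cos t + gauge_sin t * gauge_sin t = 1" "pot_s t = 2 * gauge_cos t * gauge_sin t" "pot_c t = - 2 * gauge_sin t * gauge_sin t"
proof -
  have e: "((- 1) powi N :: complex) * (- 1) powi N = 1"
    by (cases "even N") (simp_all add: power_int_minus_left)
  have cc: "gauge_cos t * gauge_cos t = of_real (cos (g t / 2) * cos (g t / 2))"
    and ss: "gauge_sin t * gauge_sin t = of_real (sin (g t / 2) * sin (g t / 2))"
    and cs: "gauge_cos t * gauge_sin t = of_real (cos (g t / 2) * sin (g t / 2))"
    unfolding gauge_cos_def gauge_sin_def using e by (simp_all add: mult.assoc mult.left_commute[of "(- 1) powi N"])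
  show "gauge_cos t * gauge_cos t + gauge_sin t * gauge_sin t = 1"
    unfolding cc ss of_real_add[symmetric] using sin_cos_squared_add3[of "g t / 2"] by simp
  have "pot_s t = 2 * of_real (cos (g t / 2) * sin (g t / 2))"
    using sin_double[of "g t / 2"] by (simp add: pot_s_def)
  then show "pot_s t = 2 * gauge_cos t * gauge_sin t" unfolding cs[symmetric] by simp
  have "pot_c t = - 2 * of_real (sin (g t / 2) * sin (g t / 2))"
    using cos_double_sin[of "g t / 2"] by (simp add: pot_c_def power2_eq_square)
  then show "pot_c t = - 2 * gauge_sin t * gauge_sin t" unfolding ss[symmetric] by simp
qed

lemma gauge_bounded: "norm (gauge_cos t) \<le> 1" "norm (gauge_sin t) \<le> 1"
  by (simp_all add: gauge_cos_def gauge_sin_def norm_mult norm_power_int)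

text \<open>
  The rotation has derivative \<open>h / 2\<close> times a rotation by a right angle, which changes the sign of \<open>h\<close> in
  \<open>u = f + h\<close>; the half-angle formulas invert \<open>k\<close>. The limits at infinity are preserved because the
  rotation tends to the identity.
\<close>

lemma gauge_lax_solution:
  assumes k: "k \<noteq> 0"
    and lax_solution: "lax_solution (cplx (\<lambda>t. f t + - h t)) (cplx (\<lambda>t. sin (- g t))) (cplx (\<lambda>t. cos (- g t) - 1)) (inverse k) x y"
  shows "lax_solution pot_u pot_s pot_c k (\<lambda>t. gauge_cos t * x t - gauge_sin t * y t) (\<lambda>t. gauge_sin t * x t + gauge_cos t * y t)"
proof -
  note A = lax_solution[unfolded lax_solution_def]
  have phase: "phase k = \<i> / 2 * (k + inverse k)" by (simp add: phase_def theta2_def inverse_eq_divide)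
  have i: "\<i> / (4 * inverse k) = \<i> / 4 * k" "\<i> / (4 * k) = \<i> / 4 * inverse k"
    by (simp_all add: inverse_eq_divide)
  have fAt: "rhs_x (cplx (\<lambda>t. f t + - h t)) (cplx (\<lambda>t. sin (- g t))) (cplx (\<lambda>t. cos (- g t) - 1)) (inverse k) x y t
      = - ((of_real (f t) - of_real (h t)) / 4) * y t - \<i> / 4 * k * (pot_c t * x t - pot_s t * y t)" for t
    unfolding rhs_x_def i by (simp add: pot_c_def pot_s_def)
  have fBt: "rhs_y (cplx (\<lambda>t. f t + - h t)) (cplx (\<lambda>t. sin (- g t))) (cplx (\<lambda>t. cos (- g t) - 1)) (inverse k) x y t
      = (of_real (f t) - of_real (h t)) / 4 * x t - \<i> / 4 * k * (- pot_s t * x t - pot_c t * y t)" for t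
    unfolding rhs_y_def i by (simp add: pot_c_def pot_s_def)
  have x': "has_ac_deriv x (\<lambda>t. - phase k * x t + (- ((of_real (f t) - of_real (h t)) / 4) * y t - \<i> / 4 * k * (pot_c t * x t - pot_s t * y t)))"
    using A unfolding phase_inverse fAt by blast
  have y': "has_ac_deriv y (\<lambda>t. (of_real (f t) - of_real (h t)) / 4 * x t - \<i> / 4 * k * (- pot_s t * x t - pot_c t * y t))"
    using A unfolding fBt[abs_def] by (metis (no_types, lifting) has_ac_deriv_cong_deriv fBt)
  let ?X = "\<lambda>t. gauge_cos t * x t - gauge_sin t * y t" and ?Y = "\<lambda>t. gauge_sin t * x t + gauge_cos t * y t"
  have U: "pot_u t = of_real (f t) + of_real (h t)" for t by (simp add: pot_u_def)
  have "has_ac_deriv ?X (\<lambda>t. - phase k * ?X t + rhs_x pot_u pot_s pot_c k ?X ?Y t)"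
  proof (rule has_ac_deriv_cong_deriv[OF has_ac_deriv_diff[OF has_ac_deriv_mult[OF gauge_has_ac_deriv(1) x'] has_ac_deriv_mult[OF gauge_has_ac_deriv(2) y']]])
    fix t :: real
    show "- (of_real (h t) / 2) * gauge_sin t * x t + gauge_cos t * (- phase k * x t + (- ((of_real (f t) - of_real (h t)) / 4) * y t - \<i> / 4 * k * (pot_c t * x t - pot_s t * y t))) -
        (of_real (h t) / 2 * gauge_cos t * y t + gauge_sin t * ((of_real (f t) - of_real (h t)) / 4 * x t - \<i> / 4 * k * (- pot_s t * x t - pot_c t * y t)))
      = - phase k * ?X t + rhs_x pot_u pot_s pot_c k ?X ?Y t"
      unfolding rhs_x_def i U by (rule gauge_algebra_1[OF gauge_trig phase])
  qed
  moreover have "has_ac_deriv ?Y (rhs_y pot_u pot_s pot_c k ?X ?Y)"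
  proof (rule has_ac_deriv_cong_deriv[OF has_ac_deriv_add[OF has_ac_deriv_mult[OF gauge_has_ac_deriv(2) x'] has_ac_deriv_mult[OF gauge_has_ac_deriv(1) y']]])
    fix t :: real
    show "of_real (h t) / 2 * gauge_cos t * x t + gauge_sin t * (- phase k * x t + (- ((of_real (f t) - of_real (h t)) / 4) * y t - \<i> / 4 * k * (pot_c t * x t - pot_s t * y t))) +
        (- (of_real (h t) / 2) * gauge_sin t * y t + gauge_cos t * ((of_real (f t) - of_real (h t)) / 4 * x t - \<i> / 4 * k * (- pot_s t * x t - pot_c t * y t)))
      = rhs_y pot_u pot_s pot_c k ?X ?Y t"
      unfolding rhs_y_def i U by (rule gauge_algebra_2[OF gauge_trig phase])
  qed
  moreover have "\<exists>D. \<forall>t\<ge>0. norm (?X t) \<le> D \<and> norm (?Y t) \<le> D"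
  proof -
    obtain D where D: "\<forall>t\<ge>0. norm (x t) \<le> D \<and> norm (y t) \<le> D" using A by blast
    have "norm (a * p) \<le> D" if "norm a \<le> 1" "norm p \<le> D" for a p :: complex
      using mult_mono[OF that] by (simp add: norm_mult)
    then have "norm (gauge_cos t * x t) \<le> D \<and> norm (gauge_sin t * y t) \<le> D \<and> norm (gauge_sin t * x t) \<le> D \<and> norm (gauge_cos t * y t) \<le> D"
      if "0 \<le> t" for t using D that gauge_bounded by blast
    then have "norm (?X t) \<le> D + D \<and> norm (?Y t) \<le> D + D" if "0 \<le> t" for t
      using that by (meson add_mono norm_triangle_ineq norm_triangle_ineq4 order_trans)
    then show ?thesis by blast
  qed
  moreover have "(?X \<longlongrightarrow> 1 * 0 - 0 * 1) at_top" "(?Y \<longlongrightarrow> 0 * 0 + 1 * 1) at_top"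
    using A by (intro tendsto_intros gauge_tendsto; blast)+
  ultimately show ?thesis unfolding lax_solution_def by simp
qed

lemma lax_solution_exists_all:
  assumes k: "k \<noteq> 0" and Im: "0 \<le> Im (theta2 k)"
  shows "\<exists>x y. lax_solution pot_u pot_s pot_c k x y"
proof (cases "1 / 2 < norm k")
  case True
  then show ?thesis using lax_solution_exists[of k] Im by (simp add: outer_region_def)
next
  case False
  interpret F: boundary_data n m "- N" "\<lambda>t. - g t" "\<lambda>t. - h t" f by (rule boundary_data_reflected)
  have "theta2 (inverse k) = theta2 k" by (simp add: theta2_def inverse_eq_divide add.commute)
  moreover have "1 / 2 < norm (inverse k)"
  proof -
    have "1 \<le> inverse (norm k)" using False k by (intro one_le_inverse) auto
    then show ?thesis unfolding norm_inverse by simp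
  qed
  ultimately have "inverse k \<in> outer_region" using Im by (simp add: outer_region_def)
  from F.lax_solution_exists[OF this] obtain x y where "lax_solution F.pot_u F.pot_s F.pot_c (inverse k) x y" by blast
  then show ?thesis using gauge_lax_solution[OF k] unfolding F.pot_u_def F.pot_s_def F.pot_c_def by blast
qed

end

section \<open>The matrix T in terms of the Lax system\<close>

lemma absolutely_integrable_on_vec2:
  fixes f :: "real \<Rightarrow> complex^2"
  shows "f absolutely_integrable_on S \<longleftrightarrow>
    (\<lambda>s. f s $ 1) absolutely_integrable_on S \<and> (\<lambda>s. f s $ 2) absolutely_integrable_on S"
proof
  assume "f absolutely_integrable_on S"
  from absolutely_integrable_linear[OF this bounded_linear_vec_nth]
  show "(\<lambda>s. f s $ 1) absolutely_integrable_on S \<and> (\<lambda>s. f s $ 2) absolutely_integrable_on S"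
    by (simp add: o_def)
next
  assume c: "(\<lambda>s. f s $ 1) absolutely_integrable_on S \<and> (\<lambda>s. f s $ 2) absolutely_integrable_on S"
  have ax: "bounded_linear (axis i :: complex \<Rightarrow> complex^2)" for i :: 2
    by (rule linear_conv_bounded_linear[THEN iffD1])
      (auto intro!: linearI simp: vec_eq_iff axis_def)
  have "(\<lambda>s. axis 1 (f s $ 1) + axis 2 (f s $ 2) :: complex^2) absolutely_integrable_on S"
    using absolutely_integrable_linear[OF c[THEN conjunct1] ax] absolutely_integrable_linear[OF c[THEN conjunct2] ax]
    by (intro set_integral_add) (simp_all add: o_def)
  moreover have "(\<lambda>s. axis 1 (f s $ 1) + axis 2 (f s $ 2) :: complex^2) = f"
    by (simp add: fun_eq_iff vec_eq_iff forall_2 axis_def)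
  ultimately show "f absolutely_integrable_on S" by simp
qed

lemma integral_vec_nth:
  fixes f :: "real \<Rightarrow> complex^2"
  assumes "f absolutely_integrable_on S"
  shows "integral S f $ i = integral S (\<lambda>s. f s $ i)"
  using integral_linear[OF set_lebesgue_integral_eq_integral(1)[OF assms] bounded_linear_vec_nth[of i]]
  by (simp add: o_def)

text \<open>
  This function is built from a chosen weak derivative; it agrees with the continuous \<open>pot_u\<close> only almost everywhere.
\<close>

definition raw_u :: "(real \<Rightarrow> real) \<Rightarrow> (real \<Rightarrow> real) \<Rightarrow> real \<Rightarrow> complex" where
  "raw_u g0 g1 = cplx (\<lambda>t. g1 t + weak_deriv 1 g0 t)"

lemma exp_sigma3_hat_column_2:
  "column 2 (exp_sigma3_hat \<alpha> M) $ 1 = exp (2 * \<alpha>) * M $ 1 $ 2"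
  "column 2 (exp_sigma3_hat \<alpha> M) $ 2 = M $ 2 $ 2"
proof -
  have E: "exp_sigma3 \<beta> $ 1 $ 1 = exp \<beta>" "exp_sigma3 \<beta> $ 1 $ 2 = 0" "exp_sigma3 \<beta> $ 2 $ 1 = 0"
    "exp_sigma3 \<beta> $ 2 $ 2 = exp (- \<beta>)" for \<beta>
    by (simp_all add: exp_sigma3_def)
  have "exp (2 * \<alpha>) = exp \<alpha> * exp \<alpha>" by (simp add: exp_double power2_eq_square)
  then have 1: "exp \<alpha> * z * exp (- (- \<alpha>)) = exp (2 * \<alpha>) * z" for z by simp
  have "exp (- \<alpha>) * exp \<alpha> = 1" by (simp only: exp_add[symmetric]) simp
  moreover have "exp (- \<alpha>) * z * exp (- (- \<alpha>)) = (exp (- \<alpha>) * exp \<alpha>) * z" for z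
    by (simp only: minus_minus ac_simps)
  ultimately have 2: "exp (- \<alpha>) * z * exp (- (- \<alpha>)) = z" for z by simp
  show "column 2 (exp_sigma3_hat \<alpha> M) $ 1 = exp (2 * \<alpha>) * M $ 1 $ 2"
    using 1[of "M $ 1 $ 2"] by (simp only: exp_sigma3_hat_def column_def matrix_matrix_mult_def sum_2 vec_lambda_beta E mult_zero_left mult_zero_right add_0_left add_0_right)
  show "column 2 (exp_sigma3_hat \<alpha> M) $ 2 = M $ 2 $ 2"
    using 2[of "M $ 2 $ 2"] by (simp only: exp_sigma3_hat_def column_def matrix_matrix_mult_def sum_2 vec_lambda_beta E mult_zero_left mult_zero_right add_0_left add_0_right)
qed

lemma V_mat_mult_column_2:
  "(V_mat g0 g1 s k ** M) $ 1 $ 2 = rhs_x (raw_u g0 g1) (cplx (\<lambda>t. sin (g0 t))) (cplx (\<lambda>t. cos (g0 t) - 1)) k (\<lambda>_. M $ 1 $ 2) (\<lambda>_. M $ 2 $ 2) s"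
  "(V_mat g0 g1 s k ** M) $ 2 $ 2 = rhs_y (raw_u g0 g1) (cplx (\<lambda>t. sin (g0 t))) (cplx (\<lambda>t. cos (g0 t) - 1)) k (\<lambda>_. M $ 1 $ 2) (\<lambda>_. M $ 2 $ 2) s"
proof -
  define w where "w = complex_of_real (g1 s + weak_deriv 1 g0 s)"
  define a where "a = complex_of_real (sin (g0 s))"
  define b where "b = complex_of_real (cos (g0 s) - 1)"
  have "\<i> * w * \<i> = (\<i> * \<i>) * w" by (simp only: ac_simps)
  then have iwi: "\<i> * w * \<i> = - w" by simp
  have V: "V_mat g0 g1 s k $ 1 $ 1 = - (\<i> / (4 * k)) * b" "V_mat g0 g1 s k $ 1 $ 2 = - (w / 4) - \<i> / (4 * k) * a"
    "V_mat g0 g1 s k $ 2 $ 1 = w / 4 - \<i> / (4 * k) * a" "V_mat g0 g1 s k $ 2 $ 2 = \<i> / (4 * k) * b"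
    unfolding V_mat_def w_def[symmetric] a_def[symmetric] b_def[symmetric]
    by (simp_all add: iwi matrix_matrix_mult_def sum_2 vector_2 mat_def sigma1_def sigma2_def sigma3_def)
  show "(V_mat g0 g1 s k ** M) $ 1 $ 2 = rhs_x (raw_u g0 g1) (cplx (\<lambda>t. sin (g0 t))) (cplx (\<lambda>t. cos (g0 t) - 1)) k (\<lambda>_. M $ 1 $ 2) (\<lambda>_. M $ 2 $ 2) s"
    and "(V_mat g0 g1 s k ** M) $ 2 $ 2 = rhs_y (raw_u g0 g1) (cplx (\<lambda>t. sin (g0 t))) (cplx (\<lambda>t. cos (g0 t) - 1)) k (\<lambda>_. M $ 1 $ 2) (\<lambda>_. M $ 2 $ 2) s"
    unfolding rhs_x_def rhs_y_def raw_u_def w_def[symmetric] a_def[symmetric] b_def[symmetric]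
    by (simp_all add: matrix_matrix_mult_def sum_2 V left_diff_distrib right_diff_distrib distrib_left distrib_right mult.assoc)
qed

lemma volterra_column_2:
  fixes g0 g1 :: "real \<Rightarrow> real" and k :: complex and T :: "real \<Rightarrow> complex^2^2"
  defines "x \<equiv> \<lambda>t. T t $ 1 $ 2" and "y \<equiv> \<lambda>t. T t $ 2 $ 2"
  defines "a \<equiv> rhs_x (raw_u g0 g1) (cplx (\<lambda>t. sin (g0 t))) (cplx (\<lambda>t. cos (g0 t) - 1)) k x y"
    and "b \<equiv> rhs_y (raw_u g0 g1) (cplx (\<lambda>t. sin (g0 t))) (cplx (\<lambda>t. cos (g0 t) - 1)) k x y"
  shows "volterra_column g0 g1 k 2 T \<longleftrightarrow>
    (\<forall>t\<ge>0. (\<lambda>r. exp (phase k * of_real (r - t)) * a r) absolutely_integrable_on {t..} \<and> b absolutely_integrable_on {t..} \<and>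
       x t = - exp_transform (phase k) a t \<and> y t = 1 - integral {t..} b)"
proof -
  let ?f = "\<lambda>t s. column 2 (exp_sigma3_hat (\<i> * theta2 k * of_real (s - t)) (V_mat g0 g1 s k ** T s))"
  have f1: "(\<lambda>s. ?f t s $ 1) = (\<lambda>r. exp (phase k * of_real (r - t)) * a r)" for t
    unfolding exp_sigma3_hat_column_2 V_mat_mult_column_2 a_def x_def y_def phase_def
    by (simp add: rhs_x_def mult.assoc)
  have f2: "(\<lambda>s. ?f t s $ 2) = b" for t
    unfolding exp_sigma3_hat_column_2 V_mat_mult_column_2 b_def x_def y_def
    by (simp add: rhs_y_def fun_eq_iff)
  have "(?f t absolutely_integrable_on {t..} \<and> column 2 (T t) = column 2 (mat 1) - integral {t..} (?f t)) \<longleftrightarrow>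
    ((\<lambda>r. exp (phase k * of_real (r - t)) * a r) absolutely_integrable_on {t..} \<and> b absolutely_integrable_on {t..} \<and>
       x t = - exp_transform (phase k) a t \<and> y t = 1 - integral {t..} b)" for t
  proof (cases "?f t absolutely_integrable_on {t..}")
    case True
    note i = integral_vec_nth[OF True, of 1, unfolded f1] integral_vec_nth[OF True, of 2, unfolded f2]
    have "column 2 (T t) = column 2 (mat 1) - integral {t..} (?f t) \<longleftrightarrow> x t = - exp_transform (phase k) a t \<and> y t = 1 - integral {t..} b"
      by (simp only: vec_eq_iff forall_2 vector_minus_component i exp_transform_def) (simp add: column_def mat_def x_def y_def)
    then show ?thesis using True unfolding absolutely_integrable_on_vec2 f1 f2 by blast
  next
    case False
    then show ?thesis unfolding absolutely_integrable_on_vec2 f1 f2 by blast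
  qed
  then show ?thesis unfolding volterra_column_def by blast
qed

context boundary_data
begin

text \<open>
  Changing the coefficient \<open>u\<close> on a null set changes neither side of the Volterra equation.
\<close>

lemma volterra_column_iff_lax_solution:
  fixes T :: "real \<Rightarrow> complex^2^2"
  assumes N: "negligible Z" and U: "\<And>t. 0 < t \<Longrightarrow> t \<notin> Z \<Longrightarrow> g1 t + weak_deriv 1 g t = f t + h t"
    and k: "0 \<le> Im (theta2 k)"
  shows "volterra_column g g1 k 2 T \<longleftrightarrow> lax_solution pot_u pot_s pot_c k (\<lambda>t. T t $ 1 $ 2) (\<lambda>t. T t $ 2 $ 2)"
proof -
  let ?x = "\<lambda>t. T t $ 1 $ 2" and ?y = "\<lambda>t. T t $ 2 $ 2"
  have Re: "Re (phase k) \<le> 0" using k by (simp add: phase_def)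
  define a where "a = rhs_x (raw_u g g1) pot_s pot_c k ?x ?y"
  define b where "b = rhs_y (raw_u g g1) pot_s pot_c k ?x ?y"
  have N': "negligible (insert 0 Z)" using N by simp
  have "raw_u g g1 r = pot_u r" if "0 \<le> t" "r \<in> {t..} - insert 0 Z" for r t
    using U[of r] that by (simp add: raw_u_def pot_u_def of_real_add[symmetric] del: of_real_add)
  then have ab: "a r = rhs_x pot_u pot_s pot_c k ?x ?y r" "b r = rhs_y pot_u pot_s pot_c k ?x ?y r" if "0 \<le> t" "r \<in> {t..} - insert 0 Z" for r t
    using that by (simp_all add: a_def b_def rhs_x_def rhs_y_def)
  have Ia: "(\<lambda>r. exp (phase k * of_real (r - t)) * a r) absolutely_integrable_on {t..} \<longleftrightarrow>
      (\<lambda>r. exp (phase k * of_real (r - t)) * rhs_x pot_u pot_s pot_c k ?x ?y r) absolutely_integrable_on {t..}" if "0 \<le> t" for t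
    using ab(1)[OF that] by (intro absolutely_integrable_spike_eq[OF N']) auto
  have Ib: "b absolutely_integrable_on {t..} \<longleftrightarrow> rhs_y pot_u pot_s pot_c k ?x ?y absolutely_integrable_on {t..}" if "0 \<le> t" for t
    using ab(2)[OF that] by (intro absolutely_integrable_spike_eq[OF N']) auto
  have Ja: "exp_transform (phase k) a t = exp_transform (phase k) (rhs_x pot_u pot_s pot_c k ?x ?y) t" if "0 \<le> t" for t
    unfolding exp_transform_def using ab(1)[OF that] by (intro integral_spike[OF N']) auto
  have Jb: "integral {t..} b = integral {t..} (rhs_y pot_u pot_s pot_c k ?x ?y)" if "0 \<le> t" for t
    using ab(2)[OF that] by (intro integral_spike[OF N']) auto
  have "volterra_column g g1 k 2 T \<longleftrightarrow>
    (\<forall>t\<ge>0. (\<lambda>r. exp (phase k * of_real (r - t)) * rhs_x pot_u pot_s pot_c k ?x ?y r) absolutely_integrable_on {t..} \<and>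
       rhs_y pot_u pot_s pot_c k ?x ?y absolutely_integrable_on {t..} \<and>
       ?x t = - exp_transform (phase k) (rhs_x pot_u pot_s pot_c k ?x ?y) t \<and> ?y t = 1 - integral {t..} (rhs_y pot_u pot_s pot_c k ?x ?y))" (is "_ \<longleftrightarrow> ?V")
    unfolding volterra_column_2 pot_s_def[symmetric] pot_c_def[symmetric] a_def[symmetric] b_def[symmetric]
    using Ia Ib Ja Jb by (metis (no_types, lifting))
  also have "?V \<longleftrightarrow> lax_solution pot_u pot_s pot_c k ?x ?y"
  proof
    assume V: ?V
    show "lax_solution pot_u pot_s pot_c k ?x ?y" by (rule volterra_lax_solution[OF Re]) (use V in auto)
  next
    assume S: "lax_solution pot_u pot_s pot_c k ?x ?y"
    show ?V using exp_transform_integrable[OF lax_solution_L1(1)[OF S] Re] L1_tail[OF lax_solution_L1(2)[OF S]] lax_solution_volterra[OF S Re] by blast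
  qed
  finally show ?thesis .
qed

text \<open>
  Existence comes from the given solution and uniqueness from \<open>lax_solution_unique\<close>, so the definite description in
  \<open>T_mat\<close> is meaningful.
\<close>

lemma T_mat_column_2:
  assumes N: "negligible Z" and U: "\<And>t. 0 < t \<Longrightarrow> t \<notin> Z \<Longrightarrow> g1 t + weak_deriv 1 g t = f t + h t"
    and k: "0 \<le> Im (theta2 k)" and lax_solution: "lax_solution pot_u pot_s pot_c k x y"
  shows "T_mat g g1 0 k $ 1 $ 2 = x 0" "T_mat g g1 0 k $ 2 $ 2 = y 0"
proof -
  have iff: "volterra_column g g1 k 2 T \<longleftrightarrow> lax_solution pot_u pot_s pot_c k (\<lambda>t. T t $ 1 $ 2) (\<lambda>t. T t $ 2 $ 2)" for T
    by (rule volterra_column_iff_lax_solution[OF N _ k]) (rule U)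
  have Re: "Re (phase k) \<le> 0" using k by (simp add: phase_def)
  have "(THE v. \<exists>T. volterra_column g g1 k 2 T \<and> v = column 2 (T 0)) = vector [x 0, y 0]"
  proof (rule the_equality)
    show "\<exists>T. volterra_column g g1 k 2 T \<and> vector [x 0, y 0] = column 2 (T 0)"
    proof (intro exI conjI)
      show "volterra_column g g1 k 2 (\<lambda>t. \<chi> i j. if i = 1 then x t else y t)"
        unfolding iff using lax_solution by simp
      show "(vector [x 0, y 0] :: complex^2) = column 2 (\<chi> i j. if i = 1 then x 0 else y 0)"
        unfolding vec_eq_iff forall_2 by (simp add: column_def)
    qed
  next
    fix v assume "\<exists>T. volterra_column g g1 k 2 T \<and> v = column 2 (T 0)"
    then obtain T where T: "volterra_column g g1 k 2 T" "v = column 2 (T 0)" by blast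
    have "T 0 $ 1 $ 2 = x 0 \<and> T 0 $ 2 $ 2 = y 0"
      by (rule lax_solution_unique[OF T(1)[unfolded iff] lax_solution Re order_refl])
    then show "v = vector [x 0, y 0]"
      unfolding T(2) vec_eq_iff forall_2 by (simp add: column_def)
  qed
  then show "T_mat g g1 0 k $ 1 $ 2 = x 0" "T_mat g g1 0 k $ 2 $ 2 = y 0"
    by (simp_all add: T_mat_def)
qed

end

lemma boundary_data_exists:
  assumes m: "1 \<le> n" and g0: "continuous_on {0..} g0"
    and w0: "weakly_differentiable (m + 2) g0" and w1: "weakly_differentiable (m + 1) g1"
    and gN: "(\<lambda>t. (1 + t) ^ n * (g0 t - 2 * pi * of_int N)) absolutely_integrable_on {0..}"
    and i0: "\<And>i. i \<in> {1..m + 2} \<Longrightarrow> (\<lambda>t. (1 + t) ^ n * weak_deriv i g0 t) absolutely_integrable_on {0..}"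
    and i1: "\<And>i. i \<in> {0..m + 1} \<Longrightarrow> (\<lambda>t. (1 + t) ^ n * weak_deriv i g1 t) absolutely_integrable_on {0..}"
  obtains h f Z where "boundary_data n m N g0 h f" "negligible Z"
    "\<And>t. 0 < t \<Longrightarrow> t \<notin> Z \<Longrightarrow> g1 t + weak_deriv 1 g0 t = f t + h t"
proof -
  have g0i: "g0 absolutely_integrable_on {0..T}" for T
    by (rule absolutely_integrable_continuous_real[OF continuous_on_subset[OF g0]]) auto
  have l1: "weighted_L1 n (cplx g1)" using weighted_L1_cplx[OF i1[of 0]] by (simp add: weak_deriv_def)
  have l0: "weighted_L1 n (cplx (weak_deriv i g0))" if "1 \<le> i" "i \<le> m + 2" for i
    using that by (intro weighted_L1_cplx i0) simp
  have l2: "weighted_L1 n (cplx (weak_deriv i g1))" if "1 \<le> i" "i \<le> m + 1" for i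
    using that by (intro weighted_L1_cplx i1) simp
  obtain D Z where Z: "negligible Z" and D: "\<And>i t. i \<le> m + 2 \<Longrightarrow> 0 < t \<Longrightarrow> t \<notin> Z \<Longrightarrow> D i t = weak_deriv i g0 t"
    and Dd: "\<And>i. i < m + 2 \<Longrightarrow> has_ac_deriv (cplx (D i)) (cplx (D (Suc i)))"
    and DW: "\<And>i. 1 \<le> i \<Longrightarrow> i \<le> m + 2 \<Longrightarrow> weighted_sobolev n (m + 2 - i) (cplx (D i))"
    by (rule sobolev_representative[OF w0 _ g0i, of n]) (erule (1) l0, blast)
  obtain E Y where Y: "negligible Y" and E: "\<And>i t. i \<le> m + 1 \<Longrightarrow> 0 < t \<Longrightarrow> t \<notin> Y \<Longrightarrow> E i t = weak_deriv i g1 t"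
    and Ed: "\<And>i. i < m + 1 \<Longrightarrow> has_ac_deriv (cplx (E i)) (cplx (E (Suc i)))"
    and EW: "\<And>i. 1 \<le> i \<Longrightarrow> i \<le> m + 1 \<Longrightarrow> weighted_sobolev n (m + 1 - i) (cplx (E i))"
    by (rule sobolev_representative[OF w1 _ weighted_L1_real_Icc[OF l1], of n]) (erule (1) l2, blast)
  have D0: "continuous_on {0..} (D 0)" using continuous_on_Re[OF has_ac_deriv_continuous[OF Dd[of 0]]] by simp
  have eq: "D 0 t = g0 t" if "0 \<le> t" for t
    by (rule continuous_ae_eq[OF D0 g0 Z _ that]) (simp add: D weak_deriv_def)
  have "boundary_data n m N g0 (D 1) (E 0)"
  proof
    show "has_ac_deriv (cplx g0) (cplx (D 1))" by (rule has_ac_deriv_cong[of "cplx (D 0)"]) (use Dd[of 0] eq in auto)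
    show "weighted_sobolev n (Suc m) (cplx (D 1))" using DW[of 1] by simp
    have "weighted_L1 n (cplx (E 0))" by (rule weighted_L1_spike[OF l1 Y]) (simp add: E weak_deriv_def)
    then show "weighted_sobolev n (Suc m) (cplx (E 0))" using Ed[of 0] EW[of 1] by auto
    show "weighted_L1 n (\<lambda>t. of_real (g0 t - 2 * pi * of_int N))" by (rule weighted_L1_cplx[OF gN])
  qed
  moreover have "negligible (Z \<union> Y)" using Z Y by simp
  moreover have "g1 t + weak_deriv 1 g0 t = E 0 t + D 1 t" if "0 < t" "t \<notin> Z \<union> Y" for t
    using that D[of 1 t] E[of 0 t] by (simp add: weak_deriv_def)
  ultimately show thesis by (rule that)
qed

section \<open>The domain of the spectral functions\<close>

lemma Im_theta2: "k \<noteq> 0 \<Longrightarrow> Im (theta2 k) = Im k * ((norm k)\<^sup>2 - 1) / (4 * (norm k)\<^sup>2)"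
proof -
  assume k: "k \<noteq> 0"
  then have d: "(norm k)\<^sup>2 \<noteq> 0" by simp
  have "Im (theta2 k) = (Im k + Im (inverse k)) / 4" by (simp add: theta2_def inverse_eq_divide)
  also have "Im (inverse k) = - Im k / (norm k)\<^sup>2" by (simp add: cmod_power2)
  finally show ?thesis using d by (simp add: divide_simps) (simp add: algebra_simps)
qed

definition spectral_domain :: "complex set" where "spectral_domain = {k. k \<noteq> 0 \<and> 0 \<le> Im (theta2 k)}"

lemma spectral_domain_iff: "k \<noteq> 0 \<Longrightarrow> k \<in> spectral_domain \<longleftrightarrow> 0 \<le> Im k * ((norm k)\<^sup>2 - 1)"
  by (simp add: spectral_domain_def Im_theta2 zero_le_divide_iff)

lemma open_D_plus: "open D_plus"
  unfolding D_plus_def D1_def D3_def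
  by (intro open_Un open_Collect_conj open_Collect_less continuous_intros)

lemma square_gt_1_iff: "0 < (norm k)\<^sup>2 - 1 \<longleftrightarrow> 1 < norm k" "(norm k)\<^sup>2 - 1 < 0 \<longleftrightarrow> norm k < 1" for k :: complex
  using abs_square_le_1[of "norm k"] abs_square_less_1[of "norm k"] by auto

lemma D_plus_iff: "k \<in> D_plus \<longleftrightarrow> 0 < Im k * ((norm k)\<^sup>2 - 1)"
  unfolding zero_less_mult_iff square_gt_1_iff by (auto simp: D_plus_def D1_def D3_def)

lemma D_plus_subset: "D_plus \<subseteq> spectral_domain"
proof
  fix k assume k: "k \<in> D_plus"
  then have "k \<noteq> 0" by (auto simp: D_plus_iff)
  then show "k \<in> spectral_domain" using k by (simp add: D_plus_iff spectral_domain_iff)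
qed

text \<open>
  The closed condition \<open>Im k (|k|\<^sup>2 - 1) \<ge> 0\<close> contains \<open>D\<^sub>+\<close>. Conversely, points with \<open>Im k \<ge> 0\<close>, \<open>|k| \<ge> 1\<close> are
  approached vertically from above, those with \<open>Im k < 0\<close>, \<open>|k| \<le> 1\<close> radially from inside, and the interval \<open>(-1, 1)\<close>
  vertically from below.
\<close>

lemma closure_D_plus: "closure D_plus = insert 0 spectral_domain"
proof -
  have E: "insert 0 spectral_domain = {k. 0 \<le> Im k * ((norm k)\<^sup>2 - 1)}"
    using spectral_domain_iff by (auto simp: spectral_domain_def)
  have "closed {k. 0 \<le> Im k * ((norm k)\<^sup>2 - 1)}"
    by (intro closed_Collect_le continuous_intros)
  moreover have "k \<in> closure D_plus" if k: "0 \<le> Im k * ((norm k)\<^sup>2 - 1)" for k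
  proof -
    have lim: "k \<in> closure D_plus" if "(f \<longlongrightarrow> k) (at_right (0::real))" "\<forall>\<^sub>F e in at_right 0. f e \<in> D_plus" for f
    proof (rule Lim_in_closed_set[OF closed_closure _ _ that(1)])
      show "\<forall>\<^sub>F e in at_right 0. f e \<in> closure D_plus"
        using that(2) by (rule eventually_mono) (use closure_subset in blast)
    qed simp
    consider "0 \<le> Im k" "1 \<le> norm k" | "Im k < 0" "norm k \<le> 1" | "Im k = 0" "norm k < 1"
    proof -
      have "Im k = 0 \<or> (Im k > 0 \<and> \<not> norm k < 1) \<or> (Im k < 0 \<and> \<not> 1 < norm k)"
        using k unfolding square_gt_1_iff[symmetric] zero_le_mult_iff by linarith
      then show thesis using that by linarith
    qed
    then show ?thesis
    proof cases
      case 1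
      show ?thesis
      proof (rule lim[of "\<lambda>e. k + of_real e * \<i>"])
        show "((\<lambda>e. k + of_real e * \<i>) \<longlongrightarrow> k) (at_right (0::real))"
          by (rule tendsto_eq_intros refl | simp)+
        have "k + of_real e * \<i> \<in> D_plus" if "0 < e" for e
        proof -
          have "(norm k)\<^sup>2 < (norm (k + of_real e * \<i>))\<^sup>2"
            unfolding cmod_power2 using that 1 by (simp add: power_strict_mono)
          then have "norm k < norm (k + of_real e * \<i>)" by (rule power2_less_imp_less) simp
          then show ?thesis using 1 that by (simp add: D_plus_def D1_def)
        qed
        then show "\<forall>\<^sub>F e in at_right 0. k + of_real e * \<i> \<in> D_plus"
          by (simp add: eventually_at_right_less eventually_mono[OF eventually_at_right_less])
      qed
    next
      case 2
      show ?thesis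
      proof (rule lim[of "\<lambda>e. of_real (1 - e) * k"])
        show "((\<lambda>e. of_real (1 - e) * k) \<longlongrightarrow> k) (at_right (0::real))"
          by (rule tendsto_eq_intros refl | simp)+
        have "of_real (1 - e) * k \<in> D_plus" if "0 < e" "e < 1" for e
        proof -
          have "k \<noteq> 0" using 2 by auto
          then have "(1 - e) * norm k < 1 * norm k" using that by (intro mult_strict_right_mono) auto
          then have "norm (of_real (1 - e) * k) < 1" using 2 that unfolding norm_mult norm_of_real by simp
          moreover have "Im (of_real (1 - e) * k) < 0" using 2 that by (simp add: mult_pos_neg)
          ultimately show ?thesis unfolding D_plus_def D3_def by blast
        qed
        moreover have "\<forall>\<^sub>F e in at_right (0::real). 0 < e \<and> e < 1"
          by (simp add: eventually_at_right_field) (meson zero_less_one)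
        ultimately show "\<forall>\<^sub>F e in at_right 0. of_real (1 - e) * k \<in> D_plus"
          by (auto elim: eventually_mono)
      qed
    next
      case 3
      have l: "((\<lambda>e. k - of_real e * \<i>) \<longlongrightarrow> k) (at_right (0::real))"
        by (rule tendsto_eq_intros refl | simp)+
      show ?thesis
      proof (rule lim[OF l])
        have "\<forall>\<^sub>F e in at_right 0. norm (k - of_real e * \<i>) < 1"
          using order_tendstoD(2)[OF tendsto_norm[OF l], of 1] 3 by simp
        then show "\<forall>\<^sub>F e in at_right 0. k - of_real e * \<i> \<in> D_plus"
          using eventually_at_right_less[of "0::real"]
          by eventually_elim (use 3 in \<open>simp add: D_plus_def D3_def\<close>)
      qed
    qed
  qed
  ultimately show ?thesis unfolding E
    by (intro antisym closure_minimal subsetI) (auto simp: D_plus_iff)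
qed

lemma spectral_domain_eq: "closure D_plus - {0} = spectral_domain"
  by (auto simp: closure_D_plus spectral_domain_def)

lemma islimpt_D_plus: assumes "z \<in> closure D_plus" shows "z islimpt D_plus"
proof (cases "z \<in> D_plus")
  case True
  then show ?thesis using open_D_plus interior_limit_point interior_open by blast
next
  case False
  then show ?thesis using assms by (simp add: closure_def)
qed

lemma at_within_spectral_domain: "z \<in> spectral_domain \<Longrightarrow> at z within spectral_domain \<noteq> bot"
  using islimpt_subset[OF islimpt_D_plus D_plus_subset] closure_D_plus by (auto simp: trivial_limit_within)

lemma at_0_within: "at 0 within closure D_plus \<noteq> bot"
  using islimpt_subset[OF islimpt_D_plus[of 0] closure_subset] closure_D_plus by (auto simp: trivial_limit_within)

lemma spectral_domain_inverse: "k \<in> spectral_domain \<Longrightarrow> inverse k \<in> spectral_domain"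
  by (auto simp: spectral_domain_def theta2_def inverse_eq_divide add.commute)

lemma spectral_domain_reflect: "k \<in> spectral_domain \<Longrightarrow> - cnj k \<in> spectral_domain"
  using spectral_domain_iff[of k] spectral_domain_iff[of "- cnj k"] by (auto simp: spectral_domain_def)

lemma spectral_domain_real_circle:
  "k \<noteq> 0 \<Longrightarrow> k \<in> \<real> \<or> norm k = 1 \<Longrightarrow> k \<in> spectral_domain \<and> cnj k \<in> spectral_domain"
  using spectral_domain_iff[of k] spectral_domain_iff[of "cnj k"] by (auto simp: complex_is_Real_iff)

text \<open>
  Overlaps with \<open>outer_region\<close>, so that both are open in the domain and local statements about derivatives can be
  combined.
\<close>

definition inner_region :: "complex set" where "inner_region = {k \<in> spectral_domain. norm k < 2}"

lemma outer_region_eq: "outer_region = spectral_domain \<inter> {k. 1 / 2 < norm k}"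
  by (auto simp: outer_region_def spectral_domain_def)

lemma openin_outer_region: "openin (top_of_set spectral_domain) outer_region"
  unfolding outer_region_eq by (intro openin_open_Int open_Collect_less continuous_intros)

lemma openin_inner_region: "openin (top_of_set spectral_domain) inner_region"
proof -
  have inner_region: "inner_region = spectral_domain \<inter> {k. norm k < 2}" by (auto simp: inner_region_def)
  show ?thesis unfolding inner_region by (intro openin_open_Int open_Collect_less continuous_intros)
qed

lemma outer_region_Un_inner_region: "outer_region \<union> inner_region = spectral_domain"
  by (auto simp: outer_region_eq inner_region_def)

lemma inner_region_inverse: "k \<in> inner_region \<Longrightarrow> k \<noteq> 0 \<and> inverse k \<in> outer_region"
proof -
  assume k: "k \<in> inner_region"
  then have "k \<noteq> 0" "norm k < 2" by (auto simp: inner_region_def spectral_domain_def)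
  then have "inverse 2 < inverse (norm k)" by (intro less_imp_inverse_less) auto
  then show ?thesis using k spectral_domain_inverse \<open>k \<noteq> 0\<close> by (simp add: outer_region_eq inner_region_def norm_inverse)
qed

section \<open>Higher derivatives relative to the domain\<close>

lemma deriv_within_eq:
  assumes "at z within S \<noteq> bot" "(f has_field_derivative d) (at z within S)"
  shows "deriv_within S f z = d"
  unfolding deriv_within_def
proof (rule the_equality)
  show "(f has_field_derivative d) (at z within S)" by (rule assms(2))
  fix d' assume "(f has_field_derivative d') (at z within S)"
  then show "d' = d" using assms tendsto_unique[OF assms(1)] unfolding has_field_derivative_iff by blast
qed

lemma at_within_openin:
  assumes "openin (top_of_set S) P" "z \<in> P" shows "at z within S = at z within P"
proof -
  obtain T where T: "open T" "P = S \<inter> T" using assms(1) by (auto simp: openin_open)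
  then have "at z within S = at z within (S \<inter> T)"
    using assms(2) by (intro at_within_nhd[of z T]) auto
  then show ?thesis using T by simp
qed

text \<open>
  Since \<open>P\<close> is open in \<open>S\<close>, derivatives within \<open>P\<close> and within \<open>S\<close> agree at points of \<open>P\<close>. They are unique at limit
  points, so any chain of derivatives is the one selected by \<open>higher_deriv_within\<close>.
\<close>

lemma higher_deriv_within_chain:
  assumes op: "openin (top_of_set S) P" and lim: "\<And>z. z \<in> S \<Longrightarrow> at z within S \<noteq> bot"
    and F: "\<And>k. k \<in> P \<Longrightarrow> F 0 k = f k"
    and d: "\<And>j k. j < n \<Longrightarrow> k \<in> P \<Longrightarrow> (F j has_field_derivative F (Suc j) k) (at k within P)"
  shows "j \<le> n \<Longrightarrow> k \<in> P \<Longrightarrow> higher_deriv_within S j f k = F j k"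
    and "j < n \<Longrightarrow> k \<in> P \<Longrightarrow> (higher_deriv_within S j f has_field_derivative F (Suc j) k) (at k within S)"
proof -
  have PS: "P \<subseteq> S" using op by (rule openin_imp_subset)
  have step: "(higher_deriv_within S j f has_field_derivative F (Suc j) k) (at k within S)"
    if j: "j < n" and k: "k \<in> P" and eq: "\<And>k. k \<in> P \<Longrightarrow> higher_deriv_within S j f k = F j k" for j k
  proof -
    have "(higher_deriv_within S j f has_field_derivative F (Suc j) k) (at k within P)"
      by (rule has_field_derivative_transform_within[OF d[OF j k] zero_less_one k]) (rule eq[symmetric])
    then show ?thesis by (simp add: at_within_openin[OF op k])
  qed
  show all: "higher_deriv_within S j f k = F j k" if "j \<le> n" "k \<in> P" for j k
    using that
  proof (induction j arbitrary: k)
    case 0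
    then show ?case by (simp add: higher_deriv_within_def F)
  next
    case (Suc j)
    have "deriv_within S (higher_deriv_within S j f) k = F (Suc j) k"
      by (rule deriv_within_eq[OF lim step]) (use Suc PS in auto)
    then show ?case by (simp add: higher_deriv_within_def)
  qed
  show "j < n \<Longrightarrow> k \<in> P \<Longrightarrow> (higher_deriv_within S j f has_field_derivative F (Suc j) k) (at k within S)"
    by (rule step) (auto intro: all)
qed

lemma derivs_bounded_chain:
  "derivs_bounded P r w f \<Longrightarrow> \<exists>F. F 0 = f \<and> (\<forall>j<r. \<forall>k\<in>P. has_cderiv (F j) (F (Suc j) k) k P) \<and>
     (\<forall>j\<le>r. continuous_on P (F j) \<and> (\<exists>C. \<forall>k\<in>P. norm (F j k) \<le> C * w j k))"
proof (induction r arbitrary: f w)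
  case 0
  then show ?case by (intro exI[of _ "\<lambda>_. f"]) simp
next
  case (Suc r)
  obtain f' where f': "\<And>k. k \<in> P \<Longrightarrow> has_cderiv f (f' k) k P" "derivs_bounded P r (\<lambda>j. w (Suc j)) f'"
    using Suc.prems by (rule derivs_bounded_SucE) blast
  obtain F where F: "F 0 = f'" "\<forall>j<r. \<forall>k\<in>P. has_cderiv (F j) (F (Suc j) k) k P"
    "\<forall>j\<le>r. continuous_on P (F j) \<and> (\<exists>C. \<forall>k\<in>P. norm (F j k) \<le> C * w (Suc j) k)"
    using Suc.IH[OF f'(2)] by blast
  show ?case
  proof (intro exI[of _ "case_nat f F"] conjI allI ballI impI)
    show "has_cderiv (case_nat f F j) (case_nat f F (Suc j) k) k P" if "j < Suc r" "k \<in> P" for j k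
      using that F(1,2) f'(1) by (cases j) auto
    show "continuous_on P (case_nat f F j)" if "j \<le> Suc r" for j
      using that F(3) derivs_bounded_continuous[OF Suc.prems] by (cases j) auto
    show "\<exists>C. \<forall>k\<in>P. norm (case_nat f F j k) \<le> C * w j k" if "j \<le> Suc r" for j
      using that F(3) derivs_bounded_bound[OF Suc.prems] by (cases j) auto
  qed simp
qed

text \<open>
  For \<open>G\<close> a truncated expansion, the derivatives of \<open>f\<close> are those of \<open>G\<close> plus the derivatives of the remainder, whose
  bounds become the error terms.
\<close>

lemma derivs_bounded_higher_deriv_within:
  fixes f G :: "complex \<Rightarrow> complex"
  assumes op: "openin (top_of_set S) P" and lim: "\<And>z. z \<in> S \<Longrightarrow> at z within S \<noteq> bot" and "0 \<notin> P"
    and G: "G holomorphic_on - {0}" and e: "derivs_bounded P n w (\<lambda>k. f k - G k)"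
  shows "j \<le> n \<Longrightarrow> continuous_on P (higher_deriv_within S j f)"
    and "j \<le> n \<Longrightarrow> \<exists>C. \<forall>k\<in>P. norm (higher_deriv_within S j f k - (deriv ^^ j) G k) \<le> C * w j k"
    and "j < n \<Longrightarrow> k \<in> P \<Longrightarrow> \<exists>d. (higher_deriv_within S j f has_field_derivative d) (at k within S)"
proof -
  obtain E where E: "E 0 = (\<lambda>k. f k - G k)" "\<forall>j<n. \<forall>k\<in>P. has_cderiv (E j) (E (Suc j) k) k P"
    "\<forall>j\<le>n. continuous_on P (E j) \<and> (\<exists>C. \<forall>k\<in>P. norm (E j k) \<le> C * w j k)"
    using derivs_bounded_chain[OF e] by blast
  define F where "F j k = (deriv ^^ j) G k + E j k" for j k
  have hol: "(deriv ^^ j) G holomorphic_on - {0}" for j by (rule holomorphic_higher_deriv[OF G]) auto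
  have Gd: "((deriv ^^ j) G has_field_derivative (deriv ^^ Suc j) G k) (at k within P)" if "k \<in> P" for j k
    using holomorphic_derivI[OF hol, of k j P] that \<open>0 \<notin> P\<close> by (auto simp: open_delete)
  have F0: "F 0 k = f k" for k by (simp add: F_def E(1))
  have Fd: "(F j has_field_derivative F (Suc j) k) (at k within P)" if "j < n" "k \<in> P" for j k
    unfolding F_def using E(2) that by (intro DERIV_add Gd) (auto simp: has_cderiv_complex)
  have eq: "higher_deriv_within S j f k = F j k" if "j \<le> n" "k \<in> P" for j k
    by (rule higher_deriv_within_chain(1)[where F = F and n = n, OF op]) (rule lim F0 Fd that | assumption)+
  show "continuous_on P (higher_deriv_within S j f)" if j: "j \<le> n"
  proof -
    have "continuous_on P (F j)" unfolding F_def using E(3) j \<open>0 \<notin> P\<close>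
      by (intro continuous_on_add continuous_on_subset[OF holomorphic_on_imp_continuous_on[OF hol]]) auto
    then show ?thesis using eq[OF j] by (simp cong: continuous_on_cong)
  qed
  show "\<exists>C. \<forall>k\<in>P. norm (higher_deriv_within S j f k - (deriv ^^ j) G k) \<le> C * w j k" if j: "j \<le> n"
    using E(3) j by (simp add: eq F_def)
  show "\<exists>d. (higher_deriv_within S j f has_field_derivative d) (at k within S)" if jk: "j < n" "k \<in> P"
  proof (rule exI)
    show "(higher_deriv_within S j f has_field_derivative F (Suc j) k) (at k within S)"
      by (rule higher_deriv_within_chain(2)[where F = F and n = n, OF op]) (rule lim F0 Fd jk | assumption)+
  qed
qed

lemma derivs_bounded_inverse_argument_0:
  fixes e :: "complex \<Rightarrow> complex"
  assumes w: "w 0 = (\<lambda>k. norm k powi (p + int M))" and e: "derivs_bounded outer_region 0 (\<lambda>_ k. 1 / norm k ^ M) e"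
  shows "derivs_bounded inner_region 0 w (\<lambda>k. a * (k powi p * e (inverse k)))"
proof -
  obtain C where C: "\<And>k. k \<in> outer_region \<Longrightarrow> norm (e k) \<le> C * (1 / norm k ^ M)" using e by auto
  have "norm (a * (k powi p * e (inverse k))) \<le> norm a * C * w 0 k" if k: "k \<in> inner_region" for k
  proof -
    have k0: "k \<noteq> 0" using inner_region_inverse[OF k] by blast
    have "norm (e (inverse k)) \<le> C * norm k ^ M"
      using C[of "inverse k"] inner_region_inverse[OF k] by (simp add: norm_inverse power_inverse divide_inverse)
    then have "norm k powi p * norm (e (inverse k)) \<le> norm k powi p * (C * norm k ^ M)"
      by (rule mult_left_mono) simp
    also have "\<dots> = C * w 0 k" unfolding w using k0 by (simp add: power_int_add)
    finally show ?thesis by (simp add: norm_mult norm_power_int mult_left_mono mult.assoc)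
  qed
  moreover have "continuous_on inner_region (\<lambda>k. a * (k powi p * e (inverse k)))"
  proof (intro continuous_intros)
    show "continuous_on inner_region (\<lambda>k. e (inverse k))"
      by (rule continuous_on_compose2[of outer_region e]) (use e inner_region_inverse in \<open>auto intro!: continuous_intros\<close>)
  qed (use inner_region_inverse in auto)
  ultimately show ?thesis by auto
qed

text \<open>
  One derivative of \<open>k\<^sup>p e(1 / k)\<close> gives \<open>p k\<^sup>p\<^sup>-\<^sup>1 e(1 / k) - k\<^sup>p\<^sup>-\<^sup>2 e'(1 / k)\<close>; the second term is the larger one near zero
  and loses two powers of \<open>k\<close>. The exponent \<open>p\<close> and the factor \<open>a\<close> serve the induction.
\<close>

lemma derivs_bounded_inverse_argument:
  fixes e :: "complex \<Rightarrow> complex"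
  assumes "derivs_bounded outer_region r (\<lambda>_ k. 1 / norm k ^ M) e"
  shows "derivs_bounded inner_region r (\<lambda>j k. norm k powi (p + int M - 2 * int j)) (\<lambda>k. a * (k powi p * e (inverse k)))"
  using assms
proof (induction r arbitrary: e a p)
  case 0
  show ?case by (rule derivs_bounded_inverse_argument_0[OF _ 0]) simp
next
  case (Suc r)
    obtain e' where e': "\<And>k. k \<in> outer_region \<Longrightarrow> has_cderiv e (e' k) k outer_region" "derivs_bounded outer_region r (\<lambda>_ k. 1 / norm k ^ M) e'"
      using Suc.prems by (rule derivs_bounded_SucE) blast
    show ?case
    proof (rule derivs_bounded_SucI)
      show "derivs_bounded inner_region 0 (\<lambda>j k. norm k powi (p + int M - 2 * int j)) (\<lambda>k. a * (k powi p * e (inverse k)))"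
        by (rule derivs_bounded_inverse_argument_0[OF _ derivs_bounded_le[OF Suc.prems]]) simp_all
      show "has_cderiv (\<lambda>k. a * (k powi p * e (inverse k)))
          ((a * of_int p) * (k powi (p - 1) * e (inverse k)) + (- a) * (k powi (p - 2) * e' (inverse k))) k inner_region"
        if k: "k \<in> inner_region" for k
      proof -
        have k0: "k \<noteq> 0" "inverse k \<in> outer_region" using inner_region_inverse[OF k] by auto
        have "(e has_field_derivative e' (inverse k)) (at (inverse k) within inverse ` inner_region)"
          using e'(1)[OF k0(2)] unfolding has_cderiv_complex
          by (rule DERIV_subset) (use inner_region_inverse in auto)
        moreover have "(inverse has_field_derivative - (inverse k * 1 * inverse k)) (at k within inner_region)"
          using k0 by (auto intro!: derivative_eq_intros)
        ultimately have "((\<lambda>z. e (inverse z)) has_field_derivative e' (inverse k) * - (inverse k * 1 * inverse k)) (at k within inner_region)"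
          by (rule DERIV_image_chain[unfolded o_def])
        note E = this
        have P: "((\<lambda>z. z powi p) has_field_derivative of_int p * k powi (p - 1)) (at k within inner_region)"
          using k0 by (auto intro!: derivative_eq_intros)
        have i: "k powi (p - 2) = k powi p * (inverse k * inverse k)"
          using k0 power_int_diff[of k p 2] by (simp add: power2_eq_square divide_inverse)
        have "((\<lambda>k. a * (k powi p * e (inverse k))) has_field_derivative
            a * (of_int p * k powi (p - 1) * e (inverse k) + e' (inverse k) * - (inverse k * 1 * inverse k) * k powi p)) (at k within inner_region)"
          by (rule DERIV_cmult[OF DERIV_mult[OF P E]])
        then show ?thesis unfolding has_cderiv_complex i by (simp add: algebra_simps)
      qed
      have w: "derivs_bounded inner_region r (\<lambda>j k. norm k powi (p + int M - 2 * int (Suc j))) (\<lambda>k. (a * of_int p) * (k powi (p - 1) * e (inverse k)))"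
      \<comment> \<open>the weight differs from the required one by a factor \<open>|k| < 2\<close>\<close>
      proof (rule derivs_bounded_weight_mono[OF Suc.IH[OF derivs_bounded_pred[OF Suc.prems], of "p - 1" "a * of_int p"], where C = 2])
        fix j k assume "k \<in> inner_region"
        then have k: "k \<noteq> 0" "norm k < 2" by (auto simp: inner_region_def spectral_domain_def)
        have "norm k powi (p - 1 + int M - 2 * int j) = norm k * norm k powi (p + int M - 2 * int (Suc j))"
          using k power_int_add_1'[of "norm k" "p + int M - 2 * int (Suc j)"] by (simp add: algebra_simps)
        then show "0 \<le> norm k powi (p - 1 + int M - 2 * int j) \<and>
            norm k powi (p - 1 + int M - 2 * int j) \<le> 2 * norm k powi (p + int M - 2 * int (Suc j))"
          using k by (simp add: mult_right_mono)
      qed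
      have eq: "p - 2 + int M - 2 * int j = p + int M - 2 * int (Suc j)" for j by simp
      show "derivs_bounded inner_region r (\<lambda>j k. norm k powi (p + int M - 2 * int (Suc j)))
         (\<lambda>k. (a * of_int p) * (k powi (p - 1) * e (inverse k)) + (- a) * (k powi (p - 2) * e' (inverse k)))"
        by (rule derivs_bounded_add[OF w Suc.IH[OF e'(2), of "p - 2" "- a", unfolded eq]])
    qed
qed

lemma higher_derivs_on_regions:
  fixes f G1 G2 :: "complex \<Rightarrow> complex"
  assumes G1: "G1 holomorphic_on - {0}" and e1: "derivs_bounded outer_region n w1 (\<lambda>k. f k - G1 k)"
    and G2: "G2 holomorphic_on - {0}" and e2: "derivs_bounded inner_region n w2 (\<lambda>k. f k - G2 k)"
  shows "n_times_differentiable_within spectral_domain n f"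
    and "j \<le> n \<Longrightarrow> continuous_on spectral_domain (higher_deriv_within spectral_domain j f)"
    and "j \<le> n \<Longrightarrow> \<exists>C. \<forall>k\<in>outer_region. norm (higher_deriv_within spectral_domain j f k - (deriv ^^ j) G1 k) \<le> C * w1 j k"
    and "j \<le> n \<Longrightarrow> \<exists>C. \<forall>k\<in>inner_region. norm (higher_deriv_within spectral_domain j f k - (deriv ^^ j) G2 k) \<le> C * w2 j k"
proof -
  have 0: "0 \<notin> outer_region" "0 \<notin> inner_region" by (auto simp: outer_region_eq inner_region_def spectral_domain_def)
  note P = derivs_bounded_higher_deriv_within[OF openin_outer_region at_within_spectral_domain 0(1) G1 e1]
    and Q = derivs_bounded_higher_deriv_within[OF openin_inner_region at_within_spectral_domain 0(2) G2 e2]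
  show "n_times_differentiable_within spectral_domain n f"
    unfolding n_times_differentiable_within_def
  proof (intro allI impI ballI)
    fix j z assume j: "j < n" and "z \<in> spectral_domain"
    then have "z \<in> outer_region \<or> z \<in> inner_region" using outer_region_Un_inner_region by blast
    then show "\<exists>d. (higher_deriv_within spectral_domain j f has_field_derivative d) (at z within spectral_domain)"
      using P(3) Q(3) j by blast
  qed
  show "\<exists>C. \<forall>k\<in>outer_region. norm (higher_deriv_within spectral_domain j f k - (deriv ^^ j) G1 k) \<le> C * w1 j k" if "j \<le> n"
    by (rule P(2)) (use that in auto)
  show "\<exists>C. \<forall>k\<in>inner_region. norm (higher_deriv_within spectral_domain j f k - (deriv ^^ j) G2 k) \<le> C * w2 j k" if "j \<le> n"
    by (rule Q(2)) (use that in auto)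
  show "continuous_on spectral_domain (higher_deriv_within spectral_domain j f)" if "j \<le> n"
    unfolding outer_region_Un_inner_region[symmetric]
  proof (rule continuous_on_Un_local_open)
    show "continuous_on outer_region (higher_deriv_within (outer_region \<union> inner_region) j f)" unfolding outer_region_Un_inner_region by (rule P(1)) (use that in auto)
    show "continuous_on inner_region (higher_deriv_within (outer_region \<union> inner_region) j f)" unfolding outer_region_Un_inner_region by (rule Q(1)) (use that in auto)
  qed (simp_all add: outer_region_Un_inner_region openin_outer_region openin_inner_region)
qed

section \<open>The spectral functions\<close>

text \<open>
  Adds the boundary value \<open>g\<^sub>1\<close> itself, which together with the chosen weak derivative of \<open>g\<^sub>0\<close> agrees with
  \<open>f + h\<close> off the null set \<open>Z\<close>.
\<close>

locale spectral_data = boundary_data +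
  fixes g1 :: "real \<Rightarrow> real" and Z :: "real set"
  assumes Z: "negligible Z" and U: "\<And>t. 0 < t \<Longrightarrow> t \<notin> Z \<Longrightarrow> g1 t + weak_deriv 1 g t = f t + h t"
begin

abbreviation "A \<equiv> spectral_A g g1"
abbreviation "B \<equiv> spectral_B g g1"

lemma spectral_value:
  assumes "k \<in> spectral_domain" "lax_solution pot_u pot_s pot_c k x y"
  shows "B k = x 0" "A k = y 0"
proof -
  have k: "k \<noteq> 0" "0 \<le> Im (theta2 k)" using assms(1) by (auto simp: spectral_domain_def)
  show "B k = x 0" using k T_mat_column_2(1)[OF Z U k(2) assms(2)] by (simp add: spectral_B_def)
  show "A k = y 0" using k T_mat_column_2(2)[OF Z U k(2) assms(2)] by (simp add: spectral_A_def)
qed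

lemma spectral_lax_solution:
  assumes "k \<in> spectral_domain"
  obtains x y where "lax_solution pot_u pot_s pot_c k x y" "B k = x 0" "A k = y 0"
proof -
  obtain x y where "lax_solution pot_u pot_s pot_c k x y"
    using lax_solution_exists_all[of k] assms by (auto simp: spectral_domain_def)
  then show thesis using that spectral_value[OF assms] by blast
qed

lemma expansion_at_infinity:
  obtains cA cB where "derivs_bounded outer_region n (\<lambda>_ k. 1 / norm k ^ (m + 1)) (\<lambda>k. B k - (\<Sum>i=1..m. cB i / k ^ i))"
    "derivs_bounded outer_region n (\<lambda>_ k. 1 / norm k ^ (m + 1)) (\<lambda>k. A k - (1 + (\<Sum>i=1..m. cA i / k ^ i)))"
proof -
  have "\<forall>k\<in>outer_region. \<exists>x y. lax_solution pot_u pot_s pot_c k x y" using lax_solution_exists by blast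
  then obtain X Y where XY: "\<And>k. k \<in> outer_region \<Longrightarrow> lax_solution pot_u pot_s pot_c k (X k) (Y k)" by metis
  have v: "X k 0 = B k" "Y k 0 = A k" if "k \<in> outer_region" for k
    using spectral_value[OF _ XY[OF that]] that by (simp_all add: outer_region_eq)
  obtain cA cB where c: "derivs_bounded outer_region n (\<lambda>_ k. 1 / norm k ^ (m + 1)) (\<lambda>k. X k 0 - (\<Sum>i=1..m. cB i / k ^ i))"
    "derivs_bounded outer_region n (\<lambda>_ k. 1 / norm k ^ (m + 1)) (\<lambda>k. Y k 0 - (1 + (\<Sum>i=1..m. cA i / k ^ i)))"
    using lax_expansion_at_infinity[OF XY] by blast
  show thesis
    by (rule that[of cB cA]; rule derivs_bounded_cong[OF c(1)] derivs_bounded_cong[OF c(2)]) (simp_all add: v)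
qed

text \<open>
  The expansion at infinity for the reflected boundary values, evaluated at \<open>1 / k\<close> and rotated by the gauge at
  \<open>t = 0\<close>.
\<close>

lemma expansion_at_zero:
  obtains cA cB where
    "derivs_bounded inner_region n (\<lambda>j k. norm k powi (int m + 1 - 2 * int j))
       (\<lambda>k. B k - (gauge_cos 0 * (\<Sum>i=1..m. cB i * k ^ i) - gauge_sin 0 * (1 + (\<Sum>i=1..m. cA i * k ^ i))))"
    "derivs_bounded inner_region n (\<lambda>j k. norm k powi (int m + 1 - 2 * int j))
       (\<lambda>k. A k - (gauge_sin 0 * (\<Sum>i=1..m. cB i * k ^ i) + gauge_cos 0 * (1 + (\<Sum>i=1..m. cA i * k ^ i))))"
proof -
  interpret F: boundary_data n m "- N" "\<lambda>t. - g t" "\<lambda>t. - h t" f by (rule boundary_data_reflected)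
  have "\<forall>k\<in>outer_region. \<exists>x y. lax_solution F.pot_u F.pot_s F.pot_c k x y" using F.lax_solution_exists by blast
  then obtain X Y where XY: "\<And>k. k \<in> outer_region \<Longrightarrow> lax_solution F.pot_u F.pot_s F.pot_c k (X k) (Y k)" by metis
  have v: "B k = gauge_cos 0 * X (inverse k) 0 - gauge_sin 0 * Y (inverse k) 0"
    "A k = gauge_sin 0 * X (inverse k) 0 + gauge_cos 0 * Y (inverse k) 0" if k: "k \<in> inner_region" for k
  proof -
    have k': "k \<noteq> 0" "inverse k \<in> outer_region" "k \<in> spectral_domain" using inner_region_inverse[OF k] k by (auto simp: inner_region_def)
    note s = gauge_lax_solution[OF k'(1) XY[OF k'(2), unfolded F.pot_u_def F.pot_s_def F.pot_c_def]]
    show "B k = gauge_cos 0 * X (inverse k) 0 - gauge_sin 0 * Y (inverse k) 0"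
      "A k = gauge_sin 0 * X (inverse k) 0 + gauge_cos 0 * Y (inverse k) 0"
      using spectral_value[OF k'(3) s] by simp_all
  qed
  obtain cA cB where c: "derivs_bounded outer_region n (\<lambda>_ k. 1 / norm k ^ (m + 1)) (\<lambda>k. X k 0 - (\<Sum>i=1..m. cB i / k ^ i))"
    "derivs_bounded outer_region n (\<lambda>_ k. 1 / norm k ^ (m + 1)) (\<lambda>k. Y k 0 - (1 + (\<Sum>i=1..m. cA i / k ^ i)))"
    using F.lax_expansion_at_infinity[OF XY] by blast
  have i: "a / inverse k ^ i = a * k ^ i" for a k :: complex and i
    by (simp add: power_inverse divide_inverse)
  have w: "0 + int (m + 1) - 2 * int j = int m + 1 - 2 * int j" for j by simp
  note cX = derivs_bounded_inverse_argument[OF c(1), of 0, unfolded w i power_int_0_right mult_1_left]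
    and cY = derivs_bounded_inverse_argument[OF c(2), of 0, unfolded w i power_int_0_right mult_1_left]
  show thesis
  proof (rule that[of cB cA])
    show "derivs_bounded inner_region n (\<lambda>j k. norm k powi (int m + 1 - 2 * int j))
       (\<lambda>k. B k - (gauge_cos 0 * (\<Sum>i=1..m. cB i * k ^ i) - gauge_sin 0 * (1 + (\<Sum>i=1..m. cA i * k ^ i))))"
      by (rule derivs_bounded_cong[OF derivs_bounded_add[OF cX[of "gauge_cos 0"] cY[of "- gauge_sin 0"]]]) (simp add: v algebra_simps)
    show "derivs_bounded inner_region n (\<lambda>j k. norm k powi (int m + 1 - 2 * int j))
       (\<lambda>k. A k - (gauge_sin 0 * (\<Sum>i=1..m. cB i * k ^ i) + gauge_cos 0 * (1 + (\<Sum>i=1..m. cA i * k ^ i))))"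
      by (rule derivs_bounded_cong[OF derivs_bounded_add[OF cX[of "gauge_sin 0"] cY[of "gauge_cos 0"]]]) (simp add: v algebra_simps)
  qed
qed

end

text \<open>
  The expansion of the function itself, \<open>j = 0\<close>, identifies the limits at \<open>k = 0\<close>, which are the values of \<open>A\<close> and \<open>B\<close> there.
\<close>

lemma tendsto_0_of_expansion:
  fixes f G :: "complex \<Rightarrow> complex"
  assumes G: "isCont G 0" and e: "derivs_bounded inner_region n (\<lambda>j k. norm k powi (int m + 1 - 2 * int j)) (\<lambda>k. f k - G k)"
  shows "(f \<longlongrightarrow> G 0) (at 0 within closure D_plus)"
proof -
  obtain C where C: "\<forall>k\<in>inner_region. norm (f k - G k) \<le> C * norm k powi (int m + 1 - 2 * int 0)"
    using derivs_bounded_bound[OF e] by blast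
  have "int m + 1 - 2 * int 0 = int (m + 1)" by simp
  note C = C[unfolded this power_int_of_nat]
  have "((\<lambda>k. f k - G k) \<longlongrightarrow> 0) (at 0 within closure D_plus)"
  proof (rule Lim_null_comparison)
    show "\<forall>\<^sub>F k in at 0 within closure D_plus. norm (f k - G k) \<le> C * norm k ^ (m + 1)"
      unfolding eventually_at using C
      by (intro exI[of _ 2]) (auto simp: inner_region_def closure_D_plus dist_norm)
    show "((\<lambda>k. C * norm k ^ (m + 1)) \<longlongrightarrow> 0) (at 0 within closure D_plus)"
      by (rule tendsto_eq_intros refl | simp)+
  qed
  moreover have "(G \<longlongrightarrow> G 0) (at 0 within closure D_plus)"
    by (rule tendsto_mono[OF at_le[OF subset_UNIV] isContD[OF G]])
  ultimately have "((\<lambda>k. (f k - G k) + G k) \<longlongrightarrow> 0 + G 0) (at 0 within closure D_plus)"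
    by (rule tendsto_add)
  then show ?thesis by simp
qed

lemma continuous_on_closure_D_plus:
  assumes S: "continuous_on spectral_domain f" and lim: "(f \<longlongrightarrow> f 0) (at 0 within closure D_plus)"
  shows "continuous_on (closure D_plus) f"
  unfolding continuous_on_eq_continuous_within
proof
  fix k assume k: "k \<in> closure D_plus"
  show "continuous (at k within closure D_plus) f"
  proof (cases "k = 0")
    case True
    then show ?thesis using lim by (simp add: continuous_within)
  next
    case False
    have "openin (top_of_set (closure D_plus)) (closure D_plus \<inter> - {0})" by (intro openin_open_Int) auto
    moreover have "closure D_plus \<inter> - {0} = spectral_domain" using spectral_domain_eq by auto
    moreover have "k \<in> spectral_domain" using k False closure_D_plus by auto
    ultimately show ?thesis using S at_within_openin[of "closure D_plus" spectral_domain k]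
      by (simp add: continuous_on_eq_continuous_within)
  qed
qed

lemma analytic_on_D_plus:
  assumes d: "n_times_differentiable_within spectral_domain n f" and n: "1 \<le> n"
  shows "f analytic_on D_plus"
proof -
  have "\<exists>d. (f has_field_derivative d) (at k)" if k: "k \<in> D_plus" for k
  proof -
    have "k \<in> spectral_domain" using k D_plus_subset by blast
    then obtain d where "(f has_field_derivative d) (at k within spectral_domain)"
      using d n unfolding n_times_differentiable_within_def higher_deriv_within_def
      by (metis funpow_0 less_eq_Suc_le One_nat_def)
    then have "(f has_field_derivative d) (at k within D_plus)"
      using D_plus_subset by (rule DERIV_subset)
    then show ?thesis using at_within_open[OF k open_D_plus] by auto
  qed
  then have "f holomorphic_on D_plus"
    unfolding holomorphic_on_def field_differentiable_def by (meson has_field_derivative_at_within)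
  then show ?thesis by (simp add: analytic_on_open open_D_plus)
qed

lemma norm_vector_2_le: "norm ((vector [a, b] :: complex^2) - vector [c, d]) \<le> norm (a - c) + norm (b - d)"
proof -
  have "norm ((vector [a, b] :: complex^2) - vector [c, d]) \<le> (\<Sum>i\<in>UNIV. norm (((vector [a, b] :: complex^2) - vector [c, d]) $ i))"
    unfolding norm_vec_def by (rule L2_set_le_sum) simp
  then show ?thesis by (simp add: sum_2)
qed

lemma bigo_large_k:
  assumes "\<exists>C. \<forall>k\<in>outer_region. norm (b k - b' k) \<le> C * (1 / norm k ^ (m + 1))"
    and "\<exists>C. \<forall>k\<in>outer_region. norm (a k - a' k) \<le> C * (1 / norm k ^ (m + 1))"
  shows "(\<lambda>k. norm ((vector [b k, a k] :: complex^2) - vector [b' k, a' k]))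
    \<in> O[inf at_infinity (principal (closure D_plus))](\<lambda>k. norm (1 / k ^ (m + 1)))"
proof -
  obtain C D where C: "\<And>k. k \<in> outer_region \<Longrightarrow> norm (b k - b' k) \<le> C * (1 / norm k ^ (m + 1))"
    and D: "\<And>k. k \<in> outer_region \<Longrightarrow> norm (a k - a' k) \<le> D * (1 / norm k ^ (m + 1))" using assms by blast
  have "norm ((vector [b k, a k] :: complex^2) - vector [b' k, a' k]) \<le> (C + D) * norm (1 / k ^ (m + 1))"
    if "k \<in> outer_region" for k
    using order_trans[OF norm_vector_2_le add_mono[OF C[OF that] D[OF that]]]
    by (simp add: norm_divide norm_power norm_mult add_divide_distrib)
  moreover have "k \<in> outer_region" if "1 \<le> norm k" "k \<in> closure D_plus" for k
    using that by (auto simp: closure_D_plus outer_region_eq)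
  ultimately show ?thesis
    by (intro bigoI[of _ "C + D"])
      (auto simp: eventually_inf_principal eventually_at_infinity intro!: exI[of _ 1])
qed

lemma bigo_small_k:
  assumes "\<exists>C. \<forall>k\<in>inner_region. norm (b k - b' k) \<le> C * norm k powi p"
    and "\<exists>C. \<forall>k\<in>inner_region. norm (a k - a' k) \<le> C * norm k powi p"
  shows "(\<lambda>k. norm ((vector [b k, a k] :: complex^2) - vector [b' k, a' k]))
    \<in> O[at 0 within closure D_plus](\<lambda>k. norm (k powi p))"
proof -
  obtain C D where C: "\<And>k. k \<in> inner_region \<Longrightarrow> norm (b k - b' k) \<le> C * norm k powi p"
    and D: "\<And>k. k \<in> inner_region \<Longrightarrow> norm (a k - a' k) \<le> D * norm k powi p" using assms by blast
  have "norm ((vector [b k, a k] :: complex^2) - vector [b' k, a' k]) \<le> (C + D) * norm (k powi p)"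
    if "k \<in> inner_region" for k
    using order_trans[OF norm_vector_2_le add_mono[OF C[OF that] D[OF that]]]
    by (simp add: norm_power_int distrib_right)
  moreover have "k \<in> inner_region" if "norm k < 2" "k \<noteq> 0" "k \<in> closure D_plus" for k
    using that by (auto simp: closure_D_plus inner_region_def)
  ultimately show ?thesis
    by (intro bigoI[of _ "C + D"])
      (auto simp: eventually_at dist_norm intro!: exI[of _ 2])
qed

context spectral_data
begin

lemma G0_mat_mult: "G0_mat g N 0 *v vector [b, a] = vector [gauge_cos 0 * b - gauge_sin 0 * a, gauge_sin 0 * b + gauge_cos 0 * a]"
  unfolding vec_eq_iff forall_2
  by (simp add: G0_mat_def gauge_cos_def gauge_sin_def matrix_matrix_mult_def matrix_vector_mult_def mat_def sum_2 vector_2)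

lemma cnj_gauge: "cnj (gauge_cos t) = gauge_cos t" "cnj (gauge_sin t) = gauge_sin t"
  by (cases "even N"; simp add: gauge_cos_def gauge_sin_def power_int_minus_left)+

lemma reflection:
  assumes "k \<in> spectral_domain"
  shows "B (- cnj k) = cnj (B k)" "A (- cnj k) = cnj (A k)"
proof -
  obtain x y where s: "lax_solution pot_u pot_s pot_c k x y" "B k = x 0" "A k = y 0" using spectral_lax_solution[OF assms] .
  note c = lax_solution_cnj[OF s(1)[unfolded pot_u_def pot_s_def pot_c_def], folded pot_u_def pot_s_def pot_c_def]
  show "B (- cnj k) = cnj (B k)" "A (- cnj k) = cnj (A k)"
    using spectral_value[OF spectral_domain_reflect[OF assms] c] s by simp_all
qed

lemma unitarity:
  assumes "k \<in> spectral_domain" "cnj k \<in> spectral_domain"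
  shows "A k * cnj (A (cnj k)) + B k * cnj (B (cnj k)) = 1"
proof -
  obtain x y where s: "lax_solution pot_u pot_s pot_c k x y" "B k = x 0" "A k = y 0" using spectral_lax_solution[OF assms(1)] .
  obtain X Y where t: "lax_solution pot_u pot_s pot_c (cnj k) X Y" "B (cnj k) = X 0" "A (cnj k) = Y 0" using spectral_lax_solution[OF assms(2)] .
  show ?thesis unfolding s(2,3) t(2,3)
    by (rule lax_solution_unitary[OF s(1)[unfolded pot_u_def pot_s_def pot_c_def] t(1)[unfolded pot_u_def pot_s_def pot_c_def]])
qed

theorem spectral_functions:
  defines "S \<equiv> closure D_plus - {0}"
  assumes n: "1 \<le> n"
  shows
    "(continuous_on (closure D_plus) A \<and> continuous_on (closure D_plus) B \<and>
      A analytic_on D_plus \<and> B analytic_on D_plus) \<and>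
     (n_times_differentiable_within S n A \<and> n_times_differentiable_within S n B \<and>
      (\<forall>j\<in>{1..n}. continuous_on S (higher_deriv_within S j A) \<and>
                  continuous_on S (higher_deriv_within S j B))) \<and>
     (\<exists>cA cB cA' cB' :: nat \<Rightarrow> complex. \<forall>j\<in>{0..n}.
        (\<lambda>k. norm
           ((vector [higher_deriv_within S j B k, higher_deriv_within S j A k] :: complex^2) -
            vector [(deriv ^^ j) (\<lambda>z. \<Sum>i=1..m. cB i / z ^ i) k,
                    (deriv ^^ j) (\<lambda>z. 1 + (\<Sum>i=1..m. cA i / z ^ i)) k]))
          \<in> O[inf at_infinity (principal (closure D_plus))](\<lambda>k. norm (1 / k ^ (m + 1))) \<and>
        (\<lambda>k. norm
           ((vector [higher_deriv_within S j B k, higher_deriv_within S j A k] :: complex^2) -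
            G0_mat g N 0 *v
              vector [(deriv ^^ j) (\<lambda>z. \<Sum>i=1..m. cB' i * z ^ i) k,
                      (deriv ^^ j) (\<lambda>z. 1 + (\<Sum>i=1..m. cA' i * z ^ i)) k]))
          \<in> O[at 0 within closure D_plus](\<lambda>k. norm (k powi (int m + 1 - 2 * int j)))) \<and>
     (\<forall>k\<in>closure D_plus. A k = cnj (A (- cnj k)) \<and> B k = cnj (B (- cnj k))) \<and>
     (\<forall>k. k \<in> \<real> \<or> cmod k = 1 \<longrightarrow> A k * cnj (A (cnj k)) + B k * cnj (B (cnj k)) = 1)"
proof -
  have S: "S = spectral_domain" unfolding S_def by (rule spectral_domain_eq)
  obtain cA cB where l: "derivs_bounded outer_region n (\<lambda>_ k. 1 / norm k ^ (m + 1)) (\<lambda>k. B k - (\<Sum>i=1..m. cB i / k ^ i))"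
    "derivs_bounded outer_region n (\<lambda>_ k. 1 / norm k ^ (m + 1)) (\<lambda>k. A k - (1 + (\<Sum>i=1..m. cA i / k ^ i)))"
    by (rule expansion_at_infinity)
  obtain cA' cB' where s:
    "derivs_bounded inner_region n (\<lambda>j k. norm k powi (int m + 1 - 2 * int j))
       (\<lambda>k. B k - (gauge_cos 0 * (\<Sum>i=1..m. cB' i * k ^ i) - gauge_sin 0 * (1 + (\<Sum>i=1..m. cA' i * k ^ i))))"
    "derivs_bounded inner_region n (\<lambda>j k. norm k powi (int m + 1 - 2 * int j))
       (\<lambda>k. A k - (gauge_sin 0 * (\<Sum>i=1..m. cB' i * k ^ i) + gauge_cos 0 * (1 + (\<Sum>i=1..m. cA' i * k ^ i))))"
    by (rule expansion_at_zero)
  let ?LB = "\<lambda>z. \<Sum>i=1..m. cB i / z ^ i" and ?LA = "\<lambda>z. 1 + (\<Sum>i=1..m. cA i / z ^ i)"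
  define pB where "pB = (\<lambda>z. \<Sum>i=1..m. cB' i * z ^ i)"
  define pA where "pA = (\<lambda>z. 1 + (\<Sum>i=1..m. cA' i * z ^ i))"
  let ?RB = "\<lambda>z. gauge_cos 0 * pB z - gauge_sin 0 * pA z" and ?RA = "\<lambda>z. gauge_sin 0 * pB z + gauge_cos 0 * pA z"
  have flat_exp: "pB holomorphic_on X" "pA holomorphic_on X" for X
    unfolding pB_def pA_def by (intro holomorphic_intros)+
  have hol: "?LB holomorphic_on - {0}" "?LA holomorphic_on - {0}" "?RB holomorphic_on - {0}" "?RA holomorphic_on - {0}"
    by (intro holomorphic_intros flat_exp; simp)+
  note s' = s[folded fun_cong[OF pB_def] fun_cong[OF pA_def]]
  note RB = higher_derivs_on_regions[OF hol(1) l(1) hol(3) s'(1)] and RA = higher_derivs_on_regions[OF hol(2) l(2) hol(4) s'(2)]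
  have pc: "isCont pB 0" "isCont pA 0" unfolding pB_def pA_def by (intro continuous_intros)+
  have p0: "pB 0 = 0" "pA 0 = 1" unfolding pB_def pA_def by (simp_all add: sum.neutral)
  have limB: "(B \<longlongrightarrow> - gauge_sin 0) (at 0 within closure D_plus)"
    using tendsto_0_of_expansion[OF _ s'(1)] pc by (simp add: p0)
  have limA: "(A \<longlongrightarrow> gauge_cos 0) (at 0 within closure D_plus)"
    using tendsto_0_of_expansion[OF _ s'(2)] pc by (simp add: p0)
  have "((\<lambda>z. T_mat g g1 0 z $ 1 $ 2) \<longlongrightarrow> - gauge_sin 0) (at 0 within closure D_plus)"
    by (rule Lim_transform_eventually[OF limB])
      (rule eventually_mono[OF eventually_neq_at_within[of 0]], simp add: spectral_B_def)
  then have B0: "B 0 = - gauge_sin 0" by (simp add: spectral_B_def tendsto_Lim[OF at_0_within])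
  have "((\<lambda>z. T_mat g g1 0 z $ 2 $ 2) \<longlongrightarrow> gauge_cos 0) (at 0 within closure D_plus)"
    by (rule Lim_transform_eventually[OF limA])
      (rule eventually_mono[OF eventually_neq_at_within[of 0]], simp add: spectral_A_def)
  then have A0: "A 0 = gauge_cos 0" by (simp add: spectral_A_def tendsto_Lim[OF at_0_within])
  have "continuous_on spectral_domain A" "continuous_on spectral_domain B"
    using RA(2)[of 0] RB(2)[of 0] by (simp_all add: higher_deriv_within_def)
  then have a: "continuous_on (closure D_plus) A" "continuous_on (closure D_plus) B"
    using limA limB by (auto intro!: continuous_on_closure_D_plus simp: A0 B0)
  have an: "A analytic_on D_plus" "B analytic_on D_plus"
    by (rule analytic_on_D_plus[OF RA(1) n] analytic_on_D_plus[OF RB(1) n])+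
  have b: "n_times_differentiable_within S n A \<and> n_times_differentiable_within S n B \<and>
      (\<forall>j\<in>{1..n}. continuous_on S (higher_deriv_within S j A) \<and> continuous_on S (higher_deriv_within S j B))"
    unfolding S using RA(1,2) RB(1,2) by auto
  have c: "(\<lambda>k. norm
           ((vector [higher_deriv_within S j B k, higher_deriv_within S j A k] :: complex^2) -
            vector [(deriv ^^ j) ?LB k, (deriv ^^ j) ?LA k]))
          \<in> O[inf at_infinity (principal (closure D_plus))](\<lambda>k. norm (1 / k ^ (m + 1))) \<and>
        (\<lambda>k. norm
           ((vector [higher_deriv_within S j B k, higher_deriv_within S j A k] :: complex^2) -
            G0_mat g N 0 *v vector [(deriv ^^ j) pB k, (deriv ^^ j) pA k]))
          \<in> O[at 0 within closure D_plus](\<lambda>k. norm (k powi (int m + 1 - 2 * int j)))" if j: "j \<le> n" for j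
  proof
    show "(\<lambda>k. norm
           ((vector [higher_deriv_within S j B k, higher_deriv_within S j A k] :: complex^2) -
            vector [(deriv ^^ j) ?LB k, (deriv ^^ j) ?LA k]))
          \<in> O[inf at_infinity (principal (closure D_plus))](\<lambda>k. norm (1 / k ^ (m + 1)))"
      unfolding S by (rule bigo_large_k[OF RB(3)[OF j] RA(3)[OF j]])
    have hc: "(\<lambda>z. a * pB z) holomorphic_on UNIV" "(\<lambda>z. a * pA z) holomorphic_on UNIV" for a
      by (intro holomorphic_intros flat_exp)+
    \<comment> \<open>the constant rotation commutes with differentiation\<close>
    have d: "(deriv ^^ j) ?RB k = gauge_cos 0 * (deriv ^^ j) pB k - gauge_sin 0 * (deriv ^^ j) pA k"
      "(deriv ^^ j) ?RA k = gauge_sin 0 * (deriv ^^ j) pB k + gauge_cos 0 * (deriv ^^ j) pA k" for k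
      using higher_deriv_diff[OF hc(1) hc(2), of k j "gauge_cos 0" "gauge_sin 0"] higher_deriv_add[OF hc(1) hc(2), of k j "gauge_sin 0" "gauge_cos 0"]
        higher_deriv_cmult[OF flat_exp(1), of k UNIV j] higher_deriv_cmult[OF flat_exp(2), of k UNIV j] by simp_all
    show "(\<lambda>k. norm
           ((vector [higher_deriv_within S j B k, higher_deriv_within S j A k] :: complex^2) -
            G0_mat g N 0 *v vector [(deriv ^^ j) pB k, (deriv ^^ j) pA k]))
          \<in> O[at 0 within closure D_plus](\<lambda>k. norm (k powi (int m + 1 - 2 * int j)))"
      unfolding S G0_mat_mult d[symmetric] by (rule bigo_small_k[OF RB(4)[OF j] RA(4)[OF j]])
  qed
  have d: "A k = cnj (A (- cnj k)) \<and> B k = cnj (B (- cnj k))" if "k \<in> closure D_plus" for k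
    using that reflection[of k] by (auto simp: closure_D_plus A0 B0 cnj_gauge)
  have e: "A k * cnj (A (cnj k)) + B k * cnj (B (cnj k)) = 1" if "k \<in> \<real> \<or> cmod k = 1" for k
  proof (cases "k = 0")
    case True
    then show ?thesis using gauge_trig(1)[of 0] by (simp add: A0 B0 cnj_gauge)
  next
    case False
    then show ?thesis using unitarity[of k] spectral_domain_real_circle[OF False that] by blast
  qed
  have "\<exists>cA cB cA' cB' :: nat \<Rightarrow> complex. \<forall>j\<in>{0..n}.
        (\<lambda>k. norm
           ((vector [higher_deriv_within S j B k, higher_deriv_within S j A k] :: complex^2) -
            vector [(deriv ^^ j) (\<lambda>z. \<Sum>i=1..m. cB i / z ^ i) k,
                    (deriv ^^ j) (\<lambda>z. 1 + (\<Sum>i=1..m. cA i / z ^ i)) k]))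
          \<in> O[inf at_infinity (principal (closure D_plus))](\<lambda>k. norm (1 / k ^ (m + 1))) \<and>
        (\<lambda>k. norm
           ((vector [higher_deriv_within S j B k, higher_deriv_within S j A k] :: complex^2) -
            G0_mat g N 0 *v
              vector [(deriv ^^ j) (\<lambda>z. \<Sum>i=1..m. cB' i * z ^ i) k,
                      (deriv ^^ j) (\<lambda>z. 1 + (\<Sum>i=1..m. cA' i * z ^ i)) k]))
          \<in> O[at 0 within closure D_plus](\<lambda>k. norm (k powi (int m + 1 - 2 * int j)))"
    by (rule exI[of _ cA], rule exI[of _ cB], rule exI[of _ cA'], rule exI[of _ cB'], rule ballI,
        rule c[unfolded pB_def pA_def], simp)
  then show ?thesis using a an b d e by blast
qed

end

theorem theorem5p2:
  fixes m n :: nat and N\<^sub>t :: int and g0 g1 :: "real \<Rightarrow> real"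
  defines "A \<equiv> spectral_A g0 g1" and "B \<equiv> spectral_B g0 g1"
    and "S \<equiv> closure D_plus - {0}"
  assumes "m \<ge> 1" and "n \<ge> 1"
    and "continuous_on {0..} g0"
    and "weakly_differentiable (m + 2) g0"
    and "weakly_differentiable (m + 1) g1"
    and "(\<lambda>t. (1 + t) ^ n * (g0 t - 2 * pi * of_int N\<^sub>t)) absolutely_integrable_on {0..}"
    and "\<forall>i\<in>{1..m + 2}. (\<lambda>t. (1 + t) ^ n * weak_deriv i g0 t) absolutely_integrable_on {0..}"
    and "\<forall>i\<in>{0..m + 1}. (\<lambda>t. (1 + t) ^ n * weak_deriv i g1 t) absolutely_integrable_on {0..}"
  shows
    "(continuous_on (closure D_plus) A \<and> continuous_on (closure D_plus) B \<and>
      A analytic_on D_plus \<and> B analytic_on D_plus) \<and>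
     (n_times_differentiable_within S n A \<and> n_times_differentiable_within S n B \<and>
      (\<forall>j\<in>{1..n}. continuous_on S (higher_deriv_within S j A) \<and>
                  continuous_on S (higher_deriv_within S j B))) \<and>
     (\<exists>cA cB cA' cB' :: nat \<Rightarrow> complex. \<forall>j\<in>{0..n}.
        (\<lambda>k. norm
           ((vector [higher_deriv_within S j B k, higher_deriv_within S j A k] :: complex^2) -
            vector [(deriv ^^ j) (\<lambda>z. \<Sum>i=1..m. cB i / z ^ i) k,
                    (deriv ^^ j) (\<lambda>z. 1 + (\<Sum>i=1..m. cA i / z ^ i)) k]))
          \<in> O[inf at_infinity (principal (closure D_plus))](\<lambda>k. norm (1 / k ^ (m + 1))) \<and>
        (\<lambda>k. norm
           ((vector [higher_deriv_within S j B k, higher_deriv_within S j A k] :: complex^2) -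
            G0_mat g0 N\<^sub>t 0 *v
              vector [(deriv ^^ j) (\<lambda>z. \<Sum>i=1..m. cB' i * z ^ i) k,
                      (deriv ^^ j) (\<lambda>z. 1 + (\<Sum>i=1..m. cA' i * z ^ i)) k]))
          \<in> O[at 0 within closure D_plus](\<lambda>k. norm (k powi (int m + 1 - 2 * int j)))) \<and>
     (\<forall>k\<in>closure D_plus. A k = cnj (A (- cnj k)) \<and> B k = cnj (B (- cnj k))) \<and>
     (\<forall>k. k \<in> \<real> \<or> cmod k = 1 \<longrightarrow> A k * cnj (A (cnj k)) + B k * cnj (B (cnj k)) = 1)"
proof -
  obtain h f Z where b: "boundary_data n m N\<^sub>t g0 h f" and Z: "negligible Z"
    and U: "\<And>t. 0 < t \<Longrightarrow> t \<notin> Z \<Longrightarrow> g1 t + weak_deriv 1 g0 t = f t + h t"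
    by (rule boundary_data_exists[OF assms(5-9)]) (use assms(10,11) in blast)+
  have "spectral_data n m N\<^sub>t g0 h f g1 Z"
    by (rule spectral_data.intro[OF b], unfold_locales) (use Z U in auto)
  from spectral_data.spectral_functions[OF this assms(5)]
  show ?thesis unfolding A_def B_def S_def .
qed

end
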